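(* For each integer $r\geq 2$ there exist a compact surface $S$ (smooth, without boundary) and a $C^r$-diffeomorphism $f\colon S\to S$ which is $C^r$-robustly $r$-expansive but is not $(r-1)$-expansive.
   Context: Let $M$ be a smooth compact manifold without boundary, with a metric $\mathrm{dist}$ induced by a Finsler (e.g. Riemannian) structure. For a positive integer $N$, a homeomorphism $f\colon M\to M$ is $N$-expansive if there is $\delta>0$ such that whenever $A\subset M$ satisfies $\mathrm{diam}(f^n(A))<\delta$ for all $n\in\mathbb Z$, then $A$ has at most $N$ elements ($1$-expansive is the usual notion of expansivity). A $C^r$-diffeomorphism $f$ is $C^r$-robustly $N$-expansive if there is a neighborhood of $f$ in the $C^r$-topology such that every diffeomorphism in this neighborhood is $N$-expansive. *)

theory Defs
  imports "HOL-Analysis.Analysis"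
begin

primrec ipd :: "('a::real_normed_vector \<Rightarrow> 'b::real_normed_vector) \<Rightarrow> 'a list \<Rightarrow> 'a \<Rightarrow> 'b" where
  "ipd f [] = f"
| "ipd f (v # vs) = ipd (\<lambda>x. frechet_derivative f (at x) v) vs"

definition Cr_on :: "nat \<Rightarrow> ('a::euclidean_space \<Rightarrow> 'b::real_normed_vector) \<Rightarrow> 'a set \<Rightarrow> bool" where
  "Cr_on r f U \<longleftrightarrow> open U \<and>
     (\<forall>vs. set vs \<subseteq> Basis \<and> length vs \<le> r \<longrightarrow>
        continuous_on U (ipd f vs) \<and>
        (length vs < r \<longrightarrow> (\<forall>x\<in>U. ipd f vs differentiable (at x))))"

definition surf_param :: "(real^2 \<Rightarrow> 'e::euclidean_space) \<Rightarrow> (real^2) set \<Rightarrow> 'e set \<Rightarrow> bool" where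
  "surf_param \<phi> V S \<longleftrightarrow> open V \<and> (\<forall>k. Cr_on k \<phi> V) \<and>
     (\<forall>x\<in>V. inj (frechet_derivative \<phi> (at x))) \<and>
     homeomorphism V (\<phi> ` V) \<phi> (inv_into V \<phi>) \<and>
     \<phi> ` V \<subseteq> S \<and> openin (top_of_set S) (\<phi> ` V)"

definition compact_surface :: "'e::euclidean_space set \<Rightarrow> bool" where
  "compact_surface S \<longleftrightarrow> compact S \<and> connected S \<and> S \<noteq> {} \<and>
     (\<forall>p\<in>S. \<exists>\<phi> V. surf_param \<phi> V S \<and> p \<in> \<phi> ` V)"

definition Cr_map :: "nat \<Rightarrow> 'e::euclidean_space set \<Rightarrow> ('e \<Rightarrow> 'e) \<Rightarrow> bool" where
  "Cr_map r S f \<longleftrightarrow> f ` S \<subseteq> S \<and> continuous_on S f \<and>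
     (\<forall>\<phi> V \<psi> W. surf_param \<phi> V S \<and> surf_param \<psi> W S \<longrightarrow>
        Cr_on r (inv_into W \<psi> \<circ> f \<circ> \<phi>) {x\<in>V. f (\<phi> x) \<in> \<psi> ` W})"

definition Cr_diffeo :: "nat \<Rightarrow> 'e::euclidean_space set \<Rightarrow> ('e \<Rightarrow> 'e) \<Rightarrow> bool" where
  "Cr_diffeo r S f \<longleftrightarrow> bij_betw f S S \<and> Cr_map r S f \<and> Cr_map r S (inv_into S f)"

definition iter_int :: "'e set \<Rightarrow> ('e \<Rightarrow> 'e) \<Rightarrow> int \<Rightarrow> 'e \<Rightarrow> 'e" where
  "iter_int S f n = (if 0 \<le> n then f ^^ nat n else (inv_into S f) ^^ nat (- n))"

definition N_expansive :: "'e::metric_space set \<Rightarrow> ('e \<Rightarrow> 'e) \<Rightarrow> nat \<Rightarrow> bool" where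
  "N_expansive S f N \<longleftrightarrow> (\<exists>\<delta>>0. \<forall>A\<subseteq>S.
     (\<forall>n::int. diameter (iter_int S f n ` A) < \<delta>) \<longrightarrow> finite A \<and> card A \<le> N)"

text \<open>Subbasic C^r neighbourhoods (Hirsch, weak = strong C^r topology on compact S):
  a datum (phi, V, psi, W, K) consists of two parametrizations and a compact K in V
  with f(phi(K)) inside psi(W).\<close>
type_synonym 'e cr_datum = "(real^2 \<Rightarrow> 'e) \<times> (real^2) set \<times> (real^2 \<Rightarrow> 'e) \<times> (real^2) set \<times> (real^2) set"

definition cr_datum_ok :: "'e::euclidean_space set \<Rightarrow> ('e \<Rightarrow> 'e) \<Rightarrow> 'e cr_datum \<Rightarrow> bool" where
  "cr_datum_ok S f d = (case d of (\<phi>, V, \<psi>, W, K) \<Rightarrow>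
     surf_param \<phi> V S \<and> surf_param \<psi> W S \<and> compact K \<and> K \<subseteq> V \<and> f ` \<phi> ` K \<subseteq> \<psi> ` W)"

definition cr_close :: "nat \<Rightarrow> real \<Rightarrow> 'e::euclidean_space cr_datum \<Rightarrow> ('e \<Rightarrow> 'e) \<Rightarrow> ('e \<Rightarrow> 'e) \<Rightarrow> bool" where
  "cr_close r \<epsilon> d f g = (case d of (\<phi>, V, \<psi>, W, K) \<Rightarrow>
     g ` \<phi> ` K \<subseteq> \<psi> ` W \<and>
     (\<forall>x\<in>K. \<forall>vs. set vs \<subseteq> Basis \<and> length vs \<le> r \<longrightarrow>
        norm (ipd (inv_into W \<psi> \<circ> g \<circ> \<phi>) vs x - ipd (inv_into W \<psi> \<circ> f \<circ> \<phi>) vs x) < \<epsilon>))"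

text \<open>f is C^r-robustly N-expansive: f is a C^r diffeomorphism and some C^r-neighbourhood
  (a finite intersection of subbasic neighbourhoods) consists of N-expansive diffeomorphisms.\<close>
definition Cr_robustly_N_expansive :: "nat \<Rightarrow> 'e::euclidean_space set \<Rightarrow> ('e \<Rightarrow> 'e) \<Rightarrow> nat \<Rightarrow> bool" where
  "Cr_robustly_N_expansive r S f N \<longleftrightarrow> Cr_diffeo r S f \<and>
     (\<exists>D \<epsilon>. \<epsilon> > 0 \<and> (\<forall>d\<in>set D. cr_datum_ok S f d) \<and>
        (\<forall>g. Cr_diffeo r S g \<and> (\<forall>d\<in>set D. cr_close r \<epsilon> d f g) \<longrightarrow> N_expansive S g N))"

end

(* The surface is a genus two surface made of two copies of a torus, glued along the unit circles around
  one lattice point.  On the upper sheet f is a derived-from-Anosov map with a repeller at the hole, on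
  the lower sheet it is the inverse of such a map with an attractor at the hole.  A heteroclinic orbit
  crosses a ring around the hole; there a perturbation makes the second upper coordinate, as a function
  along the unstable direction, have contact of order exactly r with the stable leaves.

  Non-expansivity: r points on one lower leaf share one upper leaf, arbitrarily close to each other.

  Robustness: if r + 1 points stay close forever under a nearby g, all divided differences of order at
  most r of their orbits (one coordinate as a function of the other) are small: a Rolle argument shows
  that one step of g contracts them up to a small error.  Applied to both sides of the ring crossing this
  makes all derivatives of order 1, ..., r of the crossing map small, contradicting finite contact. *)
theory Submission
  imports Defs "HOL-Computational_Algebra.Polynomial"
begin

text \<open>Everything is computed in eigencoordinates of a hyperbolic automorphism with eigenvalues
  \<open>mu\<close> and \<open>lam\<close>, and the bump at the hole is added to the contracted
  coordinate alone. The other coordinate is still multiplied by a constant, so the leaves of f that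
  matter are coordinate lines: \<open>x $ 2\<close> constant above, \<open>x $ 1\<close> constant
  below. A perturbation g has no explicit leaves; finite sets of orbit points and their divided
  differences take their place. The obstacle is that the divided difference of top order has no a
  priori bound: it may be as large as the reciprocal of the spread of the nodes, and that spread can
  shrink exponentially with the distance in time from the crossing. All estimates are therefore kept
  linear in this one quantity, and a contraction by 1/400 per step is played against a growth by at
  most 60. The parity of r decides where the contact is placed. Inversion, the transition between
  the sheets, has a fold along t = s on the lines s = const and is monotone near t = 2 s; a contact
  of even order fits into the fold, one of odd order into the monotone part, and only then does the
  cut-off between model and perturbation create no new degeneracy.\<close>

section \<open>Calculus of C^r maps through iterated partial derivatives\<close>

lemma Cr_on_open: "Cr_on r f U ==> open U"
 by (simp add: Cr_on_def)

lemma Cr_on_0: "Cr_on 0 f U \<longleftrightarrow> open U & continuous_on U f"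
 by (auto simp: Cr_on_def)

lemma Cr_on_continuous_on: "Cr_on r f U ==> continuous_on U f"
 unfolding Cr_on_def by (metis empty_iff empty_set ipd.simps(1) le0 list.size(3) subsetI)

text \<open>Since \<open>ipd\<close> differentiates by the head of the list, one direction can be
  peeled off. This recursion turns the closure properties below into inductions on r with the
  function generalised.\<close>

lemma Cr_on_Suc:
 "Cr_on (Suc r) f U \<longleftrightarrow> open U & (ALL x:U. f differentiable (at x)) &
 (ALL b:Basis. Cr_on r (%x. frechet_derivative f (at x) b) U)"
proof
 assume *: "Cr_on (Suc r) f U"
 have "ipd f [] differentiable (at x)" if "x : U" for x
 using * that unfolding Cr_on_def by (metis empty_iff empty_set le0 list.size(3) subsetI zero_less_Suc)
 moreover have "Cr_on r (%x. frechet_derivative f (at x) b) U" if b: "b : Basis" for b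
 unfolding Cr_on_def
 proof (intro conjI allI impI)
 show "open U" using * by (simp add: Cr_on_def)
 fix vs :: "'a list" assume vs: "set vs <= Basis & length vs <= r"
 hence "set (b # vs) <= Basis & length (b # vs) <= Suc r" using b by simp
 from this *[unfolded Cr_on_def, THEN conjunct2, rule_format, OF this]
 show "continuous_on U (ipd (%x. frechet_derivative f (at x) b) vs)"
 and "length vs < r ==> ALL x:U. ipd (%x. frechet_derivative f (at x) b) vs differentiable at x"
 by auto
 qed
 ultimately show "open U & (ALL x:U. f differentiable (at x)) &
 (ALL b:Basis. Cr_on r (%x. frechet_derivative f (at x) b) U)"
 using Cr_on_open[OF *] by auto
next
 assume *: "open U & (ALL x:U. f differentiable (at x)) &
 (ALL b:Basis. Cr_on r (%x. frechet_derivative f (at x) b) U)"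
 have c: "continuous_on U f"
 using * by (meson continuous_at_imp_continuous_on differentiable_imp_continuous_within)
 show "Cr_on (Suc r) f U" unfolding Cr_on_def
 proof (intro conjI allI impI)
 show "open U" using * by simp
 fix vs :: "'a list" assume vs: "set vs <= Basis & length vs <= Suc r"
 show "continuous_on U (ipd f vs)"
 using vs * c by (cases vs) (auto simp: Cr_on_def)
 show "ALL x:U. ipd f vs differentiable at x" if "length vs < Suc r"
 using that vs * by (cases vs) (auto simp: Cr_on_def)
 qed
qed

lemma ipd_cong:
 assumes "open U" "!!x. x : U ==> f x = g x" "x : U"
 shows "ipd f vs x = ipd g vs x"
 using assms
proof (induction vs arbitrary: f g x)
 case (Cons v vs)
 have "(f has_derivative D) (at y) = (g has_derivative D) (at y)" if "y : U" for y D
 using has_derivative_transform_within_open[OF _ Cons.prems(1) that] Cons.prems(2) by metis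
 hence "frechet_derivative f (at y) = frechet_derivative g (at y)" if "y : U" for y
 using that by (simp add: frechet_derivative_def)
 thus ?case unfolding ipd.simps using Cons.prems(1,3) by (intro Cons.IH) auto
qed simp

lemma ipd_append: "ipd f (vs @ ws) = ipd (ipd f vs) ws"
 by (induction vs arbitrary: f) auto

lemma Cr_on_cong:
 assumes "!!x. x : U ==> f x = g x"
 shows "Cr_on r f U = Cr_on r g U"
proof -
 have *: "Cr_on r g U" if "Cr_on r f U" "!!x. x : U ==> f x = g x" for f g :: "'a => 'b"
 using that
 proof (induction r arbitrary: f g)
 case 0 thus ?case by (simp add: Cr_on_0 cong: continuous_on_cong)
 next
 case (Suc r)
 have U: "open U" using Suc.prems Cr_on_open by auto
 have "(f has_derivative D) (at y) = (g has_derivative D) (at y)" if "y : U" for y D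
 using has_derivative_transform_within_open[OF _ U that] Suc.prems(2) by metis
 hence "frechet_derivative f (at y) = frechet_derivative g (at y)"
 "f differentiable (at y) \<longleftrightarrow> g differentiable (at y)" if "y : U" for y
 using that by (simp_all add: frechet_derivative_def differentiable_def)
 with Suc.prems(1) U Suc.IH[of "%x. frechet_derivative f (at x) b" "%x. frechet_derivative g (at x) b" for b]
 show ?case unfolding Cr_on_Suc by auto
 qed
 show ?thesis using *[of f g] *[of g f] assms by auto
qed

lemma Cr_on_SucI:
 assumes "open U" "!!x. x : U ==> (f has_derivative D x) (at x)"
 "!!b. b : Basis ==> Cr_on r (%x. D x b) U"
 shows "Cr_on (Suc r) f U"
proof -
 have "frechet_derivative f (at x) = D x" if "x : U" for x
 using assms(2)[OF that] frechet_derivative_at by metis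
 hence "Cr_on r (%x. frechet_derivative f (at x) b) U" if "b : Basis" for b
 using assms(3)[OF that] Cr_on_cong[of U "%x. frechet_derivative f (at x) b" "%x. D x b"] by simp
 thus ?thesis unfolding Cr_on_Suc using assms by (auto simp: differentiable_def)
qed

lemma Cr_on_SucD:
 assumes "Cr_on (Suc r) f U"
 shows "x : U ==> (f has_derivative frechet_derivative f (at x)) (at x)"
 "b : Basis ==> Cr_on r (%x. frechet_derivative f (at x) b) U"
 using assms unfolding Cr_on_Suc by (auto simp: frechet_derivative_works)

lemma Cr_on_mono: "Cr_on s f U ==> r <= s ==> Cr_on r f U"
 by (auto simp: Cr_on_def)

lemma Cr_on_subset: "Cr_on r f U ==> open V ==> V <= U ==> Cr_on r f V"
 unfolding Cr_on_def by (meson continuous_on_subset subsetD)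

lemma Cr_on_local:
 assumes "open U" "!!x. x : U ==> EX V. x : V & Cr_on r f V"
 shows "Cr_on r f U"
 unfolding Cr_on_def
proof (intro conjI allI impI ballI)
 show "open U" by fact
 fix vs :: "'a list" assume vs: "set vs <= Basis & length vs <= r"
 have "isCont (ipd f vs) x" if x: "x : U" for x
 proof -
 obtain V where "x : V" "Cr_on r f V" using assms(2)[OF x] by auto
 thus ?thesis using vs unfolding Cr_on_def by (meson continuous_on_eq_continuous_at)
 qed
 thus "continuous_on U (ipd f vs)" by (simp add: continuous_at_imp_continuous_on)
 fix x assume "length vs < r" "x : U"
 thus "ipd f vs differentiable at x"
 using assms(2)[of x] vs unfolding Cr_on_def by meson
qed

lemma Cr_on_const: "open U ==> Cr_on r (%x. c) U"
proof (induction r arbitrary: c)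
 case (Suc r)
 show ?case by (rule Cr_on_SucI[where D="%x h. 0"]) (use Suc in auto)
qed (simp add: Cr_on_0)

lemma Cr_on_linear: "open U ==> bounded_linear L ==> Cr_on r L U"
proof (cases r)
 case (Suc n)
 assume "open U" "bounded_linear L"
 thus ?thesis unfolding Suc
 by (intro Cr_on_SucI[where D="%x. L"] Cr_on_const) (auto intro: bounded_linear_imp_has_derivative)
qed (simp add: Cr_on_0 linear_continuous_on)

lemma Cr_on_ident: "open U ==> Cr_on r (%x. x) U"
 by (rule Cr_on_linear) auto

lemma Cr_on_nth: "open U ==> Cr_on r (%x::real^'n. x $ i) U"
 by (rule Cr_on_linear) auto

lemma Cr_on_bounded_linear:
 assumes "bounded_linear L" "Cr_on r f U"
 shows "Cr_on r (%x. L (f x)) U"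
 using assms(2)
proof (induction r arbitrary: f)
 case 0
 thus ?case by (simp add: Cr_on_0 bounded_linear.continuous_on[OF assms(1)])
next
 case (Suc r)
 show ?case
 by (rule Cr_on_SucI[where D="%x h. L (frechet_derivative f (at x) h)"])
 (use Suc Cr_on_SucD[OF Suc.prems] Cr_on_open[OF Suc.prems] in
 \<open>auto intro!: bounded_linear.has_derivative[OF assms(1)]\<close>)
qed

lemma Cr_on_add:
 assumes "Cr_on r f U" "Cr_on r g U"
 shows "Cr_on r (%x. f x + g x) U"
 using assms
proof (induction r arbitrary: f g)
 case 0
 thus ?case by (simp add: Cr_on_0 continuous_on_add)
next
 case (Suc r)
 show ?case
 by (rule Cr_on_SucI[where D="%x h. frechet_derivative f (at x) h + frechet_derivative g (at x) h"])
 (use Suc Cr_on_SucD[OF Suc.prems(1)] Cr_on_SucD[OF Suc.prems(2)] Cr_on_open[OF Suc.prems(1)] in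
 \<open>auto intro!: has_derivative_add\<close>)
qed

lemma Cr_on_minus: "Cr_on r f U ==> Cr_on r (%x. - f x) U"
 by (rule Cr_on_bounded_linear[where L=uminus]) (simp add: bounded_linear_minus bounded_linear_ident)

lemma Cr_on_diff: "Cr_on r f U ==> Cr_on r g U ==> Cr_on r (%x. f x - g x) U"
 using Cr_on_add[OF _ Cr_on_minus, of r f U g] by simp

lemma Cr_on_sum:
 assumes "open U" "!!i. i : I ==> Cr_on r (f i) U"
 shows "Cr_on r (%x. \<Sum>i\<in>I. f i x) U"
 using assms(2)
 by (induction I rule: infinite_finite_induct) (auto intro: Cr_on_const Cr_on_add assms(1))

lemma Cr_on_bilinear:
 assumes "bounded_bilinear bop" "Cr_on r f U" "Cr_on r g U"
 shows "Cr_on r (%x. bop (f x) (g x)) U"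
 using assms(2,3)
proof (induction r arbitrary: f g)
 case 0
 thus ?case by (simp add: Cr_on_0 bounded_bilinear.continuous_on[OF assms(1)])
next
 case (Suc r)
 note m = Cr_on_mono[OF Suc.prems(1), of r] Cr_on_mono[OF Suc.prems(2), of r]
 show ?case
 by (rule Cr_on_SucI[where D="%x h. bop (f x) (frechet_derivative g (at x) h) + bop (frechet_derivative f (at x) h) (g x)"])
 (use Suc Cr_on_SucD[OF Suc.prems(1)] Cr_on_SucD[OF Suc.prems(2)] Cr_on_open[OF Suc.prems(1)] m in
 \<open>auto intro!: Cr_on_add bounded_bilinear.FDERIV[OF assms(1)]\<close>)
qed

lemma Cr_on_mult: "Cr_on r f U ==> Cr_on r g U ==> Cr_on r (%x. f x*g x :: real) U"
 by (rule Cr_on_bilinear[OF bounded_bilinear_mult])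

lemma Cr_on_scaleR: "Cr_on r f U ==> Cr_on r g U ==> Cr_on r (%x. f x *\<^sub>R g x) U"
 by (rule Cr_on_bilinear[OF bounded_bilinear_scaleR])

lemma Cr_on_inner: "Cr_on r f U ==> Cr_on r g U ==> Cr_on r (%x. f x \<bullet> g x) U"
 by (rule Cr_on_bilinear[OF bounded_bilinear_inner])

lemma Cr_on_power: "Cr_on r f U ==> Cr_on r (%x. f x ^ n :: real) U"
 by (induction n) (auto intro: Cr_on_const Cr_on_open Cr_on_mult)

lemma Cr_on_prod:
 assumes "open U" "!!i. i : I ==> Cr_on r (f i) U"
 shows "Cr_on r (%x. \<Prod>i\<in>I. f i x :: real) U"
 using assms(2)
 by (induction I rule: infinite_finite_induct) (auto intro: Cr_on_const Cr_on_mult assms(1))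

text \<open>By the chain rule, with the inner derivative expanded in the basis, every partial
  derivative of the composite is a sum of products of a partial of \<open>g\<close> with a partial
  of \<open>f\<close> taken at \<open>g x\<close>; the induction hypothesis covers the latter one
  order lower.\<close>

lemma Cr_on_compose:
 fixes g :: "'a::euclidean_space => 'b::euclidean_space"
 assumes "Cr_on r f V" "Cr_on r g U" "g ` U <= V"
 shows "Cr_on r (%x. f (g x)) U"
 using assms
proof (induction r arbitrary: f)
 case 0
 thus ?case by (metis Cr_on_0 continuous_on_compose2)
next
 case (Suc r)
 have V: "g x : V" if "x : U" for x using Suc.prems that by auto
 define D where "D x h = (\<Sum>c\<in>Basis. (frechet_derivative g (at x) h \<bullet> c) *\<^sub>R frechet_derivative f (at (g x)) c)" for x h
 have "((%x. f (g x)) has_derivative D x) (at x)" if "x : U" for x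
 proof -
 note dg = Cr_on_SucD(1)[OF Suc.prems(2) that]
 note df = Cr_on_SucD(1)[OF Suc.prems(1) V[OF that]]
 interpret bounded_linear "frechet_derivative f (at (g x))" using df by (rule has_derivative_bounded_linear)
 have "frechet_derivative f (at (g x)) (frechet_derivative g (at x) h) = D x h" for h
 unfolding D_def
 by (subst euclidean_representation[symmetric, of "frechet_derivative g (at x) h"]) (simp add: sum scaleR)
 thus ?thesis using has_derivative_compose[OF dg df] by simp
 qed
 moreover have "Cr_on r (%x. D x b) U" if "b : Basis" for b
 unfolding D_def
 by (intro Cr_on_sum Cr_on_scaleR Cr_on_inner Cr_on_const Suc.IH Cr_on_SucD(2)[OF Suc.prems(2)]
 Cr_on_SucD(2)[OF Suc.prems(1)] Cr_on_mono[OF Suc.prems(2)] Suc.prems(3) Cr_on_open[OF Suc.prems(2)] that) auto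
 ultimately show ?case using Cr_on_open[OF Suc.prems(2)] by (intro Cr_on_SucI[where D=D])
qed

lemma Cr_on_components:
 fixes f :: "'a::euclidean_space => real^'n"
 assumes "!!i. Cr_on r (%x. f x $ i) U"
 shows "Cr_on r f U"
proof -
 have U: "open U" using assms Cr_on_open by blast
 have "Cr_on r (%x. \<Sum>i\<in>UNIV. (f x $ i) *\<^sub>R axis i (1::real)) U"
 by (intro Cr_on_sum Cr_on_scaleR Cr_on_const assms U)
 moreover have "(\<Sum>i\<in>UNIV. (f x $ i) *\<^sub>R axis i (1::real)) = f x" for x
 using basis_expansion[of "f x"] by (simp add: scalar_mult_eq_scaleR)
 ultimately show ?thesis by simp
qed

lemma Cr_on_component: "Cr_on r f U ==> Cr_on r (%x. f x $ i) U"
 by (rule Cr_on_bounded_linear[where L="%y. y $ i"]) auto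

lemma Cr_on_real_SucI:
 fixes f :: "real => real"
 assumes "open U" "!!x. x : U ==> (f has_real_derivative f' x) (at x)" "Cr_on r f' U"
 shows "Cr_on (Suc r) f U"
 by (rule Cr_on_SucI[where D="%x h. f' x*h"])
 (use assms in \<open>auto simp: has_field_derivative_def intro: Cr_on_const\<close>)

lemma Cr_on_real_inverse: "Cr_on r (inverse :: real => real) (- {0})"
proof (induction r)
 case 0
 show ?case by (auto simp: Cr_on_0 intro!: continuous_intros)
next
 case (Suc r)
 show ?case
 by (rule Cr_on_real_SucI[where f'="%x. - (inverse x*inverse x)"])
 (auto intro!: Cr_on_minus Cr_on_mult Suc derivative_eq_intros simp: power2_eq_square)
qed

lemma Cr_on_inverse:
 fixes f :: "'a::euclidean_space => real"
 assumes "Cr_on r f U" "!!x. x : U ==> f x ~= 0"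
 shows "Cr_on r (%x. inverse (f x)) U"
 by (rule Cr_on_compose[OF Cr_on_real_inverse assms(1)]) (use assms(2) in auto)

lemma Cr_on_divide:
 fixes f :: "'a::euclidean_space => real"
 assumes "Cr_on r f U" "Cr_on r g U" "!!x. x : U ==> g x ~= 0"
 shows "Cr_on r (%x. f x/g x) U"
 unfolding divide_inverse by (intro Cr_on_mult Cr_on_inverse assms)

lemma Cr_on_real_sin_cos: "Cr_on r (sin :: real => real) UNIV & Cr_on r (cos :: real => real) UNIV"
proof (induction r)
 case 0
 show ?case by (auto simp: Cr_on_0 intro!: continuous_intros)
next
 case (Suc r)
 thus ?case
 by (auto intro!: Cr_on_real_SucI[where f=sin and f'=cos] Cr_on_real_SucI[where f=cos and f'="%x. - sin x"]
 Cr_on_minus derivative_eq_intros)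
qed

lemma Cr_on_sin: "Cr_on r f U ==> Cr_on r (%x. sin (f x :: real)) U"
 and Cr_on_cos: "Cr_on r f U ==> Cr_on r (%x. cos (f x :: real)) U"
 by (rule Cr_on_compose[of _ _ UNIV]; simp add: Cr_on_real_sin_cos)+

lemmas Cr_on_intros = Cr_on_const Cr_on_ident Cr_on_nth Cr_on_add Cr_on_minus Cr_on_diff Cr_on_sum
 Cr_on_mult Cr_on_scaleR Cr_on_inner Cr_on_power Cr_on_prod Cr_on_inverse Cr_on_divide Cr_on_sin Cr_on_cos

lemma ipd_bounded_linear:
 assumes "bounded_linear L" "Cr_on (length vs) f U" "set vs <= Basis" "x : U"
 shows "ipd (%x. L (f x)) vs x = L (ipd f vs x)"
 using assms(2-4)
proof (induction vs arbitrary: f x)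
 case (Cons v vs)
 have U: "open U" using Cons.prems(1) Cr_on_open by auto
 note D = Cr_on_SucD[OF Cons.prems(1)[simplified]]
 have "frechet_derivative (%x. L (f x)) (at y) v = L (frechet_derivative f (at y) v)" if "y : U" for y
 using frechet_derivative_at[OF bounded_linear.has_derivative[OF assms(1) D(1)[OF that]]] by metis
 hence "ipd (%x. L (f x)) (v # vs) x = ipd (%y. L (frechet_derivative f (at y) v)) vs x"
 unfolding ipd.simps using U Cons.prems(3) by (intro ipd_cong[of U]) auto
 also have "... = L (ipd f (v # vs) x)"
 using Cons.IH[OF D(2)] Cons.prems by simp
 finally show ?case .
qed simp

lemma ipd_add:
 assumes "Cr_on (length vs) f U" "Cr_on (length vs) g U" "set vs <= Basis" "x : U"
 shows "ipd (%x. f x + g x) vs x = ipd f vs x + ipd g vs x"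
 using assms
proof (induction vs arbitrary: f g x)
 case (Cons v vs)
 have U: "open U" using Cons.prems(1) Cr_on_open by auto
 note D = Cr_on_SucD[OF Cons.prems(1)[simplified]] Cr_on_SucD[OF Cons.prems(2)[simplified]]
 have "frechet_derivative (%x. f x + g x) (at y) v = frechet_derivative f (at y) v + frechet_derivative g (at y) v" if "y : U" for y
 using frechet_derivative_at[OF has_derivative_add[OF D(1)[OF that] D(3)[OF that]]] by metis
 hence "ipd (%x. f x + g x) (v # vs) x = ipd (%y. frechet_derivative f (at y) v + frechet_derivative g (at y) v) vs x"
 unfolding ipd.simps using U Cons.prems(4) by (intro ipd_cong[of U]) auto
 also have "... = ipd f (v # vs) x + ipd g (v # vs) x"
 using Cons.IH[OF D(2,4)] Cons.prems by simp
 finally show ?case .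
qed simp

lemma ipd_diff:
 assumes "Cr_on (length vs) f U" "Cr_on (length vs) g U" "set vs <= Basis" "x : U"
 shows "ipd (%x. f x - g x) vs x = ipd f vs x - ipd g vs x"
 using ipd_add[OF assms(1) Cr_on_minus[OF assms(2)] assms(3,4)]
 ipd_bounded_linear[OF bounded_linear_minus[OF bounded_linear_ident] assms(2-4)] by simp

lemma Cr_on_ipd_deriv:
 assumes "Cr_on r f U" "x : U" "set vs <= Basis" "length vs < r"
 shows "(ipd f vs has_derivative frechet_derivative (ipd f vs) (at x)) (at x)"
 using assms unfolding Cr_on_def frechet_derivative_works[symmetric] by (meson less_imp_le)

section \<open>Local inverses of C^r maps of the plane\<close>

lemma linear_real2:
 fixes M :: "real^2 => 'b::real_vector"
 assumes "linear M"
 shows "M v = v$1 *\<^sub>R M (axis 1 1) + v$2 *\<^sub>R M (axis 2 1)"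
proof -
 have "v = v$1 *\<^sub>R axis 1 1 + v$2 *\<^sub>R axis 2 1"
 by (simp add: vec_eq_iff forall_2 axis_def)
 hence "M v = M (v$1 *\<^sub>R axis 1 1 + v$2 *\<^sub>R axis 2 1)" by simp
 thus ?thesis by (simp add: linear_add[OF assms] linear_scale[OF assms])
qed

text \<open>Explicit entries of the inverse matrix show that the derivative of a local inverse is as
  smooth as the ingredients of the formula.\<close>

lemma cramer_real2:
 fixes M :: "real^2 => real^2"
 assumes M: "linear M" and "inj M"
 defines "d \<equiv> M (axis 1 1) $ 1*M (axis 2 1) $ 2 - M (axis 1 1) $ 2*M (axis 2 1) $ 1"
 shows "d ~= 0"
 and "inv M b = vector [(M (axis 2 1) $ 2*b$1 - M (axis 2 1) $ 1*b$2)/d,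
 (M (axis 1 1) $ 1*b$2 - M (axis 1 1) $ 2*b$1)/d]"
proof -
 have Mv: "M v $ i = v$1*M (axis 1 1) $ i + v$2*M (axis 2 1) $ i" for v i
 by (subst linear_real2[OF M]) simp
 show d: "d ~= 0"
 proof
 assume d0: "d = 0"
 have z: "M v = 0 ==> v = 0" for v using M \<open>inj M\<close> by (simp add: linear_injective_0)
 let ?a = "M (axis 1 1)" and ?b = "M (axis 2 1)"
 have z1: "M (vector [?b $ 2, - ?a $ 2]) = 0" and z2: "M (vector [?b $ 1, - ?a $ 1]) = 0"
 using d0 Mv[of "vector [?b $ 2, - ?a $ 2]"] Mv[of "vector [?b $ 1, - ?a $ 1]"]
 unfolding vec_eq_iff forall_2 d_def by (simp_all add: mult.commute)
 have "vector [?b $ 2, - ?a $ 2] = (0::real^2)" "vector [?b $ 1, - ?a $ 1] = (0::real^2)"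
 using z[OF z1] z[OF z2] by simp_all
 hence "?a $ 1 = 0" "?a $ 2 = 0" by (simp_all add: vec_eq_iff forall_2)
 hence "M (axis 1 1) = 0" by (simp add: vec_eq_iff forall_2)
 from z[OF this] show False by simp
 qed
 have "M (vector [(M (axis 2 1) $ 2*b$1 - M (axis 2 1) $ 1*b$2)/d,
 (M (axis 1 1) $ 1*b$2 - M (axis 1 1) $ 2*b$1)/d]) = b" (is "M ?v = b")
 proof -
 have "d*M ?v $ i = d*b $ i" for i
 using d exhaust_2[of i] unfolding Mv[of ?v] by (auto simp: distrib_left) (simp_all add: d_def algebra_simps)
 thus ?thesis using d by (simp add: vec_eq_iff)
 qed
 thus "inv M b = vector [(M (axis 2 1) $ 2*b$1 - M (axis 2 1) $ 1*b$2)/d,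
 (M (axis 1 1) $ 1*b$2 - M (axis 1 1) $ 2*b$1)/d]"
 using inv_f_f[OF \<open>inj M\<close>] by metis
qed

text \<open>Bootstrapping: the inverse function theorem gives a differentiable \<open>G\<close>
  whose derivative at y is the inverse of that of \<open>F\<close> at \<open>G y\<close>. By
  Cramer's rule its entries are rational in the partials of \<open>F\<close> at \<open>G y\<close>,
  so class k of \<open>G\<close> yields class k + 1, as long as the partials of \<open>F\<close>
  last.\<close>

lemma Cr_local_inverse:
 fixes F :: "real^2 => real^2"
 assumes F: "Cr_on (Suc r) F V" and x0: "x0 : V" and inj: "inj (frechet_derivative F (at x0))"
 obtains U W G where "open U" "U <= V" "x0 : U" "open W" "homeomorphism U W F G" "Cr_on (Suc r) G W"
proof -
 let ?D = "%x. frechet_derivative F (at x)"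
 define F' where "F' x = Blinfun (?D x)" for x
 have V: "open V" using F Cr_on_open by auto
 note D = Cr_on_SucD[OF F]
 have bl: "bounded_linear (?D x)" if "x : V" for x using D(1)[OF that] by (rule has_derivative_bounded_linear)
 have F': "blinfun_apply (F' x) = ?D x" if "x : V" for x
 unfolding F'_def by (rule bounded_linear_Blinfun_apply[OF bl[OF that]])
 have "continuous_on V (%x. blinfun_apply (F' x) i)" if "i : Basis" for i
 using Cr_on_continuous_on[OF D(2)[OF that]] F' by (simp cong: continuous_on_cong)
 hence cont: "continuous_on V F'" by (rule continuous_on_blinfun_componentwise)
 have lin: "linear (?D x0)" using bl[OF x0] by (rule bounded_linear.linear)
 obtain I where I: "linear I" "I \<circ> ?D x0 = id" using linear_injective_left_inverse[OF lin inj] by auto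
 have 1: "Blinfun I o\<^sub>L F' x0 = id_blinfun"
 using I F'[OF x0] by (intro blinfun_eqI) (simp add: bounded_linear_Blinfun_apply linear_conv_bounded_linear o_def id_def fun_eq_iff)
 have der: "(F has_derivative (blinfun_apply (F' x))) (at x)" if "x : V" for x
 using D(1)[OF that] F'[OF that] by simp
 obtain U W G g' where *: "open U" "U <= V" "x0 : U" "open W" "homeomorphism U W F G"
 "!!y. y : W ==> (G has_derivative (g' y)) (at y)"
 "!!y. y : W ==> g' y = inv (blinfun_apply (F' (G y)))"
 "!!y. y : W ==> bij (blinfun_apply (F' (G y)))"
 using inverse_function_theorem[OF V der cont x0 1] by metis
 have GU: "G y : U" "G y : V" if "y : W" for y using * that by (auto simp: homeomorphism_def)
 have "Cr_on k G W" if "k <= Suc r" for k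
 using that
 proof (induction k)
 case 0
 thus ?case using * by (simp add: Cr_on_0 homeomorphism_def)
 next
 case (Suc k)
 hence G: "Cr_on k G W" by simp
 let ?d = "%x. ?D x (axis 1 1) $ 1*?D x (axis 2 1) $ 2 - ?D x (axis 1 1) $ 2*?D x (axis 2 1) $ 1"
 define E where "E y = (%b::real^2. vector [(?D (G y) (axis 2 1) $ 2*b$1 - ?D (G y) (axis 2 1) $ 1*b$2)/?d (G y),
 (?D (G y) (axis 1 1) $ 1*b$2 - ?D (G y) (axis 1 1) $ 2*b$1)/?d (G y)] :: real^2)" for y
 have c: "linear (?D (G y)) & inj (?D (G y))" if "y : W" for y
 using bl[OF GU(2)[OF that]] *(8)[OF that] F'[OF GU(2)[OF that]] by (simp add: bij_def bounded_linear.linear)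
 have dn: "?d (G y) ~= 0" if "y : W" for y using cramer_real2(1) c[OF that] by blast
 have g'E: "g' y = E y" if "y : W" for y
 using cramer_real2(2)[of "?D (G y)"] c[OF that] *(7)[OF that] F'[OF GU(2)[OF that]] by (auto simp: E_def fun_eq_iff)
 have ent: "Cr_on k (%y. ?D (G y) b) W" if "b : Basis" for b
 by (rule Cr_on_compose[OF Cr_on_mono[OF D(2)[OF that]] G]) (use GU Suc.prems in auto)
 have ent': "Cr_on k (%y. ?D (G y) (axis i 1) $ j) W" for i j
 by (rule Cr_on_component[OF ent]) auto
 have "Cr_on k (%y. E y b) W" for b
 proof (rule Cr_on_components)
 fix i :: 2
 show "Cr_on k (%y. E y b $ i) W"
 using exhaust_2[of i] dn by (auto simp: E_def intro!: Cr_on_divide Cr_on_diff Cr_on_mult Cr_on_const *(4) ent')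
 qed
 thus ?case using *(6) g'E by (intro Cr_on_SucI[where D=E] *(4)) auto
 qed
 thus ?thesis using * that by blast
qed

section \<open>Parametrized surfaces and C^r diffeomorphisms in charts\<close>

lemma surf_param_subset:
 assumes "surf_param fi V S" "open V'" "V' <= V"
 shows "surf_param fi V' S"
proof -
 have h: "homeomorphism V (fi ` V) fi (inv_into V fi)" and o: "openin (top_of_set S) (fi ` V)"
 using assms by (auto simp: surf_param_def)
 have inj: "inj_on fi V" using h unfolding homeomorphism_def by (auto intro: inj_on_inverseI)
 have eq: "inv_into V' fi y = inv_into V fi y" if "y : fi ` V'" for y
 using that inj inj_on_subset[OF inj assms(3)] assms(3) by (auto simp: inv_into_f_f subset_iff)
 have h': "homeomorphism V' (fi ` V') fi (inv_into V' fi)"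
 proof (rule homeomorphism_cong)
 show "homeomorphism V' (fi ` V') fi (inv_into V fi)"
 by (rule homeomorphism_of_subsets[OF h assms(3)]) auto
 qed (use eq in auto)
 have "openin (top_of_set (fi ` V)) (fi ` V')"
 by (rule homeomorphism_imp_open_map[OF h]) (use assms in \<open>simp add: open_subset\<close>)
 hence "openin (top_of_set S) (fi ` V')" using o openin_trans by blast
 with h' assms show ?thesis unfolding surf_param_def
 by (metis (no_types, lifting) Cr_on_subset openin_imp_subset subset_eq)
qed

lemma surf_paramD:
 assumes "surf_param fi V S"
 shows "open V" "Cr_on k fi V" "inj_on fi V" "continuous_on (fi ` V) (inv_into V fi)"
 "openin (top_of_set S) (fi ` V)" "fi ` V <= S" "x : V ==> inj (frechet_derivative fi (at x))"
 "x : V ==> inv_into V fi (fi x) = x" "continuous_on V fi"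
 using assms unfolding surf_param_def homeomorphism_def
 by (auto simp: inj_on_def) (metis inj_onI inv_into_f_f)

text \<open>\<open>gi\<close> takes values in a larger space. A linear left inverse \<open>L\<close>
  of its derivative at one point makes w -> \<open>L (gi w)\<close> a local diffeomorphism of the
  plane with C^k inverse \<open>G\<close>; near that point the inverse parametrization is y ->
  \<open>G (L y)\<close>.\<close>

lemma surf_param_transition:
 fixes fi gi :: "real^2 => 'e::euclidean_space"
 assumes p: "surf_param fi V S" and q: "surf_param gi W S"
 shows "Cr_on k (%x. inv_into W gi (fi x)) {x:V. fi x : gi ` W}"
proof (rule Cr_on_local)
 let ?A = "{x:V. fi x : gi ` W}"
 note P = surf_paramD[OF p] and Q = surf_paramD[OF q]
 obtain T where T: "open T" "gi ` W = S Int T" using Q(5) openin_open by metis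
 have A: "?A = {x:V. fi x : T}" using T P(6) by auto
 show oA: "open ?A" unfolding A by (rule continuous_open_preimage[OF P(9,1) T(1), unfolded vimage_def Int_def, simplified])
 have cj: "continuous_on ?A (%x. inv_into W gi (fi x))"
 by (rule continuous_on_compose2[OF Q(4) continuous_on_subset[OF P(9)]]) auto
 fix x0 assume x0: "x0 : ?A"
 define w0 where "w0 = inv_into W gi (fi x0)"
 have w0: "w0 : W" "gi w0 = fi x0" using x0 unfolding w0_def by (auto simp: inv_into_into f_inv_into_f)
 have d: "(gi has_derivative frechet_derivative gi (at w0)) (at w0)" using Cr_on_SucD(1)[OF Q(2)] w0 by auto
 have lin: "linear (frechet_derivative gi (at w0))" using d has_derivative_linear by blast
 obtain L where L: "linear L" "L \<circ> frechet_derivative gi (at w0) = id"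
 using linear_injective_left_inverse[OF lin Q(7)[OF w0(1)]] by auto
 have bL: "bounded_linear L" using L linear_conv_bounded_linear by blast
 define F where "F w = L (gi w)" for w
 have "frechet_derivative F (at w0) = id"
 using frechet_derivative_at[OF bounded_linear.has_derivative[OF bL d]] L(2) by (simp add: F_def[abs_def] o_def)
 hence i: "inj (frechet_derivative F (at w0))" by simp
 have CF: "Cr_on (Suc k) F W" unfolding F_def by (rule Cr_on_bounded_linear[OF bL Q(2)])
 obtain U W' G where *: "open U" "U <= W" "w0 : U" "open W'" "homeomorphism U W' F G" "Cr_on (Suc k) G W'"
 by (rule Cr_local_inverse[OF CF w0(1) i])
 define B where "B = {x:?A. inv_into W gi (fi x) : U}"
 have oB: "open B" unfolding B_def
 using continuous_open_preimage[OF cj oA *(1)] by (simp add: vimage_def Int_def)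
 have FU: "F ` U = W'" "!!u. u : U ==> G (F u) = u" using *(5) by (auto simp: homeomorphism_def)
 have eq: "inv_into W gi (fi x) = G (L (fi x))" "L (fi x) : W'" if "x : B" for x
 proof -
 let ?u = "inv_into W gi (fi x)"
 have u: "?u : U" "gi ?u = fi x" using that unfolding B_def by (auto simp: f_inv_into_f)
 thus "?u = G (L (fi x))" "L (fi x) : W'" using FU(2)[OF u(1)] FU(1) u unfolding F_def by (metis, metis imageI)
 qed
 have "Cr_on k (%x. G (L (fi x))) B"
 proof (rule Cr_on_compose[OF Cr_on_mono[OF *(6)]])
 show "Cr_on k (%x. L (fi x)) B"
 by (rule Cr_on_bounded_linear[OF bL Cr_on_subset[OF P(2) oB]]) (auto simp: B_def)
 qed (use eq in auto)
 hence "Cr_on k (%x. inv_into W gi (fi x)) B" using Cr_on_cong[of B, OF eq(1)] by simp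
 moreover have "x0 : B" using x0 *(3) unfolding B_def w0_def by simp
 ultimately show "EX V. x0 : V & Cr_on k (%x. inv_into W gi (fi x)) V" by blast
qed

text \<open>\<open>Cr_map\<close> quantifies over all pairs of parametrizations. Because transitions
  are smooth, one good pair around every point is enough, so a concrete map may be given by formulas
  in charts of its own.\<close>

lemma Cr_mapI:
 fixes S :: "'e::euclidean_space set"
 assumes fS: "f ` S <= S"
 and loc: "!!p. p : S ==> EX fi V gi W F. surf_param fi V S & p : fi ` V & surf_param gi W S &
 Cr_on r F V & F ` V <= W & (ALL x:V. f (fi x) = gi (F x))"
 shows "Cr_map r S f"
 unfolding Cr_map_def
proof (intro conjI allI impI)
 show "f ` S <= S" by fact
 show cf: "continuous_on S f"
 unfolding continuous_on_eq_continuous_within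
 proof
 fix p assume p: "p : S"
 obtain fi V gi W F where *: "surf_param fi V S" "p : fi ` V" "surf_param gi W S"
 "Cr_on r F V" "F ` V <= W" "ALL x:V. f (fi x) = gi (F x)" using loc[OF p] by blast
 note P = surf_paramD[OF *(1)] and Q = surf_paramD[OF *(3)]
 obtain T where T: "open T" "fi ` V = S Int T" using P(5) openin_open by metis
 have "continuous_on (fi ` V) (%y. gi (F (inv_into V fi y)))"
 by (rule continuous_on_compose2[OF Q(9) continuous_on_compose2[OF Cr_on_continuous_on[OF *(4)] P(4)]])
 (use *(5) P(8) in auto)
 moreover have "gi (F (inv_into V fi y)) = f y" if "y : fi ` V" for y using that *(6) P(8) by auto
 ultimately have "continuous_on (fi ` V) f" by (simp cong: continuous_on_cong)
 hence "continuous (at p within (fi ` V)) f" using *(2) continuous_on_eq_continuous_within by blast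
 moreover have "at p within (fi ` V) = at p within S"
 by (rule at_within_nhd[of p T]) (use T *(2) in auto)
 ultimately show "continuous (at p within S) f" by simp
 qed
 fix fi' gi' :: "real^2 => 'e" and V' W' :: "(real^2) set"
 assume s: "surf_param fi' V' S & surf_param gi' W' S"
 note P' = surf_paramD[OF s[THEN conjunct1]] and Q' = surf_paramD[OF s[THEN conjunct2]]
 let ?A = "{x : V'. f (fi' x) : gi' ` W'}"
 obtain T where T: "open T" "gi' ` W' = S Int T" using Q'(5) openin_open by metis
 have A: "?A = {x:V'. f (fi' x) : T}" using T(2) P'(6) fS by (auto simp: image_subset_iff subset_iff)
 have "continuous_on V' (%x. f (fi' x))" by (rule continuous_on_compose2[OF cf P'(9,6)])
 hence oA: "open ?A" unfolding A
 using continuous_open_preimage[OF _ P'(1) T(1)] by (simp add: vimage_def Int_def)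
 show "Cr_on r (inv_into W' gi' \<circ> f \<circ> fi') ?A"
 proof (rule Cr_on_local[OF oA])
 fix x0 assume x0: "x0 : ?A"
 then obtain fi V gi W F where *: "surf_param fi V S" "fi' x0 : fi ` V" "surf_param gi W S"
 "Cr_on r F V" "F ` V <= W" "ALL x:V. f (fi x) = gi (F x)" using loc[of "fi' x0"] P'(6) by blast
 note P = surf_paramD[OF *(1)] and Q = surf_paramD[OF *(3)]
 let ?a = "%x. inv_into V fi (fi' x)" and ?b = "%w. inv_into W' gi' (gi w)"
 let ?U1 = "{x:V'. fi' x : fi ` V}" and ?U2 = "{w:W. gi w : gi' ` W'}"
 have a: "Cr_on r ?a ?U1" and b: "Cr_on r ?b ?U2"
 using surf_param_transition s * by blast+
 let ?B = "?U1 Int ?A"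
 have oB: "open ?B" using Cr_on_open[OF a] oA by auto
 have eq: "?a x : V" "fi (?a x) = fi' x" if "x : ?U1" for x
 using that by (auto simp: inv_into_into f_inv_into_f)
 have "F (?a x) : ?U2" if "x : ?B" for x
 proof -
 have v: "?a x : V" "fi (?a x) = fi' x" using eq[of x] that by auto
 hence "gi (F (?a x)) = f (fi' x)" "F (?a x) : W" using *(5,6) by auto
 thus ?thesis using that by simp
 qed
 hence "Cr_on r (%x. ?b (F (?a x))) ?B"
 using eq(1) by (intro Cr_on_compose[OF b Cr_on_compose[OF *(4) Cr_on_subset[OF a oB]]]) blast+
 moreover have "?b (F (?a x)) = (inv_into W' gi' \<circ> f \<circ> fi') x" if "x : ?B" for x
 using eq[of x] *(6) that by auto
 ultimately have "Cr_on r (inv_into W' gi' \<circ> f \<circ> fi') ?B"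
 using Cr_on_cong[of ?B "%x. ?b (F (?a x))" "inv_into W' gi' \<circ> f \<circ> fi'" r] by simp
 moreover have "x0 : ?B" using x0 *(2) by (intro IntI CollectI conjI) auto
 ultimately show "EX V. x0 : V & Cr_on r (inv_into W' gi' \<circ> f \<circ> fi') V" by (intro exI[of _ ?B] conjI)
 qed
qed

text \<open>The inverse is treated in the same charts: where the local expression \<open>F\<close>
  has injective derivative, \<open>Cr_local_inverse\<close> provides \<open>G\<close>, which is a
  local expression of \<open>inv_into S f\<close>.\<close>

lemma Cr_diffeoI:
 fixes S :: "'e::euclidean_space set"
 assumes bij: "bij_betw f S S"
 and loc: "!!p. p : S ==> EX fi V gi W F. surf_param fi V S & p : fi ` V & surf_param gi W S &
 Cr_on (Suc r) F V & F ` V <= W & (ALL x:V. f (fi x) = gi (F x) & inj (frechet_derivative F (at x)))"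
 shows "Cr_diffeo (Suc r) S f"
 unfolding Cr_diffeo_def
proof (intro conjI bij Cr_mapI)
 have inj: "inj_on f S" and fS: "f ` S = S" using bij by (auto simp: bij_betw_def)
 show "f ` S <= S" "inv_into S f ` S <= S" using fS by (auto intro: inv_into_into)
 fix p assume p: "p : S"
 show "EX fi V gi W F. surf_param fi V S & p : fi ` V & surf_param gi W S &
 Cr_on (Suc r) F V & F ` V <= W & (ALL x:V. f (fi x) = gi (F x))"
 using loc[OF p] by meson
 obtain p' where p': "p' : S" "f p' = p" using p fS by (metis imageE)
 obtain fi V gi W F where *: "surf_param fi V S" "p' : fi ` V" "surf_param gi W S"
 "Cr_on (Suc r) F V" "F ` V <= W" "ALL x:V. f (fi x) = gi (F x)" "ALL x:V. inj (frechet_derivative F (at x))"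
 using loc[OF p'(1)] by meson
 obtain x0 where x0: "x0 : V" "p' = fi x0" using *(2) by auto
 obtain U W' G where g: "open U" "U <= V" "x0 : U" "open W'" "homeomorphism U W' F G" "Cr_on (Suc r) G W'"
 using Cr_local_inverse[OF *(4) x0(1)] *(7) x0(1) by blast
 have G: "F ` U = W'" "G ` W' = U" "!!y. y : W' ==> F (G y) = y" using g(5) by (auto simp: homeomorphism_def)
 have W': "W' <= W" using G(1) g(2) *(5) by blast
 have "inv_into S f (gi y) = fi (G y)" if "y : W'" for y
 proof -
 have "G y : V" using that G(2) g(2) by blast
 hence "f (fi (G y)) = gi y" "fi (G y) : S" using *(6) G(3)[OF that] surf_paramD(6)[OF *(1)] by auto
 thus ?thesis using inj by (metis inv_into_f_f)
 qed
 moreover have "p : gi ` W'" using p' x0 *(6) G(1) g(3) by auto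
 moreover have "G ` W' <= V" using G(2) g(2) by auto
 ultimately show "EX fi V gi W F. surf_param fi V S & p : fi ` V & surf_param gi W S &
 Cr_on (Suc r) F V & F ` V <= W & (ALL x:V. inv_into S f (fi x) = gi (F x))"
 using surf_param_subset[OF *(3) g(4) W'] *(1) g(6) by blast
qed

section \<open>Higher derivatives of functions of one variable\<close>

text \<open>Pointwise existence of k successive derivatives, which is what iterated applications of
  Rolle's theorem consume.\<close>

primrec kd :: "nat => real set => (real => real) => bool" where
 "kd 0 I f \<longleftrightarrow> True"
| "kd (Suc k) I f \<longleftrightarrow> (ALL t:I. f differentiable (at t)) & kd k I (deriv f)"

text \<open>Derivatives of order below k are bounded by M, the k-th only by M*Y. The separate factor
  Y will carry the top divided difference, which has no a priori bound, so that estimates can be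
  kept linear in it.\<close>

primrec fbd :: "nat => real => real => real set => (real => real) => bool" where
 "fbd 0 M Y I f \<longleftrightarrow> (ALL t:I. \<bar>f t\<bar> <= M*Y)"
| "fbd (Suc k) M Y I f \<longleftrightarrow> (ALL t:I. \<bar>f t\<bar> <= M & f differentiable (at t)) & fbd k M Y I (deriv f)"

lemma deriv_cong_open:
 assumes "open I" "!!t. t : I ==> f t = g t" "t : I"
 shows "deriv f t = deriv g t" "f differentiable (at t) \<longleftrightarrow> g differentiable (at t)"
proof -
 have "eventually (%x. x : I) (nhds t)" using assms by (simp add: eventually_nhds_in_open)
 hence "eventually (%x. f x = g x) (nhds t)" by (rule eventually_mono) (use assms in auto)
 thus "deriv f t = deriv g t" by (rule deriv_cong_ev) simp
 have "(f has_derivative D) (at t) = (g has_derivative D) (at t)" for D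
 using has_derivative_transform_within_open[OF _ assms(1,3)] assms(2) by metis
 thus "f differentiable (at t) \<longleftrightarrow> g differentiable (at t)" by (simp add: differentiable_def)
qed

lemma kd_cong: "open I ==> (!!t. t : I ==> f t = g t) ==> kd k I f = kd k I g"
proof (induction k arbitrary: f g)
 case (Suc k)
 have "deriv f t = deriv g t" "f differentiable (at t) \<longleftrightarrow> g differentiable (at t)" if "t : I" for t
 using deriv_cong_open[of I f g t] Suc.prems that by blast+
 thus ?case using Suc.IH[OF Suc.prems(1), of "deriv f" "deriv g"] Suc.prems(2) by simp
qed simp

lemma fbd_cong: "open I ==> (!!t. t : I ==> f t = g t) ==> fbd k M Y I f = fbd k M Y I g"
proof (induction k arbitrary: f g)
 case (Suc k)
 have "deriv f t = deriv g t" "f differentiable (at t) \<longleftrightarrow> g differentiable (at t)" if "t : I" for t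
 using deriv_cong_open[of I f g t] Suc.prems that by blast+
 thus ?case using Suc.IH[OF Suc.prems(1), of "deriv f" "deriv g"] Suc.prems(2) by simp
qed simp

lemma derivs_cong: "open I ==> (!!t. t : I ==> f t = g t) ==> t : I ==> (deriv ^^ k) f t = (deriv ^^ k) g t"
proof (induction k arbitrary: f g)
 case (Suc k)
 have "deriv f t = deriv g t" if "t : I" for t
 using deriv_cong_open[of I f g t] Suc.prems that by blast
 thus ?case using Suc.IH[OF Suc.prems(1), of "deriv f" "deriv g"] Suc.prems(3)
 by (simp add: funpow_Suc_right del: funpow.simps)
qed simp

lemma real_differentiableI: "DERIV f t :> d ==> f differentiable (at (t::real))"
 unfolding real_differentiable_def by blast

lemma real_differentiableD: "f differentiable (at (t::real)) ==> DERIV f t :> deriv f t"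
 by (metis DERIV_imp_deriv real_differentiable_def)

lemma fbd_SucI:
 assumes "open I" "!!t. t : I ==> DERIV f t :> f' t" "!!t. t : I ==> \<bar>f t\<bar> <= M" "fbd k M Y I f'"
 shows "fbd (Suc k) M Y I f"
proof -
 have "deriv f t = f' t" if "t : I" for t using assms(2)[OF that] by (rule DERIV_imp_deriv)
 hence "fbd k M Y I (deriv f)" using fbd_cong[OF assms(1), of "deriv f" f'] assms(4) by blast
 thus ?thesis using assms by (auto intro: real_differentiableI)
qed

lemma kd_SucI:
 assumes "open I" "!!t. t : I ==> DERIV f t :> f' t" "kd k I f'"
 shows "kd (Suc k) I f"
proof -
 have "deriv f t = f' t" if "t : I" for t using assms(2)[OF that] by (rule DERIV_imp_deriv)
 hence "kd k I (deriv f)" using kd_cong[OF assms(1), of "deriv f" f'] assms(3) by blast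
 thus ?thesis using assms by (auto intro: real_differentiableI)
qed

lemma fbd_mono: "fbd k M Y I f ==> M <= M' ==> Y <= Y' ==> 0 <= Y ==> 0 <= M' ==> fbd k M' Y' I f"
proof (induction k arbitrary: f)
 case 0
 hence "M*Y <= M'*Y'" by (intro mult_mono) auto
 thus ?case using 0 by (auto intro: order_trans)
qed (auto intro: order_trans)

lemma fbd_drop: "fbd (Suc k) M Y I f ==> fbd k M 1 I f"
 by (induction k arbitrary: f) auto

lemma fbd_weaken: "fbd (Suc k) M Y I f ==> 1 <= Y ==> 0 <= M ==> fbd k M Y I f"
 by (rule fbd_mono[OF fbd_drop[of k M Y I f]]) (auto simp del: fbd.simps)

lemma fbd_weaken_le: "fbd k M Y I f ==> j <= k ==> 1 <= Y ==> 0 <= M ==> fbd j M Y I f"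
 by (induction k) (auto simp: le_Suc_eq intro: fbd_weaken simp del: fbd.simps)

lemma fbd_kd: "fbd k M Y I f ==> kd k I f"
 by (induction k arbitrary: f) auto

lemma kd_weaken: "kd k I f ==> j <= k ==> kd j I f"
proof (induction k arbitrary: f j)
 case (Suc k) thus ?case by (cases j) auto
qed simp

lemma fbd_top: "fbd k M Y I f ==> t : I ==> \<bar>(deriv ^^ k) f t\<bar> <= M*Y"
 by (induction k arbitrary: f) (auto simp: funpow_Suc_right simp del: funpow.simps(2))

lemma fbd_add:
 assumes "open I" "fbd k M Y I f" "fbd k M' Y I g"
 shows "fbd k (M + M') Y I (%t. f t + g t)"
 using assms(2,3)
proof (induction k arbitrary: f g)
 case 0
 show ?case
 proof (simp, rule)
 fix t assume "t : I"
 hence "\<bar>f t\<bar> <= M*Y" "\<bar>g t\<bar> <= M'*Y" using 0 by auto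
 thus "\<bar>f t + g t\<bar> <= (M + M')*Y" unfolding distrib_right by linarith
 qed
next
 case (Suc k)
 thus ?case
 by (intro fbd_SucI[OF assms(1), where f'="%t. deriv f t + deriv g t"] Suc.IH)
 (auto intro!: DERIV_add real_differentiableD order_trans[OF abs_triangle_ineq] add_mono)
qed

lemma kd_add:
 assumes "open I" "kd k I f" "kd k I g"
 shows "kd k I (%t. f t + g t)"
 using assms(2,3)
proof (induction k arbitrary: f g)
 case (Suc k)
 thus ?case
 by (intro kd_SucI[OF assms(1), where f'="%t. deriv f t + deriv g t"] Suc.IH)
 (auto intro!: DERIV_add real_differentiableD)
qed simp

lemma derivs_add:
 assumes "open I" "kd k I f" "kd k I g" "t : I"
 shows "(deriv ^^ k) (%t. f t + g t) t = (deriv ^^ k) f t + (deriv ^^ k) g t"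
 using assms(2,3)
proof (induction k arbitrary: f g)
 case (Suc k)
 have "deriv (%t. f t + g t) x = deriv f x + deriv g x" if "x : I" for x
 using Suc.prems that by (intro DERIV_imp_deriv DERIV_add real_differentiableD) auto
 hence "(deriv ^^ k) (deriv (%t. f t + g t)) t = (deriv ^^ k) (%x. deriv f x + deriv g x) t"
 by (rule derivs_cong[OF assms(1) _ assms(4)])
 thus ?case using Suc by (simp add: funpow_Suc_right del: funpow.simps(2))
qed simp

lemma kd_const: "kd k I (%t. c)"
 by (induction k arbitrary: c) auto

lemma derivs_const: "0 < k ==> (deriv ^^ k) (%t. c) t = 0"
proof (induction k arbitrary: c)
 case (Suc k)
 thus ?case by (cases k) (simp_all add: funpow_Suc_right del: funpow.simps(2))
qed simp

lemma kd_cmult: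
 assumes "open I" "kd k I f"
 shows "kd k I (%t. c*f t)"
 using assms(2)
proof (induction k arbitrary: f)
 case (Suc k)
 thus ?case
 by (intro kd_SucI[OF assms(1), where f'="%t. c*deriv f t"] Suc.IH)
 (auto intro!: DERIV_cmult real_differentiableD)
qed simp

lemma derivs_cmult:
 assumes "open I" "kd k I f" "t : I"
 shows "(deriv ^^ k) (%t. c*f t) t = c*(deriv ^^ k) f t"
 using assms(2)
proof (induction k arbitrary: f)
 case (Suc k)
 have "deriv (%t. c*f t) x = c*deriv f x" if "x : I" for x
 using Suc.prems that by (intro DERIV_imp_deriv DERIV_cmult real_differentiableD) auto
 hence "(deriv ^^ k) (deriv (%t. c*f t)) t = (deriv ^^ k) (%x. c*deriv f x) t"
 by (rule derivs_cong[OF assms(1) _ assms(3)])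
 thus ?case using Suc by (simp add: funpow_Suc_right del: funpow.simps(2))
qed simp

text \<open>Leibniz' rule, with \<open>2 ^ k\<close> counting its terms. The first factor has top
  factor 1, so Y enters the product to the first power.\<close>

lemma fbd_mult:
 assumes I: "open I" and "1 <= Y" "0 <= M" "0 <= M'" "fbd k M 1 I f" "fbd k M' Y I g"
 shows "fbd k (2 ^ k*M*M') Y I (%t. f t*g t)"
 using assms(5,6)
proof (induction k arbitrary: f g)
 case 0
 thus ?case using assms(2-4)
 by (auto simp: abs_mult mult.assoc intro!: mult_mono)
next
 case (Suc k)
 have 1: "fbd k (2 ^ k*M*M') Y I (%t. deriv f t*g t)"
 using Suc.prems assms(2-4) by (intro Suc.IH) (auto intro: fbd_weaken simp del: fbd.simps simp: fbd.simps(2)[of k M 1 I f])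
 have 2: "fbd k (2 ^ k*M*M') Y I (%t. f t*deriv g t)"
 using Suc.prems assms(2-4) by (intro Suc.IH) (auto intro: fbd_drop simp del: fbd.simps simp: fbd.simps(2)[of k M' Y I g])
 show ?case
 proof (rule fbd_SucI[OF I, where f'="%t. deriv f t*g t + f t*deriv g t"])
 show "fbd k (2 ^ Suc k*M*M') Y I (%t. deriv f t*g t + f t*deriv g t)"
 using fbd_add[OF I 1 2] by (simp add: algebra_simps)
 fix t assume t: "t : I"
 show "DERIV (%t. f t*g t) t :> deriv f t*g t + f t*deriv g t"
 using DERIV_mult[of f "deriv f t" t UNIV g "deriv g t"] Suc.prems t by (auto simp: real_differentiableD algebra_simps)
 have "\<bar>f t*g t\<bar> <= M*M'" using Suc.prems t assms by (auto simp: abs_mult intro!: mult_mono)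
 also have "... = 1*(M*M')" by simp
 also have "... <= 2 ^ Suc k*(M*M')" using assms by (intro mult_right_mono) (auto intro: one_le_power simp del: power_Suc)
 finally show "\<bar>f t*g t\<bar> <= 2 ^ Suc k*M*M'" by (simp add: mult.assoc)
 qed
qed

lemma kd_mult:
 assumes I: "open I" and "kd k I f" "kd k I g"
 shows "kd k I (%t. f t*g t)"
 using assms(2,3)
proof (induction k arbitrary: f g)
 case (Suc k)
 have w: "kd k I f" "kd k I g" using Suc.prems kd_weaken le_SucI by blast+
 show ?case
 using DERIV_mult[of f "deriv f t" t UNIV g "deriv g t" for t] Suc w
 by (intro kd_SucI[OF I, where f'="%t. deriv f t*g t + deriv g t*f t"] kd_add[OF I] Suc.IH)
 (auto intro!: DERIV_mult real_differentiableD)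
qed simp

text \<open>Leibniz' rule with one term split off: the remainder contains only derivatives of
  \<open>f\<close> of order below k, so no bound on the k-th derivative of \<open>f\<close>
  enters.\<close>

lemma derivs_mult_approx:
 assumes I: "open I" and "1 <= Y" "0 <= M" "0 <= M'" "kd k I f" "0 < k ==> fbd (k - 1) M 1 I f"
 "kd k I g" "0 < k ==> fbd (k - 1) M' Y I (deriv g)" "t : I"
 shows "\<bar>(deriv ^^ k) (%t. f t*g t) t - (deriv ^^ k) f t*g t\<bar> <= 2 ^ k*M*M'*Y"
 using assms(5-8)
proof (induction k arbitrary: f)
 case 0
 thus ?case using assms(2-4) by simp
next
 case (Suc k)
 have w: "kd k I f" "kd k I g" using Suc.prems kd_weaken le_SucI by blast+
 have k1: "kd k I (%t. deriv f t*g t)" "kd k I (%t. f t*deriv g t)"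
 using Suc.prems w by (auto intro: kd_mult[OF I])
 have "deriv (%t. f t*g t) x = deriv f x*g x + f x*deriv g x" if "x : I" for x
 using DERIV_imp_deriv[OF DERIV_mult[of f "deriv f x" x UNIV g "deriv g x"]] Suc.prems that
 by (auto simp: real_differentiableD)
 hence "(deriv ^^ k) (deriv (%t. f t*g t)) t = (deriv ^^ k) (%x. deriv f x*g x + f x*deriv g x) t"
 by (rule derivs_cong[OF I _ assms(9)])
 also have "... = (deriv ^^ k) (%x. deriv f x*g x) t + (deriv ^^ k) (%x. f x*deriv g x) t"
 by (rule derivs_add[OF I k1 assms(9)])
 finally have eq: "(deriv ^^ Suc k) (%t. f t*g t) t = ..."
 by (simp add: funpow_Suc_right del: funpow.simps(2))
 have f: "fbd k M 1 I f" and g: "fbd k M' Y I (deriv g)" using Suc.prems by auto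
 have "\<bar>(deriv ^^ k) (%x. deriv f x*g x) t - (deriv ^^ k) (deriv f) t*g t\<bar> <= 2 ^ k*M*M'*Y"
 proof (rule Suc.IH)
 show "kd k I (deriv f)" using Suc.prems by auto
 show "fbd (k - 1) M 1 I (deriv f)" if "0 < k" using f that by (cases k) auto
 show "kd k I g" by (rule w)
 show "fbd (k - 1) M' Y I (deriv g)" if "0 < k" using g assms(2,4) by (auto intro: fbd_weaken_le)
 qed
 moreover have "\<bar>(deriv ^^ k) (%x. f x*deriv g x) t\<bar> <= 2 ^ k*M*M'*Y"
 by (rule fbd_top[OF fbd_mult[OF I assms(2-4) f g] assms(9)])
 ultimately show ?case unfolding eq by (simp add: funpow_Suc_right del: funpow.simps(2))
qed

section \<open>Derivatives along graphs and of compositions\<close>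

text \<open>What matters about this constant, and about \<open>famD\<close> and \<open>cmpC\<close>
  below, is that it depends on the order and the bound \<open>A\<close> only.\<close>

primrec famC :: "nat => real => real" where
 "famC 0 A = 1"
| "famC (Suc k) A = famC k A + 2 ^ k*famC k A*A"

lemma famC_ge1: "0 <= A ==> 1 <= famC k A"
 by (induction k) (auto intro: add_increasing2)

text \<open>The model is x -> H(x, p x). Words over booleans index the mixed partials of H, with
  False for the first and True for the second variable, and \<open>s\<close> is the slope of p. The
  family encodes the chain rule at every order at once and replaces the combinatorial formula for
  higher derivatives along a graph.\<close>

lemma fbd_family:
 assumes I: "open I" and Y: "1 <= Y" and A: "0 <= A" and M: "0 <= M"
 and u: "!!w t. length w < k ==> t : I ==> DERIV (u w) t :> u (w @ [False]) t + u (w @ [True]) t * s t"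
 and b: "!!w t. length w <= k ==> t : I ==> \<bar>u w t\<bar> <= M"
 and s: "0 < k ==> fbd (k - 1) A Y I s"
 shows "fbd k (famC k A*M) Y I (u [])"
 using u b s Y
proof (induction k arbitrary: u Y)
 case 0
 have "M*1 <= M*Y" using 0 M by (intro mult_left_mono) auto
 thus ?case using 0(2)[of "[]"] by force
next
 case (Suc k)
 note c = famC_ge1[OF A, of k]
 have F: "fbd k (famC k A*M) Y I (u [False])"
 using Suc.IH[of "%w. u (False # w)" Y] Suc.prems(1)[of "False # _"] Suc.prems(2)[of "False # _"] Suc.prems(3,4) A
 by (simp add: fbd_weaken_le)
 have "fbd (k - 1) A 1 I s" if "0 < k"
 using Suc.prems(3) that fbd_drop[of "k - 1" A Y I s] by simp
 hence T: "fbd k (famC k A*M) 1 I (u [True])"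
 using Suc.IH[of "%w. u (True # w)" 1] Suc.prems(1)[of "True # _"] Suc.prems(2)[of "True # _"] by simp
 have "fbd k (2 ^ k*(famC k A*M)*A) Y I (%t. u [True] t * s t)"
 by (rule fbd_mult[OF I Suc.prems(4) _ A T]) (use Suc.prems c M in auto)
 from fbd_add[OF I F this] have *: "fbd k (famC (Suc k) A*M) Y I (%t. u [False] t + u [True] t * s t)"
 by (simp add: algebra_simps)
 show ?case
 proof (rule fbd_SucI[OF I _ _ *])
 fix t assume t: "t : I"
 show "DERIV (u []) t :> u [False] t + u [True] t * s t" using Suc.prems(1)[of "[]" t] t by simp
 have "1*M <= famC (Suc k) A*M" by (intro mult_right_mono famC_ge1 A M)
 thus "\<bar>u [] t\<bar> <= famC (Suc k) A*M" using Suc.prems(2)[of "[]" t] t by simp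
 qed
qed

lemma kd_family:
 assumes I: "open I"
 and u: "!!w t. length w < k ==> t : I ==> DERIV (u w) t :> u (w @ [False]) t + u (w @ [True]) t * s t"
 and s: "0 < k ==> kd (k - 1) I s"
 shows "kd k I (u [])"
 using u s
proof (induction k arbitrary: u)
 case (Suc k)
 have F: "kd k I (u [False])"
 using Suc.IH[of "%w. u (False # w)"] Suc.prems(1)[of "False # _"] Suc.prems(2) by (simp add: kd_weaken)
 have T: "kd k I (u [True])"
 using Suc.IH[of "%w. u (True # w)"] Suc.prems(1)[of "True # _"] Suc.prems(2) by (simp add: kd_weaken)
 show ?case
 by (rule kd_SucI[OF I, where f'="%t. u [False] t + u [True] t * s t"])
 (use Suc.prems(1)[of "[]"] Suc.prems(2) F T in \<open>auto intro!: kd_add kd_mult I\<close>)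
qed simp

primrec famD :: "nat => real" where
 "famD 0 = 0"
| "famD (Suc k) = famD k + 2 ^ k*famC k 1"

text \<open>On a graph whose slope is of size \<open>ze\<close> together with its derivatives, every
  letter True costs a factor \<open>ze\<close>; up to that error only the word of False letters
  survives, that is, the pure k-th partial in the first variable.\<close>

lemma derivs_family_approx:
 assumes I: "open I" and e: "0 <= ze" "ze <= 1" and M: "0 <= M"
 and u: "!!w t. length w < k ==> t : I ==> DERIV (u w) t :> u (w @ [False]) t + u (w @ [True]) t * s t"
 and b: "!!w t. length w <= k ==> t : I ==> \<bar>u w t\<bar> <= M"
 and s: "0 < k ==> fbd (k - 1) ze 1 I s" and t: "t : I"
 shows "\<bar>(deriv ^^ k) (u []) t - u (replicate k False) t\<bar> <= famD k*M*ze"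
 using u b s
proof (induction k arbitrary: u)
 case (Suc k)
 have "fbd k 1 1 I s" using Suc.prems(3) e by (auto intro: fbd_mono)
 hence s1: "fbd (k - 1) 1 1 I s" by (rule fbd_weaken_le) auto
 have F: "fbd k (famC k 1*M) 1 I (u [False])"
 by (rule fbd_family[OF I order_refl _ M, where u="%w. u (False # w)" and s=s])
 (use Suc.prems(1)[of "False # _"] Suc.prems(2)[of "False # _"] s1 in auto)
 have T: "fbd k (famC k 1*M) 1 I (u [True])"
 by (rule fbd_family[OF I order_refl _ M, where u="%w. u (True # w)" and s=s])
 (use Suc.prems(1)[of "True # _"] Suc.prems(2)[of "True # _"] s1 in auto)
 have c: "0 <= famC k 1" using famC_ge1[of 1 k] by simp
 have p: "fbd k (2 ^ k*(famC k 1*M)*ze) 1 I (%t. u [True] t * s t)"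
 by (rule fbd_mult[OF I order_refl _ e(1) T]) (use Suc.prems c M in auto)
 have "deriv (u []) x = u [False] x + u [True] x * s x" if "x : I" for x
 using Suc.prems(1)[of "[]" x] that by (auto intro: DERIV_imp_deriv)
 hence "(deriv ^^ k) (deriv (u [])) t = (deriv ^^ k) (%x. u [False] x + u [True] x * s x) t"
 by (rule derivs_cong[OF I _ t])
 also have "... = (deriv ^^ k) (u [False]) t + (deriv ^^ k) (%x. u [True] x * s x) t"
 by (rule derivs_add[OF I fbd_kd[OF F] fbd_kd[OF p] t])
 finally have eq: "(deriv ^^ Suc k) (u []) t = ..."
 by (simp add: funpow_Suc_right del: funpow.simps(2))
 have "\<bar>(deriv ^^ k) (u [False]) t - u (False # replicate k False) t\<bar> <= famD k*M*ze"
 using Suc.IH[of "%w. u (False # w)"] Suc.prems(1)[of "False # _"] Suc.prems(2)[of "False # _"] Suc.prems(3) e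
 by (simp add: fbd_weaken_le)
 moreover have "\<bar>(deriv ^^ k) (%x. u [True] x * s x) t\<bar> <= 2 ^ k*(famC k 1*M)*ze"
 using fbd_top[OF p t] by simp
 ultimately show ?case unfolding eq by (simp add: algebra_simps)
qed simp

primrec cmpC :: "nat => real => real" where
 "cmpC 0 A = 0"
| "cmpC (Suc k) A = cmpC k A*A + 2 ^ k*famC (k - 1) A*A"

lemma cmpC_nonneg: "0 <= A ==> 0 <= cmpC k A"
proof (induction k)
 case (Suc k)
 thus ?case using famC_ge1[of A "k - 1"] by (auto intro!: add_nonneg_nonneg mult_nonneg_nonneg)
qed simp

lemma kd_comp:
 assumes I: "open I" and p: "!!j x. DERIV (p j) x :> p (Suc j) x" and X: "kd k I X"
 shows "kd k I (%t. p j (X t))"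
proof -
 define u where "u w t = (if False : set w then 0 else p (j + length w) (X t))" for w :: "bool list" and t
 have "kd k I (u [])"
 proof (rule kd_family[OF I, where s="deriv X"])
 show "kd (k - 1) I (deriv X)" if "0 < k" using X that by (cases k) auto
 fix w :: "bool list" and t assume w: "length w < k" "t : I"
 hence "DERIV X t :> deriv X t" using X by (cases k) (auto intro: real_differentiableD)
 hence "DERIV (%t. p (j + length w) (X t)) t :> p (Suc (j + length w)) (X t)*deriv X t"
 by (rule DERIV_chain2[OF p])
 thus "DERIV (u w) t :> u (w @ [False]) t + u (w @ [True]) t*deriv X t"
 by (auto simp: u_def[abs_def])
 qed
 thus ?thesis by (simp add: u_def[abs_def])
qed

text \<open>The formula of Faa di Bruno with one main term. Every other term contains some
  \<open>p j\<close> with 1 <= j < k and is therefore of size \<open>ze\<close>. The k-th derivative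
  of \<open>X\<close> occurs once and linearly, which gives the single factor Y.\<close>

lemma derivs_comp_approx:
 assumes I: "open I" and Y: "1 <= Y" and A: "0 <= A" and e: "0 <= ze"
 and p: "!!j x. DERIV (p j) x :> p (Suc j) x"
 and b: "!!j t. 1 <= j ==> j < k ==> t : I ==> \<bar>p j (X t)\<bar> <= ze"
 and X: "fbd k A Y I X" and t: "t : I"
 shows "\<bar>(deriv ^^ k) (%t. p 0 (X t)) t - p k (X t)*deriv X t ^ k\<bar> <= cmpC k A*ze*Y"
 using p b X Y
proof (induction k arbitrary: p Y)
 case (Suc k)
 have Xk: "kd (Suc k) I X" "kd k I X" "kd k I (deriv X)"
 using fbd_kd[OF Suc.prems(3)] kd_weaken[of "Suc k" I X k] by auto
 have "deriv (%t. p 0 (X t)) x = p 1 (X x)*deriv X x" if "x : I" for x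
 using DERIV_imp_deriv[OF DERIV_chain2[OF Suc.prems(1), of X "deriv X x" x UNIV 0]] Suc.prems(3) that
 by (auto simp: real_differentiableD)
 hence "(deriv ^^ k) (deriv (%t. p 0 (X t))) t = (deriv ^^ k) (%x. p 1 (X x)*deriv X x) t"
 by (rule derivs_cong[OF I _ t])
 hence eq: "(deriv ^^ Suc k) (%t. p 0 (X t)) t = (deriv ^^ k) (%x. p 1 (X x)*deriv X x) t"
 by (simp add: funpow_Suc_right del: funpow.simps(2))
 show ?case
 proof (cases k)
 case 0
 thus ?thesis unfolding eq using A e Suc.prems(4) by simp
 next
 case k: (Suc l)
 define u where "u w t = (if False : set w then 0 else p (1 + length w) (X t))" for w :: "bool list" and t
 have X1: "fbd k A 1 I X" by (rule fbd_drop[OF Suc.prems(3)])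
 have fb: "fbd l (famC l A*ze) 1 I (u [])"
 proof (rule fbd_family[OF I _ A e, where s="deriv X"])
 show "fbd (l - 1) A 1 I (deriv X)" if "0 < l"
 using X1 k that A by (auto intro: fbd_weaken_le)
 fix w :: "bool list" and t assume t: "t : I"
 show "\<bar>u w t\<bar> <= ze" if "length w <= l"
 using Suc.prems(2)[of "1 + length w" t] that t k e by (auto simp: u_def)
 assume w: "length w < l"
 have "DERIV X t :> deriv X t" using Suc.prems(3) t by (auto intro: real_differentiableD)
 hence "DERIV (%t. p (1 + length w) (X t)) t :> p (Suc (1 + length w)) (X t)*deriv X t"
 by (rule DERIV_chain2[OF Suc.prems(1)])
 thus "DERIV (u w) t :> u (w @ [False]) t + u (w @ [True]) t*deriv X t"
 by (auto simp: u_def[abs_def])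
 qed simp
 hence fb: "fbd (k - 1) (famC (k - 1) A*ze) 1 I (%t. p 1 (X t))" by (simp add: u_def[abs_def] k)
 have kc: "kd k I (%t. p 1 (X t))" by (rule kd_comp[where p=p, OF I _ Xk(2)]) (rule Suc.prems(1))
 have gb: "fbd (k - 1) A Y I (deriv (deriv X))" using Suc.prems(3) k by simp
 have c: "0 <= famC (k - 1) A*ze" using famC_ge1[OF A, of "k - 1"] e by simp
 have 1: "\<bar>(deriv ^^ k) (%x. p 1 (X x)*deriv X x) t - (deriv ^^ k) (%x. p 1 (X x)) t*deriv X t\<bar>
 <= 2 ^ k*(famC (k - 1) A*ze)*A*Y"
 by (rule derivs_mult_approx[OF I Suc.prems(4) c A kc fb Xk(3) gb t])
 have "\<bar>(deriv ^^ k) (%t. p (Suc 0) (X t)) t - p (Suc k) (X t)*deriv X t ^ k\<bar> <= cmpC k A*ze*1"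
 by (rule Suc.IH[of "%j. p (Suc j)"]) (use Suc.prems X1 in auto)
 moreover have dX: "\<bar>deriv X t\<bar> <= A" using Suc.prems(3) t k by auto
 ultimately have "\<bar>(deriv ^^ k) (%t. p (Suc 0) (X t)) t - p (Suc k) (X t)*deriv X t ^ k\<bar>*\<bar>deriv X t\<bar> <= cmpC k A*ze*A"
 using cmpC_nonneg[OF A, of k] e by (intro mult_mono) auto
 hence 2: "\<bar>(deriv ^^ k) (%t. p 1 (X t)) t*deriv X t - p (Suc k) (X t)*deriv X t ^ Suc k\<bar> <= cmpC k A*ze*A"
 unfolding abs_mult[symmetric] by (simp add: algebra_simps)
 have "cmpC k A*ze*A*1 <= cmpC k A*ze*A*Y" using cmpC_nonneg[OF A, of k] e A Suc.prems(4) by (intro mult_left_mono) auto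
 hence "cmpC k A*ze*A + 2 ^ k*(famC (k - 1) A*ze)*A*Y <= cmpC (Suc k) A*ze*Y"
 by (simp add: algebra_simps)
 thus ?thesis unfolding eq using 1 2 by linarith
 qed
qed simp

section \<open>Rolle's theorem, interpolation polynomials and divided differences\<close>

text \<open>The clause \<open>z < Max Z\<close> drives the induction over increasing nodes: the zero
  found between the old maximum and the new node lies beyond all earlier ones and hence is
  new.\<close>

lemma rolle_set:
 fixes f :: "real => real"
 assumes "finite Z" "Z ~= {}" "Z <= I" "convex I" "!!t. t : I ==> f differentiable (at t)" "!!z. z : Z ==> f z = 0"
 shows "EX Z'. finite Z' & card Z = Suc (card Z') & Z' <= I & (ALL z:Z'. deriv f z = 0 & z < Max Z)"
 using assms(1-3,6)
proof (induction Z rule: finite_linorder_max_induct)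
 case (insert b A)
 show ?case
 proof (cases "A = {}")
 case True thus ?thesis by (intro exI[of _ "{}"]) auto
 next
 case False
 obtain Z' where Z': "finite Z'" "card A = Suc (card Z')" "Z' <= I" "ALL z:Z'. deriv f z = 0 & z < Max A"
 using insert False by auto
 let ?m = "Max A"
 have m: "?m : A" "?m < b" using insert False by auto
 have sub: "{?m..b} <= I"
 using assms(4) m insert.prems(2) by (metis closed_segment_eq_real_ivl closed_segment_subset insertI1 insertI2 less_imp_le subsetD)
 have "EX z>?m. z < b & DERIV f z :> 0"
 proof (rule Rolle[OF m(2)])
 show "f ?m = f b" using insert.prems(3) m by simp
 show "continuous_on {?m..b} f"
 using assms(5) sub by (meson continuous_at_imp_continuous_on differentiable_imp_continuous_within subsetD)
 show "!!x. ?m < x ==> x < b ==> f differentiable at x" using assms(5) sub by (meson atLeastAtMost_iff less_imp_le subsetD)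
 qed
 then obtain z where z: "?m < z" "z < b" "deriv f z = 0" using DERIV_imp_deriv by blast
 have "Max (insert b A) = b" using insert False m by (intro Max_eqI) auto
 moreover have "z ~: Z'" using Z'(4) z by auto
 ultimately show ?thesis using Z' z sub m insert(1,2)
 by (intro exI[of _ "insert z Z'"]) (auto dest: order.strict_implies_order)
 qed
qed auto

lemma generalized_rolle:
 assumes I: "open I" "convex I" and "kd k I f" "finite Z" "card Z = Suc k" "Z <= I" "!!z. z : Z ==> f z = 0"
 shows "EX xk:I. (deriv ^^ k) f xk = 0"
 using assms(3-)
proof (induction k arbitrary: f Z)
 case 0
 hence "Z ~= {}" by auto
 thus ?case using 0 by auto
next
 case (Suc k)
 have "Z ~= {}" using Suc.prems by auto
 from rolle_set[OF Suc.prems(2) this Suc.prems(4) I(2), of f] Suc.prems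
 obtain Z' where "finite Z'" "card Z' = Suc k" "Z' <= I" "ALL z:Z'. deriv f z = 0" by auto
 hence "EX xk:I. (deriv ^^ k) (deriv f) xk = 0" using Suc.prems(1) by (intro Suc.IH) auto
 thus ?case by (simp add: funpow_Suc_right del: funpow.simps)
qed

definition pder :: "nat => real poly => real poly" where "pder j p = (pderiv ^^ j) p"

lemma pder_simps [simp]: "pder 0 p = p" "pder (Suc j) p = pderiv (pder j p)"
 by (simp_all add: pder_def)

lemma DERIV_pder: "DERIV (poly (pder j p)) x :> poly (pder (Suc j) p) x"
 by simp

lemma deriv_poly: "deriv (poly p) = poly (pderiv p)"
 by (rule ext, rule DERIV_imp_deriv) (rule poly_DERIV)

lemma derivs_poly: "(deriv ^^ k) (poly p) = poly (pder k p)"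
 by (induction k) (auto simp: deriv_poly)

lemma kd_poly: "kd k I (poly p)"
 by (induction k arbitrary: p) (auto simp: deriv_poly)

lemma pder_diff: "pder j (p - q) = pder j p - pder j q"
 by (induction j) (auto simp: pderiv_diff)

lemma pder_degree: "degree (pder j p) <= degree p - j"
 by (induction j) (auto simp: degree_pderiv)

lemma coeff_pder: "coeff (pder j p) n = (\<Prod>i\<in>{n+1..n+j}. real i)*coeff p (n + j)"
proof (induction j arbitrary: n)
 case (Suc j)
 have "{n+1..n + Suc j} = insert (n+1) {Suc n + 1..Suc n + j}" by auto
 thus ?case by (simp add: coeff_pderiv Suc)
qed simp

lemma pder_const:
 assumes "degree p <= k"
 shows "poly (pder k p) x = fact k*coeff p k"
proof -
 have "degree (pder k p) = 0" using pder_degree[of k p] assms by simp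
 then obtain c where c: "pder k p = [:c:]" by (rule degree_eq_zeroE)
 hence "c = coeff (pder k p) 0" by simp
 also have "... = fact k*coeff p k" unfolding coeff_pder by (simp add: fact_prod)
 finally show ?thesis by (simp add: c)
qed

text \<open>Newton's scheme: a new node is met by adding a multiple of the node polynomial of the
  old ones. The empty set has its own clause, since no degree is below 0.\<close>

lemma interp_exists:
 fixes t q :: "'i => real"
 assumes "finite N" "inj_on t N"
 shows "EX p. (ALL i:N. poly p (t i) = q i) & (N = {} & p = 0 | degree p < card N)"
 using assms
proof (induction N rule: finite_induct)
 case (insert a N)
 then obtain p where p: "ALL i:N. poly p (t i) = q i" "N = {} & p = 0 | degree p < card N" by auto
 define v where "v = (\<Prod>i\<in>N. [:- t i, 1:])"
 define c where "c = (q a - poly p (t a))/poly v (t a)"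
 have v0: "poly v (t i) = 0" if "i : N" for i using that insert.hyps unfolding v_def poly_prod by auto
 have va: "poly v (t a) ~= 0" using insert unfolding v_def poly_prod by (auto simp: inj_on_def)
 have dv: "degree v <= card N" unfolding v_def by (rule order_trans[OF degree_prod_sum_le]) (use insert in auto)
 have "degree (p + smult c v) <= card N"
 using p(2) dv by (intro degree_add_le order_trans[OF degree_smult_le]) auto
 thus ?case using p v0 va insert.hyps
 by (intro exI[of _ "p + smult c v"]) (auto simp: c_def)
qed (auto intro!: exI[of _ 0])

definition interp :: "('i => real) => ('i => real) => 'i set => real poly" where
 "interp t q N = (SOME p. (ALL i:N. poly p (t i) = q i) & (N = {} & p = 0 | degree p < card N))"

lemma interp:
 assumes "finite N" "inj_on t N"
 shows "i : N ==> poly (interp t q N) (t i) = q i" "N ~= {} ==> degree (interp t q N) < card N"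
 using someI_ex[OF interp_exists[OF assms, of q]] unfolding interp_def[symmetric] by auto

lemma poly_eq_nodes:
 assumes "finite N" "inj_on t N" "!!i. i : N ==> poly p (t i) = poly (q :: real poly) (t i)" "degree p < card N" "degree q < card N"
 shows "p = q"
proof (rule ccontr)
 assume "p ~= q"
 hence n: "p - q ~= 0" by simp
 have "card N = card (t ` N)" using assms by (simp add: card_image)
 also have "... <= card {x. poly (p - q) x = 0}"
 by (intro card_mono poly_roots_finite n) (use assms in auto)
 also have "... <= degree (p - q)" by (rule card_poly_roots_bound[OF n])
 also have "... < card N" using assms by (intro degree_diff_less)
 finally show False by simp
qed

text \<open>The divided difference as leading coefficient of the interpolation polynomial. Nodes
  carry labels, so that \<open>t\<close> and \<open>q\<close> can be any two coordinates of labelled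
  points and the same labels serve at all times.\<close>

definition dd :: "('i => real) => ('i => real) => 'i set => real" where
 "dd t q N = coeff (interp t q N) (card N - 1)"

text \<open>Comes from (x - t b) B - (x - t a) A = (t a - t b) P, where A and B interpolate without
  a and without b: both sides have degree below \<open>card N\<close> and agree at all nodes. The
  leading coefficients give the claim.\<close>

lemma dd_recurrence:
 assumes N: "finite N" "inj_on t N" and ab: "a : N" "b : N" "a ~= b" and c: "3 <= card N"
 shows "dd t q N*(t a - t b) = dd t q (N - {b}) - dd t q (N - {a})"
proof -
 define P where "P = interp t q N"
 define A where "A = interp t q (N - {a})"
 define B where "B = interp t q (N - {b})"
 have f: "finite (N - {x})" "inj_on t (N - {x})" for x using N by (auto intro: inj_on_subset)
 have card: "card (N - {a}) = card N - 1" "card (N - {b}) = card N - 1" using N ab by auto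
 have ne: "N - {a} ~= {}" "N - {b} ~= {}" using ab by auto
 have dA: "degree A < card N - 1" and dB: "degree B < card N - 1"
 using interp(2)[OF f ne(1), of q] interp(2)[OF f ne(2), of q] card by (auto simp: A_def B_def)
 have pA: "poly A (t i) = q i" if "i : N - {a}" for i using interp(1)[OF f that] A_def by simp
 have pB: "poly B (t i) = q i" if "i : N - {b}" for i using interp(1)[OF f that] B_def by simp
 have pP: "poly P (t i) = q i" if "i : N" for i using interp(1)[OF N that] P_def by simp
 have "[:- t b, 1:] * B - [:- t a, 1:] * A = smult (t a - t b) P"
 proof -
 have lin: "degree ([:- s, 1:] * C) <= Suc (degree C)" for s :: real and C
 using degree_mult_le[of "[:- s, 1:]" C] by simp
 show ?thesis
 proof (rule poly_eq_nodes[OF N])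
 show "degree ([:- t b, 1:] * B - [:- t a, 1:] * A) < card N"
 using lin[of "t b" B] lin[of "t a" A] dA dB by (intro degree_diff_less) linarith+
 show "degree (smult (t a - t b) P) < card N"
 using interp(2)[OF N, of q] ab order_le_less_trans[OF degree_smult_le] P_def by blast
 fix i assume i: "i : N"
 have "(t i - t b)*poly B (t i) = (t i - t b)*q i" using pB[of i] i by (cases "i = b") auto
 moreover have "(t i - t a)*poly A (t i) = (t i - t a)*q i" using pA[of i] i by (cases "i = a") auto
 ultimately show "poly ([:- t b, 1:] * B - [:- t a, 1:] * A) (t i) = poly (smult (t a - t b) P) (t i)"
 using pP[OF i] by (simp add: algebra_simps)
 qed
 qed
 hence "coeff ([:- t b, 1:] * B - [:- t a, 1:] * A) (card N - 1) = (t a - t b)*coeff P (card N - 1)" by simp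
 moreover obtain n where n: "card N - 1 = Suc n" using c by (cases "card N - 1") auto
 moreover have "coeff A (Suc n) = 0" "coeff B (Suc n) = 0"
 using dA dB n by (simp_all add: coeff_eq_0)
 ultimately have "coeff B n - coeff A n = (t a - t b)*coeff P (card N - 1)"
 by simp
 thus ?thesis using n card unfolding dd_def A_def B_def P_def by (simp add: mult.commute)
qed

text \<open>Mean value form: the interpolation polynomials over N and over J agree at the j + 1
  nodes of J, so the j-th derivative of their difference has a zero, and that of the smaller one is
  constant.\<close>

lemma interp_derivative_dd:
 assumes N: "finite N" "inj_on t N" and J: "J <= N" "card J = Suc j" and I: "open I" "convex I" "t ` N <= I"
 shows "EX xk:I. poly (pder j (interp t q N)) xk = fact j*dd t q J"
proof -
 have Jf: "finite J" "inj_on t J" using N J by (auto intro: finite_subset inj_on_subset)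
 have Jne: "J ~= {}" using J by auto
 let ?p = "interp t q N - interp t q J"
 have "EX xk:I. (deriv ^^ j) (poly ?p) xk = 0"
 by (rule generalized_rolle[OF I(1,2) kd_poly, of "t ` J"])
 (use Jf J I interp(1)[OF N] interp(1)[OF Jf] in \<open>auto simp: card_image\<close>)
 moreover have "degree (interp t q J) <= j" using interp(2)[OF Jf Jne, of q] J by simp
 ultimately show ?thesis using J by (auto simp: derivs_poly pder_diff pder_const dd_def)
qed

text \<open>No smallness of the top divided difference is assumed. The recurrence bounds it by 2 ze
  divided by the spread d of the nodes, so on an interval of length comparable to d the derivative
  of order k - 1 varies by O(ze) only. Lower orders follow by descent, each time starting from a
  mean value point of \<open>interp_derivative_dd\<close>.\<close>

lemma interp_bounds:
 assumes N: "finite N" "inj_on t N" "card N = Suc k" and k: "2 <= k" and e: "0 <= ze"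
 and dd: "!!J. J <= N ==> 2 <= card J ==> card J <= k ==> \<bar>dd t q J\<bar> <= ze"
 and ab: "a : N" "b : N" "t b - t a = d" "0 < d" "d <= 1" and dmax: "!!i j. i : N ==> j : N ==> \<bar>t i - t j\<bar> <= d"
 and c: "c : N" and K: "2 <= K" and x: "\<bar>x - t c\<bar> < K*d"
 shows "\<bar>dd t q N\<bar>*d <= 2*ze"
 and "1 <= j ==> j < k ==> \<bar>poly (pder j (interp t q N)) x\<bar> <= (4*K + 2) ^ k*fact k*ze"
proof -
 let ?p = "interp t q N"
 have "dd t q N*(t b - t a) = dd t q (N - {a}) - dd t q (N - {b})"
 by (rule dd_recurrence) (use N k ab in auto)
 moreover have "\<bar>dd t q (N - {a})\<bar> <= ze" "\<bar>dd t q (N - {b})\<bar> <= ze" using N ab k by (auto intro!: dd)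
 ultimately have "\<bar>dd t q N*d\<bar> <= 2*ze" unfolding ab(3) by linarith
 thus top: "\<bar>dd t q N\<bar>*d <= 2*ze" using ab by (simp add: abs_mult)
 define I where "I = {x. \<bar>x - t c\<bar> < K*d}"
 have I_ball: "I = ball (t c) (K*d)" by (auto simp: I_def dist_real_def)
 have Kd: "d < K*d" using K ab by simp
 have NI: "t ` N <= I" using dmax[OF _ c] Kd by (force simp: I_def)
 have Dk: "poly (pder k ?p) x = fact k*dd t q N" for x
 using interp(2)[OF N(1,2), of q] N(3) ab(1) by (subst pder_const) (auto simp: dd_def less_Suc_eq_le)
 \<comment> \<open>The induction goes down from order k - 1, and each order costs at most a factor 4
   K + 2.\<close>
 have "ALL x:I. \<bar>poly (pder (k - i) ?p) x\<bar> <= (4*K + 2) ^ i*fact k*ze" if "1 <= i" "i < k" for i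
 using that
 proof (induction i rule: nat_induct_at_least)
 case base
 show ?case
 proof
 fix x assume x: "x : I"
 obtain J where J: "J <= N" "card J = Suc (k - 1)" using N k by (metis Suc_diff_1 card_Diff_singleton diff_Suc_1 Diff_subset ab(1) zero_less_Suc not_numeral_le_zero gr0I)
 from interp_derivative_dd[OF N(1,2) J _ _ NI, of q] obtain xk where xk: "xk : I" "poly (pder (k - 1) ?p) xk = fact (k - 1)*dd t q J"
 by (auto simp: I_ball)
 have fl: "(fact (k - 1) :: real) <= fact k" by (simp add: fact_mono)
 have "\<bar>dd t q J\<bar> <= ze" using J k by (intro dd) auto
 hence 1: "\<bar>poly (pder (k - 1) ?p) xk\<bar> <= fact k*ze"
 unfolding xk(2) abs_mult using fl e by (intro mult_mono) auto
 have "\<bar>poly (pder (k - 1) ?p) x - poly (pder (k - 1) ?p) xk\<bar> <= (fact k*\<bar>dd t q N\<bar>)*\<bar>x - xk\<bar>"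
 proof -
 have "pder k ?p = pderiv (pder (k - 1) ?p)" using k by (cases k) auto
 hence d: "(poly (pder (k - 1) ?p) has_field_derivative poly (pder k ?p) z) (at z within UNIV)" for z by simp
 show ?thesis
 using field_differentiable_bound[OF convex_UNIV d, of "fact k*\<bar>dd t q N\<bar>" x xk] by (simp add: Dk abs_mult)
 qed
 also have "... <= (fact k*\<bar>dd t q N\<bar>)*(2*K*d)"
 using x xk(1) by (intro mult_left_mono) (auto simp: I_def)
 also have "... = 2*K*fact k*(\<bar>dd t q N\<bar>*d)" by simp
 also have "... <= 2*K*fact k*(2*ze)" using top K by (intro mult_left_mono) auto
 finally have "\<bar>poly (pder (k - 1) ?p) x\<bar> <= fact k*ze + 4*K*fact k*ze" using 1 by linarith
 also have "... <= (4*K + 2) ^ 1*fact k*ze" using e by (simp add: algebra_simps)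
 finally show "\<bar>poly (pder (k - 1) ?p) x\<bar> <= (4*K + 2) ^ 1*fact k*ze" .
 qed
 next
 case (Suc i)
 let ?B = "(4*K + 2) ^ i*fact k*ze"
 have B0: "0 <= ?B" using e K by simp
 have IH: "ALL x:I. \<bar>poly (pder (k - i) ?p) x\<bar> <= ?B" using Suc by auto
 let ?j = "k - Suc i"
 show ?case
 proof
 fix x assume x: "x : I"
 obtain J where J: "J <= N" "card J = Suc ?j" using N Suc by (metis obtain_subset_with_card_n Suc_le_mono diff_le_self)
 from interp_derivative_dd[OF N(1,2) J _ _ NI, of q] obtain xk where xk: "xk : I" "poly (pder ?j ?p) xk = fact ?j*dd t q J"
 by (auto simp: I_ball)
 have fl: "(fact ?j :: real) <= fact k" by (simp add: fact_mono)
 have "\<bar>dd t q J\<bar> <= ze" using J Suc by (intro dd) auto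
 hence 1: "\<bar>poly (pder ?j ?p) xk\<bar> <= fact k*ze"
 unfolding xk(2) abs_mult using fl e by (intro mult_mono) auto
 have "\<bar>poly (pder ?j ?p) x - poly (pder ?j ?p) xk\<bar> <= ?B*\<bar>x - xk\<bar>"
 proof -
 have "pder (k - i) ?p = pderiv (pder ?j ?p)" using Suc by (metis Suc_diff_Suc Suc_lessD pder_simps(2))
 hence d: "z : I ==> (poly (pder ?j ?p) has_field_derivative poly (pder (k - i) ?p) z) (at z within I)" for z
 by (simp add: has_field_derivative_at_within)
 show ?thesis
 using field_differentiable_bound[OF _ d, of ?B x xk] IH x xk(1) by (auto simp: I_ball)
 qed
 also have "... <= ?B*(2*K*1)"
 proof -
 have "\<bar>x - xk\<bar> <= 2*(K*d)" using x xk(1) by (auto simp: I_def)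
 also have "... <= 2*(K*1)" using ab K by (intro mult_left_mono) auto
 finally show ?thesis using B0 by (intro mult_left_mono) auto
 qed
 finally have "\<bar>poly (pder ?j ?p) x\<bar> <= fact k*ze + ?B*(2*K*1)" using 1 by linarith
 hence "\<bar>poly (pder ?j ?p) x\<bar> <= fact k*ze + 2*K*?B" by (simp add: algebra_simps)
 moreover have "1*(fact k*ze) <= (4*K + 2) ^ i*(fact k*ze)"
 using e K by (intro mult_right_mono one_le_power) auto
 moreover have "0 <= 2*K*?B" using B0 K by simp
 ultimately show "\<bar>poly (pder ?j ?p) x\<bar> <= (4*K + 2) ^ Suc i*fact k*ze"
 by (simp add: algebra_simps)
 qed
 qed
 from this[of "k - j"] have "\<bar>poly (pder j ?p) x\<bar> <= (4*K + 2) ^ (k - j)*fact k*ze" if "1 <= j" "j < k"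
 using that x by (auto simp: I_def)
 moreover have "(4*K + 2) ^ (k - j)*fact k*ze <= (4*K + 2) ^ k*fact k*ze"
 using K e by (intro mult_right_mono power_increasing) auto
 ultimately show "1 <= j ==> j < k ==> \<bar>poly (pder j ?p) x\<bar> <= (4*K + 2) ^ k*fact k*ze" by linarith
qed

text \<open>The same descent when the top divided difference is small too; the interval may then
  have fixed length, unrelated to the spread of the nodes.\<close>

lemma interp_bounds_full:
 assumes N: "finite N" "inj_on t N" "card N = Suc k" and e: "0 <= ze"
 and dd: "!!J. J <= N ==> 2 <= card J ==> \<bar>dd t q J\<bar> <= ze"
 and near: "!!i. i : N ==> \<bar>t i - c\<bar> < 1" and x: "\<bar>x - c\<bar> < 1" and j: "1 <= j" "j <= k"
 shows "\<bar>poly (pder j (interp t q N)) x\<bar> <= 3 ^ k*fact k*ze"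
proof -
 let ?p = "interp t q N"
 define I where "I = {x. \<bar>x - c\<bar> < 1}"
 have I_ball: "I = ball c 1" by (auto simp: I_def dist_real_def)
 have NI: "t ` N <= I" using near by (auto simp: I_def)
 have Nne: "N ~= {}" using N by auto
 have Dk: "poly (pder k ?p) x = fact k*dd t q N" for x
 using interp(2)[OF N(1,2) Nne, of q] N(3) by (subst pder_const) (auto simp: dd_def)
 have "ALL x:I. \<bar>poly (pder (k - i) ?p) x\<bar> <= 3 ^ i*fact k*ze" if "i < k" for i
 using that
 proof (induction i)
 case 0
 have "\<bar>dd t q N\<bar> <= ze" using N 0 by (intro dd) auto
 thus ?case by (simp add: Dk abs_mult)
 next
 case (Suc i)
 let ?B = "3 ^ i*fact k*ze"
 have IH: "ALL x:I. \<bar>poly (pder (k - i) ?p) x\<bar> <= ?B" using Suc by auto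
 let ?j = "k - Suc i"
 show ?case
 proof
 fix x assume x: "x : I"
 obtain J where J: "J <= N" "card J = Suc ?j" using N Suc by (metis obtain_subset_with_card_n Suc_le_mono diff_le_self)
 from interp_derivative_dd[OF N(1,2) J _ _ NI, of q] obtain xk where xk: "xk : I" "poly (pder ?j ?p) xk = fact ?j*dd t q J"
 by (auto simp: I_ball)
 have fl: "(fact ?j :: real) <= fact k" by (simp add: fact_mono)
 have "\<bar>dd t q J\<bar> <= ze" using J Suc by (intro dd) auto
 hence 1: "\<bar>poly (pder ?j ?p) xk\<bar> <= fact k*ze"
 unfolding xk(2) abs_mult using fl e by (intro mult_mono) auto
 have "\<bar>poly (pder ?j ?p) x - poly (pder ?j ?p) xk\<bar> <= ?B*\<bar>x - xk\<bar>"
 proof -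
 have "pder (k - i) ?p = pderiv (pder ?j ?p)" using Suc by (metis Suc_diff_Suc Suc_lessD pder_simps(2))
 hence d: "z : I ==> (poly (pder ?j ?p) has_field_derivative poly (pder (k - i) ?p) z) (at z within I)" for z
 by (simp add: has_field_derivative_at_within)
 show ?thesis
 using field_differentiable_bound[OF _ d, of ?B x xk] IH x xk(1) by (auto simp: I_ball)
 qed
 also have "... <= ?B*2"
 using x xk(1) e by (intro mult_left_mono) (auto simp: I_def)
 finally have "\<bar>poly (pder ?j ?p) x\<bar> <= fact k*ze + 2*?B" using 1 by linarith
 moreover have "1*(fact k*ze) <= 3 ^ i*(fact k*ze)"
 using e by (intro mult_right_mono one_le_power) auto
 ultimately show "\<bar>poly (pder ?j ?p) x\<bar> <= 3 ^ Suc i*fact k*ze"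
 by (simp add: algebra_simps)
 qed
 qed
 from this[of "k - j"] have "\<bar>poly (pder j ?p) x\<bar> <= 3 ^ (k - j)*fact k*ze"
 using j x by (auto simp: I_def)
 moreover have "3 ^ (k - j)*fact k*ze <= 3 ^ k*fact k*ze"
 using e by (intro mult_right_mono power_increasing) auto
 ultimately show ?thesis by linarith
qed

lemma fbd_poly:
 assumes "!!j x. j < k ==> x : I ==> \<bar>poly (pder j p) x\<bar> <= M" "!!x. x : I ==> \<bar>poly (pder k p) x\<bar> <= M*Y"
 shows "fbd k M Y I (poly p)"
proof -
 have "fbd k M Y I (poly p)" if "ALL j<k. ALL x:I. \<bar>poly (pder j p) x\<bar> <= M" "ALL x:I. \<bar>poly (pder k p) x\<bar> <= M*Y"
 using that
 proof (induction k arbitrary: p)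
 case (Suc k)
 have "pder j (pderiv p) = pder (Suc j) p" for j by (simp only: pder_def funpow_Suc_right o_def)
 hence "fbd k M Y I (poly (pderiv p))" using Suc.prems by (intro Suc.IH) (auto simp del: pder_simps(2))
 thus ?case using Suc.prems(1)[rule_format, of 0] by (simp add: deriv_poly)
 qed simp
 thus ?thesis using assms by blast
qed

lemma pder_pderiv: "pder j (pderiv p) = pder (Suc j) p"
 by (simp only: pder_def funpow_Suc_right o_def)

section \<open>Divided differences under one step of a planar map\<close>

text \<open>What the Rolle argument takes from a C^k function of two variables: its mixed partials
  as a family indexed by words (False for the first variable, True for the second), the chain rule
  along graphs, and one common bound.\<close>

definition wfam :: "nat => (real \<times> real) set => (bool list => real => real => real) => real => bool" where
 "wfam k Dm G M \<longleftrightarrow> (ALL w p x p'. length w < k & (x, p x) : Dm & DERIV p x :> p' -->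
 DERIV (%s. G w s (p s)) x :> G (w @ [False]) x (p x) + G (w @ [True]) x (p x)*p') &
 (ALL w x y. length w <= k & (x, y) : Dm --> \<bar>G w x y\<bar> <= M)"

definition sqr :: "real => real => real => (real \<times> real) set" where
 "sqr x0 y0 rh = {(x, y). \<bar>x - x0\<bar> < rh & \<bar>y - y0\<bar> < rh}"

text \<open>How far the image of an interval comparable to the node spread d can reach, in multiples
  of the spread d' of the image nodes: the image curve has speed at most
  \<open>famC k 1 * A\<close>, and d' >= m d.\<close>

definition osK :: "nat => real => real => real" where
 "osK k A m = max 2 (2*(famC k 1*A)/m)"

definition osC :: "nat => real => real => real" where
 "osC k A m = fact k * (famC k 1 + cmpC k (famC k 1 * A) * ((4 * osK k A m + 2) ^ k * fact k))"

text \<open>Let p interpolate \<open>q\<close> over \<open>t\<close>, let P interpolate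
  \<open>q'\<close> over \<open>t'\<close>, and put X x = G(x, p x). Then c0 p + c1 + E(x, p x) -
  P(X x) vanishes at k + 1 nodes, so its k-th derivative vanishes somewhere. At that point c0 k! dd
  equals k! dd' X'^k up to terms that contain \<open>eps\<close> or a lower derivative of P. The
  factor 1 + |dd| of the error stems from the k-th derivative of p, for which no bound is
  available.\<close>

lemma one_step:
 assumes N: "finite N" "inj_on t N" "inj_on t' N" "card N = Suc k" and k: "2 <= k"
 and e: "0 <= ze" "10 ^ k*fact k*ze <= 1" and ep: "0 <= eps" and A: "1 <= A" and m: "0 < m"
 and dd: "!!J. J <= N ==> 2 <= card J ==> card J <= k ==> \<bar>dd t q J\<bar> <= ze & \<bar>dd t' q' J\<bar> <= ze"
 and c: "c : N" and rho: "0 < rh" "rh <= 1"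
 and dist: "!!i j. i : N ==> j : N ==> \<bar>t i - t j\<bar> <= rh/2 & \<bar>t' i - t' j\<bar> <= 1 & m*\<bar>t i - t j\<bar> <= \<bar>t' i - t' j\<bar>"
 and G: "wfam k (sqr (t c) (q c) rh) G A" and E: "wfam k (sqr (t c) (q c) rh) E eps"
 and maps: "!!i. i : N ==> t' i = G [] (t i) (q i) & q' i = c0*q i + c1 + E [] (t i) (q i)"
 shows "EX x y s. (x, y) : sqr (t c) (q c) rh & \<bar>s\<bar> <= 10 ^ k*fact k*ze &
 \<bar>c0*(fact k*dd t q N) - fact k*dd t' q' N*(G [False] x y + G [True] x y * s) ^ k\<bar>
 <= osC k A m*(ze + eps)*(1 + \<bar>dd t q N\<bar>)"
proof -
 let ?p = "interp t q N" and ?P = "interp t' q' N"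
 have Nne: "N ~= {}" using c by auto
 have ex: "EX a b. a : N & b : N & 0 < u b - u a & (ALL i:N. ALL j:N. \<bar>u i - u j\<bar> <= u b - u a)"
 if inj: "inj_on u N" for u :: "'a => real"
 proof -
 have "Min (u ` N) : u ` N" by (rule Min_in) (use N(1) Nne in auto)
 then obtain a where "a : N" "Min (u ` N) = u a" by (rule imageE) simp
 hence a: "a : N" "!!i. i : N ==> u a <= u i" using Min_le[OF finite_imageI[OF N(1)] imageI, of _ u] by simp_all
 have "Max (u ` N) : u ` N" by (rule Max_in) (use N(1) Nne in auto)
 then obtain b where "b : N" "Max (u ` N) = u b" by (rule imageE) simp
 hence b: "b : N" "!!i. i : N ==> u i <= u b" using Max_ge[OF finite_imageI[OF N(1)] imageI, of _ u] by simp_all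
 have "EX i:N. i ~= a"
 proof (rule ccontr)
 assume "~ ?thesis"
 hence "N <= {a}" by auto
 hence "card N <= 1" using card_mono[of "{a}" N] by simp
 thus False using N k by simp
 qed
 then obtain i where i: "i : N" "i ~= a" by blast
 have "u i ~= u a" using inj i a by (auto simp: inj_on_def)
 hence "u a < u b" using a(2)[OF i(1)] b(2)[OF i(1)] by linarith
 moreover have "\<bar>u i - u j\<bar> <= u b - u a" if "i : N" "j : N" for i j
 using a(2) b(2) that by (smt (verit))
 ultimately show ?thesis using a b by (intro exI[of _ a] exI[of _ b]) auto
 qed
 obtain a b where ab: "a : N" "b : N" "0 < t b - t a" "!!i j. i : N ==> j : N ==> \<bar>t i - t j\<bar> <= t b - t a"
 using ex[OF N(2)] by blast
 obtain a' b' where ab': "a' : N" "b' : N" "0 < t' b' - t' a'" "!!i j. i : N ==> j : N ==> \<bar>t' i - t' j\<bar> <= t' b' - t' a'"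
 using ex[OF N(3)] by blast
 define d where "d = t b - t a"
 define d' where "d' = t' b' - t' a'"
 have d: "0 < d" "d <= rh/2" "d <= 1" using ab dist[of b a] rho by (auto simp: d_def)
 have d': "0 < d'" "d' <= 1" using ab' dist[of b' a'] by (auto simp: d'_def)
 have md: "m*d <= d'" using dist[OF ab(2,1)] ab'(4)[OF ab(2,1)] ab(3) by (auto simp: d_def d'_def)
 define I where "I = {x. \<bar>x - t c\<bar> < 2*d}"
 have I_ball: "I = ball (t c) (2*d)" by (auto simp: I_def dist_real_def)
 have oI: "open I" and cI: "convex I" unfolding I_ball by auto
 have NI: "t ` N <= I" using ab(4)[OF _ c] d by (force simp: I_def d_def)
 \<comment> \<open>The interval \<open>I\<close> of radius 2 d is the case K = 2 of
   \<open>interp_bounds\<close>, whence the base 10 = 4 * 2 + 2.\<close>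
 define ze1 where "ze1 = 10 ^ k*fact k*ze"
 have e1: "0 <= ze1" "ze1 <= 1" using e by (auto simp: ze1_def)
 have pb: "\<bar>poly (pder j ?p) x\<bar> <= ze1" if "1 <= j" "j < k" "x : I" for j x
 proof -
 have "\<bar>poly (pder j ?p) x\<bar> <= (4*2 + 2) ^ k*fact k*ze"
 by (rule interp_bounds(2)[OF N(1,2,4) k e(1) _ ab(1,2) d_def[symmetric] d(1,3) _ c order_refl])
 (use dd ab(4) that in \<open>auto simp: I_def d_def\<close>)
 thus ?thesis by (simp add: ze1_def)
 qed
 have Dk: "poly (pder k ?p) x = fact k*dd t q N" for x
 using interp(2)[OF N(1,2) Nne, of q] N(4) by (subst pder_const) (auto simp: dd_def)
 have DkP: "poly (pder k ?P) x = fact k*dd t' q' N" for x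
 using interp(2)[OF N(1,3) Nne, of q'] N(4) by (subst pder_const) (auto simp: dd_def)
 \<comment> \<open>Y dominates the k-th derivative of the interpolation polynomial and is at least
   1.\<close>
 define Y where "Y = fact k*(1 + \<bar>dd t q N\<bar>)"
 have fk: "(1::real) <= fact k" by simp
 have Y: "1 <= Y" unfolding Y_def using mult_mono[of 1 "fact k :: real" 1 "1 + \<bar>dd t q N\<bar>"] by simp
 have s: "fbd (k - 1) 1 Y I (poly (pderiv ?p))"
 proof (rule fbd_poly)
 show "\<bar>poly (pder j (pderiv ?p)) x\<bar> <= 1" if "j < k - 1" "x : I" for j x
 proof -
 have "Suc j < k" using that by simp
 thus ?thesis using pb[of "Suc j" x] e1 that by (simp add: pder_pderiv del: pder_simps(2))
 qed
 show "\<bar>poly (pder (k - 1) (pderiv ?p)) x\<bar> <= 1*Y" for x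
 using Dk[of x] k by (simp add: pder_pderiv Y_def abs_mult del: pder_simps(2))
 qed
 have pc: "poly ?p (t i) = q i" if "i : N" for i using interp(1)[OF N(1,2) that] .
 have Pc: "poly ?P (t' i) = q' i" if "i : N" for i using interp(1)[OF N(1,3) that] .
 have dom: "(x, poly ?p x) : sqr (t c) (q c) rh" if x: "x : I" for x
 proof -
 have "\<bar>poly ?p x - poly ?p (t c)\<bar> <= 1*\<bar>x - t c\<bar>"
 using field_differentiable_bound[OF cI, of "poly ?p" "poly (pderiv ?p)" 1 x "t c"] pb[of 1] e1 k x NI c
 by (force simp: has_field_derivative_at_within)
 thus ?thesis using x d pc[OF c] by (auto simp: sqr_def I_def)
 qed
 define X where "X x = G [] x (poly ?p x)" for x
 define ee where "ee x = E [] x (poly ?p x)" for x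
 define A2 where "A2 = famC k 1*A"
 have A2: "1 <= A2" using mult_mono[of 1 "famC k 1" 1 A] famC_ge1[of 1 k] A by (simp add: A2_def)
 have fam: "fbd k (famC k 1*M) Y I (%x. H [] x (poly ?p x))" if "wfam k (sqr (t c) (q c) rh) H M" "0 <= M" for H M
 by (rule fbd_family[OF oI Y _ that(2), where s="poly (pderiv ?p)" and u="%w x. H w x (poly ?p x)"])
 (use that(1) dom s in \<open>auto simp: wfam_def\<close>)
 have X: "fbd k A2 Y I X" unfolding X_def[abs_def] A2_def using fam[OF G] A by simp
 have ee: "fbd k (famC k 1*eps) Y I ee" unfolding ee_def[abs_def] using fam[OF E] ep by simp
 have dX: "deriv X x = G [False] x (poly ?p x) + G [True] x (poly ?p x)*poly (pderiv ?p) x" if "x : I" for x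
 using G[unfolded wfam_def, THEN conjunct1, rule_format, of "[]" x "poly ?p" "poly (pderiv ?p) x"] dom[OF that] k
 unfolding X_def[abs_def] by (intro DERIV_imp_deriv) simp
 have dXA: "\<bar>deriv X x\<bar> <= A2" "DERIV X x :> deriv X x" if "x : I" for x
 proof -
 obtain l where l: "k = Suc (Suc l)" using k by (metis One_nat_def Suc_le_D numeral_2_eq_2 Suc_le_mono)
 show "\<bar>deriv X x\<bar> <= A2" "DERIV X x :> deriv X x" using X that unfolding l by (auto intro: real_differentiableD)
 qed
 have Xt: "X (t i) = t' i" if "i : N" for i using maps[OF that] pc[OF that] by (simp add: X_def)
 define K where "K = osK k A m"
 have K: "2 <= K" "2*A2/m <= K" by (auto simp: K_def osK_def A2_def)
 have XJ: "\<bar>X x - t' c\<bar> < K*d'" if x: "x : I" for x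
 proof -
 have "\<bar>X x - X (t c)\<bar> <= A2*\<bar>x - t c\<bar>"
 using field_differentiable_bound[OF cI, of X "deriv X" A2 x "t c"] dXA x NI c
 by (force simp: has_field_derivative_at_within)
 also have "... < A2*(2*d)" using x A2 by (intro mult_strict_left_mono) (auto simp: I_def)
 also have "... = (2*A2/m)*(m*d)" using m by simp
 also have "... <= K*d'" using md K d m by (intro mult_mono) auto
 finally show ?thesis using Xt[OF c] by simp
 qed
 define ze2 where "ze2 = (4*K + 2) ^ k*fact k*ze"
 have e2: "0 <= ze2" using e K by (simp add: ze2_def)
 have Pb: "\<bar>poly (pder j ?P) (X x)\<bar> <= ze2" if "1 <= j" "j < k" "x : I" for j x
 unfolding ze2_def
 by (rule interp_bounds(2)[OF N(1,3,4) k e(1) _ ab'(1,2) d'_def[symmetric] d'(1,2) _ c K(1) XJ[OF that(3)] that(1,2)])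
 (use dd ab'(4) in \<open>auto simp: d'_def\<close>)
 have kdX: "kd k I X" and kde: "kd k I ee" using X ee fbd_kd by auto
 have kdP: "kd k I (%x. poly ?P (X x))"
 using kd_comp[where p="%j. poly (pder j ?P)" and j=0, OF oI DERIV_pder kdX] by simp
 define R where "R x = (c0*poly ?p x + c1) + (ee x + (-1)*poly ?P (X x))" for x
 have kd1: "kd k I (%x. c0*poly ?p x)" "kd k I (%x. c1)" "kd k I (%x. (-1)*poly ?P (X x))"
 by (rule kd_cmult[OF oI kd_poly], rule kd_const, rule kd_cmult[OF oI kdP])
 have kd2: "kd k I (%x. c0*poly ?p x + c1)" "kd k I (%x. ee x + (-1)*poly ?P (X x))"
 using kd_add[OF oI kd1(1,2)] kd_add[OF oI kde kd1(3)] by auto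
 have "kd k I R" unfolding R_def[abs_def] by (rule kd_add[OF oI kd2])
 moreover have "R z = 0" if "z : t ` N" for z
 using that maps pc Pc Xt by (auto simp: R_def ee_def)
 ultimately have "EX xk:I. (deriv ^^ k) R xk = 0"
 using N NI by (intro generalized_rolle[OF oI cI, of k R "t ` N"]) (auto simp: card_image)
 then obtain xk where xi: "xk : I" "(deriv ^^ k) R xk = 0" by blast
 have "(deriv ^^ k) R xk = (c0*(deriv ^^ k) (poly ?p) xk + 0) + ((deriv ^^ k) ee xk + (-1)*(deriv ^^ k) (%x. poly ?P (X x)) xk)"
 unfolding R_def[abs_def] using k
 by (simp only: derivs_add[OF oI kd2 xi(1)] derivs_add[OF oI kd1(1,2) xi(1)] derivs_add[OF oI kde kd1(3) xi(1)]
 derivs_cmult[OF oI kd_poly xi(1)] derivs_cmult[OF oI kdP xi(1)]) (simp add: derivs_const)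
 hence eq: "c0*(fact k*dd t q N) + (deriv ^^ k) ee xk = (deriv ^^ k) (%x. poly ?P (X x)) xk"
 using xi by (simp add: derivs_poly Dk)
 have 1: "\<bar>(deriv ^^ k) ee xk\<bar> <= famC k 1*eps*Y" by (rule fbd_top[OF ee xi(1)])
 have 2: "\<bar>(deriv ^^ k) (%x. poly ?P (X x)) xk - poly (pder k ?P) (X xk)*deriv X xk ^ k\<bar> <= cmpC k A2*ze2*Y"
 using derivs_comp_approx[where p="%j. poly (pder j ?P)", OF oI Y _ e2 DERIV_pder Pb X xi(1)] A2 by simp
 have c0: "0 <= cmpC k A2" using cmpC_nonneg A2 by simp
 have "famC k 1*eps*Y + cmpC k A2*ze2*Y = (famC k 1*eps + cmpC k A2*ze2)*Y" by (simp add: algebra_simps)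
 also have "... <= (famC k 1 + cmpC k A2*((4*K + 2) ^ k*fact k))*(ze + eps)*Y"
 proof (rule mult_right_mono)
 have "0 <= famC k 1*ze" "0 <= cmpC k A2*((4*K + 2) ^ k*fact k)*eps"
 using famC_ge1[of 1 k] e ep c0 K by auto
 thus "famC k 1*eps + cmpC k A2*ze2 <= (famC k 1 + cmpC k A2*((4*K + 2) ^ k*fact k))*(ze + eps)"
 unfolding ze2_def by (simp add: algebra_simps)
 qed (use Y in simp)
 also have "... = osC k A m*(ze + eps)*(1 + \<bar>dd t q N\<bar>)" by (simp add: osC_def Y_def A2_def K_def)
 finally have 3: "famC k 1*eps*Y + cmpC k A2*ze2*Y <= osC k A m*(ze + eps)*(1 + \<bar>dd t q N\<bar>)" .
 have "\<bar>c0*(fact k*dd t q N) - fact k*dd t' q' N*deriv X xk ^ k\<bar> <= osC k A m*(ze + eps)*(1 + \<bar>dd t q N\<bar>)"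
 using eq 1 2 3 unfolding DkP by linarith
 moreover have "\<bar>poly (pderiv ?p) xk\<bar> <= 10 ^ k*fact k*ze" using pb[of 1 xk] k xi by (simp add: ze1_def)
 ultimately show ?thesis using dom[OF xi(1)] unfolding dX[OF xi(1)]
 by (intro exI[of _ xk] exI[of _ "poly ?p xk"] exI[of _ "poly (pderiv ?p) xk"]) auto
qed

definition fsC :: "nat => real => real" where
 "fsC k A = (famD k*A + cmpC k (famC k 1*A) + (famC k 1*A) ^ k)*(3 ^ k*fact k)"

text \<open>The Rolle argument once more, now for the crossing: the second image coordinate is E
  alone, and divided differences of all orders up to k are small on both sides. All derivatives of P
  from order 1 on are then small, hence so is the k-th derivative of E along the graph of p; this
  graph is nearly horizontal, so the pure k-th partial of E is what is estimated.\<close>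

lemma final_step:
 assumes N: "finite N" "inj_on t N" "inj_on t' N" "card N = Suc k" and k: "1 <= k"
 and e: "0 <= ze" "3 ^ k*fact k*ze <= 1" and A: "1 <= A"
 and dd: "!!J. J <= N ==> 2 <= card J ==> \<bar>dd t q J\<bar> <= ze & \<bar>dd t' q' J\<bar> <= ze"
 and c: "c : N" and rho: "0 < rh" "rh*(famC k 1*A) <= 1"
 and dist: "!!i. i : N ==> \<bar>t i - t c\<bar> < rh & \<bar>t' i - t' c\<bar> < 1"
 and G: "wfam k (sqr (t c) (q c) rh) G A" and E: "wfam k (sqr (t c) (q c) rh) E A"
 and maps: "!!i. i : N ==> t' i = G [] (t i) (q i) & q' i = E [] (t i) (q i)"
 shows "EX x y. (x, y) : sqr (t c) (q c) rh & \<bar>E (replicate k False) x y\<bar> <= fsC k A*ze"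
proof -
 let ?p = "interp t q N" and ?P = "interp t' q' N"
 define A2 where "A2 = famC k 1*A"
 have A2: "1 <= A2" using mult_mono[of 1 "famC k 1" 1 A] famC_ge1[of 1 k] A by (simp add: A2_def)
 have "rh*1 <= rh*A2" using rho A2 by (intro mult_left_mono) auto
 hence rho1: "rh <= 1" using rho(2) unfolding A2_def by linarith
 define I where "I = {x. \<bar>x - t c\<bar> < rh}"
 have I_ball: "I = ball (t c) rh" by (auto simp: I_def dist_real_def)
 have oI: "open I" and cI: "convex I" unfolding I_ball by auto
 have NI: "t ` N <= I" using dist by (force simp: I_def)
 define ze1 where "ze1 = 3 ^ k*fact k*ze"
 have e1: "0 <= ze1" "ze1 <= 1" using e by (auto simp: ze1_def)
 have pb: "\<bar>poly (pder j ?p) x\<bar> <= ze1" if "1 <= j" "j <= k" "x : I" for j x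
 unfolding ze1_def
 by (rule interp_bounds_full[OF N(1,2,4) e(1), of q "t c"]) (use dd dist that rho1 in \<open>force simp: I_def\<close>)+
 have Pb: "\<bar>poly (pder j ?P) x\<bar> <= ze1" if "1 <= j" "j <= k" "\<bar>x - t' c\<bar> < 1" for j x
 unfolding ze1_def
 by (rule interp_bounds_full[OF N(1,3,4) e(1), of q' "t' c"]) (use dd dist that in \<open>force\<close>)+
 have s: "fbd (k - 1) ze1 1 I (poly (pderiv ?p))"
 by (rule fbd_poly) (use pb k in \<open>auto simp: pder_pderiv simp del: pder_simps(2)\<close>)
 hence s1: "fbd (k - 1) 1 1 I (poly (pderiv ?p))" using e1 by (auto intro: fbd_mono)
 have pc: "poly ?p (t i) = q i" if "i : N" for i using interp(1)[OF N(1,2) that] .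
 have Pc: "poly ?P (t' i) = q' i" if "i : N" for i using interp(1)[OF N(1,3) that] .
 have dom: "(x, poly ?p x) : sqr (t c) (q c) rh" if x: "x : I" for x
 proof -
 have "\<bar>poly ?p x - poly ?p (t c)\<bar> <= 1*\<bar>x - t c\<bar>"
 using field_differentiable_bound[OF cI, of "poly ?p" "poly (pderiv ?p)" 1 x "t c"] pb[of 1] e1 k x NI c
 by (force simp: has_field_derivative_at_within)
 thus ?thesis using x pc[OF c] by (auto simp: sqr_def I_def)
 qed
 define X where "X x = G [] x (poly ?p x)" for x
 define ee where "ee x = E [] x (poly ?p x)" for x
 have fam: "fbd k (famC k 1*A) 1 I (%x. H [] x (poly ?p x))" if "wfam k (sqr (t c) (q c) rh) H A" for H
 by (rule fbd_family[OF oI order_refl, where s="poly (pderiv ?p)" and u="%w x. H w x (poly ?p x)"])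
 (use that(1) dom s1 A in \<open>auto simp: wfam_def\<close>)
 have X: "fbd k A2 1 I X" unfolding X_def[abs_def] A2_def using fam[OF G] by simp
 have ee: "fbd k A2 1 I ee" unfolding ee_def[abs_def] A2_def using fam[OF E] by simp
 have dXA: "\<bar>deriv X x\<bar> <= A2" "DERIV X x :> deriv X x" if "x : I" for x
 proof -
 obtain l where l: "k = Suc l" using k by (cases k) auto
 show "\<bar>deriv X x\<bar> <= A2" "DERIV X x :> deriv X x" using X that unfolding l
 by (cases l; auto intro: real_differentiableD)+
 qed
 have Xt: "X (t i) = t' i" if "i : N" for i using maps[OF that] pc[OF that] by (simp add: X_def)
 have XJ: "\<bar>X x - t' c\<bar> < 1" if x: "x : I" for x
 proof -
 have "\<bar>X x - X (t c)\<bar> <= A2*\<bar>x - t c\<bar>"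
 using field_differentiable_bound[OF cI, of X "deriv X" A2 x "t c"] dXA x NI c
 by (force simp: has_field_derivative_at_within)
 also have "... < A2*rh" using x A2 by (intro mult_strict_left_mono) (auto simp: I_def)
 also have "... <= 1" using rho by (simp add: A2_def mult.commute)
 finally show ?thesis using Xt[OF c] by simp
 qed
 have kdX: "kd k I X" and kde: "kd k I ee" using X ee fbd_kd by auto
 have kdP: "kd k I (%x. poly ?P (X x))"
 using kd_comp[where p="%j. poly (pder j ?P)" and j=0, OF oI DERIV_pder kdX] by simp
 define R where "R x = ee x + (-1)*poly ?P (X x)" for x
 have kd1: "kd k I (%x. (-1)*poly ?P (X x))" by (rule kd_cmult[OF oI kdP])
 have "kd k I R" unfolding R_def[abs_def] by (rule kd_add[OF oI kde kd1])
 moreover have "R z = 0" if "z : t ` N" for z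
 using that maps pc Pc Xt by (auto simp: R_def ee_def)
 ultimately have "EX xk:I. (deriv ^^ k) R xk = 0"
 using N NI by (intro generalized_rolle[OF oI cI, of k R "t ` N"]) (auto simp: card_image)
 then obtain xk where xi: "xk : I" "(deriv ^^ k) R xk = 0" by blast
 have "(deriv ^^ k) R xk = (deriv ^^ k) ee xk + (-1)*(deriv ^^ k) (%x. poly ?P (X x)) xk"
 unfolding R_def[abs_def]
 by (simp only: derivs_add[OF oI kde kd1 xi(1)] derivs_cmult[OF oI kdP xi(1)])
 hence eq: "(deriv ^^ k) ee xk = (deriv ^^ k) (%x. poly ?P (X x)) xk"
 using xi by simp
 have 1: "\<bar>(deriv ^^ k) ee xk - E (replicate k False) xk (poly ?p xk)\<bar> <= famD k*A*ze1"
 unfolding ee_def[abs_def]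
 by (rule derivs_family_approx[OF oI e1 _ _ _ _ xi(1), where s="poly (pderiv ?p)" and u="%w x. E w x (poly ?p x)"])
 (use E dom s A in \<open>auto simp: wfam_def\<close>)
 have 2: "\<bar>(deriv ^^ k) (%x. poly ?P (X x)) xk - poly (pder k ?P) (X xk)*deriv X xk ^ k\<bar> <= cmpC k A2*ze1*1"
 using derivs_comp_approx[where p="%j. poly (pder j ?P)", OF oI order_refl _ e1(1) DERIV_pder _ X xi(1)] Pb XJ A2 by simp
 have "\<bar>poly (pder k ?P) (X xk)*deriv X xk ^ k\<bar> <= ze1*A2 ^ k"
 unfolding abs_mult power_abs using Pb[OF k order_refl XJ[OF xi(1)]] dXA[OF xi(1)] e1 by (intro mult_mono power_mono) auto
 hence "\<bar>E (replicate k False) xk (poly ?p xk)\<bar> <= famD k*A*ze1 + cmpC k A2*ze1 + ze1*A2 ^ k"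
 using 1 2 eq by linarith
 also have "... = fsC k A*ze" by (simp add: fsC_def ze1_def A2_def algebra_simps)
 finally show ?thesis using dom[OF xi(1)] by blast
qed

section \<open>A smooth step function\<close>

text \<open>The powers of 1/x make the family of flat functions closed under differentiation, so
  smoothness of all members follows by one induction on r.\<close>

definition fl :: "nat => real => real" where
 "fl n x = (if 0 < x then (1/x) ^ n*exp (- (1/x)) else 0)"

lemma fl_nonneg: "0 <= fl n x" and fl_pos: "0 < x ==> 0 < fl n x" and fl_zero: "x <= 0 ==> fl n x = 0"
 by (auto simp: fl_def)

text \<open>One term, of order n + 2, of the exponential series at 1/x is enough; the square on the
  right gives derivative 0 at the origin.\<close>

lemma fl_bound: "fl n x <= fact (n + 2)*x^2"
proof (cases "0 < x")
 case True
 define y where "y = 1/x"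
 have y: "0 < y" using True by (simp add: y_def)
 define F :: real where "F = fact (n + 2)"
 have F: "0 < F" by (simp add: F_def)
 have s: "(%k. y ^ k /\<^sub>R fact k) sums exp y" by (rule exp_converges)
 have "sum (%k. y ^ k /\<^sub>R fact k) {n + 2} <= suminf (%k. y ^ k /\<^sub>R fact k)"
 by (rule sum_le_suminf) (use s y in \<open>auto simp: sums_iff\<close>)
 hence "inverse F*y ^ (n + 2) <= exp y" using s unfolding F_def by (simp add: sums_iff del: fact_Suc)
 hence "y ^ (n + 2) <= F*exp y" using F by (simp add: field_simps)
 hence "y ^ n*exp (- y) <= F/y^2"
 using y by (simp add: field_simps exp_minus power_add power2_eq_square mult_ac)
 thus ?thesis using True unfolding F_def[symmetric] by (simp add: fl_def y_def power_divide)
qed (simp add: fl_zero)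

lemma DERIV_fl: "DERIV (fl n) x :> fl (n + 2) x - real n * fl (Suc n) x"
proof -
 consider "0 < x" | "x < 0" | "x = 0" by linarith
 thus ?thesis
 proof cases
 case 1
 have d1: "DERIV (\<lambda>x. 1 / x) x :> - ((1 / x)\<^sup>2)"
 using 1 by (auto intro!: derivative_eq_intros simp: power2_eq_square)
 have d2: "DERIV (\<lambda>x. (1 / x) ^ n) x :> - (real n * (1 / x) ^ Suc n)"
 using DERIV_power[OF d1, of n] by (cases n) (auto simp: power2_eq_square algebra_simps)
 have d3: "DERIV (\<lambda>x. exp (- (1 / x))) x :> exp (- (1 / x)) * (1 / x)\<^sup>2"
 using DERIV_chain2[OF DERIV_exp DERIV_minus[OF d1]] by simp
 have "- (real n * (1 / x) ^ Suc n) * exp (- (1 / x)) + exp (- (1 / x)) * (1 / x)\<^sup>2 * (1 / x) ^ n = fl (n + 2) x - real n * fl (Suc n) x"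
 using 1 by (simp add: fl_def power_add power2_eq_square mult_ac)
 hence "DERIV (\<lambda>x. (1 / x) ^ n * exp (- (1 / x))) x :> fl (n + 2) x - real n * fl (Suc n) x"
 using DERIV_mult[OF d2 d3] by simp
 thus ?thesis
 by (rule has_field_derivative_transform_within_open[where S="{0<..}"]) (use 1 in \<open>auto simp: fl_def\<close>)
 next
 case 2
 have "DERIV (\<lambda>x. 0) x :> fl (n + 2) x - real n * fl (Suc n) x" using 2 by (simp add: fl_zero)
 thus ?thesis
 by (rule has_field_derivative_transform_within_open[where S="{..<0}"]) (use 2 in \<open>auto simp: fl_def\<close>)
 next
 case 3
 have "(fl n has_field_derivative 0) (at 0)"
 unfolding has_field_derivative_iff
 proof (rule Lim_null_comparison)
 have "norm ((fl n h - fl n 0) / (h - 0)) <= fact (n + 2) * \<bar>h\<bar>" if "h ~= 0" for h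
 proof -
 have "\<bar>fl n h\<bar> <= fact (n + 2) * \<bar>h\<bar> * \<bar>h\<bar>"
 using fl_bound[of n h] fl_nonneg[of n h] by (simp add: power2_eq_square mult.assoc del: fact_Suc)
 thus ?thesis using that by (simp add: fl_zero abs_divide pos_divide_le_eq del: fact_Suc)
 qed
 thus "\<forall>\<^sub>F h in at 0. norm ((fl n h - fl n 0) / (h - 0)) <= fact (n + 2) * \<bar>h\<bar>"
 by (simp add: eventually_at_filter)
 show "((\<lambda>h. fact (n + 2) * \<bar>h\<bar>) \<longlongrightarrow> 0) (at (0::real))"
 by (intro tendsto_eq_intros) auto
 qed
 thus ?thesis using 3 by (simp add: fl_zero)
 qed
qed

lemma Cr_on_fl: "Cr_on r (fl n) UNIV"
proof (induction r arbitrary: n)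
 case 0
 have "continuous_on UNIV (fl n)" by (meson DERIV_fl DERIV_isCont continuous_at_imp_continuous_on)
 thus ?case by (simp add: Cr_on_0)
next
 case (Suc r)
 show ?case
 by (rule Cr_on_real_SucI[OF open_UNIV DERIV_fl]) (intro Cr_on_diff Cr_on_mult Cr_on_const Suc open_UNIV)
qed

definition st :: "real => real" where "st x = fl 0 x/(fl 0 x + fl 0 (1 - x))"

definition st' :: "real => real" where
 "st' x = (fl 2 x*fl 0 (1 - x) + fl 0 x*fl 2 (1 - x))/(fl 0 x + fl 0 (1 - x))^2"

lemma st_den: "0 < fl 0 x + fl 0 (1 - x)"
 using fl_pos[of x 0] fl_pos[of "1 - x" 0] fl_nonneg[of 0 x] fl_nonneg[of 0 "1 - x"]
 by (cases "0 < x") (auto simp: add_pos_nonneg add_nonneg_pos)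

lemma Cr_on_st_aux: "Cr_on r (%x. fl n (1 - x)) UNIV"
 by (rule Cr_on_compose[OF Cr_on_fl]) (auto intro!: Cr_on_intros)

lemma Cr_on_st: "Cr_on r f U ==> Cr_on r (%x. st (f x)) U"
proof -
 have "Cr_on r st UNIV" unfolding st_def[abs_def]
 using st_den by (intro Cr_on_divide Cr_on_add Cr_on_fl Cr_on_st_aux) (metis less_irrefl)
 thus "Cr_on r f U ==> Cr_on r (%x. st (f x)) U" by (rule Cr_on_compose) auto
qed

lemma st_0: "x <= 0 ==> st x = 0" and st_1: "1 <= x ==> st x = 1"
 and st_nonneg: "0 <= st x" and st_le1: "st x <= 1" and st_sym: "st (1 - x) = 1 - st x"
 and st_pos: "0 < x ==> 0 < st x" and st_less1: "x < 1 ==> st x < 1"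
 using st_den[of x] fl_nonneg[of 0 x] fl_nonneg[of 0 "1 - x"] fl_pos[of x 0] fl_pos[of "1 - x" 0]
 by (auto simp: st_def fl_zero field_simps)

lemma DERIV_st: "DERIV st x :> st' x"
proof -
 have d: "DERIV (%x. fl 0 (1 - x)) x :> - fl 2 (1 - x)"
 proof -
 have 1: "DERIV (%x. 1 - x) x :> (-1 :: real)" by (auto intro!: derivative_eq_intros)
 have 2: "DERIV (fl 0) (1 - x) :> fl 2 (1 - x)" using DERIV_fl[of 0 "1 - x"] by (simp add: numeral_2_eq_2)
 show ?thesis using DERIV_chain2[where f="fl 0" and g="%x. 1 - x", OF 2 1] by simp
 qed
 have d0: "DERIV (fl 0) x :> fl 2 x" using DERIV_fl[of 0 x] by (simp add: numeral_2_eq_2)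
 show ?thesis unfolding st_def[abs_def] st'_def
 using st_den[of x] by (auto intro!: derivative_eq_intros d d0 simp: power2_eq_square algebra_simps)
qed

lemma st'_nonneg: "0 <= st' x" and st'_pos: "0 < x ==> x < 1 ==> 0 < st' x"
 and st'_zero: "x <= 0 | 1 <= x ==> st' x = 0"
 using st_den[of x] fl_nonneg[of 0 x] fl_nonneg[of 0 "1 - x"] fl_nonneg[of 2 x] fl_nonneg[of 2 "1 - x"]
 fl_pos[of x 0] fl_pos[of "1 - x" 0] fl_pos[of x 2] fl_pos[of "1 - x" 2]
 by (auto simp: st'_def fl_zero intro!: divide_nonneg_pos divide_pos_pos add_pos_pos)

lemma continuous_st': "continuous_on UNIV st'"
 unfolding st'_def[abs_def]
 by (intro continuous_intros Cr_on_continuous_on[OF Cr_on_fl[of 0]] Cr_on_continuous_on[OF Cr_on_st_aux[of 0]])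
 (use st_den in \<open>force simp: less_le\<close>)

lemma st'_bounded: "EX C>0. ALL x. st' x <= C"
proof -
 have "compact (st' ` {0..1})" by (intro compact_continuous_image continuous_on_subset[OF continuous_st']) auto
 then obtain C where C: "!!x. x : {0..1} ==> st' x <= C"
 by (metis bounded_imp_bdd_above compact_imp_bounded bdd_above.unfold imageI)
 have "st' x <= max C 1" for x
 using C[of x] st'_zero[of x] by (cases "x : {0..1}") auto
 thus ?thesis by (intro exI[of _ "max C 1"]) auto
qed

text \<open>A bound for the slope of the step function, fixed once and for all because the sizes
  \<open>NN\<close> and \<open>hh\<close> of later bumps are tuned to it.\<close>

definition stC :: real where "stC = (SOME C. 0 < C & (ALL x. st' x <= C))"

lemma stC: "0 < stC" "st' x <= stC"
 using someI_ex[of "%C. 0 < C & (ALL x. st' x <= C)"] st'_bounded unfolding stC_def by auto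

lemma st_inj:
 assumes "st x = st y" "0 < st x" "st x < 1"
 shows "x = y"
proof -
 have *: "st x < st y" if "x < y" "0 < st x" "st y < 1" for x y
 proof (rule DERIV_pos_imp_increasing_open[OF that(1)])
 fix z assume z: "x < z" "z < y"
 have "0 < x" "y < 1" using that st_0 st_1 by (metis less_irrefl not_less)+
 thus "EX d. DERIV st z :> d & 0 < d" using DERIV_st st'_pos z by (meson less_trans)
 qed (meson DERIV_st DERIV_isCont continuous_at_imp_continuous_on)
 show ?thesis using *[of x y] *[of y x] assms by (metis less_irrefl linorder_neqE_linordered_idom)
qed

section \<open>The hyperbolic automorphism and its lattice\<close>

text \<open>\<open>mu\<close> and \<open>lam\<close> are the roots of x^2 - 18 x + 1, the
  eigenvalues of an integer matrix of trace 18 and determinant 1. The large trace leaves room for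
  crude numerical estimates in a single step.\<close>

definition mu :: real where "mu = 9 + sqrt 80"
definition lam :: real where "lam = 9 - sqrt 80"

lemma mu_lam: "mu + lam = 18" "mu*lam = 1" "lam*mu = 1"
 by (auto simp: mu_def lam_def algebra_simps)

lemma mu_bounds: "17.9 < mu" "mu < 18" and lam_bounds: "0 < lam" "lam < 0.06"
proof -
 have "(8.9::real) < sqrt 80" by (rule real_less_rsqrt) (simp add: power2_eq_square)
 moreover have "sqrt 80 < (9::real)" by (rule real_less_lsqrt) (auto simp: power2_eq_square)
 ultimately show mu: "17.9 < mu" "mu < 18" and l: "0 < lam" by (auto simp: mu_def lam_def)
 have "17.9*lam < mu*lam" using mu l by simp
 thus "lam < 0.06" using mu_lam by simp
qed

text \<open>Beyond \<open>NN\<close> the bump is switched off so slowly that the contraction rate never drops below \<open>lam / 2\<close>.\<close>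

definition NN :: real where "NN = 10 + 1000 * stC*mu^2"
definition RR :: real where "RR = 10*NN"
text \<open>The scale of the lattice: distinct lattice points have distance at least
  \<open>4*RR\<close>, while all bumps live within \<open>RR\<close> of a lattice point.\<close>

definition om :: real where "om = pi/(4*RR*mu)"

lemma NN_ge: "10 <= NN" and RR_ge: "100 <= RR" and om_pos: "0 < om"
proof -
 show N: "10 <= NN" using stC by (simp add: NN_def)
 thus R: "100 <= RR" by (simp add: RR_def)
 show "0 < om" using R mu_bounds by (simp add: om_def)
qed

text \<open>The angles of the torus written in eigencoordinates. On the pair (\<open>th1\<close>,
  \<open>th2\<close>) the automorphism acts by the integer matrix with rows (18, -1) and (1,
  0).\<close>

definition th1 :: "real^2 => real" where "th1 x = om*(mu*x$2 - lam*x$1)"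
definition th2 :: "real^2 => real" where "th2 x = om*(x$2 - x$1)"

definition LL :: "(real^2) set" where
 "LL = {l. EX (i::int) (j::int). th1 l = 2*pi*i & th2 l = 2*pi*j}"

lemma th_linear: "th1 (x + y) = th1 x + th1 y" "th2 (x + y) = th2 x + th2 y" "th1 (x - y) = th1 x - th1 y"
 "th2 (x - y) = th2 x - th2 y" "th1 0 = 0" "th2 0 = 0" "th1 (c *\<^sub>R x) = c*th1 x" "th2 (c *\<^sub>R x) = c*th2 x"
 "th1 (- x) = - th1 x" "th2 (- x) = - th2 x"
 by (simp_all add: th1_def th2_def algebra_simps)

lemma LL_0: "0 : LL" by (auto simp: LL_def th_linear intro!: exI[of _ 0])

lemma LL_diff: "l : LL ==> m : LL ==> l - m : LL"
proof -
 assume "l : LL" "m : LL"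
 then obtain i j i' j' :: int where "th1 l = 2*pi*i" "th2 l = 2*pi*j" "th1 m = 2*pi*i'" "th2 m = 2*pi*j'"
 by (auto simp: LL_def)
 thus ?thesis unfolding LL_def by (intro CollectI exI[of _ "i - i'"] exI[of _ "j - j'"]) (simp add: th_linear algebra_simps)
qed

lemma LL_minus: "l : LL ==> - l : LL" using LL_diff[OF LL_0] by simp
lemma LL_add: "l : LL ==> m : LL ==> l + m : LL" using LL_diff[OF _ LL_minus] by force

lemma th_bound: "\<bar>th1 x\<bar> <= 2 * om * mu * norm x" "\<bar>th2 x\<bar> <= 2 * om * mu * norm x"
proof -
 have n: "\<bar>x$1\<bar> <= norm x" "\<bar>x$2\<bar> <= norm x" by (auto simp: component_le_norm_cart)
 have "\<bar>mu * x$2 - lam * x$1\<bar> <= mu * \<bar>x$2\<bar> + lam * \<bar>x$1\<bar>"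
 using abs_triangle_ineq4[of "mu * x$2" "lam * x$1"] mu_bounds lam_bounds by (simp add: abs_mult)
 also have "\<dots> <= mu * norm x + mu * norm x" using n mu_bounds lam_bounds by (intro add_mono mult_mono) auto
 finally have "om * \<bar>mu * x$2 - lam * x$1\<bar> <= om * (mu * norm x + mu * norm x)" using om_pos by simp
 thus "\<bar>th1 x\<bar> <= 2 * om * mu * norm x" using om_pos unfolding th1_def abs_mult by (simp add: mult.assoc mult.left_commute)
 have "1 * norm x <= mu * norm x" using mu_bounds by (intro mult_right_mono) auto
 hence "\<bar>x$2 - x$1\<bar> <= mu * norm x + mu * norm x" using n by linarith
 hence "om * \<bar>x$2 - x$1\<bar> <= om * (mu * norm x + mu * norm x)" using om_pos by simp
 thus "\<bar>th2 x\<bar> <= 2 * om * mu * norm x" using om_pos unfolding th2_def abs_mult by (simp add: mult.assoc mult.left_commute)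
qed

lemma coords_th: "x$1 = (th1 x - mu*th2 x)/(om*(mu - lam))" "x$2 = (th1 x - lam*th2 x)/(om*(mu - lam))"
proof -
 have "om*(mu - lam) ~= 0" using om_pos mu_bounds lam_bounds by auto
 thus "x$1 = (th1 x - mu*th2 x)/(om*(mu - lam))" "x$2 = (th1 x - lam*th2 x)/(om*(mu - lam))"
 by (simp_all add: field_simps th1_def th2_def)
qed

lemma LL_sep:
 assumes "l \<in> LL" "norm l < 4 * RR"
 shows "l = 0"
proof -
 obtain i j :: int where ij: "th1 l = 2 * pi * i" "th2 l = 2 * pi * j" using assms by (auto simp: LL_def)
 have "2 * om * mu * norm l < 2 * om * mu * (4 * RR)" using assms om_pos mu_bounds by simp
 also have "\<dots> = 2 * pi" using RR_ge mu_bounds by (simp add: om_def)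
 finally have "\<bar>2 * pi * i\<bar> < 2 * pi * 1" "\<bar>2 * pi * j\<bar> < 2 * pi * 1" using th_bound[of l] ij by auto
 hence "\<bar>real_of_int i\<bar> < 1" "\<bar>real_of_int j\<bar> < 1" by (simp_all add: abs_mult)
 hence "i = 0" "j = 0" by linarith+
 hence "th1 l = 0" "th2 l = 0" using ij by auto
 hence "l$1 = 0" "l$2 = 0" using coords_th[of l] by simp_all
 thus ?thesis by (simp add: vec_eq_iff forall_2)
qed

definition RC :: real where "RC = 2*pi*(1 + mu)/(om*(mu - lam))"

lemma RC_pos: "0 < RC"
 using om_pos mu_bounds lam_bounds by (auto simp: RC_def intro!: divide_pos_pos mult_pos_pos)

text \<open>Both angles are rounded to multiples of 2 pi and the eigencoordinates are solved for;
  \<open>RC\<close> is the covering radius that results.\<close>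

lemma LL_cover: "EX l:LL. norm (x - l) <= RC"
proof -
 define i where "i = round (th1 x/(2*pi))"
 define j where "j = round (th2 x/(2*pi))"
 define l :: "real^2" where "l = vector [(2*pi*i - mu*(2*pi*j))/(om*(mu - lam)), (2*pi*i - lam*(2*pi*j))/(om*(mu - lam))]"
 have ne: "om*(mu - lam) > 0" using om_pos mu_bounds lam_bounds by auto
 define D where "D = om*(mu - lam)"
 have D: "D ~= 0" using ne unfolding D_def by (rule less_imp_neq[symmetric])
 have l12: "l$1 = (2*pi*i - mu*(2*pi*j))/D" "l$2 = (2*pi*i - lam*(2*pi*j))/D"
 by (simp_all add: l_def D_def)
 have "mu*l$2 - lam*l$1 = (mu - lam)*(2*pi*i)/D" "l$2 - l$1 = (mu - lam)*(2*pi*j)/D"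
 unfolding l12 by (simp_all add: diff_divide_distrib[symmetric] algebra_simps)
 moreover have "om ~= 0" "mu ~= lam" using om_pos mu_bounds lam_bounds by auto
 ultimately have th: "th1 l = 2*pi*i" "th2 l = 2*pi*j"
 unfolding th1_def th2_def by (simp_all add: D_def mult.assoc)
 have r: "\<bar>y - 2*pi*round (y/(2*pi))\<bar> <= pi" for y :: real
 proof -
 have "\<bar>y/(2*pi) - round (y/(2*pi))\<bar> <= 1/2" using of_int_round_abs_le[of "y/(2*pi)"] by (simp add: abs_minus_commute)
 hence "2*pi*\<bar>y/(2*pi) - round (y/(2*pi))\<bar> <= 2*pi*(1/2)" by (intro mult_left_mono) auto
 moreover have "2*pi*\<bar>y/(2*pi) - round (y/(2*pi))\<bar> = \<bar>y - 2*pi*round (y/(2*pi))\<bar>"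
 proof -
 have "y - 2*pi*round (y/(2*pi)) = 2*pi*(y/(2*pi) - round (y/(2*pi)))"
 by (simp add: right_diff_distrib)
 thus ?thesis by (simp only: abs_mult) simp
 qed
 ultimately show ?thesis by simp
 qed
 have t: "\<bar>th1 (x - l)\<bar> <= pi" "\<bar>th2 (x - l)\<bar> <= pi" using r th by (auto simp: th_linear i_def j_def)
 have b: "\<bar>(th1 (x - l) - s*th2 (x - l))/(om*(mu - lam))\<bar> <= pi*(1 + mu)/(om*(mu - lam))" if "0 <= s" "s <= mu" for s
 proof -
 have "\<bar>th1 (x - l) - s*th2 (x - l)\<bar> <= \<bar>th1 (x - l)\<bar> + s*\<bar>th2 (x - l)\<bar>"
 using abs_triangle_ineq4[of "th1 (x - l)" "s*th2 (x - l)"] that by (simp add: abs_mult)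
 also have "... <= pi + mu*pi" using t that mu_bounds by (intro add_mono mult_mono) auto
 finally have "\<bar>th1 (x - l) - s*th2 (x - l)\<bar> <= pi*(1 + mu)" by (simp add: algebra_simps)
 thus ?thesis using ne unfolding abs_divide by (simp add: divide_right_mono)
 qed
 have "norm (x - l) <= \<bar>(x - l)$1\<bar> + \<bar>(x - l)$2\<bar>" using norm_le_l1_cart[of "x - l"] by (simp add: sum_2)
 also have "... <= pi*(1 + mu)/(om*(mu - lam)) + pi*(1 + mu)/(om*(mu - lam))"
 unfolding coords_th[of "x - l"] by (intro add_mono b) (use mu_bounds lam_bounds in auto)
 also have "... = RC" by (simp add: RC_def add_divide_distrib[symmetric])
 finally have "norm (x - l) <= RC" .
 moreover have "l : LL" using th by (auto simp: LL_def)
 ultimately show ?thesis by blast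
qed

definition Lm :: "real^2 => real^2" where "Lm x = vector [lam*x$1, mu*x$2]"
definition Li :: "real^2 => real^2" where "Li x = vector [mu*x$1, lam*x$2]"

lemma Lm_simps [simp]: "Lm x $ 1 = lam*x$1" "Lm x $ 2 = mu*x$2" "Li x $ 1 = mu*x$1" "Li x $ 2 = lam*x$2"
 by (simp_all add: Lm_def Li_def)

lemma Lm_Li: "Lm (Li x) = x" "Li (Lm x) = x"
 using mu_lam by (simp_all add: vec_eq_iff forall_2 mult.assoc[symmetric])

lemma Lm_LL: "l \<in> LL ==> Lm l \<in> LL" and Li_LL: "l \<in> LL ==> Li l \<in> LL"
proof -
 assume "l \<in> LL"
 then obtain i j :: int where ij: "th1 l = 2 * pi * i" "th2 l = 2 * pi * j" by (auto simp: LL_def)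
 define s where "s = sqrt 80"
 have ss: "s * s = 80" "s * (s * y) = 80 * y" for y by (simp_all add: s_def mult.assoc[symmetric])
 have ms: "mu = 9 + s" "lam = 9 - s" by (simp_all add: mu_def lam_def s_def)
 have "th1 (Lm l) = 18 * th1 l - th2 l" "th2 (Lm l) = th1 l" "th1 (Li l) = th2 l" "th2 (Li l) = 18 * th2 l - th1 l"
 unfolding th1_def th2_def Lm_simps ms by (simp_all add: algebra_simps ss)
 hence "th1 (Lm l) = 2 * pi * of_int (18 * i - j)" "th2 (Lm l) = 2 * pi * of_int i"
 "th1 (Li l) = 2 * pi * of_int j" "th2 (Li l) = 2 * pi * of_int (18 * j - i)"
 using ij by (simp_all add: algebra_simps)
 thus "Lm l \<in> LL" "Li l \<in> LL" unfolding LL_def by blast+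
qed

section \<open>Periodic bumps and the plane with holes\<close>

text \<open>\<open>Dm 1\<close> will be one sheet of the surface before division by the lattice;
  smaller values of d add a collar inside the holes.\<close>

definition Dm :: "real => (real^2) set" where "Dm d = {x. ALL l:LL. d <= norm (x - l)}"

text \<open>Stands for the sum of all lattice translates of a function supported in the ball of
  radius \<open>RR\<close>. At most one lattice point lies within \<open>2*RR\<close>, so the choice
  is unambiguous, and between \<open>RR\<close> and \<open>2*RR\<close> the value is already 0,
  which makes the two cases fit smoothly.\<close>

definition per :: "(real^2 => 'b::real_normed_vector) => real^2 => 'b" where
 "per H x = (if EX l:LL. norm (x - l) < 2*RR then H (x - (SOME l. l : LL & norm (x - l) < 2*RR)) else 0)"

lemma LL_unique: "l : LL ==> m : LL ==> norm (x - l) < 2*RR ==> norm (x - m) < 2*RR ==> l = m"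
proof -
 assume *: "l : LL" "m : LL" "norm (x - l) < 2*RR" "norm (x - m) < 2*RR"
 have "norm (l - m) <= norm (x - m) + norm (x - l)" using norm_triangle_ineq4[of "x - m" "x - l"] by simp
 thus ?thesis using LL_sep[OF LL_diff[OF *(1,2)]] * by simp
qed

lemma per_near:
 assumes "l : LL" "norm (x - l) < 2*RR"
 shows "per H x = H (x - l)"
proof -
 have "(SOME l. l : LL & norm (x - l) < 2*RR) = l"
 proof (rule some_equality)
 show "l : LL & norm (x - l) < 2*RR" using assms by simp
 show "m = l" if "m : LL & norm (x - m) < 2*RR" for m
 using LL_unique[of m l x] that assms by blast
 qed
 thus ?thesis using assms by (auto simp: per_def)
qed

lemma per_far:
 assumes "!!w. RR <= norm w ==> H w = 0" "x : Dm RR"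
 shows "per H x = 0"
proof (cases "EX l:LL. norm (x - l) < 2*RR")
 case True
 thus ?thesis using per_near[of _ x H] assms by (auto simp: Dm_def)
qed (simp add: per_def)

lemma per_periodic:
 assumes "l : LL" shows "per H (x + l) = per H x"
proof (cases "EX m:LL. norm (x - m) < 2*RR")
 case True
 then obtain m where m: "m : LL" "norm (x - m) < 2*RR" by blast
 have "norm (x + l - (m + l)) < 2*RR" using m by simp
 from per_near[OF LL_add[OF m(1) assms] this, of H] per_near[OF m, of H] show ?thesis by simp
next
 case False
 have "~ norm (x + l - m) < 2*RR" if "m : LL" for m
 using False LL_diff[OF that assms] by (metis add_diff_eq diff_diff_eq2)
 thus ?thesis using False by (simp add: per_def)
qed

lemma Cr_on_per:
 assumes V: "open V" and H0: "!!w. RR <= norm w ==> H w = 0" and H: "Cr_on r H U"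
 and U: "!!x l. x : V ==> l : LL ==> norm (x - l) < 2*RR ==> x - l : U"
 shows "Cr_on r (per H) V"
proof (rule Cr_on_local[OF V])
 fix x assume x: "x : V"
 show "EX W. x : W & Cr_on r (per H) W"
 proof (cases "EX l:LL. norm (x - l) < 2*RR")
 case True
 then obtain l where l: "l : LL" "norm (x - l) < 2*RR" by blast
 let ?W = "V Int ball l (2*RR)"
 have "Cr_on r (%x. H (x - l)) ?W"
 by (rule Cr_on_compose[OF H]) (use V U l in \<open>auto intro!: Cr_on_intros simp: dist_norm norm_minus_commute\<close>)
 moreover have "per H y = H (y - l)" if "y : ?W" for y
 using per_near[OF l(1), of y H] that by (auto simp: dist_norm norm_minus_commute)
 ultimately have "Cr_on r (per H) ?W" using Cr_on_cong[of ?W "per H" "%x. H (x - l)"] by simp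
 thus ?thesis using x l by (intro exI[of _ ?W]) (auto simp: dist_norm norm_minus_commute)
 next
 case False
 have "per H y = 0" if "y : ball x RR" for y
 proof (rule per_far[OF H0])
 show "y : Dm RR" unfolding Dm_def
 proof (intro CollectI ballI)
 fix l assume "l : LL"
 hence "2*RR <= norm (x - l)" using False by force
 moreover have "norm (x - l) <= norm (x - y) + norm (y - l)" using norm_triangle_ineq[of "x - y" "y - l"] by simp
 ultimately show "RR <= norm (y - l)" using that by (simp add: dist_norm)
 qed
 qed simp
 hence "Cr_on r (per H) (ball x RR)" using Cr_on_cong[of "ball x RR" "per H" "%x. 0"] by (simp add: Cr_on_const)
 thus ?thesis using RR_ge by (intro exI[of _ "ball x RR"]) auto
 qed
qed

lemma closed_LL: "closed LL"
 by (rule discrete_imp_closed[of "4*RR"])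
 (use RR_ge LL_sep[OF LL_diff] in \<open>auto simp: dist_norm\<close>)

definition Dmo :: "real => (real^2) set" where "Dmo d = {x. d < infdist x LL}"

lemma LL_attained: obtains l where "l : LL" "infdist x LL = norm (x - l)"
 using infdist_attains_inf[OF closed_LL, of x] LL_0 by (auto simp: dist_norm)

lemma infdist_LL_le: "l : LL ==> infdist x LL <= norm (x - l)"
 using infdist_le[of l LL x] by (simp add: dist_norm)

lemma Dm_iff: "x : Dm d \<longleftrightarrow> d <= infdist x LL"
proof -
 obtain l where "l : LL" "infdist x LL = norm (x - l)" by (rule LL_attained)
 thus ?thesis unfolding Dm_def using infdist_LL_le[of _ x] by force
qed

lemma Dmo_iff: "x : Dmo d \<longleftrightarrow> (ALL l:LL. d < norm (x - l))"
proof -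
 obtain l where "l : LL" "infdist x LL = norm (x - l)" by (rule LL_attained)
 thus ?thesis unfolding Dmo_def using infdist_LL_le[of _ x] by force
qed

lemma open_Dmo: "open (Dmo d)"
 unfolding Dmo_def by (intro open_Collect_less continuous_intros)

lemma closed_Dm: "closed (Dm d)"
proof -
 have "Dm d = {x. d <= infdist x LL}" by (auto simp: Dm_iff)
 thus ?thesis by (auto intro!: closed_Collect_le continuous_intros)
qed

lemma Dm_mono: "x : Dm d ==> e <= d ==> x : Dm e" and Dmo_Dm: "x : Dmo d ==> x : Dm d"
 and Dm_Dmo: "x : Dm d ==> e < d ==> x : Dmo e" and Dmo_mono: "x : Dmo d ==> e <= d ==> x : Dmo e"
 by (auto simp: Dm_iff Dmo_def)

lemma Dm_periodic:
 assumes "l : LL" shows "x + l : Dm d \<longleftrightarrow> x : Dm d"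
proof -
 have *: "x + l : Dm d" if "x : Dm d" "l : LL" for x l
 unfolding Dm_def
 proof (intro CollectI ballI)
 fix m assume "m : LL"
 hence "d <= norm (x - (m - l))" using that LL_diff by (auto simp: Dm_def)
 thus "d <= norm (x + l - m)" by (simp add: algebra_simps)
 qed
 from *[of x l] *[of "x + l" "- l"] LL_minus assms show ?thesis by auto
qed

lemma Dmo_0: "Dmo 0 = - LL"
 by (auto simp: Dmo_iff)

lemma Dm_near:
 assumes "l : LL" "d <= norm w" "norm w <= 2*RR" "d <= RR"
 shows "l + w : Dm d"
 unfolding Dm_def
proof (intro CollectI ballI)
 fix m assume m: "m : LL"
 show "d <= norm (l + w - m)"
 proof (cases "m = l")
 case False
 hence "4*RR <= norm (l - m)" using LL_sep[OF LL_diff[OF assms(1) m]] by force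
 moreover have "norm (l - m) <= norm (l + w - m) + norm w" using norm_triangle_ineq4[of "l + w - m" w] by (simp add: algebra_simps)
 ultimately show ?thesis using assms RR_ge by linarith
 qed (use assms in simp)
qed

section \<open>The two-sheeted surface in four-space\<close>

text \<open>The argument \<open>rh\<close> is a squared distance. The inner fraction turns rh ->
  1/rh into x -> 1 - x, so inversion in the unit circle exchanges \<open>aa\<close> and 1 -
  \<open>aa\<close>.\<close>

definition aa :: "real => real" where "aa rh = st (2*rh/(1 + rh) - 1/2)"

lemma aa_range: "0 <= aa rh" "aa rh <= 1" by (simp_all add: aa_def st_nonneg st_le1)

lemma aa_1: "3 <= rh ==> aa rh = 1" unfolding aa_def by (rule st_1) (simp add: field_simps)

lemma aa_inverse: "0 < rh ==> aa (1/rh) = 1 - aa rh"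
proof -
 assume "0 < rh"
 hence "2*(1/rh)/(1 + 1/rh) - 1/2 = 1 - (2*rh/(1 + rh) - 1/2)" by (simp add: field_simps)
 thus ?thesis unfolding aa_def by (simp only: st_sym)
qed

lemma aa_inj: "aa rh = aa rh' ==> 0 < aa rh ==> aa rh < 1 ==> 0 < rh ==> 0 < rh' ==> rh = rh'"
 using st_inj[of "2*rh/(1 + rh) - 1/2" "2*rh'/(1 + rh') - 1/2"] unfolding aa_def
 by (simp add: field_simps)

lemma DERIV_aa:
 assumes "0 < rh"
 obtains a' where "DERIV aa rh :> a'" "a' = 0 --> aa rh = 0 | aa rh = 1"
proof -
 let ?g = "%rh::real. 2*rh/(1 + rh) - 1/2"
 have "DERIV ?g rh :> 2/(1 + rh)^2"
 using assms by (auto intro!: derivative_eq_intros simp: power2_eq_square algebra_simps)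
 from DERIV_chain2[where f=st and g="?g", OF DERIV_st this]
 have "DERIV aa rh :> st' (?g rh)*(2/(1 + rh)^2)" by (simp add: aa_def[abs_def])
 moreover have "aa rh = 0 | aa rh = 1" if "st' (?g rh)*(2/(1 + rh)^2) = 0"
 proof -
 have "st' (?g rh) = 0" using that assms by auto
 hence "?g rh <= 0 | 1 <= ?g rh" using st'_pos[of "?g rh"] by force
 thus ?thesis unfolding aa_def using st_0 st_1 by blast
 qed
 ultimately show ?thesis using that by blast
qed

text \<open>Taken at the squared norm of w, it scales w to w itself far out and to the inverted
  vector far in. This position is invariant under inversion while the height \<open>ZZ\<close>
  changes sign, so a single formula describes the neck between the sheets.\<close>

definition Xi :: "real => real" where "Xi rh = aa rh + (1 - aa rh)/rh"

lemma Xi_inverse: "0 < rh ==> Xi (1/rh)/rh = Xi rh"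
 by (simp add: Xi_def aa_inverse field_simps)

lemma Xi_pos: "0 < rh ==> 0 < Xi rh"
 using aa_range[of rh] by (cases "aa rh = 0") (auto simp: Xi_def intro!: add_pos_nonneg)

definition Y0 :: "real^2 => real^2" where "Y0 w = (Xi (w \<bullet> w) - 1) *\<^sub>R w"
definition Z0 :: "real^2 => real" where "Z0 w = 2*aa (w \<bullet> w) - 2"
definition YY :: "real^2 => real^2" where "YY x = x + per Y0 x"
definition ZZ :: "real^2 => real" where "ZZ x = 1 + per Z0 x"

lemma inner_ge3: "2 <= norm (w::real^2) ==> 3 <= w \<bullet> w"
proof -
 assume "2 <= norm w"
 hence "2^2 <= (norm w)^2" by (rule power_mono) simp
 thus ?thesis by (simp add: power2_norm_eq_inner)
qed

lemma YZ0_zero: "2 <= norm w ==> Y0 w = 0" "2 <= norm w ==> Z0 w = 0"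
 by (simp_all add: Y0_def Z0_def Xi_def aa_1[OF inner_ge3])

lemma YZ_near:
 assumes "l : LL" "norm (x - l) < 2*RR"
 shows "YY x = l + Xi ((x - l) \<bullet> (x - l)) *\<^sub>R (x - l)" "ZZ x = 2*aa ((x - l) \<bullet> (x - l)) - 1"
 using per_near[OF assms, of Y0] per_near[OF assms, of Z0] by (simp_all add: YY_def ZZ_def Y0_def Z0_def algebra_simps)

lemma YZ_far:
 assumes "x : Dm 2"
 shows "YY x = x" "ZZ x = 1"
proof -
 have "per Y0 x = 0 & per Z0 x = 0"
 proof (cases "EX l:LL. norm (x - l) < 2*RR")
 case True
 then obtain l where l: "l : LL" "norm (x - l) < 2*RR" by blast
 thus ?thesis using per_near[OF l, of Y0] per_near[OF l, of Z0] assms YZ0_zero by (auto simp: Dm_def)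
 qed (simp add: per_def)
 thus "YY x = x" "ZZ x = 1" by (auto simp: YY_def ZZ_def)
qed

lemma near_or_far: obtains l where "l : LL" "norm (x - l) < 2" | "x : Dm 2"
 unfolding Dm_def by force

lemma ZZ_range: "\<bar>ZZ x\<bar> <= 1"
proof (cases rule: near_or_far[of x])
 case (1 l)
 thus ?thesis using YZ_near(2)[of l x] RR_ge aa_range[of "(x - l) \<bullet> (x - l)"] by (simp add: abs_le_iff)
qed (simp add: YZ_far)

lemma Cr_on_YZ: "Cr_on r YY (Dmo 0)" "Cr_on r ZZ (Dmo 0)"
proof -
 have a: "Cr_on r (%w::real^2. aa (w \<bullet> w)) (- {0})"
 unfolding aa_def by (intro Cr_on_st Cr_on_intros open_Compl closed_singleton) (auto simp: add_nonneg_eq_0_iff)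
 have Y: "Cr_on r Y0 (- {0})" unfolding Y0_def[abs_def] Xi_def
 by (intro a Cr_on_intros open_Compl closed_singleton) auto
 have Z: "Cr_on r Z0 (- {0})" unfolding Z0_def[abs_def]
 by (intro a Cr_on_intros open_Compl closed_singleton)
 have "Cr_on r (per Y0) (Dmo 0)"
 by (rule Cr_on_per[OF open_Dmo _ Y]) (use RR_ge YZ0_zero in \<open>auto simp: Dmo_0\<close>)
 moreover have "Cr_on r (per Z0) (Dmo 0)"
 by (rule Cr_on_per[OF open_Dmo _ Z]) (use RR_ge YZ0_zero in \<open>auto simp: Dmo_0\<close>)
 ultimately show "Cr_on r YY (Dmo 0)" "Cr_on r ZZ (Dmo 0)"
 unfolding YY_def[abs_def] ZZ_def[abs_def] by (auto intro!: Cr_on_intros open_Dmo)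
qed

text \<open>A thickened torus in four-space: 2 + z and \<open>th1\<close> are polar coordinates in
  the first plane, \<open>th2\<close> is the angle on the unit circle of the second. The height z in
  [-1, 1] will tell the sheets apart.\<close>

definition Pim :: "real^2 => real => real^4" where
 "Pim y z = vector [(2 + z)*cos (th1 y), (2 + z) * sin (th1 y), cos (th2 y), sin (th2 y)]"

lemma Pim_nth: "Pim y z $ 1 = (2 + z)*cos (th1 y)" "Pim y z $ 2 = (2 + z) * sin (th1 y)"
 "Pim y z $ 3 = cos (th2 y)" "Pim y z $ 4 = sin (th2 y)"
 unfolding Pim_def by (simp_all add: vector_def)

text \<open>The sheets differ by the sign of the height; on the unit circles around lattice points
  the height is 0 and they meet.\<close>

definition EE :: "real => real^2 => real^4" where "EE sg x = Pim (YY x) (sg*ZZ x)"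

lemma Pim_periodic:
 assumes "y - y' : LL"
 shows "Pim y z = Pim y' z"
proof -
 obtain i j :: int where ij: "th1 (y - y') = 2*pi*i" "th2 (y - y') = 2*pi*j" using assms by (auto simp: LL_def)
 hence "th1 y = th1 y' + 2*pi*i" "th2 y = th2 y' + 2*pi*j" by (auto simp: th_linear)
 hence "sin (th1 y) = sin (th1 y') & cos (th1 y) = cos (th1 y')" "sin (th2 y) = sin (th2 y') & cos (th2 y) = cos (th2 y')"
 using sin_cos_eq_iff by blast+
 thus ?thesis by (simp add: Pim_def)
qed

lemma Pim_eq:
 assumes "\<bar>z\<bar> <= 1" "\<bar>z'\<bar> <= 1"
 shows "Pim y z = Pim y' z' \<longleftrightarrow> z = z' & y - y' : LL"
proof
 assume "z = z' & y - y' : LL"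
 thus "Pim y z = Pim y' z'" using Pim_periodic by blast
next
 assume "Pim y z = Pim y' z'"
 hence e: "(2 + z)*cos (th1 y) = (2 + z')*cos (th1 y')" "(2 + z) * sin (th1 y) = (2 + z') * sin (th1 y')"
 "cos (th2 y) = cos (th2 y')" "sin (th2 y) = sin (th2 y')" using Pim_nth by metis+
 have "((2 + z)*cos (th1 y))^2 + ((2 + z) * sin (th1 y))^2 = ((2 + z')*cos (th1 y'))^2 + ((2 + z') * sin (th1 y'))^2"
 using e by simp
 hence "(2 + z)^2*((cos (th1 y))^2 + (sin (th1 y))^2) = (2 + z')^2*((cos (th1 y'))^2 + (sin (th1 y'))^2)"
 by (simp only: power_mult_distrib distrib_left)
 hence "(2 + z)^2 = (2 + z')^2" by simp
 hence "2 + z = 2 + z' | 2 + z = - (2 + z')" by (simp add: power2_eq_iff)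
 hence z: "z = z'" using assms by linarith
 have "2 + z ~= 0" using assms by auto
 hence "sin (th1 y) = sin (th1 y') & cos (th1 y) = cos (th1 y')" using e z by auto
 moreover have "sin (th2 y) = sin (th2 y') & cos (th2 y) = cos (th2 y')" using e by auto
 ultimately obtain i j :: int where "th1 y = th1 y' + 2*pi*i" "th2 y = th2 y' + 2*pi*j"
 unfolding sin_cos_eq_iff by blast
 hence "y - y' : LL" unfolding LL_def by (auto simp: th_linear intro!: exI[of _ i] exI[of _ j])
 thus "z = z' & y - y' : LL" using z by simp
qed

definition sgn_ok :: "real => bool" where "sgn_ok sg \<longleftrightarrow> sg = 1 | sg = - 1"

lemma sgn_ok_simps [simp]: "sgn_ok 1" "sgn_ok (- 1)" "sgn_ok (- sg) \<longleftrightarrow> sgn_ok sg"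
 by (auto simp: sgn_ok_def)

lemma EE_eq:
 assumes "sgn_ok s" "sgn_ok s'"
 shows "EE s x = EE s' x' \<longleftrightarrow> s*ZZ x = s'*ZZ x' & YY x - YY x' : LL"
 unfolding EE_def by (rule Pim_eq) (use assms ZZ_range[of x] ZZ_range[of x'] in \<open>auto simp: sgn_ok_def\<close>)

lemma EE_periodic:
 assumes "l : LL" shows "EE s (x + l) = EE s x"
proof -
 have "YY (x + l) - YY x = l" "ZZ (x + l) = ZZ x" by (auto simp: YY_def ZZ_def per_periodic[OF assms])
 thus ?thesis unfolding EE_def using Pim_periodic assms by metis
qed

definition inv2 :: "real^2 => real^2" where "inv2 w = (1/(w \<bullet> w)) *\<^sub>R w"

lemma inv2: "norm (inv2 w) = 1/norm w" "w ~= 0 ==> inv2 (inv2 w) = w" "w ~= 0 ==> inv2 w ~= 0"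
 by (auto simp: inv2_def power2_norm_eq_inner[symmetric] power2_eq_square)

text \<open>Passage through the neck: inversion keeps the position \<open>YY\<close> and reverses
  the height \<open>ZZ\<close>, so each chart continues into the other sheet.\<close>

lemma EE_flip:
 assumes l: "l : LL" and w: "w ~= 0" "norm w < 2*RR" "1/norm w < 2*RR" and s: "sgn_ok s"
 shows "EE (- s) (l + w) = EE s (l + inv2 w)"
proof -
 let ?r = "w \<bullet> w"
 have r: "0 < ?r" using w by simp
 have i: "inv2 w \<bullet> inv2 w = 1/?r" by (simp add: inv2_def)
 have 1: "YY (l + w) = l + Xi ?r *\<^sub>R w" "ZZ (l + w) = 2*aa ?r - 1"
 using YZ_near[OF l, of "l + w"] w by auto
 have 2: "YY (l + inv2 w) = l + Xi (1/?r) *\<^sub>R inv2 w" "ZZ (l + inv2 w) = 2*aa (1/?r) - 1"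
 using YZ_near[OF l, of "l + inv2 w"] w by (auto simp: inv2(1) i)
 have "Xi (1/?r) *\<^sub>R inv2 w = Xi ?r *\<^sub>R w" using Xi_inverse[OF r] by (simp add: inv2_def)
 hence yy: "YY (l + inv2 w) = YY (l + w)" using 1 2 by simp
 have zz: "ZZ (l + inv2 w) = - ZZ (l + w)" using 1 2 aa_inverse[OF r] by simp
 show ?thesis unfolding EE_def yy zz by simp
qed

text \<open>Equal heights give equal \<open>aa\<close>. If this value lies strictly between 0 and 1,
  it determines the distance from the lattice point; if it is 1, the position is the point itself,
  and if it is 0, the inverted point. The collar bound 1/RR keeps positions within 2 RR of their
  lattice points, so that positions congruent modulo the lattice coincide after translation.\<close>

lemma EE_inj:
 assumes x: "x : Dm (1/RR)" and x': "x' : Dm (1/RR)" and s: "sgn_ok s" and eq: "EE s x = EE s x'"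
 shows "x - x' : LL"
proof -
 have e: "ZZ x = ZZ x'" "YY x - YY x' : LL" using eq EE_eq[OF s s] s by (auto simp: sgn_ok_def)
 have far: "YY x = x" if "ZZ x = 1" for x
 proof (cases rule: near_or_far[of x])
 case (1 l)
 hence n: "norm (x - l) < 2*RR" using RR_ge by simp
 hence "aa ((x - l) \<bullet> (x - l)) = 1" using YZ_near(2)[OF 1(1) n] that by simp
 thus ?thesis using YZ_near(1)[OF 1(1) n] by (simp add: Xi_def)
 qed (simp add: YZ_far)
 show ?thesis
 proof (cases "ZZ x = 1")
 case True
 thus ?thesis using far[of x] far[of x'] e by simp
 next
 case False
 hence "~ x : Dm 2" "~ x' : Dm 2" using YZ_far e(1) by auto
 then obtain l m where l: "l : LL" "norm (x - l) < 2" and m: "m : LL" "norm (x' - m) < 2"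
 using near_or_far by metis
 define w where "w = x - l"
 define w' where "w' = x' - m"
 have n: "norm w < 2" "norm w' < 2" "1/RR <= norm w" "1/RR <= norm w'" using x x' l m by (auto simp: w_def w'_def Dm_def)
 have n0: "0 < norm w" "0 < norm w'" using n RR_ge by (smt (verit) divide_pos_pos)+
 define r where "r = w \<bullet> w"
 define r' where "r' = w' \<bullet> w'"
 have r: "0 < r" "0 < r'" using n0 by (auto simp: r_def r'_def)
 have YZ: "YY x = l + Xi r *\<^sub>R w" "ZZ x = 2*aa r - 1" "YY x' = m + Xi r' *\<^sub>R w'" "ZZ x' = 2*aa r' - 1"
 using YZ_near[OF l(1), of x] YZ_near[OF m(1), of x'] l m RR_ge by (auto simp: w_def w'_def r_def r'_def)
 have aar: "aa r = aa r'" "aa r < 1" using e YZ False aa_range[of r] by (auto simp: order.strict_iff_order)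
 have b: "norm (Xi (u \<bullet> u) *\<^sub>R u) < 2*RR" if "norm u < 2" "1/RR <= norm u" "0 < norm u" for u :: "real^2"
 proof -
 have "norm (Xi (u \<bullet> u) *\<^sub>R u) = Xi (u \<bullet> u)*norm u" using Xi_pos[of "u \<bullet> u"] that by simp
 also have "... = aa (u \<bullet> u)*norm u + (1 - aa (u \<bullet> u))*(1/norm u)"
 using that by (simp add: Xi_def distrib_right power2_norm_eq_inner[symmetric] power2_eq_square)
 also have "... <= 1*norm u + 1*(1/norm u)" using aa_range[of "u \<bullet> u"] by (intro add_mono mult_right_mono) auto
 also have "1/norm u <= RR" using that RR_ge by (simp add: field_simps)
 finally show ?thesis using that RR_ge by simp
 qed
 have "Xi r *\<^sub>R w - Xi r' *\<^sub>R w' = (YY x - YY x') - (l - m)" using YZ by simp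
 hence "Xi r *\<^sub>R w - Xi r' *\<^sub>R w' : LL" using LL_diff[OF e(2) LL_diff[OF l(1) m(1)]] by simp
 moreover have "norm (Xi r *\<^sub>R w - Xi r' *\<^sub>R w') < 4*RR"
 using norm_triangle_ineq4[of "Xi r *\<^sub>R w" "Xi r' *\<^sub>R w'"] b[of w] b[of w'] n n0 unfolding r_def r'_def by linarith
 ultimately have eqw: "Xi r *\<^sub>R w = Xi r' *\<^sub>R w'" using LL_sep by force
 have "r = r'"
 proof (cases "aa r = 0")
 case True
 hence "Xi r = 1/r" "Xi r' = 1/r'" using aar by (auto simp: Xi_def)
 hence "norm ((1/r) *\<^sub>R w) = norm ((1/r') *\<^sub>R w')" using eqw by simp
 hence "norm w/r = norm w'/r'" using r by simp
 hence "1/norm w = 1/norm w'" using n0 by (simp add: r_def r'_def power2_norm_eq_inner[symmetric] power2_eq_square)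
 hence "norm w = norm w'" by simp
 thus ?thesis by (simp add: r_def r'_def power2_norm_eq_inner[symmetric])
 next
 case False
 thus ?thesis using aa_inj[OF aar(1)] aar r aa_range[of r] by auto
 qed
 hence "w = w'" using eqw Xi_pos[OF r(1)] by auto
 hence "x - x' = l - m" by (simp add: w_def w'_def algebra_simps)
 thus ?thesis using LL_diff l m by simp
 qed
qed

text \<open>Opposite heights exclude that both points are at distance 2 or more from the lattice,
  where the height is extreme. A point that is nearer is moved through the neck by
  \<open>EE_flip\<close>, and injectivity on one sheet applies.\<close>

lemma EE_cross:
 assumes x: "x : Dm (1/RR)" and x': "x' : Dm (1/RR)" and s: "sgn_ok s" and eq: "EE s x = EE (- s) x'"
 shows "EX l m w. l : LL & m : LL & w ~= 0 & 1/RR <= norm w & norm w <= RR & x = l + w & x' = m + inv2 w"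
proof -
 have *: "EX l m w. l : LL & m : LL & w ~= 0 & 1/RR <= norm w & norm w <= RR & x = l + w & x' = m + inv2 w"
 if x: "x : Dm (1/RR)" and x': "x' : Dm (1/RR)" and s: "sgn_ok s" and eq: "EE s x = EE (- s) x'" and n: "x' ~: Dm 2" for s x x'
 proof -
 obtain m where m: "m : LL" "norm (x' - m) < 2" using near_or_far[of x'] n by metis
 define w' where "w' = x' - m"
 have w': "norm w' < 2" "1/RR <= norm w'" using m x' by (auto simp: w'_def Dm_def)
 have n0: "0 < norm w'" using w' RR_ge by (smt (verit) divide_pos_pos)
 have i: "1/norm w' <= RR" "1/2 <= 1/norm w'" "1/RR <= 1/norm w'" using w' n0 RR_ge by (auto simp: field_simps)
 define w where "w = inv2 w'"
 have nw: "norm w = 1/norm w'" "w ~= 0" "inv2 w = w'" using inv2 n0 by (auto simp: w_def)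
 have "EE s x = EE s (m + w)"
 using EE_flip[OF m(1), of w' s] eq s w' n0 i RR_ge by (auto simp: w'_def w_def)
 moreover have "m + w : Dm (1/RR)" by (rule Dm_near) (use m nw i RR_ge in auto)
 ultimately have "x - (m + w) : LL" using EE_inj[OF x _ s] by blast
 hence "x - w : LL" using LL_add[OF _ m(1)] by fastforce
 thus ?thesis using m nw i w' by (intro exI[of _ "x - w"] exI[of _ m] exI[of _ w]) (auto simp: w'_def)
 qed
 show ?thesis
 proof (cases "x' : Dm 2")
 case True
 have "s*ZZ x = - s*ZZ x'" using eq EE_eq[of s "- s" x x'] s by simp
 hence "ZZ x = - 1" using YZ_far[OF True] s by (auto simp: sgn_ok_def)
 hence "x ~: Dm 2" using YZ_far[of x] by auto
 then obtain l m w where h: "l : LL" "m : LL" "w ~= 0" "1/RR <= norm w" "norm w <= RR" "x' = l + w" "x = m + inv2 w"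
 using *[of x' x "- s"] x x' s eq by auto
 have "1/RR <= norm (inv2 w)" "norm (inv2 w) <= RR" using h RR_ge by (auto simp: inv2 field_simps)
 thus ?thesis using h inv2[of w] by metis
 qed (use *[OF x x' s eq] in blast)
qed

lemma EE_disjoint:
 assumes "x : Dm 1" "x' : Dmo 1" "sgn_ok s"
 shows "EE s x ~= EE (- s) x'"
proof
 have R: "1/RR <= 1" using RR_ge by simp
 assume "EE s x = EE (- s) x'"
 then obtain l m w where h: "l : LL" "m : LL" "w ~= 0" "x = l + w" "x' = m + inv2 w"
 using EE_cross[of x x' s] assms R by (metis Dm_mono Dmo_Dm)
 have 1: "1 <= norm w" using assms h by (force simp: Dm_def)
 have "1 < 1/norm w" using assms h by (force simp: Dmo_iff inv2(1)[symmetric])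
 moreover have "1/norm w <= 1" using 1 by (simp add: divide_le_eq)
 ultimately show False by linarith
qed

definition SS :: "(real^4) set" where "SS = EE 1 ` Dm 1 Un EE (- 1) ` Dm 1"

lemma SS_sgn: "sgn_ok s ==> SS = EE s ` Dm 1 Un EE (- s) ` Dm 1"
 by (auto simp: SS_def sgn_ok_def)

lemma EE_in_SS:
 assumes "x : Dm (1/RR)" "sgn_ok s"
 shows "EE s x : SS"
proof (cases "x : Dm 1")
 case True
 thus ?thesis using SS_sgn[OF assms(2)] by blast
next
 case False
 then obtain l where l: "l : LL" "norm (x - l) < 1" by (auto simp: Dm_def not_le)
 define w where "w = x - l"
 have w: "norm w < 1" "1/RR <= norm w" using l assms by (auto simp: w_def Dm_def)
 have n0: "0 < norm w" using w RR_ge by (smt (verit) divide_pos_pos)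
 have i: "1/norm w <= RR" "1 <= 1/norm w" using w n0 RR_ge by (auto simp: field_simps)
 have "EE s x = EE (- s) (l + inv2 w)"
 using EE_flip[OF l(1), of w "- s"] assms w n0 i RR_ge by (auto simp: w_def)
 moreover have "l + inv2 w : Dm 1" by (rule Dm_near) (use l i RR_ge in \<open>auto simp: inv2\<close>)
 ultimately show ?thesis using SS_sgn[OF assms(2)] by auto
qed

lemma Cr_on_EE: "Cr_on r (EE s) (Dmo 0)"
proof (rule Cr_on_components)
 fix i :: 4
 have t: "Cr_on r (%x. th1 (YY x)) (Dmo 0)" "Cr_on r (%x. th2 (YY x)) (Dmo 0)"
 unfolding th1_def th2_def by (intro Cr_on_intros Cr_on_component Cr_on_YZ open_Dmo)+
 show "Cr_on r (%x. EE s x $ i) (Dmo 0)"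
 using exhaust_4[of i] by (auto simp: EE_def Pim_nth intro!: Cr_on_intros t Cr_on_YZ open_Dmo)
qed

text \<open>On vectors orthogonal to w the derivative of \<open>YY\<close> is multiplication by
  \<open>Xi\<close> > 0. Other vectors change the height unless the derivative of \<open>aa\<close>
  vanishes, which happens only where \<open>aa\<close> is 0 or 1; there \<open>YY\<close> agrees to
  first order with inversion or with the identity.\<close>

lemma YY_ZZ_immersion:
 assumes x: "x : Dmo 0" and dY: "(YY has_derivative Y') (at x)" and dZ: "(ZZ has_derivative Z') (at x)"
 and v: "Y' v = 0" "Z' v = 0"
 shows "v = 0"
proof (cases "EX l:LL. norm (x - l) < 2*RR")
 case True
 then obtain l where l: "l : LL" "norm (x - l) < 2*RR" by blast
 define w where "w = x - l"
 define rh where "rh = w \<bullet> w"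
 have "x ~= l" using x l by (auto simp: Dmo_0)
 hence r: "0 < rh" and w0: "w ~= 0" by (auto simp: rh_def w_def)
 obtain a' where a': "DERIV aa rh :> a'" "a' = 0 --> aa rh = 0 | aa rh = 1" by (rule DERIV_aa[OF r])
 define X' where "X' = a' + (- a'*rh - (1 - aa rh))/(rh*rh)"
 have X': "DERIV Xi rh :> X'"
 unfolding Xi_def[abs_def] X'_def using r by (auto intro!: derivative_eq_intros a'(1) simp: field_simps)
 have dr: "((%y. (y - l) \<bullet> (y - l)) has_derivative (%h. 2*(w \<bullet> h))) (at x)"
 by (auto intro!: derivative_eq_intros simp: w_def inner_commute)
 have da: "((%y. aa ((y - l) \<bullet> (y - l))) has_derivative (%h. 2*(w \<bullet> h)*a')) (at x)"
 using has_derivative_compose[OF dr] a'(1) unfolding has_field_derivative_def rh_def w_def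
 by (fastforce simp: mult.commute[of a'])
 have dX: "((%y. Xi ((y - l) \<bullet> (y - l))) has_derivative (%h. 2*(w \<bullet> h)*X')) (at x)"
 using has_derivative_compose[OF dr] X' unfolding has_field_derivative_def rh_def w_def
 by (fastforce simp: mult.commute[of X'])
 have o: "open (ball l (2*RR))" "x : ball l (2*RR)" using l by (auto simp: dist_norm norm_minus_commute)
 have "((%y. 2*aa ((y - l) \<bullet> (y - l)) - 1) has_derivative (%h. 2*(2*(w \<bullet> h)*a'))) (at x)"
 by (auto intro!: derivative_eq_intros da)
 hence "(ZZ has_derivative (%h. 2*(2*(w \<bullet> h)*a'))) (at x)"
 by (rule has_derivative_transform_within_open[OF _ o])
 (use YZ_near(2)[OF l(1)] in \<open>auto simp: dist_norm norm_minus_commute\<close>)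
 hence Z': "Z' = (%h. 2*(2*(w \<bullet> h)*a'))" using dZ has_derivative_unique by blast
 have "((%y. l + Xi ((y - l) \<bullet> (y - l)) *\<^sub>R (y - l)) has_derivative (%h. Xi rh *\<^sub>R h + (2*(w \<bullet> h)*X') *\<^sub>R w)) (at x)"
 by (auto intro!: derivative_eq_intros dX simp: rh_def w_def)
 hence "(YY has_derivative (%h. Xi rh *\<^sub>R h + (2*(w \<bullet> h)*X') *\<^sub>R w)) (at x)"
 by (rule has_derivative_transform_within_open[OF _ o])
 (use YZ_near(1)[OF l(1)] in \<open>auto simp: dist_norm norm_minus_commute\<close>)
 hence Y': "Y' = (%h. Xi rh *\<^sub>R h + (2*(w \<bullet> h)*X') *\<^sub>R w)" using dY has_derivative_unique by blast
 have "w \<bullet> v = 0"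
 proof (rule ccontr)
 assume n: "w \<bullet> v ~= 0"
 hence "a' = 0" using v Z' by simp
 then consider "aa rh = 0" | "aa rh = 1" using a' by blast
 thus False
 proof cases
 case 1
 hence "Xi rh = 1/rh" "X' = - 1/(rh*rh)" using \<open>a' = 0\<close> by (auto simp: Xi_def X'_def)
 hence "(1/rh)*(w \<bullet> v) + 2*(w \<bullet> v)*(- 1/(rh*rh))*rh = w \<bullet> Y' v"
 unfolding Y' by (simp add: inner_add_right inner_diff_right rh_def)
 thus False using v n r by (simp add: field_simps)
 next
 case 2
 hence "Xi rh = 1" "X' = 0" using \<open>a' = 0\<close> by (auto simp: Xi_def X'_def)
 thus False using v Y' n by simp
 qed
 qed
 thus "v = 0" using v Y' Xi_pos[OF r] by simp
next
 case False
 have o: "open (Dmo 2)" "x : Dmo 2" using False RR_ge by (force simp: open_Dmo Dmo_iff)+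
 have "((%y. y) has_derivative (%h. h)) (at x)" by (rule has_derivative_ident)
 hence "(YY has_derivative (%h. h)) (at x)"
 by (rule has_derivative_transform_within_open[OF _ o]) (simp add: YZ_far Dmo_Dm)
 thus ?thesis using dY v has_derivative_unique by metis
qed

lemma EE_immersion:
 assumes x: "x : Dmo 0" and s: "sgn_ok s"
 shows "inj (frechet_derivative (EE s) (at x))"
proof -
 let ?D = "frechet_derivative (EE s) (at x)"
 define Y' where "Y' = frechet_derivative YY (at x)"
 define Z' where "Z' = frechet_derivative ZZ (at x)"
 have dY: "(YY has_derivative Y') (at x)" and dZ: "(ZZ has_derivative Z') (at x)" and dE: "(EE s has_derivative ?D) (at x)"
 using Cr_on_SucD(1)[OF Cr_on_YZ(1) x] Cr_on_SucD(1)[OF Cr_on_YZ(2) x] Cr_on_SucD(1)[OF Cr_on_EE x]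
 by (auto simp: Y'_def Z'_def)
 have bl: "bounded_linear th1" "bounded_linear th2"
 unfolding th1_def[abs_def] th2_def[abs_def] by (auto intro!: bounded_linear_intros simp: algebra_simps)
 have d1: "((%y. th1 (YY y)) has_derivative (%h. th1 (Y' h))) (at x)" and d2: "((%y. th2 (YY y)) has_derivative (%h. th2 (Y' h))) (at x)"
 using bounded_linear.has_derivative[OF bl(1) dY] bounded_linear.has_derivative[OF bl(2) dY] by auto
 let ?a = "th1 (YY x)" and ?b = "th2 (YY x)" and ?z = "s*ZZ x"
 have comp: "((%y. EE s y $ i) has_derivative (%h. ?D h $ i)) (at x)" for i
 by (rule bounded_linear.has_derivative[OF bounded_linear_vec_nth dE])
 have c1: "((%y. EE s y $ 1) has_derivative (%h. (2 + ?z)*(- sin ?a*th1 (Y' h)) + s*Z' h*cos ?a)) (at x)"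
 unfolding EE_def Pim_nth by (auto intro!: derivative_eq_intros d1 dZ simp: algebra_simps)
 have c2: "((%y. EE s y $ 2) has_derivative (%h. (2 + ?z)*(cos ?a*th1 (Y' h)) + s*Z' h * sin ?a)) (at x)"
 unfolding EE_def Pim_nth by (auto intro!: derivative_eq_intros d1 dZ simp: algebra_simps)
 have c3: "((%y. EE s y $ 3) has_derivative (%h. - sin ?b*th2 (Y' h))) (at x)"
 unfolding EE_def Pim_nth by (auto intro!: derivative_eq_intros d2 simp: algebra_simps)
 have c4: "((%y. EE s y $ 4) has_derivative (%h. cos ?b*th2 (Y' h))) (at x)"
 unfolding EE_def Pim_nth by (auto intro!: derivative_eq_intros d2 simp: algebra_simps)
 have D: "?D h $ 1 = (2 + ?z)*(- sin ?a*th1 (Y' h)) + s*Z' h*cos ?a"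
 "?D h $ 2 = (2 + ?z)*(cos ?a*th1 (Y' h)) + s*Z' h * sin ?a"
 "?D h $ 3 = - sin ?b*th2 (Y' h)" "?D h $ 4 = cos ?b*th2 (Y' h)" for h
 using has_derivative_unique[OF comp c1] has_derivative_unique[OF comp c2] has_derivative_unique[OF comp c3]
 has_derivative_unique[OF comp c4] by metis+
 have "v = 0" if v: "?D v = 0" for v
 proof -
 let ?t = "th1 (Y' v)" and ?u = "th2 (Y' v)" and ?q = "s*Z' v"
 have e: "(2 + ?z)*(- sin ?a*?t) + ?q*cos ?a = 0" "(2 + ?z)*(cos ?a*?t) + ?q * sin ?a = 0"
 "- sin ?b*?u = 0" "cos ?b*?u = 0" using D[of v] v by auto
 have u: "?u = 0" using e(3,4) sin_zero_abs_cos_one[of ?b] by fastforce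
 have sc: "sin ?a * sin ?a + cos ?a*cos ?a = 1" using sin_cos_squared_add[of ?a] by (simp add: power2_eq_square)
 have gen: "q*(S*S + C*C) = C*((2 + z)*(- S*t) + q*C) + S*((2 + z)*(C*t) + q*S)"
 "(2 + z)*t*(S*S + C*C) = C*((2 + z)*(C*t) + q*S) - S*((2 + z)*(- S*t) + q*C)" for q S C z t :: real
 by (simp_all add: algebra_simps)
 have q: "?q = 0" using gen(1)[of ?q "sin ?a" "cos ?a" ?z ?t] unfolding e sc by simp
 have "(2 + ?z)*?t = 0" using gen(2)[of ?z ?t "sin ?a" "cos ?a" ?q] unfolding e sc by simp
 moreover have "2 + ?z ~= 0" using ZZ_range[of x] s by (auto simp: sgn_ok_def)
 ultimately have t: "?t = 0" by simp
 have "Y' v $ 1 = 0" "Y' v $ 2 = 0" unfolding coords_th using t u by auto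
 hence "Y' v = 0" by (simp add: vec_eq_iff forall_2)
 moreover have "Z' v = 0" using q s by (auto simp: sgn_ok_def)
 ultimately show "v = 0" using YY_ZZ_immersion[OF x dY dZ] by blast
 qed
 thus ?thesis using linear_injective_0[of ?D] has_derivative_linear[OF dE] by blast
qed

definition K1 :: "(real^2) set" where "K1 = Dm 1 Int cball 0 RC"

lemma compact_K1: "compact K1"
 unfolding K1_def using closed_Dm compact_Int_closed[OF compact_cball] by (metis Int_commute)

lemma EE_continuous: "continuous_on (Dmo 0) (EE s)"
 by (rule Cr_on_continuous_on[OF Cr_on_EE])

lemma Dm_reduce:
 assumes "x : Dm d"
 obtains l where "l : LL" "x - l : Dm d" "norm (x - l) <= RC"
proof -
 obtain l where l: "l : LL" "norm (x - l) <= RC" using LL_cover by blast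
 moreover have "x - l : Dm d" using Dm_periodic[OF LL_minus[OF l(1)], of x d] assms by simp
 ultimately show ?thesis using that by blast
qed

lemma EE_Dm1: "EE s ` Dm 1 = EE s ` K1"
proof
 show "EE s ` Dm 1 <= EE s ` K1"
 proof
 fix p assume "p : EE s ` Dm 1"
 then obtain x where x: "x : Dm 1" "p = EE s x" by auto
 obtain l where l: "l : LL" "x - l : Dm 1" "norm (x - l) <= RC" by (rule Dm_reduce[OF x(1)])
 hence "x - l : K1" by (simp add: K1_def)
 moreover have "EE s (x - l) = p" using EE_periodic[OF LL_minus[OF l(1)], of s x] x by simp
 ultimately show "p : EE s ` K1" by force
 qed
qed (auto simp: K1_def)

lemma SS_K1: "sgn_ok s ==> SS = EE s ` K1 Un EE (- s) ` K1"
 using SS_sgn[of s] by (simp add: EE_Dm1)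

lemma K1_sub: "K1 <= Dmo 0" "K1 <= Dm 1"
 by (auto simp: K1_def intro: Dm_Dmo)

lemma compact_SS: "compact SS"
 unfolding SS_K1[of 1, simplified]
 by (intro compact_Un compact_continuous_image compact_K1 continuous_on_subset[OF EE_continuous K1_sub(1)])

text \<open>The point with content is that the image is open in \<open>SS\<close>: its complement is
  the union of the images of two compact sets, one per sheet. Injectivity on the disc holds because
  its diameter is below the lattice distance.\<close>

lemma surf_param_EE:
 assumes s: "sgn_ok s" and e: "0 < eps" "eps < RR" and sub: "cball x0 eps <= Dmo (1/RR)"
 shows "surf_param (EE s) (ball x0 eps) SS"
proof -
 let ?V = "ball x0 eps"
 have R: "0 < 1/RR" using RR_ge by simp
 have V: "?V <= Dmo (1/RR)" "?V <= Dmo 0" "cball x0 eps <= Dmo 0"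
 using sub R Dmo_mono[of _ "1/RR" 0] ball_subset_cball[of x0 eps] by (meson less_imp_le subset_eq)+
 have inj: "inj_on (EE s) (cball x0 eps)"
 proof (rule inj_onI)
 fix x y assume xy: "x : cball x0 eps" "y : cball x0 eps" "EE s x = EE s y"
 hence "x - y : LL" using EE_inj[OF _ _ s] sub Dmo_Dm by blast
 moreover have "norm (x - y) < 4*RR"
 using norm_triangle_ineq4[of "x - x0" "y - x0"] xy e by (simp add: dist_norm norm_minus_commute)
 ultimately show "x = y" using LL_sep by force
 qed
 obtain g where "homeomorphism (cball x0 eps) (EE s ` cball x0 eps) (EE s) g"
 using homeomorphism_compact[OF compact_cball continuous_on_subset[OF EE_continuous V(3)] refl inj] by blast
 hence h: "homeomorphism ?V (EE s ` ?V) (EE s) g"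
 by (rule homeomorphism_of_subsets) auto
 have "homeomorphism ?V (EE s ` ?V) (EE s) (inv_into ?V (EE s))"
 proof (rule homeomorphism_cong[OF h])
 fix y assume "y : EE s ` ?V"
 then obtain x where x: "x : ?V" "y = EE s x" by auto
 thus "inv_into ?V (EE s) y = g y"
 using h inj_on_subset[OF inj ball_subset_cball] by (simp add: homeomorphism_def)
 qed auto
 moreover have "EE s ` ?V <= SS" using EE_in_SS[OF _ s] V(1) Dmo_Dm by blast
 moreover have "openin (top_of_set SS) (EE s ` ?V)"
 proof -
 \<comment> \<open>Open sets that describe the image as seen from the same sheet, by translation,
   and from the opposite sheet, by inversion.\<close>
 define O1 where "O1 = (\<Union>l\<in>LL. (%x. x + l) ` ?V)"
 define O2 where "O2 = (\<Union>m\<in>LL. \<Union>l\<in>LL. {x : ball m (2*RR) - cball m (1/(2*RR)). l + inv2 (x - m) : ?V})"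
 have o1: "open O1" unfolding O1_def by (intro open_UN ballI open_translation_subtract) (simp add: open_translation add.commute)
 have o2: "open O2" unfolding O2_def
 proof (intro open_UN ballI)
 fix m l :: "real^2"
 have "continuous_on (ball m (2*RR) - cball m (1/(2*RR))) (%x. l + inv2 (x - m))"
 unfolding inv2_def using RR_ge by (intro continuous_intros) auto
 from continuous_open_preimage[OF this _ open_ball, of x0 eps]
 show "open {x : ball m (2*RR) - cball m (1/(2*RR)). l + inv2 (x - m) : ?V}"
 by (simp add: open_Diff vimage_def Int_def)
 qed
 have i1: "EE s x : EE s ` ?V \<longleftrightarrow> x : O1" if x: "x : K1" for x
 proof
 assume "EE s x : EE s ` ?V"
 then obtain v where v: "v : ?V" "EE s x = EE s v" by auto
 have "x - v : LL"
 by (rule EE_inj[OF _ _ s v(2)]) (use x V v RR_ge in \<open>auto simp: K1_def intro: Dm_mono Dmo_Dm\<close>)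
 thus "x : O1" using v unfolding O1_def by (force intro: bexI[of _ "x - v"])
 next
 assume "x : O1"
 then obtain l v where "l : LL" "v : ?V" "x = v + l" unfolding O1_def by auto
 thus "EE s x : EE s ` ?V" using EE_periodic by auto
 qed
 have i2: "EE (- s) x : EE s ` ?V \<longleftrightarrow> x : O2" if x: "x : K1" for x
 proof
 assume "EE (- s) x : EE s ` ?V"
 then obtain v where v: "v : ?V" "EE s v = EE (- s) x" by auto
 have xv: "v : Dm (1/RR)" "x : Dm (1/RR)" using v V(1) x Dmo_Dm Dm_mono[of x 1 "1/RR"] RR_ge by (auto simp: K1_def)
 obtain l m w where h: "l : LL" "m : LL" "w ~= 0" "1/RR <= norm w" "norm w <= RR" "v = l + w" "x = m + inv2 w"
 using EE_cross[OF xv s v(2)] by blast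
 have n: "norm (x - m) = 1/norm w" "0 < norm w" using h by (auto simp: inv2)
 have "1/norm w < 2*RR" "1/(2*RR) < 1/norm w"
 using h n RR_ge by (auto simp: field_simps) (smt (verit) mult_nonneg_nonneg norm_ge_zero)?
 hence "x : ball m (2*RR) - cball m (1/(2*RR))" using n by (simp add: dist_norm norm_minus_commute)
 moreover have "l + inv2 (x - m) : ?V" using h v by (simp add: inv2)
 ultimately show "x : O2" unfolding O2_def using h(1,2) by blast
 next
 assume "x : O2"
 then obtain m l where h: "m : LL" "l : LL" "norm (x - m) < 2*RR" "1/(2*RR) < norm (x - m)" "l + inv2 (x - m) : ?V"
 unfolding O2_def by (auto simp: dist_norm norm_minus_commute)
 have n: "0 < norm (x - m)" using h RR_ge by (smt (verit) divide_pos_pos)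
 have "1/norm (x - m) < 2*RR" using h n RR_ge by (simp add: field_simps)
 hence "EE (- s) (m + (x - m)) = EE s (m + inv2 (x - m))"
 using n by (intro EE_flip[OF h(1) _ h(3) _ s]) auto
 also have "... = EE s (l + inv2 (x - m))"
 using EE_periodic[OF LL_diff[OF h(2,1)], of s "m + inv2 (x - m)"] by (simp add: algebra_simps)
 finally show "EE (- s) x : EE s ` ?V" using h(5) by simp
 qed
 have "SS - EE s ` ?V = EE s ` (K1 - O1) Un EE (- s) ` (K1 - O2)"
 proof -
 have "EE s ` K1 - EE s ` ?V = EE s ` (K1 - O1)" using i1 by auto
 moreover have "EE (- s) ` K1 - EE s ` ?V = EE (- s) ` (K1 - O2)" using i2 by auto
 ultimately show ?thesis unfolding SS_K1[OF s] Un_Diff by simp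
 qed
 moreover have "compact (EE s ` (K1 - O1) Un EE (- s) ` (K1 - O2))"
 using K1_sub(1) by (intro compact_Un compact_continuous_image compact_diff compact_K1 o1 o2 continuous_on_subset[OF EE_continuous]) auto
 ultimately have "closed (SS - EE s ` ?V)" by (simp add: compact_imp_closed)
 moreover have "EE s ` ?V = SS Int - (SS - EE s ` ?V)" using \<open>EE s ` ?V <= SS\<close> by blast
 ultimately show ?thesis by (metis open_Compl openin_open)
 qed
 ultimately show ?thesis unfolding surf_param_def
 using EE_immersion[OF _ s] V(2) Cr_on_subset[OF Cr_on_EE open_ball V(2)] by auto
qed

lemma surf_param_EE_at:
 assumes "sgn_ok s" "x : Dmo (1/RR)" "open W" "x : W"
 obtains eps where "0 < eps" "eps < 1" "cball x eps <= W" "surf_param (EE s) (ball x eps) SS"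
proof -
 have "open (Dmo (1/RR) Int W)" "x : Dmo (1/RR) Int W" using assms open_Dmo by auto
 then obtain eps where e: "0 < eps" "cball x eps <= Dmo (1/RR) Int W" by (meson open_contains_cball)
 define d where "d = min eps (1/2)"
 have "cball x d <= cball x eps" by (auto simp: d_def)
 thus ?thesis
 using e surf_param_EE[OF assms(1), of d x] RR_ge by (intro that[of d]) (auto simp: d_def)
qed

lemma countable_LL: "countable LL"
proof -
 define F :: "int \<times> int => real^2" where "F = (%(i, j). vector [(2*pi*i - mu*(2*pi*j))/(om*(mu - lam)), (2*pi*i - lam*(2*pi*j))/(om*(mu - lam))])"
 have "LL <= range F"
 proof
 fix l assume "l : LL"
 then obtain i j :: int where "th1 l = 2*pi*i" "th2 l = 2*pi*j" by (auto simp: LL_def)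
 hence "l = F (i, j)" unfolding F_def by (simp add: vec_eq_iff forall_2 coords_th[of l])
 thus "l : range F" by blast
 qed
 thus ?thesis by (rule countable_subset) simp
qed

text \<open>Pushing points radially out of the holes retracts the complement of the lattice onto
  \<open>Dm 1\<close>, and the plane without a countable set is connected.\<close>

lemma connected_Dm1: "connected (Dm 1)"
proof -
 define R0 :: "real^2 => real^2" where "R0 w = max 0 (1/norm w - 1) *\<^sub>R w" for w
 define ret where "ret x = x + per R0 x" for x
 have R0: "R0 w = 0" if "1 <= norm w" for w
 proof -
 have "1/norm w - 1 <= 0" using that by (simp add: divide_le_eq)
 thus ?thesis by (simp add: R0_def max_def)
 qed
 have c0: "Cr_on 0 R0 (- {0})" unfolding Cr_on_0 R0_def[abs_def] by (auto intro!: continuous_intros)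
 have "Cr_on 0 (per R0) (Dmo 0)"
 by (rule Cr_on_per[OF open_Dmo _ c0]) (use RR_ge R0 in \<open>auto simp: Dmo_0\<close>)
 hence c: "continuous_on (Dmo 0) ret" unfolding ret_def[abs_def] by (auto simp: Cr_on_0 intro!: continuous_intros)
 have near: "ret x = l + (x - l) + R0 (x - l)" if "l : LL" "norm (x - l) < 1" for x l
 using per_near[OF that(1), of x R0] that RR_ge by (simp add: ret_def)
 have far: "ret x = x" if "x : Dm 1" for x
 proof (cases "EX l:LL. norm (x - l) < 2*RR")
 case True
 then obtain l where l: "l : LL" "norm (x - l) < 2*RR" by blast
 thus ?thesis using per_near[OF l, of R0] that R0 by (auto simp: Dm_def ret_def)
 qed (simp add: per_def ret_def)
 have "ret x : Dm 1" if x: "x : Dmo 0" for x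
 proof (cases "x : Dm 1")
 case False
 then obtain l where l: "l : LL" "norm (x - l) < 1" by (auto simp: Dm_def not_le)
 let ?w = "x - l"
 have n: "0 < norm ?w" using x l by (auto simp: Dmo_0)
 have "ret x = l + (1 + max 0 (1/norm ?w - 1)) *\<^sub>R ?w" unfolding near[OF l] R0_def by (simp add: algebra_simps)
 also have "1 + max 0 (1/norm ?w - 1) = 1/norm ?w" using l n by (simp add: max_def field_simps)
 finally have r: "ret x = l + (1/norm ?w) *\<^sub>R ?w" .
 have "norm ((1/norm ?w) *\<^sub>R ?w) = 1" using n by simp
 thus ?thesis unfolding r using RR_ge by (intro Dm_near[OF l(1)]) auto
 qed (simp add: far)
 moreover have "Dm 1 <= ret ` Dmo 0"
 proof
 fix x assume "x : Dm 1"
 hence "x = ret x" "x : Dmo 0" using far Dm_Dmo[of x 1 0] by auto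
 thus "x : ret ` Dmo 0" by (rule image_eqI)
 qed
 ultimately have "Dm 1 = ret ` Dmo 0" by blast
 moreover have "connected (Dmo 0)" unfolding Dmo_0
 using path_connected_complement_countable[OF _ countable_LL] by (intro path_connected_imp_connected) simp
 ultimately show ?thesis using connected_continuous_image[OF c] by simp
qed

lemma compact_surface_SS: "compact_surface SS"
 unfolding compact_surface_def
proof (intro conjI compact_SS ballI)
 have c: "connected (EE s ` Dm 1)" for s
 by (intro connected_continuous_image connected_Dm1 continuous_on_subset[OF EE_continuous]) (auto intro: Dm_Dmo)
 \<comment> \<open>A point of the unit circle is fixed by inversion and hence lies on both
   sheets.\<close>
 let ?w = "axis 1 1 :: real^2"
 have w: "0 + ?w : Dm 1" using RR_ge by (intro Dm_near LL_0) auto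
 have "inv2 ?w = ?w" by (simp add: inv2_def inner_axis_axis)
 hence "EE (- 1) (0 + ?w) = EE 1 (0 + ?w)"
 using EE_flip[OF LL_0, of ?w 1] RR_ge by (simp add: axis_eq_0_iff)
 hence ne: "EE 1 ` Dm 1 Int EE (- 1) ` Dm 1 ~= {}" using w by blast
 show "connected SS" unfolding SS_def by (rule connected_Un[OF c c ne])
 show "SS ~= {}" using ne by (auto simp: SS_def)
 fix p assume "p : SS"
 then obtain s x where sx: "sgn_ok s" "x : Dm 1" "p = EE s x" by (auto simp: SS_def sgn_ok_def)
 have "x : Dmo (1/RR)" using sx RR_ge by (intro Dm_Dmo[of x 1]) auto
 from surf_param_EE_at[OF sx(1) this open_UNIV UNIV_I]
 obtain eps where "0 < eps" "surf_param (EE s) (ball x eps) SS" by blast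
 thus "EX fi V. surf_param fi V SS & p : fi ` V" using sx by (intro exI[of _ "EE s"] exI[of _ "ball x eps"]) auto
qed

section \<open>The bump that creates a repeller\<close>

definition Gam :: "real => real" where "Gam x = x + (3 - x) * st (x - 2) - (3 + x) * st (- x - 2)"
definition Gam' :: "real => real" where
 "Gam' x = 1 - st (x - 2) + (3 - x) * st' (x - 2) - st (- x - 2) + (3 + x) * st' (- x - 2)"
definition ck :: "real => real" where "ck x = st (2 - x^2/NN^2)"
definition ck' :: "real => real" where "ck' x = - (2*x/NN^2) * st' (2 - x^2/NN^2)"
definition kk :: "real => real" where "kk y = st ((9 - y^2)/5)"
definition kk' :: "real => real" where "kk' y = - (2*y/5) * st' ((9 - y^2)/5)"

lemma Cr_on_Gam: "Cr_on r f U ==> Cr_on r (%x. Gam (f x)) U"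
 and Cr_on_ck: "Cr_on r f U ==> Cr_on r (%x. ck (f x)) U"
 and Cr_on_kk: "Cr_on r f U ==> Cr_on r (%x. kk (f x)) U"
 unfolding Gam_def ck_def kk_def using NN_ge
 by (intro Cr_on_st Cr_on_intros Cr_on_open; simp)+

lemma DERIV_st_comp: "(g has_real_derivative d) (at x) ==> ((%x. st (g x)) has_real_derivative (st' (g x)*d)) (at x)"
 using DERIV_chain2[OF DERIV_st] by blast

lemma DERIV_Gam: "DERIV Gam x :> Gam' x"
 unfolding Gam_def[abs_def] Gam'_def by (auto intro!: derivative_eq_intros DERIV_st_comp simp: algebra_simps)

lemma DERIV_ck: "DERIV ck x :> ck' x"
proof -
 have "DERIV (%x. 2 - x^2*c) x :> - (2*x*c)" for c
 by (auto intro!: derivative_eq_intros)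
 from DERIV_st_comp[OF this[of "1/NN^2"]] show ?thesis by (simp add: ck_def[abs_def] ck'_def mult.commute)
qed

lemma DERIV_kk: "DERIV kk x :> kk' x"
proof -
 have "DERIV (%x. (9 - x^2)/5) x :> - (2*x/5)"
 by (auto intro!: derivative_eq_intros)
 from DERIV_st_comp[OF this] show ?thesis by (simp add: kk_def[abs_def] kk'_def mult.commute)
qed

lemma Gam_linear: "\<bar>x\<bar> <= 2 ==> Gam x = x"
 by (simp add: Gam_def st_0)

lemma Gam'_nonneg: "0 <= Gam' x"
proof -
 consider "x <= - 2" | "- 2 <= x" "x <= 2" | "2 <= x" by linarith
 thus ?thesis
 proof cases
 case 1
 have "0 <= (3 + x) * st' (- x - 2)"
 using st'_zero[of "- x - 2"] st'_nonneg[of "- x - 2"] by (cases "x <= - 3") auto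
 thus ?thesis using 1 st_le1[of "- x - 2"] by (simp add: Gam'_def st_0 st'_zero)
 next
 case 3
 have "0 <= (3 - x) * st' (x - 2)"
 using st'_zero[of "x - 2"] st'_nonneg[of "x - 2"] by (cases "3 <= x") auto
 thus ?thesis using 3 st_le1[of "x - 2"] by (simp add: Gam'_def st_0 st'_zero)
 qed (simp add: Gam'_def st_0 st'_zero)
qed

lemma Gam'_zero: "3 <= \<bar>x\<bar> ==> Gam' x = 0"
 using st'_zero[of "x - 2"] st'_zero[of "- x - 2"]
 by (cases "3 <= x"; cases "x <= - 3") (auto simp: Gam'_def st_0 st_1)

lemma Gam_bounds: "\<bar>Gam x\<bar> <= 3" "0 <= x*Gam x"
proof -
 consider "x <= - 2" | "- 2 <= x" "x <= 2" | "2 <= x" by linarith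
 hence "\<bar>Gam x\<bar> <= 3 & 0 <= x*Gam x"
 proof cases
 case 1
 define s where "s = st (- x - 2)"
 have s: "0 <= s" "s <= 1" by (auto simp: s_def st_nonneg st_le1)
 have G: "Gam x = x*(1 - s) - 3 * s" using 1 by (simp add: Gam_def st_0 s_def algebra_simps)
 have "s = 1 | - 3 <= x" unfolding s_def using st_1[of "- x - 2"] by linarith
 hence "- 3*(1 - s) <= x*(1 - s)" using s mult_right_mono[of "-3" x "1 - s"] by auto
 hence "- 3 <= Gam x" unfolding G by simp
 moreover have "x*(1 - s) <= 0" using 1 s by (simp add: mult_nonpos_nonneg)
 hence "Gam x <= 0" unfolding G using s by simp
 ultimately show ?thesis using 1 by (auto intro: mult_nonpos_nonpos)
 next
 case 3
 define s where "s = st (x - 2)"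
 have s: "0 <= s" "s <= 1" by (auto simp: s_def st_nonneg st_le1)
 have G: "Gam x = x*(1 - s) + 3 * s" using 3 by (simp add: Gam_def st_0 s_def algebra_simps)
 have "s = 1 | x <= 3" unfolding s_def using st_1[of "x - 2"] by linarith
 hence "x*(1 - s) <= 3*(1 - s)" using s mult_right_mono[of x 3 "1 - s"] by auto
 hence "Gam x <= 3" unfolding G by simp
 moreover have "0 <= x*(1 - s)" using 3 s by simp
 hence "0 <= Gam x" unfolding G using s by simp
 ultimately show ?thesis using 3 by auto
 qed (auto simp: Gam_linear)
 thus "\<bar>Gam x\<bar> <= 3" "0 <= x*Gam x" by auto
qed

lemma ck_1: "\<bar>x\<bar> <= NN ==> ck x = 1" and ck_0: "2*NN <= \<bar>x\<bar> ==> ck x = 0"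
proof -
 have N: "0 < NN" using NN_ge by simp
 show "\<bar>x\<bar> <= NN ==> ck x = 1"
 proof -
 assume "\<bar>x\<bar> <= NN"
 hence "x^2 <= NN^2" using power_mono[of "\<bar>x\<bar>" NN 2] by simp
 thus ?thesis unfolding ck_def using N by (intro st_1) (simp add: field_simps)
 qed
 show "2*NN <= \<bar>x\<bar> ==> ck x = 0"
 proof -
 assume "2*NN <= \<bar>x\<bar>"
 hence "(2*NN)^2 <= x^2" using power_mono[of "2*NN" "\<bar>x\<bar>" 2] N by simp
 hence "4*NN^2 <= x^2" by (simp add: power_mult_distrib)
 hence "2*NN^2 <= x^2" using zero_le_power2[of NN] by linarith
 thus ?thesis unfolding ck_def using N by (intro st_0) (simp add: field_simps)
 qed
qed

lemma kk_1: "\<bar>y\<bar> <= 2 ==> kk y = 1" and kk_0: "3 <= \<bar>y\<bar> ==> kk y = 0" and kk_range: "0 <= kk y" "kk y <= 1"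
proof -
 show "\<bar>y\<bar> <= 2 ==> kk y = 1" unfolding kk_def using power_mono[of "\<bar>y\<bar>" 2 2] by (intro st_1) simp
 show "3 <= \<bar>y\<bar> ==> kk y = 0" unfolding kk_def using power_mono[of 3 "\<bar>y\<bar>" 2] by (intro st_0) simp
qed (auto simp: kk_def st_nonneg st_le1)

text \<open>The cut-off \<open>ck\<close> falls away from 0, where \<open>Gam\<close> has the sign
  of x, so the product is nonpositive; and \<open>ck\<close> falls over a length of order
  \<open>NN\<close>, so its slope is of order stC/NN.\<close>

lemma Gam_ck': "Gam x*ck' x <= 0" "- (12 * stC/NN) <= Gam x*ck' x"
proof -
 have N: "0 < NN" using NN_ge by simp
 let ?s = "st' (2 - x^2/NN^2)"
 have "0 <= (2/NN^2)*?s" using st'_nonneg by simp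
 from mult_nonneg_nonneg[OF Gam_bounds(2) this] have "0 <= (x*Gam x)*((2/NN^2)*?s)" .
 thus "Gam x*ck' x <= 0" unfolding ck'_def by (simp add: algebra_simps)
 have "\<bar>Gam x*ck' x\<bar> <= 12 * stC/NN"
 proof (cases "\<bar>x\<bar> <= 2*NN")
 case True
 have "\<bar>ck' x\<bar> = (2*\<bar>x\<bar>/NN^2)*?s" unfolding ck'_def using st'_nonneg by (simp add: abs_mult)
 also have "... <= (2*(2*NN)/NN^2) * stC" using True stC st'_nonneg by (intro mult_mono divide_right_mono) auto
 finally have "\<bar>ck' x\<bar> <= 4 * stC/NN" using N by (simp add: power2_eq_square)
 hence "\<bar>Gam x\<bar>*\<bar>ck' x\<bar> <= 3*(4 * stC/NN)" using Gam_bounds(1)[of x] by (intro mult_mono) auto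
 thus ?thesis by (simp add: abs_mult)
 next
 case False
 hence "(2*NN)^2 <= x^2" using power_mono[of "2*NN" "\<bar>x\<bar>" 2] N by simp
 hence "4*NN^2 <= x^2" by (simp add: power_mult_distrib)
 hence "2*NN^2 <= x^2" using zero_le_power2[of NN] by linarith
 hence "?s = 0" using N by (intro st'_zero) (simp add: field_simps)
 thus ?thesis using stC N by (simp add: ck'_def)
 qed
 thus "- (12 * stC/NN) <= Gam x*ck' x" by linarith
qed

text \<open>Near the lattice point it equals (mu - lam) x and so turns the contraction rate
  \<open>lam\<close> into \<open>mu\<close>. Beyond 3 the ramp \<open>Gam\<close> is constant, and
  only the slow cut-off \<open>ck\<close> acts on the rate, with the sign that strengthens
  contraction.\<close>

definition hb :: "real => real => real" where "hb x y = (mu - lam)*(Gam x*ck x)*kk y"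
definition hb1 :: "real => real => real" where "hb1 x y = (mu - lam)*(Gam' x*ck x + Gam x*ck' x)*kk y"

text \<open>As lam = 1/mu, the size 1000 stC mu^2 in \<open>NN\<close> makes (mu - lam) 12 stC/NN at
  most lam/2. The rate lam + \<open>hb1\<close> along lines then stays positive, on which
  monotonicity and bijectivity rest.\<close>

lemma hb1_lower: "- (lam/2) <= hb1 x y"
proof -
 have N: "0 < NN" using NN_ge by simp
 have "(mu - lam)*(12 * stC/NN) <= lam/2"
 proof -
 have "(mu - lam)*12 * stC*mu*2 <= mu*12 * stC*mu*2"
 using mu_bounds lam_bounds stC by (intro mult_right_mono) auto
 also have "... <= NN" using stC mu_bounds by (simp add: NN_def power2_eq_square)
 finally have "lam*((mu - lam)*12 * stC*mu*2) <= lam*NN" using lam_bounds by (intro mult_left_mono) auto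
 hence "(lam*mu)*((mu - lam)*12 * stC*2) <= lam*NN" by (simp add: algebra_simps)
 hence "(mu - lam)*12 * stC*2 <= lam*NN" unfolding mu_lam by simp
 thus ?thesis using N by (simp add: field_simps)
 qed
 moreover have "- (12 * stC/NN) <= Gam' x*ck x + Gam x*ck' x"
 using Gam_ck'(2)[of x] mult_nonneg_nonneg[OF Gam'_nonneg, of "ck x" x] st_nonneg by (simp add: ck_def add_increasing)
 ultimately have b: "- (lam/2) <= (mu - lam)*(Gam' x*ck x + Gam x*ck' x)"
 using mult_left_mono[of "- (12 * stC/NN)" "Gam' x*ck x + Gam x*ck' x" "mu - lam"] mu_bounds lam_bounds by simp
 have "- (lam/2) <= - (lam/2)*kk y" using kk_range[of y] lam_bounds by simp
 also have "... <= hb1 x y" unfolding hb1_def using b kk_range[of y] by (intro mult_right_mono) auto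
 finally show ?thesis .
qed

lemma hb1_upper: "3 <= \<bar>x\<bar> | 3 <= \<bar>y\<bar> ==> hb1 x y <= 0"
proof (cases "3 <= \<bar>y\<bar>")
 case False
 assume "3 <= \<bar>x\<bar> | 3 <= \<bar>y\<bar>"
 hence "Gam' x = 0" using False Gam'_zero by auto
 thus ?thesis unfolding hb1_def using Gam_ck'(1)[of x] kk_range[of y] mu_bounds lam_bounds
 by (simp add: mult_nonneg_nonpos mult_nonpos_nonneg)
qed (simp add: hb1_def kk_0)

lemma hb_linear: "\<bar>x\<bar> <= 2 ==> \<bar>y\<bar> <= 2 ==> hb x y = (mu - lam)*x"
 using NN_ge by (simp add: hb_def Gam_linear ck_1 kk_1)

lemma hb_bound: "\<bar>hb x y\<bar> <= 60"
proof -
 have "\<bar>Gam x*ck x*kk y\<bar> <= 3*1*1" unfolding abs_mult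
 using Gam_bounds(1)[of x] kk_range[of y] st_nonneg st_le1 by (intro mult_mono) (auto simp: ck_def)
 hence "(mu - lam)*\<bar>Gam x*ck x*kk y\<bar> <= 20*3" using mu_bounds lam_bounds by (intro mult_mono) auto
 thus ?thesis using mu_bounds lam_bounds by (simp add: hb_def abs_mult mult.assoc)
qed

section \<open>The derived-from-Anosov map of the plane\<close>

definition other :: "2 => 2" where "other i = (if i = 1 then 2 else 1)"

lemma other: "other 1 = 2" "other 2 = 1" "other i ~= i" "j ~= i \<longleftrightarrow> j = other i" "other (other i) = i"
 using exhaust_2[of i] exhaust_2[of j] by (auto simp: other_def)

lemma vec_eq_other: "x = y \<longleftrightarrow> x $ i = y $ i & x $ other i = (y :: 'a^2) $ other i"
 using exhaust_2[of i] by (auto simp: vec_eq_iff forall_2 other_def)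

definition hbi :: "2 => real^2 => real" where "hbi i w = hb (w $ i) (w $ other i)"

lemma norm2_le: "norm (w::real^2) <= \<bar>w $ i\<bar> + \<bar>w $ other i\<bar>"
 using norm_le_l1_cart[of w] exhaust_2[of i] by (auto simp: sum_2 other_def)

lemma hbi_zero: "RR <= norm w ==> hbi i w = 0"
proof -
 assume "RR <= norm w"
 hence "10*NN <= \<bar>w $ i\<bar> + \<bar>w $ other i\<bar>" using norm2_le[of w i] by (simp add: RR_def)
 hence "2*NN <= \<bar>w $ i\<bar> | 3 <= \<bar>w $ other i\<bar>" using NN_ge by linarith
 thus ?thesis using ck_0 kk_0 by (auto simp: hbi_def hb_def)
qed

lemma Cr_on_hbi: "Cr_on r (hbi i) UNIV"
 unfolding hbi_def[abs_def] hb_def by (intro Cr_on_intros Cr_on_Gam Cr_on_ck Cr_on_kk open_UNIV)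

definition Lat :: "2 => real^2 => real^2" where "Lat i x = (\<chi> j. if j = i then lam*x $ j else mu*x $ j)"

lemma Lat_eq: "Lat 1 = Lm" "Lat 2 = Li"
 by (auto simp: Lat_def Lm_def Li_def vec_eq_iff forall_2)

lemma Lat_LL: "l : LL ==> Lat i l : LL"
 using exhaust_2[of i] Lm_LL Li_LL by (auto simp: Lat_eq)

lemma Lat_inverse: "Lat i (Lat (other i) x) = x"
 using exhaust_2[of i] Lm_Li by (auto simp: Lat_eq other)

lemma Lat_diff: "Lat i (x - y) = Lat i x - Lat i y" and Lat_add: "Lat i (x + y) = Lat i x + Lat i y"
 by (simp_all add: Lat_def vec_eq_iff algebra_simps)

text \<open>Only the contracted coordinate i is altered, so lines in direction i go to lines and the
  other coordinate is multiplied by \<open>mu\<close>. The upper sheet uses \<open>ff 1\<close>, the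
  lower sheet the inverse of \<open>ff 2\<close>; the index lets one proof serve both.\<close>

definition ff :: "2 => real^2 => real^2" where "ff i x = Lat i x + per (hbi i) x *\<^sub>R axis i 1"

lemma ff_nth: "ff i x $ i = lam*x $ i + per (hbi i) x" "ff i x $ other i = mu*x $ other i"
 using other(3)[of i] by (simp_all add: ff_def Lat_def axis_def)

lemma Cr_on_ff: "Cr_on r (ff i) UNIV"
proof -
 have "Cr_on r (per (hbi i)) UNIV"
 by (rule Cr_on_per[OF open_UNIV hbi_zero Cr_on_hbi]) auto
 moreover have "Cr_on r (Lat i) UNIV"
 proof (rule Cr_on_components)
 show "Cr_on r (%x. Lat i x $ j) UNIV" for j
 by (cases "j = i") (auto simp: Lat_def intro!: Cr_on_intros)
 qed
 ultimately show ?thesis unfolding ff_def[abs_def] by (intro Cr_on_intros open_UNIV)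
qed

lemma ff_periodic: "l : LL ==> ff i (x + l) = ff i x + Lat i l"
 by (simp add: ff_def per_periodic Lat_add)

lemma ff_linear:
 assumes "l : LL" "\<bar>(x - l) $ 1\<bar> <= 2" "\<bar>(x - l) $ 2\<bar> <= 2"
 shows "ff i x = Lat i l + mu *\<^sub>R (x - l)"
proof -
 have a: "\<bar>(x - l) $ j\<bar> <= 2" for j using assms exhaust_2[of j] by auto
 have "norm (x - l) <= 4" using norm2_le[of "x - l" i] a[of i] a[of "other i"] by linarith
 hence "per (hbi i) x = (mu - lam)*(x - l) $ i"
 using per_near[OF assms(1), of x "hbi i"] RR_ge hb_linear[OF a a] by (simp add: hbi_def)
 hence "ff i x $ i = (Lat i l + mu *\<^sub>R (x - l)) $ i" "ff i x $ other i = (Lat i l + mu *\<^sub>R (x - l)) $ other i"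
 unfolding ff_nth using other(3)[of i] by (auto simp: Lat_def algebra_simps)
 thus ?thesis using vec_eq_other by blast
qed

definition Bx :: "real => (real^2) set" where
 "Bx v = {x. EX l:LL. \<bar>(x - l) $ 1\<bar> < v & \<bar>(x - l) $ 2\<bar> < v}"

lemma ff_deriv:
 obtains s h where "(ff i has_derivative (%v. \<chi> j. if j = i then s * v $ i + h * v $ other i else mu * v $ j)) (at x)"
 "lam/2 <= s" "x ~: Bx 3 --> s <= lam"
proof -
 let ?D = "%s h. (%v. \<chi> j. if j = i then s * v $ i + h * v $ other i else mu * v $ j)"
 have main: "(ff i has_derivative ?D (lam + s) h) (at x)"
 if "(per (hbi i) has_derivative (%v. s * v $ i + h * v $ other i)) (at x)" for s h
 proof -
 have bl: "bounded_linear (Lat i)"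
 proof -
 have "linear (Lat i)" by (rule linearI) (auto simp: Lat_def vec_eq_iff algebra_simps)
 thus ?thesis by (simp add: linear_conv_bounded_linear)
 qed
 have "(ff i has_derivative (%v. Lat i v + (s * v $ i + h * v $ other i) *\<^sub>R axis i 1)) (at x)"
 unfolding ff_def[abs_def] using that
 by (intro has_derivative_add bounded_linear_imp_has_derivative[OF bl] has_derivative_scaleR_left)
 moreover have "(%v. Lat i v + (s * v $ i + h * v $ other i) *\<^sub>R axis i 1) = ?D (lam + s) h"
 by (auto simp: fun_eq_iff vec_eq_iff Lat_def axis_def algebra_simps)
 ultimately show ?thesis by simp
 qed
 show ?thesis
 proof (cases "EX l:LL. norm (x - l) < 2*RR")
 case True
 then obtain l where l: "l : LL" "norm (x - l) < 2*RR" by blast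
 have o: "open (ball l (2*RR))" "x : ball l (2*RR)" using l by (auto simp: dist_norm norm_minus_commute)
 let ?a = "(x - l) $ i" and ?b = "(x - l) $ other i"
 define h where "h = (mu - lam)*(Gam ?a*ck ?a)*kk' ?b"
 have "((%y. y - l) has_derivative (%v. v)) (at x)" by (auto intro!: derivative_eq_intros)
 hence n: "((%y. (y - l) $ j) has_derivative (%v. v $ j)) (at x)" for j
 by (rule bounded_linear.has_derivative[OF bounded_linear_vec_nth])
 have c: "((%y. F ((y - l) $ j)) has_derivative (%v. F' * v $ j)) (at x)"
 if "DERIV F ((x - l) $ j) :> F'" for F F' j
 using has_derivative_compose[OF n that[unfolded has_field_derivative_def]] by simp
 have "((%y. (mu - lam)*(Gam ((y - l) $ i)*ck ((y - l) $ i))*kk ((y - l) $ other i)) has_derivative (%v. hb1 ?a ?b * v $ i + h * v $ other i)) (at x)"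
 using has_derivative_mult[OF has_derivative_mult_right[OF has_derivative_mult[OF c[OF DERIV_Gam, of i] c[OF DERIV_ck, of i]], of "mu - lam"] c[OF DERIV_kk, of "other i"]]
 by (rule has_derivative_eq_rhs) (simp add: hb1_def h_def fun_eq_iff algebra_simps)
 hence "(per (hbi i) has_derivative (%v. hb1 ?a ?b * v $ i + h * v $ other i)) (at x)"
 by (rule has_derivative_transform_within_open[OF _ o])
 (use per_near[OF l(1), of _ "hbi i"] in \<open>auto simp: hbi_def hb_def dist_norm norm_minus_commute\<close>)
 from main[OF this] have "(ff i has_derivative ?D (lam + hb1 ?a ?b) h) (at x)" .
 moreover have "lam + hb1 ?a ?b <= lam" if "x ~: Bx 3"
 proof -
 have "~ (\<bar>(x - l) $ 1\<bar> < 3 & \<bar>(x - l) $ 2\<bar> < 3)" using that l(1) unfolding Bx_def by blast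
 hence "3 <= \<bar>?a\<bar> | 3 <= \<bar>?b\<bar>" using exhaust_2[of i] by (auto simp: other_def)
 from hb1_upper[OF this] show ?thesis by simp
 qed
 ultimately show ?thesis using hb1_lower[of ?a ?b] by (intro that[of "lam + hb1 ?a ?b" h]) auto
 next
 case False
 have o: "open (Dmo RR)" "x : Dmo RR" using False RR_ge by (force simp: open_Dmo Dmo_iff)+
 have "((%y. 0) has_derivative (%v. 0)) (at x)" by simp
 hence "(per (hbi i) has_derivative (%v. 0)) (at x)"
 by (rule has_derivative_transform_within_open[OF _ o]) (simp add: per_far[OF hbi_zero] Dmo_Dm)
 hence "(per (hbi i) has_derivative (%v. 0 * v $ i + 0 * v $ other i)) (at x)" by simp
 from main[OF this] show ?thesis using lam_bounds by (intro that[of "lam + 0" 0]) auto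
 qed
qed

definition upd :: "2 => real => real^2 => real^2" where "upd i t x = x + (t - x $ i) *\<^sub>R axis i 1"

lemma upd_nth: "upd i t x $ i = t" "upd i t x $ other i = x $ other i" "upd i (x $ i) x = x"
 using other(3)[of i] by (auto simp: upd_def axis_def)

lemma ff_line_deriv: "EX s>0. DERIV (%t. ff i (upd i t x) $ i) t :> s"
proof -
 obtain s h where sh: "(ff i has_derivative (%v. \<chi> j. if j = i then s * v $ i + h * v $ other i else mu * v $ j)) (at (upd i t x))"
 "lam/2 <= s" by (rule ff_deriv)
 have u: "((%t. upd i t x) has_derivative (%h. h *\<^sub>R axis i 1)) (at t)"
 unfolding upd_def by (auto intro!: derivative_eq_intros)
 have "((%t. ff i (upd i t x) $ i) has_derivative (%h. s*h)) (at t)"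
 using bounded_linear.has_derivative[OF bounded_linear_vec_nth[of i] has_derivative_compose[OF u sh(1)]] other(3)[of i]
 by (simp add: axis_def)
 thus ?thesis using sh lam_bounds by (intro exI[of _ s]) (auto simp: has_field_derivative_def)
qed

lemma ff_line_mono: "t < t' ==> ff i (upd i t x) $ i < ff i (upd i t' x) $ i"
 by (rule DERIV_pos_imp_increasing[where f="%t. ff i (upd i t x) $ i"]) (use ff_line_deriv in \<open>blast+\<close>)

text \<open>A preimage of a small box lies in a box smaller by the factor \<open>mu\<close>: on the
  line in direction i, monotonicity traps the point between the two points at offset v/mu, where the
  map is linear.\<close>

lemma ff_box:
 assumes l: "l : LL" and eq: "\<bar>(ff i x - Lat i l) $ 1\<bar> <= v" "\<bar>(ff i x - Lat i l) $ 2\<bar> <= v" and v: "v <= 2*mu"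
 shows "\<bar>(x - l) $ j\<bar> <= v/mu"
proof -
 have m: "0 < mu" using mu_bounds by simp
 have e: "\<bar>(ff i x - Lat i l) $ j\<bar> <= v" for j using eq exhaust_2[of j] by auto
 define a where "a = v/mu"
 have a: "mu*a = v" "0 <= a" "a <= 2" using m v e[of 1] by (auto simp: a_def field_simps)
 have "(ff i x - Lat i l) $ other i = mu*(x - l) $ other i"
 using ff_nth(2)[of i x] other(3)[of i] by (simp add: Lat_def algebra_simps)
 hence "mu*\<bar>(x - l) $ other i\<bar> <= mu*a" using e[of "other i"] m a by (simp add: abs_mult)
 hence o: "\<bar>(x - l) $ other i\<bar> <= a" using m by simp
 have lin: "ff i (upd i (l $ i + b) x) $ i = Lat i l $ i + mu*b" if "\<bar>b\<bar> <= a" for b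
 proof -
 have c: "(upd i (l $ i + b) x - l) $ i = b" "(upd i (l $ i + b) x - l) $ other i = (x - l) $ other i"
 by (simp_all add: upd_nth)
 have "\<bar>(upd i (l $ i + b) x - l) $ j\<bar> <= 2" for j
 using c o that a other(4)[of j i] by (cases "j = i") auto
 thus ?thesis using ff_linear[OF l, of "upd i (l $ i + b) x" i] c by simp
 qed
 have "(x - l) $ i <= a"
 proof (rule ccontr)
 assume "~ ?thesis"
 hence "l $ i + a < x $ i" by simp
 from ff_line_mono[OF this, of i x] lin[of a] a e[of i] show False by (simp add: upd_nth)
 qed
 moreover have "- a <= (x - l) $ i"
 proof (rule ccontr)
 assume "~ ?thesis"
 hence "x $ i < l $ i + - a" by simp
 from ff_line_mono[OF this, of i x] lin[of "- a"] a e[of i] show False by (simp add: upd_nth)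
 qed
 ultimately have "\<bar>(x - l) $ i\<bar> <= a" by simp
 thus ?thesis using o other(4)[of j i] by (cases "j = i") (auto simp: a_def)
qed

lemma per_bound: "(!!w. \<bar>H w\<bar> <= B) ==> 0 <= B ==> \<bar>per H x\<bar> <= (B::real)"
 by (auto simp: per_def)

text \<open>Each line in direction i is mapped increasingly into a line, and by a bounded amount,
  60, off from multiplication by \<open>lam\<close>, hence onto it.\<close>

lemma ff_bij: "bij (ff i)"
proof (rule bijI)
 have m: "0 < mu" "0 < lam" using mu_bounds lam_bounds by auto
 show "inj (ff i)"
 proof (rule injI)
 fix x y assume e: "ff i x = ff i y"
 hence o: "x $ other i = y $ other i" using ff_nth(2)[of i x] ff_nth(2)[of i y] m by simp
 have u: "upd i (y $ i) x = y" using o by (simp add: vec_eq_other[of _ _ i] upd_nth)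
 have "x $ i = y $ i"
 using ff_line_mono[of "x $ i" "y $ i" i x] ff_line_mono[of "y $ i" "x $ i" i x] e u upd_nth(3)[of i x]
 by (metis less_irrefl linorder_neqE_linordered_idom)
 thus "x = y" using o vec_eq_other by blast
 qed
 have "EX x. ff i x = z" for z
 proof -
 define x0 :: "real^2" where "x0 = upd (other i) (z $ other i/mu) 0"
 have x0: "x0 $ other i = z $ other i/mu" by (simp add: x0_def upd_nth)
 let ?fi = "%t. ff i (upd i t x0) $ i"
 have b: "\<bar>?fi t - lam*t\<bar> <= 60" for t
 unfolding ff_nth(1) upd_nth using per_bound[of "hbi i" 60] hb_bound by (simp add: hbi_def)
 have "?fi ((z $ i - 60)/lam) <= z $ i" "z $ i <= ?fi ((z $ i + 60)/lam)"
 using b[of "(z $ i - 60)/lam"] b[of "(z $ i + 60)/lam"] m by auto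
 moreover have "(z $ i - 60)/lam <= (z $ i + 60)/lam" using m by (simp add: divide_right_mono)
 moreover have "isCont ?fi t" for t using ff_line_deriv[of i x0 t] DERIV_isCont by blast
 ultimately obtain t where t: "?fi t = z $ i" using IVT[of ?fi] by blast
 have "ff i (upd i t x0) = z" unfolding vec_eq_other[of _ _ i] using t m by (simp add: ff_nth(2) upd_nth x0)
 thus "EX x. ff i x = z" by blast
 qed
 thus "surj (ff i)" unfolding surj_def by metis
qed

section \<open>A contact of order exactly r on the ring\<close>

text \<open>The contact is placed on the line t = tau0 s. For fixed s > 0 the unperturbed label
  t/(s^2 + t^2) has its maximum at t = s and is strictly monotone near t = 2 s, which are the models
  for even and odd order.\<close>

definition tau0 :: "nat => real" where "tau0 r = (if even r then 1 else 2)"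
text \<open>The value of (s^2 + t^2)/(s t) on the line t = tau0 s, so that \<open>b0\<close>
  vanishes there.\<close>

definition kap0 :: "nat => real" where "kap0 r = tau0 r + 1/tau0 r"
text \<open>Width of the perturbed strip. The perturbation has size O(hh), the radial slopes of the
  cut-offs are O(stC), and 200 (1 + stC) hh = 1 keeps the products small in
  \<open>DD_radial\<close>.\<close>

definition hh :: real where "hh = 1/(200*(1 + stC))"
text \<open>Normalised so that a product of r factors of size 2 m <= 1 is at most m^2 after
  multiplication by \<open>KK\<close>, and so that the r terms of its derivative stay
  bounded.\<close>

definition KK :: "nat => real" where "KK r = 1/(real r*2 ^ r)"
definition chi :: "real => real" where "chi s = st ((1/4 - (s - 2)^2)*(16/3))"
definition kap :: "real => real" where "kap u = st ((4 - u^2)/3)"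
text \<open>Unfolding of the contact: the offsets of the r roots are proportional to s - 2, distinct
  for s different from 2 and all 0 at s = 2.\<close>

definition cc :: "nat => nat => real => real" where "cc r i s = real i*(hh/(2*real r))*(s - 2)"
definition QQ :: "nat => real => real => real" where "QQ r s t = KK r*(\<Prod>i<r. t - tau0 r * s - cc r i s)"
definition b0 :: "nat => real => real => real" where "b0 r s t = s^2 + t^2 - kap0 r * s*t"

text \<open>On a line \<open>s = const\<close> the leaf label of the attractor is \<open>t / DD r s t\<close>. The unperturbed
 \<open>s\<^sup>2 + t\<^sup>2 = kap0 r * s * t + b0 r s t\<close> is replaced near \<open>(2, 2 * tau0 r)\<close> by
 \<open>kap0 r * s * t + QQ r s t\<close>, so the level through \<open>t = tau0 r * s\<close> has \<open>r\<close> merging roots.\<close>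

definition PP :: "nat => real => real => real" where
 "PP r s t = chi s*kap ((t - tau0 r * s)/hh)*(QQ r s t - b0 r s t)"
definition DD :: "nat => real => real => real" where "DD r s t = s^2 + t^2 + PP r s t"

lemma hh: "0 < hh" "hh <= 1/200" "200*(1 + stC)*hh = 1"
 using stC(1) by (auto simp: hh_def field_simps)

lemma tau0: "tau0 r = 1 | tau0 r = 2" "1 <= tau0 r" "tau0 r <= 2"
 by (auto simp: tau0_def)

text \<open>For even r the factors coincide and the zero is double; for odd r the second factor is
  near 3 s/2 on the strip and the zero is simple. So \<open>b0\<close> and \<open>QQ\<close> change
  sign, or do not, together.\<close>

lemma b0_factor: "b0 r s t = (t - tau0 r * s)*(t - tau0 r * s + (tau0 r - 1/tau0 r) * s)"
 using tau0(1)[of r] by (auto simp: b0_def kap0_def power2_eq_square algebra_simps)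

lemma chi_range: "0 <= chi s" "chi s <= 1" by (auto simp: chi_def st_nonneg st_le1)
lemma kap_range: "0 <= kap u" "kap u <= 1" by (auto simp: kap_def st_nonneg st_le1)

lemma chi_0: "1/2 <= \<bar>s - 2\<bar> ==> chi s = 0" and chi_1: "\<bar>s - 2\<bar> <= 1/4 ==> chi s = 1"
proof -
 show "1/2 <= \<bar>s - 2\<bar> ==> chi s = 0"
 unfolding chi_def using power_mono[of "1/2" "\<bar>s - 2\<bar>" 2] by (intro st_0) (simp add: power2_eq_square)
 show "\<bar>s - 2\<bar> <= 1/4 ==> chi s = 1"
 unfolding chi_def using power_mono[of "\<bar>s - 2\<bar>" "1/4" 2] by (intro st_1) (simp add: power2_eq_square)
qed

lemma kap_0: "2 <= \<bar>u\<bar> ==> kap u = 0" and kap_1: "\<bar>u\<bar> <= 1 ==> kap u = 1"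
proof -
 show "2 <= \<bar>u\<bar> ==> kap u = 0"
 unfolding kap_def using power_mono[of 2 "\<bar>u\<bar>" 2] by (intro st_0) simp
 show "\<bar>u\<bar> <= 1 ==> kap u = 1"
 unfolding kap_def using power_mono[of "\<bar>u\<bar>" 1 2] by (intro st_1) simp
qed

lemma DERIV_chi: "EX d. DERIV chi s :> d & (\<bar>s - 2\<bar> <= 1/2 --> \<bar>d\<bar> <= 6 * stC)"
proof -
 let ?g = "%s::real. (1/4 - (s - 2)^2)*(16/3)"
 have "DERIV ?g s :> - (2*(s - 2))*(16/3)" by (auto intro!: derivative_eq_intros)
 from DERIV_st_comp[OF this] have "DERIV chi s :> st' (?g s)*(- (2*(s - 2))*(16/3))" by (simp add: chi_def[abs_def])
 moreover have "\<bar>st' (?g s)*(- (2*(s - 2))*(16/3))\<bar> <= 6 * stC" if "\<bar>s - 2\<bar> <= 1/2"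
 proof -
 have "s - 2 <= 1/2" "- (s - 2) <= 1/2" using that by linarith+
 hence "- (2*(s - 2))*(16/3) <= 6" "- (- (2*(s - 2))*(16/3)) <= 6" by (simp_all add: field_simps)
 hence "\<bar>- (2*(s - 2))*(16/3)\<bar> <= 6" unfolding abs_le_iff by blast
 hence "\<bar>st' (?g s)\<bar>*\<bar>- (2*(s - 2))*(16/3)\<bar> <= stC*6"
 using stC st'_nonneg[of "?g s"] by (intro mult_mono) auto
 thus ?thesis by (simp add: abs_mult)
 qed
 ultimately show ?thesis by blast
qed

lemma DERIV_kap: "EX d. DERIV kap u :> d & d*u <= 0 & (\<bar>u\<bar> <= 2 --> \<bar>d\<bar> <= 2 * stC)"
proof -
 let ?g = "%u::real. (4 - u^2)/3"
 have "DERIV ?g u :> - (2*u)/3" by (auto intro!: derivative_eq_intros)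
 from DERIV_st_comp[OF this] have "DERIV kap u :> st' (?g u)*(- (2*u)/3)" by (simp add: kap_def[abs_def])
 moreover have "\<bar>st' (?g u)*(- (2*u)/3)\<bar> <= 2 * stC" if "\<bar>u\<bar> <= 2"
 proof -
 have "\<bar>st' (?g u)\<bar>*\<bar>- (2*u)/3\<bar> <= stC*2"
 using that stC st'_nonneg[of "?g u"] by (intro mult_mono) (auto simp: abs_mult)
 thus ?thesis by (simp add: abs_mult)
 qed
 moreover have "st' (?g u)*(- (2*u)/3)*u = - (2/3*(st' (?g u)*(u*u)))" by simp
 moreover have "0 <= st' (?g u)*(u*u)" using st'_nonneg by simp
 ultimately show ?thesis by (intro exI[of _ "st' (?g u)*(- (2*u)/3)"]) (simp add: mult.commute mult.left_commute)
qed

lemma KK: "2 <= r ==> 0 < KK r" "2 <= r ==> KK r*2 ^ r <= 1" "2 <= r ==> KK r*real r <= 1" "2 <= r ==> KK r <= 1/4"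
proof -
 assume r: "2 <= r"
 have p: "(4::real) <= 2 ^ r" using power_increasing[of 2 r "2::real"] r by simp
 show "0 < KK r" "KK r*2 ^ r <= 1" using r by (auto simp: KK_def field_simps)
 show "KK r*real r <= 1" using r p by (auto simp: KK_def field_simps)
 have "1*4 <= real r*2 ^ r" using r p by (intro mult_mono) auto
 thus "KK r <= 1/4" using r by (auto simp: KK_def field_simps)
qed

lemma cc_bound: "i < r ==> \<bar>s - 2\<bar> <= 1/2 ==> \<bar>cc r i s\<bar> <= hh/4"
proof -
 assume i: "i < r" and s: "\<bar>s - 2\<bar> <= 1/2"
 have "real i*(hh/(2*real r)) <= hh/2" using i hh by (simp add: field_simps)
 hence "real i*(hh/(2*real r))*\<bar>s - 2\<bar> <= hh/2*(1/2)" using s hh by (intro mult_mono) auto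
 thus ?thesis using hh by (simp add: cc_def abs_mult)
qed

lemma abs_prod_le: "finite I ==> (!!i. i : I ==> \<bar>f i\<bar> <= (B::real)) ==> \<bar>\<Prod>i\<in>I. f i\<bar> <= B ^ card I"
 using prod_mono[of I "%i. \<bar>f i\<bar>" "%_. B"] by (simp add: abs_prod)

lemma QQ_bound:
 assumes r: "2 <= r" and s: "\<bar>s - 2\<bar> <= 1/2" and z: "\<bar>t - tau0 r * s\<bar> <= m" "hh/4 <= m" "2*m <= 1"
 shows "\<bar>QQ r s t\<bar> <= m^2"
proof -
 have m0: "0 <= m" using z by linarith
 have "\<bar>\<Prod>i<r. t - tau0 r * s - cc r i s\<bar> <= (2*m) ^ card {..<r}"
 proof (rule abs_prod_le)
 fix i assume "i : {..<r}"
 thus "\<bar>t - tau0 r * s - cc r i s\<bar> <= 2*m" using cc_bound[of i r s] s z by auto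
 qed simp
 hence "\<bar>QQ r s t\<bar> <= KK r*(2*m) ^ r" using KK(1)[OF r] by (simp add: QQ_def abs_mult)
 also have "... = (KK r*2 ^ r)*m ^ r" by (simp add: power_mult_distrib)
 also have "... <= 1*m^2" using KK(1,2)[OF r] r z m0 by (intro mult_mono power_decreasing) auto
 finally show ?thesis by simp
qed

lemma prod_deriv_bound:
 fixes f :: "nat => real => real"
 assumes "!!i. i < n ==> DERIV (f i) x :> f' i" "!!i. i < n ==> \<bar>f i x\<bar> <= 1" "!!i. i < n ==> \<bar>f' i\<bar> <= B" "0 <= B"
 shows "EX d. DERIV (%x. \<Prod>i<n. f i x) x :> d & \<bar>d\<bar> <= real n*B"
 using assms
proof (induction n)
 case (Suc n)
 then obtain d where d: "DERIV (%x. \<Prod>i<n. f i x) x :> d" "\<bar>d\<bar> <= real n*B" by auto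
 have 1: "DERIV (%x. (\<Prod>i<n. f i x)*f n x) x :> d*f n x + f' n*(\<Prod>i<n. f i x)"
 by (rule DERIV_mult[OF d(1)]) (use Suc.prems in simp)
 have p: "\<bar>\<Prod>i<n. f i x\<bar> <= 1" using abs_prod_le[of "{..<n}" "%i. f i x" 1] Suc.prems(2) by auto
 have "\<bar>d\<bar>*\<bar>f n x\<bar> <= (real n*B)*1" using d(2) Suc.prems(2)[of n] by (intro mult_mono) auto
 moreover have "\<bar>f' n\<bar>*\<bar>\<Prod>i<n. f i x\<bar> <= B*1" using p Suc.prems(3)[of n] by (intro mult_mono) auto
 ultimately have "\<bar>d*f n x + f' n*(\<Prod>i<n. f i x)\<bar> <= real (Suc n)*B"
 using abs_triangle_ineq[of "d*f n x" "f' n*(\<Prod>i<n. f i x)"] by (simp add: abs_mult algebra_simps)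
 thus ?case using 1 by auto
qed auto

lemma PP_support: "PP r s t ~= 0 ==> \<bar>s - 2\<bar> < 1/2 & \<bar>t - tau0 r * s\<bar> < 2*hh"
proof -
 assume "PP r s t ~= 0"
 hence "chi s ~= 0" "kap ((t - tau0 r * s)/hh) ~= 0" by (auto simp: PP_def)
 hence "\<bar>s - 2\<bar> < 1/2" "\<bar>(t - tau0 r * s)/hh\<bar> < 2" using chi_0[of s] kap_0[of "(t - tau0 r * s)/hh"] by force+
 thus ?thesis using hh by (simp add: abs_divide field_simps)
qed

lemma support_bounds:
 assumes r: "2 <= r" and s: "\<bar>s - 2\<bar> <= 1/2" and z: "\<bar>t - tau0 r * s\<bar> <= 2*hh"
 shows "\<bar>b0 r s t\<bar> <= 8*hh" "\<bar>QQ r s t\<bar> <= hh" "1.4 <= t" "t <= 5.1"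
proof -
 have h: "2*hh <= 1/100" using hh by simp
 have s': "3/2 <= s" "s <= 5/2" using s by linarith+
 have "\<bar>(tau0 r - 1/tau0 r) * s\<bar> <= 15/4" using tau0(1)[of r] s' by auto
 hence "\<bar>t - tau0 r * s + (tau0 r - 1/tau0 r) * s\<bar> <= 4" using z h by linarith
 hence "\<bar>t - tau0 r * s\<bar>*\<bar>t - tau0 r * s + (tau0 r - 1/tau0 r) * s\<bar> <= (2*hh)*4" using z by (intro mult_mono) auto
 thus "\<bar>b0 r s t\<bar> <= 8*hh" unfolding b0_factor abs_mult by simp
 have "\<bar>QQ r s t\<bar> <= (2*hh)^2" by (rule QQ_bound[OF r s z]) (use hh in auto)
 also have "... = (4*hh)*hh" by (simp add: power2_eq_square)
 also have "... <= 1*hh" using hh by (intro mult_right_mono) auto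
 finally show "\<bar>QQ r s t\<bar> <= hh" by simp
 show "1.4 <= t" "t <= 5.1" using tau0(1)[of r] s' z h by auto
qed

lemma PP_bound: "2 <= r ==> \<bar>PP r s t\<bar> <= 9*hh"
proof (cases "PP r s t = 0")
 case False
 assume r: "2 <= r"
 have b: "\<bar>s - 2\<bar> <= 1/2" "\<bar>t - tau0 r * s\<bar> <= 2*hh" using PP_support[OF False] by auto
 have q: "\<bar>QQ r s t - b0 r s t\<bar> <= 9*hh" using support_bounds(1,2)[OF r b] by linarith
 have "\<bar>PP r s t\<bar> = chi s*kap ((t - tau0 r * s)/hh)*\<bar>QQ r s t - b0 r s t\<bar>"
 using chi_range[of s] kap_range[of "(t - tau0 r * s)/hh"] by (simp add: PP_def abs_mult)
 also have "... <= 1*1*(9*hh)" using chi_range[of s] kap_range[of "(t - tau0 r * s)/hh"] q hh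
 by (intro mult_mono) auto
 finally show ?thesis by simp
qed (use hh in simp)

lemma DD_pos: "2 <= r ==> s ~= 0 | t ~= 0 ==> 0 < DD r s t"
proof (cases "PP r s t = 0")
 case True
 assume "s ~= 0 | t ~= 0"
 thus ?thesis using True by (auto simp: DD_def sum_power2_gt_zero_iff)
next
 case False
 assume r: "2 <= r"
 have "3/2 <= s" using PP_support[OF False] by (auto simp: abs_if split: if_splits)
 hence "1 <= s^2" by simp
 thus ?thesis using PP_bound[OF r, of s t] hh zero_le_power2[of t] unfolding DD_def by linarith
qed

text \<open>Makes the quotient of \<open>Dv\<close> by the radius increase along rays. For s^2 + t^2
  the radial derivative is twice the value; on the support, where s^2 >= 1, the perturbation alters
  the derivative by at most 171 stC hh + 20 hh and the value by at most 9 hh, together less than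
  1.\<close>

lemma DD_radial:
 assumes r: "2 <= r" and st: "s ~= 0 | t ~= 0"
 shows "EX d. DERIV (%rh. DD r (rh * s) (rh*t)) 1 :> d & DD r s t < d"
proof -
 let ?z = "t - tau0 r * s"
 have q: "DERIV (%rh. (rh * s)^2 + (rh*t)^2) 1 :> 2*(s^2 + t^2)"
 by (auto intro!: derivative_eq_intros simp: power2_eq_square algebra_simps)
 have pos: "0 < s^2 + t^2" using st by (simp add: sum_power2_gt_zero_iff)
 show ?thesis
 proof (cases "\<bar>s - 2\<bar> <= 1/2 & \<bar>?z\<bar> <= 2*hh")
 case True
 note b = support_bounds[OF r True[THEN conjunct1] True[THEN conjunct2]]
 have sb: "\<bar>s\<bar> <= 5/2" using True by linarith
 obtain c' where c': "DERIV chi s :> c'" "\<bar>c'\<bar> <= 6 * stC" using DERIV_chi[of s] True by auto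
 obtain k' where k': "DERIV kap (?z/hh) :> k'" "\<bar>k'\<bar> <= 2 * stC"
 using DERIV_kap[of "?z/hh"] True hh by (auto simp: abs_divide field_simps)
 have 1: "DERIV (%rh. chi (rh * s)) 1 :> c' * s"
 by (rule DERIV_chain2[where f=chi]) (use c' in \<open>auto intro!: derivative_eq_intros\<close>)
 have 2: "DERIV (%rh. kap ((rh*t - tau0 r*(rh * s))/hh)) 1 :> k'*(?z/hh)"
 by (rule DERIV_chain2[where f=kap]) (use k' hh in \<open>auto intro!: derivative_eq_intros simp: field_simps\<close>)
 have "EX d. DERIV (%rh. \<Prod>i<r. (rh*t - tau0 r*(rh * s) - cc r i (rh * s))) 1 :> d & \<bar>d\<bar> <= real r*(4*hh)"
 proof (rule prod_deriv_bound[where f'="%i. ?z - real i*(hh/(2*real r)) * s"])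
 fix i assume i: "i < r"
 show "DERIV (%rh. rh*t - tau0 r*(rh * s) - cc r i (rh * s)) 1 :> ?z - real i*(hh/(2*real r)) * s"
 unfolding cc_def using r by (auto intro!: derivative_eq_intros)
 show "\<bar>1*t - tau0 r*(1 * s) - cc r i (1 * s)\<bar> <= 1" using cc_bound[OF i, of s] True hh by auto
 have "real i*(hh/(2*real r)) <= hh/2" using i r hh by (simp add: field_simps)
 hence "real i*(hh/(2*real r))*\<bar>s\<bar> <= hh/2*(5/2)" using sb hh by (intro mult_mono) auto
 hence "\<bar>real i*(hh/(2*real r)) * s\<bar> <= hh/2*(5/2)" using hh by (simp add: abs_mult)
 thus "\<bar>?z - real i*(hh/(2*real r)) * s\<bar> <= 4*hh" using True[THEN conjunct2] hh(1) by linarith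
 qed (use hh in simp)
 then obtain d where d: "DERIV (%rh. \<Prod>i<r. (rh*t - tau0 r*(rh * s) - cc r i (rh * s))) 1 :> d" "\<bar>d\<bar> <= real r*(4*hh)" by blast
 have 3: "DERIV (%rh. QQ r (rh * s) (rh*t)) 1 :> KK r*d"
 unfolding QQ_def by (rule DERIV_cmult[OF d(1)])
 have "KK r*\<bar>d\<bar> <= KK r*(real r*(4*hh))" using d KK(1)[OF r] by (intro mult_left_mono) auto
 also have "... <= 1*(4*hh)" unfolding mult.assoc[symmetric] using KK(3)[OF r] hh by (intro mult_right_mono) auto
 finally have dQ: "\<bar>KK r*d\<bar> <= 4*hh" using KK(1)[OF r] by (simp add: abs_mult)
 have 4: "DERIV (%rh. b0 r (rh * s) (rh*t)) 1 :> 2*b0 r s t"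
 unfolding b0_def by (auto intro!: derivative_eq_intros simp: power2_eq_square algebra_simps)
 let ?k = "kap (?z/hh)" and ?W = "QQ r s t - b0 r s t"
 define e where "e = (c' * s*?k + k'*(?z/hh)*chi s)*?W + (KK r*d - 2*b0 r s t)*(chi s*?k)"
 have "DERIV (%rh. PP r (rh * s) (rh*t)) 1 :> e"
 unfolding PP_def e_def using DERIV_mult[OF DERIV_mult[OF 1 2] DERIV_diff[OF 3 4]] by simp
 from DERIV_add[OF q this] have D: "DERIV (%rh. DD r (rh * s) (rh*t)) 1 :> 2*(s^2 + t^2) + e"
 by (simp add: DD_def)
 have W: "\<bar>?W\<bar> <= 9*hh" using b(1,2) by linarith
 have s1: "\<bar>c' * s*?k\<bar> <= 6 * stC*(5/2)*1"
 unfolding abs_mult using c' sb kap_range[of "?z/hh"] stC by (intro mult_mono) auto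
 have zh: "\<bar>?z/hh\<bar> <= 2" using True hh by (simp add: abs_divide field_simps)
 have s2: "\<bar>k'*(?z/hh)*chi s\<bar> <= 2 * stC*2*1"
 unfolding abs_mult[of _ "chi s"] abs_mult[of k'] using k' zh chi_range[of s] stC by (intro mult_mono) auto
 have s3: "\<bar>c' * s*?k + k'*(?z/hh)*chi s\<bar>*\<bar>?W\<bar> <= (19 * stC)*(9*hh)"
 proof (rule mult_mono)
 show "\<bar>c' * s*?k + k'*(?z/hh)*chi s\<bar> <= 19 * stC"
 using abs_triangle_ineq[of "c' * s*?k" "k'*(?z/hh)*chi s"] s1 s2 by (simp del: times_divide_eq_right times_divide_eq_left)
 qed (use W stC in auto)
 have "\<bar>chi s*?k\<bar> <= 1*1" unfolding abs_mult using chi_range[of s] kap_range[of "?z/hh"] by (intro mult_mono) auto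
 moreover have "\<bar>KK r*d - 2*b0 r s t\<bar> <= 20*hh" using dQ b(1) by linarith
 ultimately have "\<bar>KK r*d - 2*b0 r s t\<bar>*\<bar>chi s*?k\<bar> <= (20*hh)*1" using hh by (intro mult_mono) auto
 hence "\<bar>e\<bar> <= 171*(stC*hh) + 20*hh"
 using s3 unfolding e_def abs_mult[symmetric] by (simp add: algebra_simps)
 hence e1: "- (171*(stC*hh) + 20*hh) <= e" by (rule abs_le_D2[THEN minus_le_iff[THEN iffD1]])
 define x where "x = stC*hh"
 have h1: "200*hh + 200*x = 1" using hh(3) by (simp add: x_def algebra_simps)
 have h2: "0 <= x" "0 < hh" using stC hh by (auto simp: x_def)
 have "1 <= s" using True[THEN conjunct1] by linarith
 hence h3: "1 <= s^2" by (rule one_le_power)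
 have h4: "PP r s t <= 9*hh" using PP_bound[OF r] abs_le_D1 by blast
 have "DD r s t < 2*(s^2 + t^2) + e" unfolding DD_def using zero_le_power2[of t] e1[folded x_def] h1 h2 h3 h4 by argo
 thus ?thesis using D by blast
 next
 case False
 define U where "U = {rh. 1/2 < \<bar>rh * s - 2\<bar>} Un {rh. 2*hh < \<bar>rh*t - tau0 r*(rh * s)\<bar>}"
 have U: "open U" "1 : U" unfolding U_def using False
 by (auto intro!: open_Un open_Collect_less continuous_intros)
 have P0: "PP r (rh * s) (rh*t) = 0" if "rh : U" for rh
 proof (rule ccontr)
 assume "~ ?thesis"
 from PP_support[OF this] show False using that by (auto simp: U_def)
 qed
 have "DERIV (%rh. DD r (rh * s) (rh*t)) 1 :> 2*(s^2 + t^2)"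
 by (rule has_field_derivative_transform_within_open[OF q U]) (simp add: DD_def P0)
 moreover have "DD r s t = s^2 + t^2" using P0[OF U(2)] by (simp add: DD_def)
 ultimately show ?thesis using pos by auto
 qed
qed

lemma Cr_on_DD:
 assumes "Cr_on k f U" "Cr_on k g U"
 shows "Cr_on k (%x. DD r (f x) (g x)) U"
 unfolding DD_def PP_def QQ_def b0_def chi_def kap_def cc_def using hh
 by (intro Cr_on_intros Cr_on_st assms Cr_on_open[OF assms(1)]) auto

lemma flat_mult_zero:
 assumes I: "open I" and "kd j I f" "kd j I g" "t : I" "!!i. i <= j ==> (deriv ^^ i) g t = 0"
 shows "(deriv ^^ j) (%x. f x*g x) t = 0"
 using assms(2,3,5)
proof (induction j arbitrary: f g)
 case 0 thus ?case by (auto simp: le_zero_eq)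
next
 case (Suc j)
 have w: "kd j I f" "kd j I g" using Suc.prems kd_weaken le_SucI by blast+
 have eq: "deriv (%t. f t*g t) x = deriv f x*g x + f x*deriv g x" if "x : I" for x
 using DERIV_imp_deriv[OF DERIV_mult[of f "deriv f x" x UNIV g "deriv g x"]] Suc.prems that
 by (auto simp: real_differentiableD)
 have "(deriv ^^ j) (deriv (%t. f t*g t)) t = (deriv ^^ j) (%x. deriv f x*g x + f x*deriv g x) t"
 by (rule derivs_cong[OF I eq assms(4)])
 also have "... = (deriv ^^ j) (%x. deriv f x*g x) t + (deriv ^^ j) (%x. f x*deriv g x) t"
 by (rule derivs_add[OF I _ _ assms(4)]) (use Suc.prems w in \<open>auto intro: kd_mult[OF I]\<close>)
 also have "(deriv ^^ j) (%x. deriv f x*g x) t = 0"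
 by (rule Suc.IH) (use Suc.prems w in auto)
 also have "(deriv ^^ j) (%x. f x*deriv g x) t = 0"
 proof (rule Suc.IH)
 show "(deriv ^^ i) (deriv g) t = 0" if "i <= j" for i
 using Suc.prems(3)[of "Suc i"] that by (simp add: funpow_Suc_right del: funpow.simps)
 qed (use Suc.prems w in auto)
 finally show ?case by (simp add: funpow_Suc_right del: funpow.simps)
qed

text \<open>If all derivatives of g from order 1 to j vanish at t, Leibniz' rule leaves a single
  term.\<close>

lemma flat_mult:
 assumes I: "open I" and "kd j I f" "kd j I g" "t : I" "!!i. 1 <= i ==> i <= j ==> (deriv ^^ i) g t = 0"
 shows "(deriv ^^ j) (%x. f x*g x) t = (deriv ^^ j) f t*g t"
 using assms(2,3,5)
proof (induction j arbitrary: f)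
 case (Suc j)
 have w: "kd j I f" "kd j I g" using Suc.prems kd_weaken le_SucI by blast+
 have eq: "deriv (%t. f t*g t) x = deriv f x*g x + f x*deriv g x" if "x : I" for x
 using DERIV_imp_deriv[OF DERIV_mult[of f "deriv f x" x UNIV g "deriv g x"]] Suc.prems that
 by (auto simp: real_differentiableD)
 have "(deriv ^^ j) (deriv (%t. f t*g t)) t = (deriv ^^ j) (%x. deriv f x*g x + f x*deriv g x) t"
 by (rule derivs_cong[OF I eq assms(4)])
 also have "... = (deriv ^^ j) (%x. deriv f x*g x) t + (deriv ^^ j) (%x. f x*deriv g x) t"
 by (rule derivs_add[OF I _ _ assms(4)]) (use Suc.prems w in \<open>auto intro: kd_mult[OF I]\<close>)
 also have "(deriv ^^ j) (%x. deriv f x*g x) t = (deriv ^^ j) (deriv f) t*g t"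
 by (rule Suc.IH) (use Suc.prems w in auto)
 also have "(deriv ^^ j) (%x. f x*deriv g x) t = 0"
 proof (rule flat_mult_zero[OF I])
 show "(deriv ^^ i) (deriv g) t = 0" if "i <= j" for i
 using Suc.prems(3)[of "Suc i"] that by (simp add: funpow_Suc_right del: funpow.simps)
 qed (use Suc.prems w assms(4) in auto)
 finally show ?case by (simp add: funpow_Suc_right del: funpow.simps)
qed simp

text \<open>With the logarithmic derivative S, a sum of reciprocals 1/u i, one has q t - QQ = QQ (S
  t - 1). To the right of the roots QQ > 0 and S t > 1, since u 0 <= 1 and t >= 1.4; to their left S
  <= 0, and QQ has the sign of (-1)^r.\<close>

lemma QQ_sign:
 assumes r: "2 <= r" and s: "\<bar>s - 2\<bar> <= 1/2" and z: "hh <= \<bar>t - tau0 r * s\<bar>" "\<bar>t - tau0 r * s\<bar> <= 2*hh"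
 obtains q where "DERIV (QQ r s) t :> q"
 "if even r then 0 < (t - tau0 r * s)*(q*t - QQ r s t) else 0 < q*t - QQ r s t"
proof -
 let ?z = "t - tau0 r * s"
 define u where "u i = ?z - cc r i s" for i
 have c: "\<bar>cc r i s\<bar> <= hh/4" if "i < r" for i using cc_bound[OF that s] .
 have t: "1.4 <= t" using support_bounds(3)[OF r s z(2)] .
 have un: "u i ~= 0" if "i < r" for i using c[OF that] z hh unfolding u_def by linarith
 define S where "S = (\<Sum>i<r. 1/u i)"
 define q where "q = QQ r s t*S"
 have "((%t. \<Prod>i<r. t - tau0 r * s - cc r i s) has_real_derivative (\<Prod>i<r. u i)*S) (at t)"
 proof -
 have "((%t. \<Prod>i\<in>I. t - tau0 r * s - cc r i s) has_real_derivative (\<Prod>i\<in>I. u i)*(\<Sum>i\<in>I. 1/u i)) (at t)"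
 if "finite I" "I <= {..<r}" for I
 using that
 proof (induction I rule: finite_induct)
 case (insert i I)
 have 1: "((%t. t - tau0 r * s - cc r i s) has_real_derivative 1) (at t)" by (auto intro!: derivative_eq_intros)
 have IH: "((%t. \<Prod>i\<in>I. t - tau0 r * s - cc r i s) has_real_derivative (\<Prod>i\<in>I. u i)*(\<Sum>i\<in>I. 1/u i)) (at t)"
 using insert by auto
 have ui: "u i ~= 0" using un[of i] insert by simp
 have "((%t. (t - tau0 r * s - cc r i s)*(\<Prod>i\<in>I. t - tau0 r * s - cc r i s)) has_real_derivative
 (\<Prod>i\<in>I. u i) + (\<Prod>i\<in>I. u i)*(\<Sum>i\<in>I. 1/u i)*u i) (at t)"
 using DERIV_mult[OF 1 IH] by (simp add: u_def)
 moreover have "(\<Prod>i\<in>I. u i) + (\<Prod>i\<in>I. u i)*(\<Sum>i\<in>I. 1/u i)*u i = (\<Prod>i\<in>insert i I. u i)*(\<Sum>i\<in>insert i I. 1/u i)"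
 using insert(1,2) ui by (simp add: distrib_left mult_ac)
 ultimately show ?case using insert(1,2) by simp
 qed simp
 from this[of "{..<r}"] show ?thesis by (simp add: S_def)
 qed
 from DERIV_cmult[OF this, of "KK r"] have D: "DERIV (QQ r s) t :> q"
 by (simp add: QQ_def[abs_def] q_def u_def mult.assoc)
 have eq: "q*t - QQ r s t = QQ r s t*(S*t - 1)" by (simp add: q_def algebra_simps)
 have Q: "QQ r s t = KK r*(\<Prod>i<r. u i)" by (simp add: QQ_def u_def)
 have i0: "0 : {..<r}" using r by simp
 show ?thesis
 proof (cases "0 < ?z")
 case True
 have up: "0 < u i" "u i <= 3*hh" if "i < r" for i using c[OF that] True z hh unfolding u_def by linarith+
 have "0 < QQ r s t" unfolding Q using KK(1)[OF r] up by (auto intro!: mult_pos_pos prod_pos)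
 moreover have "1 < S*t"
 proof -
 have "1/u 0 <= S" unfolding S_def using up r by (intro member_le_sum i0) (auto simp: less_imp_le)
 moreover have "1 <= 1/u 0" using up[of 0] r hh by (simp add: field_simps)
 ultimately have "1*t <= S*t" using t by (intro mult_right_mono) auto
 thus ?thesis using t by linarith
 qed
 ultimately have "0 < q*t - QQ r s t" unfolding eq by simp
 thus ?thesis using D True by (intro that[of q]) auto
 next
 case False
 hence zn: "?z < 0" using z hh by linarith
 have un': "u i < 0" if "i < r" for i using c[OF that] zn z hh unfolding u_def by linarith
 have sgn: "0 < (-1) ^ r*QQ r s t"
 proof -
 have "0 < (\<Prod>i<r. - u i)" using un' by (intro prod_pos) auto
 also have "(\<Prod>i<r. - u i) = (-1) ^ r*(\<Prod>i<r. u i)" by (simp add: prod_uminus)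
 finally show ?thesis using KK(1)[OF r] unfolding Q by (simp add: mult.left_commute)
 qed
 have "S <= 0" unfolding S_def using un' by (intro sum_nonpos) (auto simp: less_imp_le divide_nonneg_neg)
 hence "S*t - 1 < 0" using t mult_nonpos_nonneg[of S t] by auto
 hence "((-1) ^ r*QQ r s t)*(S*t - 1) < 0" using sgn by (simp add: mult_pos_neg)
 thus ?thesis using D zn unfolding eq[symmetric]
 by (intro that[of q]) (auto simp: eq zero_less_mult_iff mult_less_0_iff split: if_splits)
 qed
qed

text \<open>Up to sign, d t - DD is the numerator of the derivative of t/DD, so no contact arises in
  the transition strip. It is the sum of three terms, from the unperturbed quadratic, from
  \<open>QQ\<close> and from the slope of \<open>kap\<close>; none of them has the wrong sign
  because \<open>b0\<close> and \<open>QQ\<close> have the same parity.\<close>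

lemma DD_transition:
 assumes r: "2 <= r" and c: "0 < chi s" and s: "\<bar>s - 2\<bar> <= 1/2"
 and z: "hh <= \<bar>t - tau0 r * s\<bar>" "\<bar>t - tau0 r * s\<bar> <= 2*hh" and D: "DERIV (DD r s) t :> d"
 shows "d*t ~= DD r s t"
proof -
 let ?z = "t - tau0 r * s"
 obtain q where q: "DERIV (QQ r s) t :> q"
 "if even r then 0 < ?z*(q*t - QQ r s t) else 0 < q*t - QQ r s t" by (rule QQ_sign[OF r s z])
 obtain k' where k': "DERIV kap (?z/hh) :> k'" "k'*(?z/hh) <= 0" using DERIV_kap by blast
 have t: "1.4 <= t" using support_bounds(3)[OF r s z(2)] .
 have s0: "3/2 <= s" using s by linarith
 let ?k = "kap (?z/hh)" and ?W = "QQ r s t - b0 r s t" and ?w = "chi s*kap (?z/hh)"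
 have dk: "DERIV (%t. kap ((t - tau0 r * s)/hh)) t :> k'*(1/hh)"
 by (rule DERIV_chain2[where f=kap]) (use k' hh in \<open>auto intro!: derivative_eq_intros\<close>)
 have db: "DERIV (b0 r s) t :> 2*t - kap0 r * s"
 unfolding b0_def[abs_def] by (auto intro!: derivative_eq_intros)
 have "DERIV (%t. s^2 + t^2) t :> 2*t" by (auto intro!: derivative_eq_intros)
 from DERIV_add[OF this DERIV_mult[OF DERIV_cmult[OF dk, of "chi s"] DERIV_diff[OF q(1) db]]]
 have "DERIV (DD r s) t :> 2*t + (chi s*(k'*(1/hh))*?W + (q - (2*t - kap0 r * s))*?w)"
 by (simp add: DD_def[abs_def] PP_def)
 hence d: "d = 2*t + (chi s*(k'*(1/hh))*?W + (q - (2*t - kap0 r * s))*?w)"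
 using D DERIV_unique by blast
 define G where "G = (1 - ?w)*(t^2 - s^2) + ?w*(q*t - QQ r s t) + chi s*(t/hh)*(k'*?W)"
 have "d*t - DD r s t = G"
 unfolding d G_def DD_def PP_def by (simp add: b0_def power2_eq_square algebra_simps)
 moreover have "G ~= 0"
 proof -
 \<comment> \<open>The common sign: for even r the label has an extremum at t = tau0 s and the sign
   depends on the side, for odd r it does not.\<close>
 define \<sigma> :: real where "\<sigma> = (if even r then sgn ?z else 1)"
 have z0: "?z ~= 0" using z hh by auto
 have w: "0 <= ?w" "?w <= 1" using chi_range[of s] kap_range[of "?z/hh"] by (auto intro: mult_le_one)
 have ts: "t^2 - s^2 = (t - s)*(t + s)" by (simp add: power2_eq_square algebra_simps)
 have 1: "0 < \<sigma>*(t^2 - s^2)"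
 proof (cases "even r")
 case True
 hence "t - s = ?z" by (simp add: tau0_def)
 hence "\<sigma>*(t^2 - s^2) = (sgn ?z*?z)*(t + s)" unfolding ts using True by (simp add: \<sigma>_def)
 moreover have "0 < sgn ?z*?z" using z0 by (simp add: sgn_if)
 ultimately show ?thesis using t s0 by simp
 next
 case False
 hence "t - s = ?z + s" by (simp add: tau0_def)
 hence "0 < t - s" using z hh s0 by linarith
 thus ?thesis unfolding ts using False t s0 by (simp add: \<sigma>_def)
 qed
 have 2: "0 < \<sigma>*(q*t - QQ r s t)"
 using q(2) z0 by (cases "even r") (auto simp: \<sigma>_def sgn_if zero_less_mult_iff mult_less_0_iff)
 have 3: "0 <= \<sigma>*(k'*?W)"
 proof -
 define m where "m = \<bar>?z\<bar>"
 have Qm: "\<bar>QQ r s t\<bar> <= m^2"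
 by (rule QQ_bound[OF r s]) (use z hh in \<open>auto simp: m_def\<close>)
 have m2: "m^2 = ?z*?z" by (simp add: m_def power2_eq_square abs_mult_self_eq)
 have kz: "k'*?z <= 0" using k'(2) hh by (simp add: field_simps mult_le_0_iff zero_le_mult_iff split: if_splits)
 have W: "\<sigma> * sgn ?z*?W <= 0"
 proof (cases "even r")
 case True
 hence "b0 r s t = m^2" unfolding b0_factor m2 by (simp add: tau0_def)
 hence "?W <= 0" using Qm by linarith
 moreover have "\<sigma> * sgn ?z = 1" using True z0 by (simp add: \<sigma>_def sgn_if)
 ultimately show ?thesis by simp
 next
 case False
 hence b: "b0 r s t = ?z*(?z + 3/2 * s)" unfolding b0_factor by (simp add: tau0_def)
 show ?thesis
 proof (cases "0 < ?z")
 case True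
 hence "m^2 <= b0 r s t" unfolding b m2 using s0 by (intro mult_left_mono) auto
 thus ?thesis using True False Qm by (simp add: \<sigma>_def)
 next
 case neg: False
 have "?z*(?z + 3/2 * s) <= ?z*(- ?z)" using neg s0 z hh by (intro mult_left_mono_neg) linarith+
 hence "b0 r s t <= - (m^2)" unfolding b m2 by (simp only: mult_minus_right)
 hence "0 <= ?W" using Qm by linarith
 moreover have "sgn ?z = -1" using neg z0 by simp
 ultimately show ?thesis using False by (simp add: \<sigma>_def)
 qed
 qed
 have "\<sigma>*(k'*?W)*(?z*?z) = (\<sigma> * sgn ?z*?W)*(k'*?z)*\<bar>?z\<bar>"
 proof -
 have gen: "a*(b*c)*(x*x) = (a * sgn x*c)*(b*x)*\<bar>x\<bar>" for a b c x :: real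
 proof -
 have "(a * sgn x*c)*(b*x)*\<bar>x\<bar> = a*(b*c)*(x*(sgn x*\<bar>x\<bar>))" by (simp only: mult_ac)
 thus ?thesis by (simp only: mult_sgn_abs)
 qed
 show ?thesis by (rule gen)
 qed
 also have "0 <= ..." using W kz by (intro mult_nonneg_nonneg mult_nonpos_nonpos) auto
 finally have nn: "0 <= \<sigma>*(k'*?W)*(?z*?z)" .
 have "0 < ?z*?z" using z0 not_real_square_gt_zero by blast
 thus ?thesis using nn mult_neg_pos[of "\<sigma>*(k'*?W)" "?z*?z"] by linarith
 qed
 have "\<sigma>*G = (1 - ?w)*(\<sigma>*(t^2 - s^2)) + ?w*(\<sigma>*(q*t - QQ r s t)) + chi s*(t/hh)*(\<sigma>*(k'*?W))"
 by (simp add: G_def algebra_simps)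
 moreover have "0 <= chi s*(t/hh)*(\<sigma>*(k'*?W))" by (rule mult_nonneg_nonneg[OF _ 3]) (use c t hh in auto)
 moreover have "0 < (1 - ?w)*(\<sigma>*(t^2 - s^2)) + ?w*(\<sigma>*(q*t - QQ r s t))"
 using 1 2 w by (cases "?w = 1") (auto intro!: add_pos_nonneg mult_pos_pos)
 ultimately show ?thesis by auto
 qed
 ultimately show ?thesis by auto
qed

definition TT :: "nat => real => real => real" where "TT r s t = mu*t/DD r s t"

lemma Cr_on_real_kd: "Cr_on k f I ==> kd k (I::real set) f"
proof (induction k arbitrary: f)
 case (Suc k)
 have I: "open I" using Suc.prems Cr_on_open by auto
 have D: "(f has_real_derivative frechet_derivative f (at x) 1) (at x)" if "x : I" for x
 proof -
 note d = Cr_on_SucD(1)[OF Suc.prems that]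
 have "frechet_derivative f (at x) h = frechet_derivative f (at x) 1*h" for h
 using linear_scale[OF has_derivative_linear[OF d], of h 1] by (simp add: mult.commute)
 hence "frechet_derivative f (at x) = (*) (frechet_derivative f (at x) 1)" by (rule ext)
 thus ?thesis using d unfolding has_field_derivative_def by simp
 qed
 show ?case by (rule kd_SucI[OF I D]) (use Suc.IH Cr_on_SucD(2)[OF Suc.prems] in auto)
qed simp

text \<open>If the derivatives of orders 1 to r vanished at t, then by DD TT = mu t those of
  \<open>DD\<close> up to order r would be proportional to those of t: \<open>DD\<close> would be
  tangent to a line through 0, with derivatives of orders 2 to r zero. Where \<open>PP\<close>
  vanishes the second derivative is 2; in the transition strip tangency fails; in the core
  \<open>DD\<close> is a polynomial whose coefficient of order r is positive.\<close>

lemma TT_nondegenerate: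
 assumes r: "2 <= r" and st: "s ~= 0 | t ~= 0"
 shows "EX j. 1 <= j & j <= r & (deriv ^^ j) (TT r s) t ~= 0"
proof (rule ccontr)
 assume "~ ?thesis"
 hence flat: "(deriv ^^ j) (TT r s) t = 0" if "1 <= j" "j <= r" for j using that by blast
 define I where "I = (if s = 0 then - {0} else UNIV :: real set)"
 have I: "open I" "t : I" using st by (auto simp: I_def)
 have ne: "DD r s x ~= 0" if "x : I" for x using DD_pos[OF r, of s x] that by (auto simp: I_def split: if_splits)
 have CD: "Cr_on k (DD r s) I" for k by (rule Cr_on_DD) (auto intro!: Cr_on_intros I)
 hence CT: "Cr_on k (TT r s) I" for k unfolding TT_def[abs_def] using ne by (intro Cr_on_intros I) auto
 note kD = Cr_on_real_kd[OF CD] and kT = Cr_on_real_kd[OF CT]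
 have prod: "(deriv ^^ j) (DD r s) t*TT r s t = (deriv ^^ j) (poly [:0, mu:]) t" if "j <= r" for j
 proof -
 have "(deriv ^^ j) (%x. DD r s x*TT r s x) t = (deriv ^^ j) (DD r s) t*TT r s t"
 by (rule flat_mult[OF I(1) kD kT I(2)]) (use flat that in auto)
 moreover have "(deriv ^^ j) (%x. DD r s x*TT r s x) t = (deriv ^^ j) (poly [:0, mu:]) t"
 by (rule derivs_cong[OF I(1) _ I(2)]) (use ne in \<open>simp add: TT_def mult.commute\<close>)
 ultimately show ?thesis by simp
 qed
 have p1: "deriv (DD r s) t*TT r s t = mu" using prod[of 1] r by (simp add: deriv_poly pderiv_pCons)
 hence T0: "TT r s t ~= 0" using mu_bounds by auto
 have "DD r s t*TT r s t = mu*t" using prod[of 0] by (simp add: mult.commute)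
 have tang: "deriv (DD r s) t*t = DD r s t"
 proof -
 have "(deriv (DD r s) t*t)*TT r s t = DD r s t*TT r s t"
 using p1 \<open>DD r s t * TT r s t = mu * t\<close> by (simp add: mult_ac)
 thus ?thesis using T0 by simp
 qed
 have high: "(deriv ^^ j) (DD r s) t = 0" if "2 <= j" "j <= r" for j
 proof -
 define i where "i = j - 2"
 have i: "j = Suc (Suc i)" using that by (simp add: i_def)
 have "pder (Suc (Suc i)) [:0, mu:] = 0" by (induction i) (simp_all add: pderiv_pCons)
 hence "pder j [:0, mu:] = 0" by (simp only: i)
 thus ?thesis using prod[OF that(2)] T0 by (simp add: derivs_poly)
 qed
 have sq: False if U: "open U" "t : U" "!!x. x : U ==> DD r s x = s^2 + x^2" for U
 proof -
 have "(deriv ^^ 2) (DD r s) t = (deriv ^^ 2) (poly [:s^2, 0, 1:]) t"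
 by (rule derivs_cong[OF U(1) _ U(2)]) (simp add: U(3) power2_eq_square)
 also have "... = 2" unfolding derivs_poly by (simp add: numeral_2_eq_2 pderiv_pCons)
 finally show False using high[of 2] r by simp
 qed
 show False
 proof (cases "chi s = 0")
 case True
 thus False by (intro sq[of UNIV]) (auto simp: DD_def PP_def)
 next
 case chi: False
 hence s: "\<bar>s - 2\<bar> <= 1/2" and cp: "0 < chi s" using chi_0[of s] chi_range[of s] by force+
 consider "2*hh < \<bar>t - tau0 r * s\<bar>" | "hh <= \<bar>t - tau0 r * s\<bar>" "\<bar>t - tau0 r * s\<bar> <= 2*hh" | "\<bar>t - tau0 r * s\<bar> < hh" by linarith
 thus False
 proof cases
 case 1
 show False
 proof (rule sq[of "{t. 2*hh < \<bar>t - tau0 r * s\<bar>}"])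
 show "open {t. 2*hh < \<bar>t - tau0 r * s\<bar>}" by (intro open_Collect_less continuous_intros)
 show "DD r s x = s^2 + x^2" if "x : {t. 2*hh < \<bar>t - tau0 r * s\<bar>}" for x
 proof -
 have "PP r s x = 0" using PP_support[of r s x] that by force
 thus ?thesis by (simp add: DD_def)
 qed
 qed (use 1 in simp)
 next
 case 2
 have "DERIV (DD r s) t :> deriv (DD r s) t" using kD[of 1] I by (auto intro: real_differentiableD)
 from DD_transition[OF r cp s 2 this] tang show False by simp
 next
 case 3
 \<comment> \<open>In the core \<open>kap\<close> is 1, so \<open>DD\<close> is kap0 s t plus the
   combination of \<open>b0\<close> and \<open>QQ\<close> with weight \<open>chi s\<close>. The
   quadratic contributes to the coefficient of order r only for r = 2, and then with the right
   sign.\<close>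
 define p where "p = smult (1 - chi s) [:s^2, - (kap0 r * s), 1:] + smult (chi s*KK r) (\<Prod>i<r. [:- (tau0 r * s + cc r i s), 1:]) + [:0, kap0 r * s:]"
 define M where "M = (\<Prod>i<r. [:- (tau0 r * s + cc r i s), 1:])"
 have dM: "degree M = r" "coeff M r = 1"
 proof -
 show d: "degree M = r" unfolding M_def by (subst degree_prod_eq_sum_degree) auto
 have "lead_coeff M = 1" unfolding M_def by (simp add: lead_coeff_prod)
 thus "coeff M r = 1" using d by simp
 qed
 have dp: "degree p <= r" unfolding p_def M_def[symmetric] using r dM(1)
 by (intro degree_add_le order_trans[OF degree_smult_le]) (auto simp: degree_pCons_eq_if)
 have U: "open {t. \<bar>t - tau0 r * s\<bar> < hh}" by (intro open_Collect_less continuous_intros)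
 have eq: "DD r s x = poly p x" if "x : {t. \<bar>t - tau0 r * s\<bar> < hh}" for x
 proof -
 have k: "kap ((x - tau0 r * s)/hh) = 1" using that hh by (intro kap_1) (simp add: abs_divide)
 have q: "chi s*KK r*poly M x = chi s*QQ r s x"
 by (simp add: M_def QQ_def poly_prod algebra_simps)
 have "DD r s x = s^2 + x^2 + chi s*(QQ r s x - b0 r s x)" by (simp add: DD_def PP_def k)
 thus ?thesis unfolding p_def M_def[symmetric] poly_add poly_smult q
 by (simp add: b0_def power2_eq_square algebra_simps)
 qed
 have "(deriv ^^ r) (DD r s) t = fact r*coeff p r"
 proof -
 have "(deriv ^^ r) (DD r s) t = (deriv ^^ r) (poly p) t"
 by (rule derivs_cong[OF U eq]) (use 3 in simp_all)
 thus ?thesis using pder_const[OF dp] by (simp add: derivs_poly)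
 qed
 moreover have "0 < coeff p r"
 proof -
 have "coeff [:0, kap0 r * s:] r = 0" using r by (simp add: coeff_pCons split: nat.split)
 moreover have "0 <= coeff [:s^2, - (kap0 r * s), 1:] r" using r by (auto simp: coeff_pCons split: nat.split)
 hence "0 <= (1 - chi s)*coeff [:s^2, - (kap0 r * s), 1:] r"
 using chi_range[of s] by (intro mult_nonneg_nonneg) auto
 moreover have "0 < chi s*KK r*coeff M r" using dM(2) cp KK(1)[OF r] by simp
 ultimately show ?thesis unfolding p_def M_def[symmetric] coeff_add coeff_smult by linarith
 qed
 ultimately show False using high[of r] r by simp
 qed
 qed
qed

section \<open>The radial map that inserts the contact\<close>

definition Dv :: "nat => real^2 => real" where "Dv r w = DD r (w$1) (w$2)"
text \<open>Chosen so that \<open>ph\<close> followed by inversion at a lattice point is w -> w/Dv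
  w: the perturbed denominator replaces the squared norm, while rays are preserved.\<close>

definition H3 :: "nat => real^2 => real^2" where "H3 r w = (PP r (w$1) (w$2)/(w \<bullet> w)) *\<^sub>R w"
definition ph :: "nat => real^2 => real^2" where "ph r x = x + per (H3 r) x"

lemma inner2: "w \<bullet> w = (w$1)^2 + (w$2)^2" for w :: "real^2"
 by (simp add: inner_vec_def sum_2 power2_eq_square)

lemma Dv_eq: "Dv r w = w \<bullet> w + PP r (w$1) (w$2)"
 by (simp add: Dv_def DD_def inner2)

lemma PP_zero:
 fixes w :: "real^2"
 assumes "norm w <= 3/2 | 8 <= norm w" "2 <= r" shows "PP r (w$1) (w$2) = 0"
proof (rule ccontr)
 assume n: "PP r (w$1) (w$2) ~= 0"
 hence s: "\<bar>w$1 - 2\<bar> < 1/2" and z: "\<bar>w$2 - tau0 r*w$1\<bar> < 2*hh" using PP_support by auto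
 have "3/2 < w$1" "w$1 < 5/2" using s by linarith+
 moreover have "w$2 <= 5.1" "1.4 <= w$2" using support_bounds(3,4)[OF assms(2), of "w$1" "w$2"] s z by auto
 moreover have "\<bar>w$1\<bar> <= norm w" by (rule component_le_norm_cart)
 moreover have "norm w <= \<bar>w$1\<bar> + \<bar>w$2\<bar>" using norm2_le[of w 1] by (simp add: other)
 ultimately show False using assms by linarith
qed

lemma Dv_pos: "2 <= r ==> w ~= 0 ==> 0 < Dv r w"
 unfolding Dv_def by (rule DD_pos) (auto simp: vec_eq_iff forall_2)

lemma Cr_on_Dv: "Cr_on k (Dv r) UNIV"
 unfolding Dv_def[abs_def] by (intro Cr_on_DD Cr_on_intros open_UNIV)

lemma Cr_on_H3:
 assumes r: "2 <= r" shows "Cr_on k (H3 r) UNIV"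
proof (rule Cr_on_local[OF open_UNIV])
 fix x :: "real^2"
 have PPe: "PP r (w$1) (w$2) = Dv r w - w \<bullet> w" for w by (simp add: Dv_eq)
 show "EX V. x : V & Cr_on k (H3 r) V"
 proof (cases "norm x < 1")
 case True
 have "Cr_on k (H3 r) (ball 0 1)"
 using Cr_on_cong[of "ball 0 1" "H3 r" "%x. 0" k] PP_zero[OF _ r] by (simp add: H3_def Cr_on_const)
 thus ?thesis using True by (intro exI[of _ "ball 0 1"]) simp
 next
 case False
 have "Cr_on k (H3 r) (- {0})"
 unfolding H3_def[abs_def] PPe
 by (intro Cr_on_intros Cr_on_subset[OF Cr_on_Dv] open_Compl closed_singleton) auto
 thus ?thesis using False by (intro exI[of _ "- {0}"]) auto
 qed
qed

lemma H3_zero: "2 <= r ==> RR <= norm w ==> H3 r w = 0"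
 using PP_zero[of w r] RR_ge by (simp add: H3_def)

lemma Cr_on_ph: "2 <= r ==> Cr_on k (ph r) UNIV"
 unfolding ph_def[abs_def] by (intro Cr_on_intros Cr_on_per[OF open_UNIV H3_zero Cr_on_H3] open_UNIV) auto

lemma ph_near:
 assumes "l : LL" "norm w < 2*RR" "w ~= 0"
 shows "ph r (l + w) = l + (Dv r w/(w \<bullet> w)) *\<^sub>R w"
 using per_near[OF assms(1), of "l + w" "H3 r"] assms(2,3)
 by (simp add: ph_def H3_def Dv_eq add_divide_distrib algebra_simps)

lemma ph_far:
 assumes r: "2 <= r" and "!!l. l : LL ==> norm (x - l) <= 3/2 | 8 <= norm (x - l)"
 shows "ph r x = x"
proof (cases "EX l:LL. norm (x - l) < 2*RR")
 case True
 then obtain l where l: "l : LL" "norm (x - l) < 2*RR" by blast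
 have "H3 r (x - l) = 0" using PP_zero[of "x - l" r] assms l by (simp add: H3_def)
 thus ?thesis using per_near[OF l, of "H3 r"] by (simp add: ph_def)
qed (simp add: ph_def per_def)

definition ray :: "nat => real^2 => real => real" where "ray r u rh = Dv r (rh *\<^sub>R u)/rh"

lemma ray_deriv:
 assumes r: "2 <= r" and u: "u ~= 0" and rh: "0 < rh"
 shows "EX d. DERIV (ray r u) rh :> d & 0 < d"
proof -
 have "rh*u$1 ~= 0 | rh*u$2 ~= 0" using u rh by (auto simp: vec_eq_iff forall_2)
 then obtain d where d: "DERIV (%x. DD r (x*(rh*u$1)) (x*(rh*u$2))) 1 :> d" "DD r (rh*u$1) (rh*u$2) < d"
 using DD_radial[OF r] by blast
 have "DERIV (%x. x/rh) rh :> 1/rh" using rh by (auto intro!: derivative_eq_intros)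
 moreover have "rh/rh = 1" using rh by simp
 ultimately have "DERIV (%x. DD r (x/rh*(rh*u$1)) (x/rh*(rh*u$2))) rh :> d*(1/rh)"
 using d(1) by (intro DERIV_chain2[where f="%x. DD r (x*(rh*u$1)) (x*(rh*u$2))" and g="%x. x/rh"]) metis+
 moreover have "(%x. DD r (x/rh*(rh*u$1)) (x/rh*(rh*u$2))) = (%x. Dv r (x *\<^sub>R u))"
 using rh by (simp add: Dv_def fun_eq_iff)
 ultimately have D: "DERIV (%x. Dv r (x *\<^sub>R u)) rh :> d/rh" by (metis times_divide_eq_right mult.right_neutral)
 have "DERIV (ray r u) rh :> (d/rh*rh - Dv r (rh *\<^sub>R u)*1)/(rh*rh)"
 unfolding ray_def[abs_def] by (rule DERIV_divide[OF D DERIV_ident]) (use rh in simp)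
 moreover have "0 < (d/rh*rh - Dv r (rh *\<^sub>R u)*1)/(rh*rh)" using d(2) rh by (simp add: Dv_def)
 ultimately show ?thesis by blast
qed

lemma ray_mono: "2 <= r ==> u ~= 0 ==> 0 < a ==> a < b ==> ray r u a < ray r u b"
 by (rule DERIV_pos_imp_increasing) (use ray_deriv in \<open>auto dest: less_le_trans\<close>)

lemma ray_id: "2 <= r ==> norm u = 1 ==> 0 < rh ==> rh <= 3/2 | 8 <= rh ==> ray r u rh = rh"
proof -
 assume r: "2 <= r" and u: "norm u = 1" and d: "0 < rh" "rh <= 3/2 | 8 <= rh"
 have "PP r ((rh *\<^sub>R u)$1) ((rh *\<^sub>R u)$2) = 0" by (rule PP_zero[OF _ r]) (use u d in simp)
 moreover have "u \<bullet> u = 1" using u by (simp add: norm_eq_1)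
 ultimately show ?thesis using d by (simp add: ray_def Dv_eq)
qed

lemma ph_ray:
 assumes "l : LL" "norm u = 1" "0 < rh" "rh < 2*RR"
 shows "ph r (l + rh *\<^sub>R u) = l + ray r u rh *\<^sub>R u"
proof -
 have "ph r (l + rh *\<^sub>R u) = l + (Dv r (rh *\<^sub>R u)/((rh *\<^sub>R u) \<bullet> (rh *\<^sub>R u))) *\<^sub>R rh *\<^sub>R u"
 by (rule ph_near) (use assms in auto)
 moreover have "u \<bullet> u = 1" using assms by (simp add: norm_eq_1)
 ultimately show ?thesis using assms by (simp add: ray_def)
qed

text \<open>On each ray \<open>ph\<close> is increasing and fixes radii up to 3/2 and from 8 on, so
  discs of these radii are preserved exactly; the perturbation is confined to the annulus
  between.\<close>

lemma ph_ball:
 assumes r: "2 <= r" and l: "l : LL" and d: "0 < d" "d <= 3/2 | 8 <= d" "d < RR"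
 shows "norm (ph r x - l) < d \<longleftrightarrow> norm (x - l) < d"
proof (cases "EX m:LL. norm (x - m) < 8")
 case False
 hence "ph r x = x" by (intro ph_far[OF r]) force
 thus ?thesis by simp
next
 case True
 then obtain m where m: "m : LL" "norm (x - m) < 8" by blast
 show ?thesis
 proof (cases "x = m")
 case True
 have "ph r x = x"
 proof (rule ph_far[OF r])
 fix k assume k: "k : LL"
 show "norm (x - k) <= 3/2 | 8 <= norm (x - k)"
 using LL_sep[OF LL_diff[OF m(1) k]] True RR_ge by (cases "m = k") (auto simp: not_less[symmetric])
 qed
 thus ?thesis by simp
 next
 case False
 define rh where "rh = norm (x - m)"
 define u where "u = (1/rh) *\<^sub>R (x - m)"
 have rh: "0 < rh" "rh < 8" and u: "norm u = 1" and x: "x = m + rh *\<^sub>R u" using False m by (auto simp: rh_def u_def)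
 have px: "ph r x = m + ray r u rh *\<^sub>R u" unfolding x by (rule ph_ray) (use m u rh RR_ge in auto)
 have u0: "u ~= 0" using u by auto
 have rp: "0 < ray r u rh" using Dv_pos[OF r, of "rh *\<^sub>R u"] u0 rh by (simp add: ray_def)
 have r8: "ray r u rh < 8" using ray_mono[OF r u0 rh] ray_id[OF r u, of 8] by simp
 have np: "norm (ph r x - m) = ray r u rh" using px u rp by simp
 show ?thesis
 proof (cases "m = l")
 case True
 have "ray r u rh < d \<longleftrightarrow> rh < d"
 using ray_mono[OF r u0 rh(1), of d] ray_mono[OF r u0 d(1), of rh] ray_id[OF r u d(1,2)]
 by (metis less_asym linorder_neqE_linordered_idom less_irrefl)
 thus ?thesis using np True by (simp add: rh_def)
 next
 case False
 hence s: "4*RR <= norm (m - l)" using LL_sep[OF LL_diff[OF m(1) l]] by force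
 have "norm (m - l) <= norm (y - l) + norm (y - m)" for y
 using norm_triangle_ineq4[of "y - l" "y - m"] by simp
 from this[of x] this[of "ph r x"] show ?thesis using s m np r8 d RR_ge by linarith
 qed
 qed
qed

lemma ph_bij:
 assumes r: "2 <= r" shows "bij (ph r)"
proof (rule bijI)
 have dec: "EX rh u. 0 < rh & norm u = 1 & w = rh *\<^sub>R u & rh = norm w" if "w ~= 0" for w :: "real^2"
 using that by (intro exI[of _ "norm w"] exI[of _ "(1/norm w) *\<^sub>R w"]) auto
 have far: "ph r x = x" if "!!m. m : LL ==> ~ norm (x - m) < 8" for x
 by (rule ph_far[OF r]) (use that in force)
 have ctr: "ph r m = m" if m: "m : LL" for m
 proof (rule ph_far[OF r])
 fix k assume k: "k : LL"
 show "norm (m - k) <= 3/2 | 8 <= norm (m - k)"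
 using LL_sep[OF LL_diff[OF m k]] RR_ge by (cases "m = k") (auto simp: not_less[symmetric])
 qed
 show "inj (ph r)"
 proof (rule injI)
 fix x y assume e: "ph r x = ph r y"
 show "x = y"
 proof (cases "EX m:LL. norm (x - m) < 8")
 case False
 hence "~ norm (y - m) < 8" if "m : LL" for m
 using ph_ball[OF r that, of 8 x] ph_ball[OF r that, of 8 y] e that RR_ge by auto
 thus ?thesis using far[of x] far[of y] False e by metis
 next
 case True
 then obtain m where m: "m : LL" "norm (x - m) < 8" by blast
 hence y: "norm (y - m) < 8" using ph_ball[OF r m(1), of 8 x] ph_ball[OF r m(1), of 8 y] e RR_ge by auto
 have val: "ph r z ~= m" if z: "norm (z - m) < 8" "z ~= m" for z
 proof -
 obtain rh u where p: "0 < rh" "norm u = 1" "z - m = rh *\<^sub>R u" "rh = norm (z - m)" using dec[of "z - m"] z(2) by (metis right_minus_eq)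
 have zz: "m + rh *\<^sub>R u = z" using p(3) by (metis add.commute diff_add_cancel)
 have "ph r (m + rh *\<^sub>R u) = m + ray r u rh *\<^sub>R u"
 by (rule ph_ray[OF m(1) p(2,1)]) (use p(4) z(1) RR_ge in linarith)
 hence pz: "ph r z = m + ray r u rh *\<^sub>R u" unfolding zz .
 have u0: "u ~= 0" using p(2) by auto
 have "0 < Dv r (rh *\<^sub>R u)" by (rule Dv_pos[OF r]) (use p(1) u0 in simp)
 hence "ray r u rh ~= 0" using p(1) by (simp add: ray_def)
 thus ?thesis unfolding pz using u0 by simp
 qed
 show ?thesis
 proof (cases "x = m | y = m")
 case True
 thus ?thesis using val[of x] val[of y] ctr[OF m(1)] e m y by metis
 next
 case False
 obtain rh u where p: "0 < rh" "norm u = 1" "x - m = rh *\<^sub>R u" "rh = norm (x - m)" using dec[of "x - m"] False by (metis right_minus_eq)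
 obtain rh' u' where p': "0 < rh'" "norm u' = 1" "y - m = rh' *\<^sub>R u'" "rh' = norm (y - m)" using dec[of "y - m"] False by (metis right_minus_eq)
 have x: "x = m + rh *\<^sub>R u" "y = m + rh' *\<^sub>R u'" using p(3) p'(3) by (simp_all add: algebra_simps)
 have px: "ph r x = m + ray r u rh *\<^sub>R u" unfolding x by (rule ph_ray[OF m(1) p(2,1)]) (use p(4) m(2) RR_ge in linarith)
 have py: "ph r y = m + ray r u' rh' *\<^sub>R u'" unfolding x by (rule ph_ray[OF m(1) p'(2,1)]) (use p'(4) y RR_ge in linarith)
 have eq: "ray r u rh *\<^sub>R u = ray r u' rh' *\<^sub>R u'" using e px py by simp
 have u0: "u ~= 0" "u' ~= 0" using p(2) p'(2) by auto
 have rp: "0 < ray r u rh" "0 < ray r u' rh'"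
 using Dv_pos[OF r, of "rh *\<^sub>R u"] Dv_pos[OF r, of "rh' *\<^sub>R u'"] u0 p(1) p'(1) by (auto simp: ray_def)
 hence req: "ray r u rh = ray r u' rh'" using eq p(2) p'(2) by (metis abs_of_pos mult.right_neutral norm_scaleR)
 hence uu: "u = u'" using eq rp by simp
 hence "rh = rh'" using req ray_mono[OF r u0(1) p(1), of rh'] ray_mono[OF r u0(1) p'(1), of rh]
 by (metis less_irrefl linorder_neqE_linordered_idom)
 thus ?thesis using x uu by simp
 qed
 qed
 qed
 have "EX x. ph r x = z" for z
 proof (cases "EX m:LL. norm (z - m) < 8")
 case False
 thus ?thesis using far[of z] by blast
 next
 case True
 then obtain m where m: "m : LL" "norm (z - m) < 8" by blast
 show ?thesis
 proof (cases "norm (z - m) <= 1")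
 case True
 have "ph r z = z"
 proof (rule ph_far[OF r])
 fix k assume k: "k : LL"
 have "norm (m - k) <= norm (z - k) + norm (z - m)" using norm_triangle_ineq4[of "z - k" "z - m"] by simp
 thus "norm (z - k) <= 3/2 | 8 <= norm (z - k)"
 using LL_sep[OF LL_diff[OF m(1) k]] RR_ge True by (cases "m = k") (auto simp: not_less[symmetric])
 qed
 thus ?thesis by blast
 next
 case False
 hence "z - m ~= 0" by auto
 from dec[OF this] obtain rh u where p: "0 < rh" "norm u = 1" "z - m = rh *\<^sub>R u" "rh = norm (z - m)" by blast
 have u0: "u ~= 0" using p(2) by auto
 have c: "isCont (ray r u) x" if "1 <= x" for x using ray_deriv[OF r u0, of x] that DERIV_isCont by force
 have "EX x>=1. x <= 8 & ray r u x = rh"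
 by (rule IVT) (use ray_id[OF r p(2), of 1] ray_id[OF r p(2), of 8] c False p(4) m(2) in auto)
 then obtain x where x: "1 <= x" "x <= 8" "ray r u x = rh" by blast
 have "ph r (m + x *\<^sub>R u) = m + ray r u x *\<^sub>R u" by (rule ph_ray[OF m(1) p(2)]) (use x RR_ge in linarith)+
 also have "... = z" using x p(3) by (simp add: algebra_simps)
 finally show ?thesis by blast
 qed
 qed
 thus "surj (ph r)" unfolding surj_def by metis
qed

text \<open>The formula for the derivative forces a kernel vector to be a multiple of w, and on w
  the derivative is a positive multiple of w because the radius grows along the ray.\<close>

lemma ph_immersion:
 assumes r: "2 <= r" and D: "(ph r has_derivative D) (at x)" and v: "D v = 0"
 shows "v = 0"
proof (cases "EX l:LL. 0 < norm (x - l) & norm (x - l) < 2*RR")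
 case True
 then obtain l where l: "l : LL" "0 < norm (x - l)" "norm (x - l) < 2*RR" by blast
 define w where "w = x - l"
 have w0: "w ~= 0" using l by (auto simp: w_def)
 have xw: "x = l + w" by (simp add: w_def)
 let ?q = "%y. Dv r y/(y \<bullet> y)"
 have "Cr_on 1 ?q (- {0})"
 by (intro Cr_on_intros Cr_on_subset[OF Cr_on_Dv] open_Compl closed_singleton) auto
 from Cr_on_SucD(1)[of 0 ?q "- {0}" w, OF _ ] this w0
 obtain Q where Q: "(?q has_derivative Q) (at w)" by auto
 have I: "((%y. y - l) has_derivative (%h. h)) (at x)" by (auto intro!: derivative_eq_intros)
 have Qx: "((%y. ?q (y - l)) has_derivative Q) (at x)"
 by (rule has_derivative_compose[OF I, where g="?q"]) (use Q in \<open>unfold w_def\<close>)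
 have "((%y. l + ?q (y - l) *\<^sub>R (y - l)) has_derivative (%h. ?q w *\<^sub>R h + Q h *\<^sub>R w)) (at x)"
 using has_derivative_add[OF has_derivative_const has_derivative_scaleR[OF Qx I]] by (simp add: w_def)
 moreover have o: "open (ball l (2*RR) - {l})" "x : ball l (2*RR) - {l}"
 using l by (auto simp: dist_norm norm_minus_commute)
 ultimately have "(ph r has_derivative (%h. ?q w *\<^sub>R h + Q h *\<^sub>R w)) (at x)"
 proof (rule has_derivative_transform_within_open)
 fix y assume "y : ball l (2*RR) - {l}"
 thus "l + ?q (y - l) *\<^sub>R (y - l) = ph r y"
 using ph_near[OF l(1), of "y - l" r] by (auto simp: dist_norm norm_minus_commute)
 qed
 hence De: "D = (%h. ?q w *\<^sub>R h + Q h *\<^sub>R w)" using D has_derivative_unique by blast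
 have lQ: "linear Q" using Q by (rule has_derivative_linear)
 have qp: "0 < ?q w" using Dv_pos[OF r w0] w0 by simp
 have "?q w *\<^sub>R v = - Q v *\<^sub>R w" using v De by (simp add: eq_neg_iff_add_eq_0)
 moreover have "v = (c/q) *\<^sub>R w" if "0 < q" "q *\<^sub>R v = c *\<^sub>R w" for q c
 proof -
 have "v = (1/q) *\<^sub>R (q *\<^sub>R v)" using that(1) by simp
 thus ?thesis using that(2) by simp
 qed
 ultimately have "v = (- Q v/?q w) *\<^sub>R w" using qp by blast
 then obtain a where a: "v = a *\<^sub>R w" by blast
 have Qw: "0 < ?q w + Q w"
 proof -
 obtain d where d: "DERIV (ray r w) 1 :> d" "0 < d" using ray_deriv[OF r w0, of 1] by auto
 have "((%rh. rh*?q (rh *\<^sub>R w)) has_derivative (%h. h*?q w + Q (h *\<^sub>R w))) (at 1)"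
 proof -
 have "((%rh. ?q (rh *\<^sub>R w)) has_derivative (%h. Q (h *\<^sub>R w))) (at 1)"
 proof (rule has_derivative_compose[where g="?q"])
 show "((%rh. rh *\<^sub>R w) has_derivative (%h. h *\<^sub>R w)) (at 1)" by (auto intro!: derivative_eq_intros)
 show "(?q has_derivative Q) (at (1 *\<^sub>R w))" by (subst scaleR_one) (rule Q)
 qed
 from has_derivative_mult[OF has_derivative_ident this] show ?thesis by (simp add: add.commute)
 qed
 moreover have "h*?q w + Q (h *\<^sub>R w) = (?q w + Q w)*h" for h
 by (simp add: linear_scale[OF lQ] algebra_simps)
 ultimately have "DERIV (%rh. rh*?q (rh *\<^sub>R w)) 1 :> ?q w + Q w"
 unfolding has_field_derivative_def by (simp add: fun_eq_iff)
 hence "DERIV (%rh. (rh*?q (rh *\<^sub>R w))*(w \<bullet> w)) 1 :> (?q w + Q w)*(w \<bullet> w)" by (rule DERIV_cmult_right)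
 hence "DERIV (ray r w) 1 :> (?q w + Q w)*(w \<bullet> w)"
 by (rule has_field_derivative_transform_within_open[where S="{0<..}"]) (use w0 in \<open>auto simp: ray_def power2_eq_square\<close>)
 hence "(?q w + Q w)*(w \<bullet> w) = d" using d DERIV_unique by blast
 thus ?thesis using d w0 by (metis inner_gt_zero_iff zero_less_mult_pos2)
 qed
 have "D v = (a*(?q w + Q w)) *\<^sub>R w" unfolding De a by (simp add: linear_scale[OF lQ] algebra_simps)
 hence "a = 0" using v w0 Qw by simp
 thus "v = 0" using a by simp
next
 case False
 have ex: "EX V. open V & x : V & (ALL y:V. ph r y = y)"
 proof (cases "x : LL")
 case True
 have "ph r y = y" if "y : ball x 1" for y
 proof (rule ph_far[OF r])
 fix k assume k: "k : LL"
 have "norm (x - k) <= norm (x - y) + norm (y - k)" using norm_triangle_ineq[of "x - y" "y - k"] by simp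
 thus "norm (y - k) <= 3/2 | 8 <= norm (y - k)"
 using LL_sep[OF LL_diff[OF True k]] that RR_ge by (cases "x = k") (auto simp: dist_norm norm_minus_commute not_less[symmetric])
 qed
 thus ?thesis by (intro exI[of _ "ball x 1"]) auto
 next
 case nl: False
 have "x : Dmo 8" unfolding Dmo_iff
 proof
 fix l assume l: "l : LL"
 hence "0 < norm (x - l)" using nl by auto
 hence "2*RR <= norm (x - l)" using False l by force
 thus "8 < norm (x - l)" using RR_ge by linarith
 qed
 thus ?thesis using ph_far[OF r] open_Dmo by (intro exI[of _ "Dmo 8"]) (force simp: Dmo_iff)
 qed
 then obtain V where V: "open V" "x : V" "ALL y:V. ph r y = y" by blast
 have "(ph r has_derivative (%h. h)) (at x)"
 by (rule has_derivative_transform_within_open[OF has_derivative_ident V(1,2)]) (use V(3) in simp)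
 thus ?thesis using D v has_derivative_unique by metis
qed

section \<open>The map of the lower sheet\<close>

definition gj :: "real^2 => real^2" where "gj = inv (ff 2)"
definition fm :: "nat => real^2 => real^2" where "fm r x = gj (ph r x)"

lemma lam_gt: "1/18 < lam"
proof -
 have "1 = mu*lam" using mu_lam by simp
 also have "... < 18*lam" using mu_bounds lam_bounds by (intro mult_strict_right_mono) auto
 finally show ?thesis by simp
qed

lemma lam_gt_RR: "1/RR < lam"
proof -
 have "1/RR <= 1/100" using RR_ge by (intro divide_left_mono) auto
 thus ?thesis using lam_gt by simp
qed

lemma ff_gj: "ff 2 (gj x) = x" and gj_ff: "gj (ff 2 x) = x"
 using ff_bij[of 2] by (simp_all add: gj_def bij_is_surj surj_f_inv_f bij_is_inj)

lemma gj_periodic: "l : LL ==> gj (x + l) = gj x + Lat 1 l"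
proof -
 assume l: "l : LL"
 have "ff 2 (gj x + Lat 1 l) = x + l"
 using ff_periodic[OF Lat_LL[OF l], of 2 "gj x" 1] Lat_inverse[of 2 l] by (simp add: other ff_gj)
 thus ?thesis using gj_ff by metis
qed

lemma ph_periodic: "l : LL ==> ph r (x + l) = ph r x + l"
 using per_periodic[of l "H3 r" x] by (simp add: ph_def algebra_simps)

lemma fm_periodic: "l : LL ==> fm r (x + l) = fm r x + Lat 1 l"
 by (simp add: fm_def ph_periodic gj_periodic)

lemma comp_norm: "norm (w :: real^2) <= c ==> \<bar>w $ j\<bar> <= c"
 using component_le_norm_cart[of w j] by linarith

lemma gj_linear:
 assumes l: "l : LL" and u: "norm u <= 2*mu" shows "gj (l + u) = Lat 1 l + lam *\<^sub>R u"
proof -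
 have b: "\<bar>(lam *\<^sub>R u) $ j\<bar> <= 2" for j
 proof -
 have "\<bar>(lam *\<^sub>R u) $ j\<bar> <= lam*(2*mu)"
 using comp_norm[OF u, of j] lam_bounds by (simp add: abs_mult)
 thus ?thesis using mu_lam by (simp add: mult.left_commute)
 qed
 have "ff 2 (Lat 1 l + lam *\<^sub>R u) = Lat 2 (Lat 1 l) + mu *\<^sub>R (Lat 1 l + lam *\<^sub>R u - Lat 1 l)"
 by (rule ff_linear) (use b Lat_LL[OF l] in \<open>simp_all add: \<close>)
 also have "... = l + u" using Lat_inverse[of 2 l] mu_lam by (simp add: other)
 finally show ?thesis using gj_ff by metis
qed

lemma gj_norm:
 assumes l: "l : LL" and d: "0 <= d" "d <= 2"
 shows "norm (gj x - Lat 1 l) < d \<longleftrightarrow> norm (x - l) < mu*d"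
 "norm (gj x - Lat 1 l) <= d \<longleftrightarrow> norm (x - l) <= mu*d"
proof -
 have m: "0 < mu" using mu_bounds by simp
 have eq: "norm (x - l) = mu*norm (gj x - Lat 1 l)"
 if "norm (gj x - Lat 1 l) <= d | norm (x - l) <= mu*d"
 proof (cases "norm (x - l) <= mu*d")
 case True
 have "mu*d <= mu*2" using d m by (intro mult_left_mono) auto
 hence "gj (l + (x - l)) = Lat 1 l + lam *\<^sub>R (x - l)" using True by (intro gj_linear[OF l]) linarith
 hence "norm (gj x - Lat 1 l) = lam*norm (x - l)" using lam_bounds by simp
 thus ?thesis using mu_lam by (simp add: mult.assoc[symmetric])
 next
 case False
 hence n: "norm (gj x - Lat 1 l) <= 2" using that d by linarith
 have "ff 2 (gj x) = Lat 2 (Lat 1 l) + mu *\<^sub>R (gj x - Lat 1 l)"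
 by (rule ff_linear[OF Lat_LL[OF l]]) (rule comp_norm[OF n])+
 hence "x = l + mu *\<^sub>R (gj x - Lat 1 l)" using Lat_inverse[of 2 l] by (simp add: other ff_gj)
 hence "x - l = mu *\<^sub>R (gj x - Lat 1 l)" by (metis add_diff_cancel_left')
 thus ?thesis using m by simp
 qed
 show "norm (gj x - Lat 1 l) < d \<longleftrightarrow> norm (x - l) < mu*d"
 using eq m by (metis less_imp_le mult_less_cancel_left_pos)
 show "norm (gj x - Lat 1 l) <= d \<longleftrightarrow> norm (x - l) <= mu*d"
 using eq m by (metis mult_le_cancel_left_pos)
qed

lemma fp_norm:
 assumes l: "l : LL" and d: "0 <= d" "d <= 2"
 shows "norm (ff 1 x - Lat 1 l) < mu*d \<longleftrightarrow> norm (x - l) < d"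
proof -
 have m: "0 < mu" using mu_bounds by simp
 have eq: "norm (ff 1 x - Lat 1 l) = mu*norm (x - l)"
 if "norm (ff 1 x - Lat 1 l) < mu*d | norm (x - l) < d"
 proof -
 have "\<bar>(x - l) $ j\<bar> <= 2" for j
 proof (cases "norm (x - l) < d")
 case True
 thus ?thesis using d by (intro comp_norm) linarith
 next
 case False
 hence "norm (ff 1 x - Lat 1 l) <= mu*d" using that by linarith
 also have "... <= mu*2" using d m by (intro mult_left_mono) auto
 finally have "norm (ff 1 x - Lat 1 l) <= 2*mu" by simp
 from ff_box[OF l comp_norm[OF this] comp_norm[OF this] order_refl, of j] show ?thesis using m by simp
 qed
 from ff_linear[OF l this[of 1] this[of 2], of 1] show ?thesis using m by simp
 qed
 show ?thesis using eq m by (metis mult_less_cancel_left_pos)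
qed

text \<open>The closed unit disc is the intersection of the open discs with radii between 1 and 3/2,
  all preserved by \<open>ph_ball\<close>.\<close>

lemma ph_ball_le:
 assumes r: "2 <= r" and l: "l : LL"
 shows "norm (ph r x - l) <= 1 \<longleftrightarrow> norm (x - l) <= 1"
proof -
 have eq: "(a::real) <= 1 \<longleftrightarrow> (ALL d. 1 < d & d < 3/2 --> a < d)" for a
 proof
 assume h: "ALL d. 1 < d & d < 3/2 --> a < d"
 show "a <= 1"
 proof (rule ccontr)
 assume "~ a <= 1"
 moreover have "a < 5/4" using h[rule_format, of "5/4"] by simp
 ultimately show False using h[rule_format, of a] by simp
 qed
 qed auto
 have "norm (ph r x - l) < d \<longleftrightarrow> norm (x - l) < d" if "1 < d & d < 3/2" for d
 by (rule ph_ball[OF r l]) (use that RR_ge in auto)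
 thus ?thesis unfolding eq by blast
qed

lemma Dm_not: "x : Dm d \<longleftrightarrow> (ALL l:LL. ~ norm (x - l) < d)"
 by (auto simp: Dm_def not_less)

lemma Lat_surj: "l : LL ==> EX m:LL. l = Lat 1 m"
 using Lat_LL[of l 2] Lat_inverse[of 1 l] unfolding other by metis

lemma all_LL_Lat: "(ALL l:LL. P l) \<longleftrightarrow> (ALL l:LL. P (Lat 1 l))"
 using Lat_surj Lat_LL by metis

lemma fp_Dm: "0 <= d ==> d <= 2 ==> ff 1 x : Dm (mu*d) \<longleftrightarrow> x : Dm d"
 unfolding Dm_not by (subst all_LL_Lat) (simp add: fp_norm)

lemma fm_Dm:
 assumes r: "2 <= r" and d: "0 < d" "d <= 2" "mu*d <= 3/2 | 8 <= mu*d"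
 shows "fm r x : Dm d \<longleftrightarrow> x : Dm (mu*d)"
proof -
 have "mu*d <= 18*2" using d mu_bounds by (intro mult_mono) auto
 hence "norm (ph r x - l) < mu*d \<longleftrightarrow> norm (x - l) < mu*d" if "l : LL" for l
 using that d mu_bounds RR_ge by (intro ph_ball[OF r]) auto
 thus ?thesis unfolding Dm_not fm_def using d by (subst all_LL_Lat) (simp add: gj_norm)
qed

lemma fm_Dmo:
 assumes r: "2 <= r" shows "fm r x : Dmo lam \<longleftrightarrow> x : Dmo 1"
proof -
 have "norm (fm r x - Lat 1 l) <= lam \<longleftrightarrow> norm (x - l) <= 1" if "l : LL" for l
 unfolding fm_def using gj_norm(2)[OF that, of lam "ph r x"] lam_bounds mu_lam ph_ball_le[OF r that, of x] by simp
 thus ?thesis unfolding Dmo_iff not_le[symmetric] by (subst all_LL_Lat) simp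
qed

lemma fm_near:
 assumes r: "2 <= r" and l: "l : LL" and w: "0 < norm w" "norm w <= 24"
 shows "fm r (l + w) = Lat 1 l + (lam*Dv r w/(w \<bullet> w)) *\<^sub>R w" "norm (fm r (l + w) - Lat 1 l) < 2"
proof -
 have p: "ph r (l + w) = l + (Dv r w/(w \<bullet> w)) *\<^sub>R w" by (rule ph_near[OF l]) (use w RR_ge in auto)
 have n: "norm (ph r (l + w) - l) < 25"
 by (subst ph_ball[OF r l]) (use w RR_ge in auto)
 hence "norm ((Dv r w/(w \<bullet> w)) *\<^sub>R w) < 25" unfolding p by simp
 hence "gj (l + (Dv r w/(w \<bullet> w)) *\<^sub>R w) = Lat 1 l + lam *\<^sub>R (Dv r w/(w \<bullet> w)) *\<^sub>R w"
 by (intro gj_linear[OF l]) (use mu_bounds in linarith)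
 thus "fm r (l + w) = Lat 1 l + (lam*Dv r w/(w \<bullet> w)) *\<^sub>R w" by (simp add: fm_def p)
 show "norm (fm r (l + w) - Lat 1 l) < 2" unfolding fm_def
 by (subst gj_norm(1)[OF l]) (use n mu_bounds in auto)
qed

lemma fp_near: "l : LL ==> norm w <= 2 ==> ff 1 (l + w) = Lat 1 l + mu *\<^sub>R w"
 using ff_linear[of l "l + w" 1] comp_norm[of w 2] by simp

lemma bij_fm: "2 <= r ==> bij (fm r)"
proof -
 assume r: "2 <= r"
 have "bij gj" unfolding gj_def by (rule bij_imp_bij_inv[OF ff_bij])
 hence "bij (gj \<circ> ph r)" using ph_bij[OF r] by (rule bij_comp[rotated])
 thus ?thesis by (simp add: fm_def[abs_def] comp_def)
qed

section \<open>The diffeomorphism of the glued surface\<close>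

text \<open>Points of the common circles count as upper points. The chosen preimage matters only up
  to a lattice vector, and the maps are equivariant under these.\<close>

definition fS :: "nat => real^4 => real^4" where
 "fS r p = (if p : EE 1 ` Dm 1 then EE 1 (ff 1 (SOME x. x : Dm 1 & EE 1 x = p))
 else EE (- 1) (fm r (SOME x. x : Dm 1 & EE (- 1) x = p)))"

lemma one_RR: "1/RR < 1/2" using RR_ge by (simp add: field_simps)

lemma Dm_RR: "x : Dm d ==> 1/2 <= d ==> x : Dm (1/RR)"
 using Dm_mono[of x d "1/RR"] one_RR by linarith

lemma fS_plus0:
 assumes x: "x : Dm 1" shows "fS r (EE 1 x) = EE 1 (ff 1 x)"
proof -
 define y where "y = (SOME y. y : Dm 1 & EE 1 y = EE 1 x)"
 have y: "y : Dm 1" "EE 1 y = EE 1 x" using someI[of "%y. y : Dm 1 & EE 1 y = EE 1 x" x] x by (auto simp: y_def)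
 have l: "y - x : LL" using EE_inj[OF Dm_RR Dm_RR, of y 1 x 1 1] x y by simp
 have "fS r (EE 1 x) = EE 1 (ff 1 y)" using x by (simp add: fS_def y_def)
 also have "ff 1 y = ff 1 x + Lat 1 (y - x)" using ff_periodic[OF l, of 1 x] by simp
 finally show ?thesis using EE_periodic[OF Lat_LL[OF l]] by simp
qed

lemma fS_minus0:
 assumes x: "x : Dmo 1" shows "fS r (EE (- 1) x) = EE (- 1) (fm r x)"
proof -
 define y where "y = (SOME y. y : Dm 1 & EE (- 1) y = EE (- 1) x)"
 have x1: "x : Dm 1" using x by (rule Dmo_Dm)
 have y: "y : Dm 1" "EE (- 1) y = EE (- 1) x"
 using someI[of "%y. y : Dm 1 & EE (- 1) y = EE (- 1) x" x] x1 by (auto simp: y_def)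
 have l: "y - x : LL" using EE_inj[OF Dm_RR Dm_RR, of y 1 x 1 "- 1"] x1 y by simp
 have "EE (- 1) x ~: EE 1 ` Dm 1" using EE_disjoint[OF _ x, of _ 1] by (auto dest: sym)
 hence "fS r (EE (- 1) x) = EE (- 1) (fm r y)" by (simp add: fS_def y_def)
 also have "fm r y = fm r x + Lat 1 (y - x)" using fm_periodic[OF l, of r x] by simp
 finally show ?thesis using EE_periodic[OF Lat_LL[OF l]] by simp
qed

lemma inv2_bounds:
 assumes "3/4 <= norm w" "norm w <= 4/3"
 shows "3/4 <= norm (inv2 w)" "norm (inv2 w) <= 4/3" "w ~= 0" "norm w < 2*RR" "1/norm w < 2*RR"
proof -
 show w: "w ~= 0" using assms by auto
 show "3/4 <= norm (inv2 w)" "norm (inv2 w) <= 4/3" using assms w by (simp_all add: inv2 field_simps)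
 thus "1/norm w < 2*RR" using RR_ge by (simp add: inv2)
 show "norm w < 2*RR" using assms RR_ge by simp
qed

lemma inv2_ge1: "3/4 <= norm w ==> norm w <= 1 ==> 1 <= norm (inv2 w)"
 "3/4 <= norm w ==> norm w < 1 ==> 1 < norm (inv2 w)"
 using inv2(1)[of w] less_divide_eq_1_pos[of "norm w" 1] le_divide_eq_1_pos[of "norm w" 1] by linarith+

text \<open>On this annulus both maps are homotheties relative to the lattice point, by
  \<open>mu\<close> above and by \<open>lam\<close> below, since \<open>PP\<close> vanishes there.
  Inversion conjugates one to the other because lam = 1/mu.\<close>

lemma compat:
 assumes r: "2 <= r" and l: "l : LL" and w: "3/4 <= norm w" "norm w <= 4/3"
 shows "EE 1 (ff 1 (l + w)) = EE (- 1) (fm r (l + inv2 w))"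
proof -
 note b = inv2_bounds[OF w]
 have "PP r (inv2 w $ 1) (inv2 w $ 2) = 0" by (rule PP_zero[OF _ r]) (use b in auto)
 moreover have "inv2 w ~= 0" using inv2(3)[OF b(3)] .
 ultimately have "fm r (l + inv2 w) = Lat 1 l + lam *\<^sub>R inv2 w"
 using fm_near(1)[OF r l, of "inv2 w"] b by (simp add: Dv_eq)
 moreover have "ff 1 (l + w) = Lat 1 l + mu *\<^sub>R w" using fp_near[OF l] w by simp
 moreover have "EE 1 (Lat 1 l + mu *\<^sub>R w) = EE (- 1) (Lat 1 l + inv2 (mu *\<^sub>R w))"
 proof -
 have "mu*norm w <= 18*(4/3)" using w mu_bounds by (intro mult_mono) auto
 moreover have "17*(3/4) <= mu*norm w" using w mu_bounds by (intro mult_mono) auto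
 moreover have "1/(mu*norm w) <= 1/(17*(3/4))" using \<open>17 * (3/4) <= mu * norm w\<close> by (intro divide_left_mono) auto
 ultimately show ?thesis
 using EE_flip[OF Lat_LL[OF l, of 1], of "mu *\<^sub>R w" "- 1"] b(3) mu_bounds RR_ge by simp
 qed
 moreover have "inv2 (mu *\<^sub>R w) = lam *\<^sub>R inv2 w"
 proof -
 have "lam = 1/mu" using mu_lam mu_bounds by (simp add: field_simps)
 thus ?thesis unfolding inv2_def \<open>lam = 1 / mu\<close> by simp
 qed
 ultimately show ?thesis by simp
qed

lemma Dm_cases:
 assumes "x : Dm (3/4)" "x ~: Dmo 1"
 obtains l w where "l : LL" "x = l + w" "3/4 <= norm w" "norm w <= 1"
proof -
 obtain l where l: "l : LL" "norm (x - l) <= 1" using assms(2) by (auto simp: Dmo_iff not_less)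
 thus ?thesis using that[of l "x - l"] assms(1) by (auto simp: Dm_def)
qed

text \<open>The formula of a sheet persists on a collar inside the unit circle. This overlap allows
  smoothness at the seam to be read off in a single chart.\<close>

lemma fS_plus:
 assumes r: "2 <= r" and x: "x : Dm (3/4)" shows "fS r (EE 1 x) = EE 1 (ff 1 x)"
proof (cases "x : Dm 1")
 case False
 then obtain l w where l: "l : LL" "x = l + w" "3/4 <= norm w" "norm w <= 1"
 using Dm_cases[OF x] Dmo_Dm by metis
 have w1: "norm w < 1"
 proof (rule ccontr)
 assume "~ norm w < 1"
 hence "l + w : Dm 1" using l RR_ge by (intro Dm_near) auto
 thus False using False l by simp
 qed
 note b = inv2_bounds[of w]
 have "1 < norm (inv2 w)" using w1 l inv2_ge1 by simp
 hence "l + inv2 w : Dmo 1"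
 using Dm_Dmo[OF Dm_near[OF l(1), of "norm (inv2 w)" "inv2 w"]] b l RR_ge by auto
 from fS_minus0[OF this, of r] show ?thesis
 using compat[OF r l(1), of w] EE_flip[OF l(1), of w "-1"] b l by simp
qed (rule fS_plus0)

lemma fS_minus:
 assumes r: "2 <= r" and x: "x : Dm (3/4)" shows "fS r (EE (- 1) x) = EE (- 1) (fm r x)"
proof (cases "x : Dmo 1")
 case False
 then obtain l w where l: "l : LL" "x = l + w" "3/4 <= norm w" "norm w <= 1"
 using Dm_cases[OF x] by metis
 note b = inv2_bounds[of w] and b' = inv2_bounds[of "inv2 w"]
 have "1 <= norm (inv2 w)" using l inv2_ge1 by simp
 hence "l + inv2 w : Dm 1" using b l RR_ge by (intro Dm_near) auto
 from fS_plus0[OF this, of r] show ?thesis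
 using compat[OF r l(1), of "inv2 w"] EE_flip[OF l(1), of w 1] b l inv2(2)[of w] by simp
qed (rule fS_minus0)

text \<open>On the ring in the lower sheet that is mapped into the upper sheet, \<open>f\<close> reads
 \<open>w \<mapsto> (mu / Dv w) w\<close> relative to the lattice, from lower to upper coordinates.\<close>

definition TR :: "nat => real^2 => real^2" where "TR r w = (mu/Dv r w) *\<^sub>R w"

text \<open>The lower map sends the ring to vectors v of norm between 1/25 and 2 around the image
  lattice point; \<open>EE_flip\<close> reads them in the upper chart, where inversion of v gives
  \<open>TR\<close>.\<close>

lemma fS_ring:
 assumes r: "2 <= r" and l: "l : LL" and w: "3/4 <= norm w" "norm w <= 24"
 shows "fS r (EE (- 1) (l + w)) = EE 1 (Lat 1 l + TR r w)" "1/2 <= norm (TR r w)" "norm (TR r w) <= 25"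
proof -
 define v where "v = (lam*Dv r w/(w \<bullet> w)) *\<^sub>R w"
 have w0: "w ~= 0" using w by auto
 have D: "0 < Dv r w" by (rule Dv_pos[OF r w0])
 have "fS r (EE (- 1) (l + w)) = EE (- 1) (Lat 1 l + v)"
 using fS_minus[OF r Dm_near[OF l w(1)]] fm_near(1)[OF r l, of w] w w0 RR_ge by (simp add: v_def)
 have nv: "norm (fm r (l + w) - Lat 1 l) = norm v" using fm_near(1)[OF r l, of w] w w0 by (simp add: v_def)
 hence n2: "norm v < 2" using fm_near(2)[OF r l, of w] w w0 by simp
 have "~ norm (l + w - l) < 3/4" using w by simp
 hence "~ norm (ph r (l + w) - l) < 3/4" using RR_ge by (subst ph_ball[OF r l]) auto
 moreover have "mu*(1/25) < 3/4" using mu_bounds by simp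
 ultimately have "~ norm (ph r (l + w) - l) < mu*(1/25)" by linarith
 hence n1: "1/25 <= norm v" using gj_norm(1)[OF l, of "1/25" "ph r (l + w)"] nv by (simp add: fm_def)
 have vT: "inv2 v = TR r w"
 proof -
 have m: "mu = 1/lam" using mu_lam lam_bounds by (simp add: field_simps)
 show ?thesis unfolding v_def TR_def inv2_def m using D w0 lam_bounds by (simp add: field_simps)
 qed
 have "0 < norm v" using n1 by linarith
 hence v0: "v ~= 0" and i: "1/norm v <= 25" "1/2 <= 1/norm v" using n1 n2 by (auto simp: field_simps)
 show "1/2 <= norm (TR r w)" "norm (TR r w) <= 25" using i by (simp_all add: vT[symmetric] inv2)
 have "EE (- 1) (Lat 1 l + v) = EE 1 (Lat 1 l + TR r w)"
 using EE_flip[OF Lat_LL[OF l, of 1] v0, of 1] i n2 RR_ge by (simp add: vT)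
 thus "fS r (EE (- 1) (l + w)) = EE 1 (Lat 1 l + TR r w)"
 using \<open>fS r (EE (- 1) (l + w)) = EE (- 1) (Lat 1 l + v)\<close> by simp
qed

lemma SS_cases:
 assumes "p : SS" obtains x where "x : Dm 1" "p = EE 1 x" | x where "x : Dmo 1" "p = EE (- 1) x"
proof -
 have "EX y:Dm 1. p = EE 1 y" if x: "x : Dm 1" "x ~: Dmo 1" "p = EE (- 1) x" for x
 proof -
 obtain l w where l: "l : LL" "x = l + w" "3/4 <= norm w" "norm w <= 1"
 using Dm_cases[of x] Dm_mono[OF x(1), of "3/4"] x(2) by auto
 note b = inv2_bounds[of w]
 have "1 <= norm (inv2 w)" using l inv2_ge1 by simp
 hence "l + inv2 w : Dm 1" using b l RR_ge by (intro Dm_near) auto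
 thus ?thesis using EE_flip[OF l(1), of w 1] b l x(3) by auto
 qed
 thus ?thesis using assms that unfolding SS_def by blast
qed

lemma fS_bij:
 assumes r: "2 <= r" shows "bij_betw (fS r) SS SS"
 unfolding bij_betw_def
proof (intro conjI equalityI subsetI)
 have mu1: "x : Dm 1 ==> ff 1 x : Dm mu" for x using fp_Dm[of 1 x] by simp
 have fpR: "x : Dm 1 ==> ff 1 x : Dm (1/RR)" for x using mu1[of x] Dm_RR mu_bounds by auto
 have fmR: "x : Dmo 1 ==> fm r x : Dm (1/RR)" for x
 using fm_Dmo[OF r, of x] Dm_mono[OF Dmo_Dm] lam_gt_RR by (meson less_imp_le)
 \<comment> \<open>Images of upper points are at distance at least \<open>mu\<close> from the
   lattice, images of open lower points beyond \<open>lam\<close>; inversion would bring the former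
   to distance at most 1/mu = lam.\<close>
 have X: False if xy: "x : Dm 1" "y : Dmo 1" "EE 1 (ff 1 x) = EE (- 1) (fm r y)" for x y
 proof -
 obtain l m w where w: "l : LL" "m : LL" "w ~= 0" "ff 1 x = l + w" "fm r y = m + inv2 w"
 using EE_cross[OF fpR[OF xy(1)] fmR[OF xy(2)], of 1] xy(3) by auto
 have "mu <= norm w" using mu1[OF xy(1)] w by (force simp: Dm_def)
 moreover have "lam < 1/norm w" using fm_Dmo[OF r, of y] xy(2) w by (force simp: Dmo_iff inv2)
 hence "lam*norm w < 1" using w(3) by (simp add: field_simps)
 ultimately show False using mu_lam lam_bounds by (metis mult_left_mono not_less less_imp_le)
 qed
 show "inj_on (fS r) SS"
 proof (rule inj_onI)
 fix p q assume pq: "p : SS" "q : SS" "fS r p = fS r q"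
 from pq(1) show "p = q"
 proof (cases rule: SS_cases)
 case (1 x)
 from pq(2) show ?thesis
 proof (cases rule: SS_cases)
 case y: (1 y)
 have "ff 1 x - ff 1 y : LL" by (rule EE_inj[OF fpR fpR, of _ _ 1]) (use 1 y pq(3) fS_plus0 in auto)
 then obtain m where m: "m : LL" "ff 1 x - ff 1 y = Lat 1 m" using Lat_surj by blast
 hence "ff 1 x = ff 1 (y + m)" using ff_periodic[OF m(1), of 1 y] by (simp add: algebra_simps)
 hence "x = y + m" using ff_bij[of 1] by (simp add: bij_is_inj inj_eq)
 thus ?thesis using 1 y EE_periodic[OF m(1)] by simp
 next
 case y: (2 y)
 thus ?thesis using X[OF 1(1) y(1)] 1 pq(3) fS_plus0[OF 1(1), of r] fS_minus0[OF y(1), of r] by simp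
 qed
 next
 case (2 x)
 from pq(2) show ?thesis
 proof (cases rule: SS_cases)
 case y: (1 y)
 thus ?thesis using X[OF y(1) 2(1)] 2 pq(3) fS_plus0[OF y(1), of r] fS_minus0[OF 2(1), of r] by simp
 next
 case y: (2 y)
 have "fm r x - fm r y : LL" by (rule EE_inj[OF fmR fmR, of _ _ "- 1"]) (use 2 y pq(3) fS_minus0 in auto)
 then obtain m where m: "m : LL" "fm r x - fm r y = Lat 1 m" using Lat_surj by blast
 hence "fm r x = fm r (y + m)" using fm_periodic[OF m(1), of r y] by (simp add: algebra_simps)
 hence "x = y + m" using bij_fm[OF r] by (simp add: bij_is_inj inj_eq)
 thus ?thesis using 2 y EE_periodic[OF m(1)] by simp
 qed
 qed
 qed
 fix p assume p: "p : SS"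
 have minus: "EE (- 1) z : fS r ` SS" if "z : Dmo lam" for z
 proof -
 obtain x where x: "fm r x = z" using bij_is_surj[OF bij_fm[OF r]] by (metis surjD)
 hence "x : Dmo 1" using that fm_Dmo[OF r, of x] by simp
 hence "fS r (EE (- 1) x) = EE (- 1) z" "EE (- 1) x : SS"
 using fS_minus0[of x r] x Dmo_Dm[of x 1] by (auto simp: SS_def)
 thus ?thesis by (metis image_eqI)
 qed
 from p show "p : fS r ` SS"
 proof (cases rule: SS_cases)
 case (1 z)
 show ?thesis
 proof (cases "z : Dm mu")
 case True
 obtain x where x: "ff 1 x = z" using bij_is_surj[OF ff_bij[of 1]] by (metis surjD)
 hence "x : Dm 1" using True fp_Dm[of 1 x] by simp
 hence "fS r (EE 1 x) = p" "EE 1 x : SS" using fS_plus0[of x r] x 1 by (auto simp: SS_def)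
 thus ?thesis by (metis image_eqI)
 next
 case False
 then obtain m where m: "m : LL" "norm (z - m) < mu" by (auto simp: Dm_not)
 define w where "w = z - m"
 have w1: "1 <= norm w" "norm w < mu" using m 1(1) by (auto simp: w_def Dm_def)
 hence w0: "w ~= 0" by auto
 have n: "lam < norm (inv2 w)" "norm (inv2 w) <= 1"
 proof -
 have "lam*norm w < lam*mu" using w1 lam_bounds by (intro mult_strict_left_mono) auto
 hence "lam*norm w < 1" using mu_lam by simp
 moreover have "0 < norm w" using w1 by linarith
 ultimately show "lam < norm (inv2 w)" by (simp add: inv2 pos_less_divide_eq)
 show "norm (inv2 w) <= 1" using w1 by (simp add: inv2 divide_le_eq)
 qed
 have i: "1/norm w <= 1" using w1 by (simp add: divide_le_eq)
 have "m + inv2 w : Dmo lam"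
 by (rule Dm_Dmo[OF Dm_near[OF m(1) order_refl]]) (use n RR_ge in auto)
 moreover have "EE 1 (m + w) = EE (- 1) (m + inv2 w)"
 using EE_flip[OF m(1) w0, of "- 1"] w1 mu_bounds RR_ge i by simp
 moreover have "m + w = z" by (simp add: w_def)
 ultimately show ?thesis using minus 1(2) by metis
 qed
 next
 case (2 z)
 hence "z : Dmo lam" using Dmo_mono[of z 1 lam] lam_bounds by simp
 thus ?thesis using minus 2 by simp
 qed
next
 fix p assume "p : fS r ` SS"
 then obtain q where q: "q : SS" "p = fS r q" by blast
 from q(1) show "p : SS"
 proof (cases rule: SS_cases)
 case (1 x)
 have "ff 1 x : Dm (1/RR)" using fp_Dm[of 1 x] 1 Dm_RR[of _ mu] mu_bounds by simp
 thus ?thesis using q(2) 1 fS_plus0[OF 1(1), of r] EE_in_SS by simp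
 next
 case (2 x)
 have "fm r x : Dm (1/RR)"
 using fm_Dmo[OF r, of x] 2(1) Dm_mono[OF Dmo_Dm] lam_gt_RR by (meson less_imp_le)
 thus ?thesis using q(2) 2 fS_minus0[OF 2(1), of r] EE_in_SS by simp
 qed
qed

lemma ff_inj_deriv:
 assumes "(ff i has_derivative D) (at x)" "D v = 0" shows "v = 0"
proof -
 obtain s h where s: "(ff i has_derivative (%v. \<chi> j. if j = i then s * v $ i + h * v $ other i else mu * v $ j)) (at x)" "lam/2 <= s" "x ~: Bx 3 --> s <= lam"
 by (rule ff_deriv[of i x])
 have D: "D = (%v. \<chi> j. if j = i then s * v $ i + h * v $ other i else mu * v $ j)"
 using has_derivative_unique[OF assms(1) s(1)] .
 have "D v $ other i = 0" "D v $ i = 0" using assms(2) by simp_all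
 hence "mu * v $ other i = 0" "s * v $ i + h * v $ other i = 0" unfolding D using other(3)[of i] by simp_all
 hence "v $ other i = 0" "v $ i = 0" using mu_bounds lam_bounds s(2) by auto
 thus ?thesis by (simp add: vec_eq_other[of v 0 i])
qed

lemma inj_frechetI:
 assumes "(f has_derivative D) (at x)" "!!v. D v = 0 ==> v = 0"
 shows "inj (frechet_derivative f (at x))"
proof -
 have "frechet_derivative f (at x) = D" using frechet_derivative_at[OF assms(1)] by simp
 thus ?thesis using linear_injective_0[OF has_derivative_linear[OF assms(1)]] assms(2) by simp
qed

lemma Cr_on_gj: "Cr_on k gj UNIV"
proof -
 have "Cr_on (Suc k) gj UNIV"
 proof (rule Cr_on_local[OF open_UNIV])
 fix y
 have "inj (frechet_derivative (ff 2) (at (gj y)))"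
 by (rule inj_frechetI[OF Cr_on_SucD(1)[OF Cr_on_ff[of "Suc 0"] UNIV_I] ff_inj_deriv[OF Cr_on_SucD(1)[OF Cr_on_ff[of "Suc 0"] UNIV_I]]])
 from Cr_local_inverse[OF Cr_on_ff UNIV_I this, of k] obtain U W G where
 G: "open U" "gj y : U" "open W" "homeomorphism U W (ff 2) G" "Cr_on (Suc k) G W" by metis
 have "gj w = G w" if "w : W" for w
 using homeomorphism_apply2[OF G(4) that] gj_ff by metis
 hence "Cr_on (Suc k) gj W" using Cr_on_cong G(5) by metis
 moreover have "y : W" using homeomorphism_image1[OF G(4)] G(2) ff_gj[of y] by (metis imageI)
 ultimately show "EX V. y : V & Cr_on (Suc k) gj V" by blast
 qed
 thus ?thesis by (rule Cr_on_mono) simp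
qed

lemma Cr_on_fm: "2 <= r ==> Cr_on k (fm r) UNIV"
 unfolding fm_def[abs_def] by (rule Cr_on_compose[OF Cr_on_gj Cr_on_ph]) auto

lemma fm_inj_deriv:
 assumes r: "2 <= r" and D: "(fm r has_derivative D) (at x)" and v: "D v = 0" shows "v = 0"
proof -
 obtain E where E: "(ff 2 has_derivative E) (at (fm r x))" using Cr_on_SucD(1)[OF Cr_on_ff[of "Suc 0"] UNIV_I] by blast
 have "((%x. ff 2 (fm r x)) has_derivative (%h. E (D h))) (at x)" by (rule has_derivative_compose[OF D E])
 moreover have "(%x. ff 2 (fm r x)) = ph r" by (simp add: fm_def ff_gj)
 ultimately show ?thesis using ph_immersion[OF r, of "%h. E (D h)" x v] v linear_0[OF has_derivative_linear[OF E]] by simp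
qed

definition fh :: "nat => real => real^2 => real^2" where "fh r s = (if s = 1 then ff 1 else fm r)"

lemma fh_simps [simp]: "fh r 1 = ff 1" "fh r (- 1) = fm r" by (simp_all add: fh_def)

lemma Cr_on_fh: "2 <= r ==> Cr_on k (fh r s) UNIV" by (simp add: fh_def Cr_on_ff Cr_on_fm)

lemma fS_fh: "2 <= r ==> sgn_ok s ==> x : Dm (3/4) ==> fS r (EE s x) = EE s (fh r s x)"
 using fS_plus fS_minus by (auto simp: sgn_ok_def)

lemma fh_Dmo:
 assumes r: "2 <= r" and s: "sgn_ok s" and x: "x : Dm 1" shows "fh r s x : Dmo (1/RR)"
proof (cases "s = 1")
 case True
 hence "fh r s x : Dm mu" using fp_Dm[of 1 x] x by simp
 thus ?thesis by (rule Dm_Dmo) (use one_RR mu_bounds in linarith)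
next
 case False
 hence "fh r s x : Dm lam" using fm_Dm[OF r, of lam x] x s mu_lam lam_bounds by (simp add: sgn_ok_def)
 thus ?thesis by (rule Dm_Dmo) (use lam_gt_RR in linarith)
qed

theorem Cr_diffeo_fS:
 assumes r: "2 <= r" shows "Cr_diffeo (Suc k) SS (fS r)"
proof (rule Cr_diffeoI[OF fS_bij[OF r]])
 fix p assume p: "p : SS"
 then obtain s x where s: "sgn_ok s" and x: "x : Dm 1" "p = EE s x"
 using sgn_ok_simps(1,2) unfolding SS_def by blast
 have c: "continuous_on UNIV (fh r s)" using Cr_on_continuous_on[OF Cr_on_fh[OF r]] .
 obtain e where e: "0 < e" "surf_param (EE s) (ball (fh r s x) e) SS"
 using surf_param_EE_at[OF s fh_Dmo[OF r s x(1)] open_UNIV UNIV_I] by metis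
 define V where "V = Dmo (3/4) Int fh r s -` ball (fh r s x) e"
 have V: "open V" "x : V" using open_Dmo open_vimage[OF open_ball c] Dm_Dmo[OF x(1), of "3/4"] e by (auto simp: V_def)
 have xR: "x : Dmo (1/RR)" by (rule Dm_Dmo[OF x(1)]) (use one_RR in linarith)
 obtain d where d: "0 < d" "cball x d <= V" "surf_param (EE s) (ball x d) SS"
 using surf_param_EE_at[OF s xR V] by metis
 have b: "ball x d <= V" using d(2) ball_subset_cball by blast
 have "inj (frechet_derivative (fh r s) (at y))" for y
 proof (rule inj_frechetI)
 show "(fh r s has_derivative frechet_derivative (fh r s) (at y)) (at y)"
 by (rule Cr_on_SucD(1)[OF Cr_on_fh[OF r] UNIV_I])
 thus "frechet_derivative (fh r s) (at y) v = 0 ==> v = 0" for v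
 using s ff_inj_deriv[of 1 _ y v] fm_inj_deriv[OF r, of _ y v] by (auto simp: sgn_ok_def)
 qed
 moreover have "fS r (EE s y) = EE s (fh r s y)" if "y : ball x d" for y
 using fS_fh[OF r s, of y] Dmo_Dm[of y "3/4"] that b by (auto simp: V_def)
 moreover have "Cr_on (Suc k) (fh r s) (ball x d)" by (rule Cr_on_subset[OF Cr_on_fh[OF r]]) auto
 ultimately show "EX fi V gi W F. surf_param fi V SS & p : fi ` V & surf_param gi W SS &
 Cr_on (Suc k) F V & F ` V <= W & (ALL x:V. fS r (fi x) = gi (F x) & inj (frechet_derivative F (at x)))"
 using d(1,3) e b x by (intro exI[of _ "EE s"] exI[of _ "ball x d"] exI[of _ "ball (fh r s x) e"] exI[of _ "fh r s"]) (auto simp: V_def)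
qed

section \<open>Failure of (r-1)-expansivity\<close>

text \<open>\<open>Dm 1\<close> is not compact, but lattice periodicity moves both points into one
  compact set.\<close>

lemma EE_uniform:
 assumes s: "sgn_ok s" and d: "0 < d"
 shows "EX ze>0. ALL x:Dm 1. ALL y:Dm 1. norm (x - y) < ze --> dist (EE s x) (EE s y) < d"
proof -
 let ?K = "Dm 1 Int cball 0 (RC + 1)"
 have K: "compact ?K" by (intro closed_Int_compact closed_Dm compact_cball)
 have "?K <= Dmo 0" using Dm_Dmo[of _ 1 0] by auto
 hence "uniformly_continuous_on ?K (EE s)"
 by (intro compact_uniformly_continuous[OF continuous_on_subset[OF EE_continuous] K])
 then obtain ze where e: "0 < ze" "!!x y. x : ?K ==> y : ?K ==> dist y x < ze ==> dist (EE s y) (EE s x) < d"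
 unfolding uniformly_continuous_on_def using d by metis
 show ?thesis
 proof (intro exI[of _ "min ze 1"] conjI ballI impI)
 fix x y assume xy: "x : Dm 1" "y : Dm 1" "norm (x - y) < min ze 1"
 obtain l where l: "l : LL" "x - l : Dm 1" "norm (x - l) <= RC" using Dm_reduce[OF xy(1)] by blast
 have y: "y - l : Dm 1" using Dm_periodic[OF LL_minus[OF l(1)], of y 1] xy(2) by simp
 have "norm (y - l) <= norm (x - l) + norm (x - y)"
 using norm_triangle_ineq4[of "x - l" "x - y"] by simp
 hence "x - l : ?K" "y - l : ?K" using l y xy(3) by simp_all
 moreover have "dist (x - l) (y - l) < ze" using xy(3) by (simp add: dist_norm)
 ultimately have "dist (EE s (x - l)) (EE s (y - l)) < d" using e(2) by blast
 thus "dist (EE s x) (EE s y) < d"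
 using EE_periodic[OF LL_minus[OF l(1)], of s x] EE_periodic[OF LL_minus[OF l(1)], of s y] by simp
 qed (use e in auto)
qed

lemma ff_line_strong:
 "EX s. lam/2 <= s & (upd i t x ~: Bx 3 --> s <= lam) & DERIV (%t. ff i (upd i t x) $ i) t :> s"
proof -
 obtain s h where s: "(ff i has_derivative (%v. \<chi> j. if j = i then s * v $ i + h * v $ other i else mu * v $ j)) (at (upd i t x))"
 "lam/2 <= s" "upd i t x ~: Bx 3 --> s <= lam" by (rule ff_deriv)
 have "((%t. upd i t x) has_derivative (%h. h *\<^sub>R axis i 1)) (at t)"
 unfolding upd_def by (auto intro!: derivative_eq_intros)
 from has_derivative_compose[OF this s(1)]
 have "((%t. ff i (upd i t x) $ i) has_derivative (%h'. s*h')) (at t)"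
 using other(3)[of i] by (auto dest!: bounded_linear.has_derivative[OF bounded_linear_vec_nth[of i]] simp: axis_def mult.commute)
 thus ?thesis using s by (auto simp: has_field_derivative_def)
qed

text \<open>A segment in direction i that misses all boxes \<open>Bx 3\<close>, the only places
  where \<open>ff i\<close> may fail to contract this direction.\<close>

definition hseg :: "2 => real^2 => real^2 => bool" where
 "hseg i x y \<longleftrightarrow> x $ other i = y $ other i &
 (ALL u. u $ other i = x $ other i & min (x $ i) (y $ i) <= u $ i & u $ i <= max (x $ i) (y $ i) --> u ~: Bx 3)"

lemma hseg_sym: "hseg i x y \<longleftrightarrow> hseg i y x"
 by (auto simp: hseg_def min.commute max.commute)

text \<open>The repeller pushes outwards: preimages of boxes lie in smaller boxes. Hence a segment
  that misses the boxes has images that miss them as well.\<close>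

lemma ff_Bx3: "ff i v : Bx 3 ==> v : Bx 3"
proof -
 assume "ff i v : Bx 3"
 then obtain m where m: "m : LL" "\<bar>(ff i v - m) $ 1\<bar> < 3" "\<bar>(ff i v - m) $ 2\<bar> < 3" by (auto simp: Bx_def)
 define l where "l = Lat (other i) m"
 have l: "l : LL" "Lat i l = m" using m Lat_LL Lat_inverse by (auto simp: l_def)
 have "\<bar>(v - l) $ j\<bar> <= 3/mu" for j
 by (rule ff_box[OF l(1), of i]) (use m l mu_bounds in auto)
 moreover have "3/mu < 3" using mu_bounds by (simp add: field_simps)
 ultimately have "\<bar>(v - l) $ j\<bar> < 3" for j by (meson le_less_trans)
 thus ?thesis using l(1) unfolding Bx_def by blast
qed

lemma hseg_step_le:
 assumes h: "hseg i x y" and le: "x $ i <= y $ i"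
 shows "hseg i (ff i x) (ff i y)" "norm (ff i x - ff i y) <= lam*norm (x - y)"
 "ff i x $ i <= ff i y $ i"
proof -
 have xx: "upd i (x $ i) x = x" by (rule upd_nth)
 have yy: "upd i (y $ i) x = y" using h by (simp add: vec_eq_other[of _ y i] upd_nth hseg_def)
 have mono: "ff i (upd i a x) $ i <= ff i (upd i b x) $ i" if "a <= b" for a b
 using ff_line_mono[of a b i x] that by (cases "a = b") auto
 show le': "ff i x $ i <= ff i y $ i" using mono[OF le] by (simp add: xx yy)
 have o: "ff i x $ other i = ff i y $ other i" using h by (simp add: ff_nth hseg_def)
 have n: "norm (a - b) = \<bar>a $ i - b $ i\<bar>" if "a $ other i = b $ other i" for a b :: "real^2"
 proof (rule antisym)
 show "norm (a - b) <= \<bar>a $ i - b $ i\<bar>" using norm2_le[of "a - b" i] that by simp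
 show "\<bar>a $ i - b $ i\<bar> <= norm (a - b)" using component_le_norm_cart[of "a - b" i] by simp
 qed
 have "ff i y $ i - ff i x $ i <= lam*(y $ i - x $ i)"
 proof (cases "x $ i = y $ i")
 case False
 define g where "g t = ff i (upd i t x) $ i" for t
 have "EX z>x $ i. z < y $ i & (EX s. s <= lam & g (y $ i) - g (x $ i) = (y $ i - x $ i) * s)"
 proof -
 obtain g' where g': "!!t. DERIV g t :> g' t" "!!t. upd i t x ~: Bx 3 ==> g' t <= lam"
 using ff_line_strong[of i _ x] unfolding g_def[abs_def] by metis
 obtain z where z: "x $ i < z" "z < y $ i" "g (y $ i) - g (x $ i) = (y $ i - x $ i)*g' z"
 using MVT2[of "x $ i" "y $ i" g g'] g' False le by auto
 have "upd i z x ~: Bx 3" using h z le by (simp add: hseg_def upd_nth)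
 thus ?thesis using z g'(2) by blast
 qed
 then obtain s where s: "s <= lam" "g (y $ i) - g (x $ i) = (y $ i - x $ i) * s" by blast
 have "(y $ i - x $ i) * s <= (y $ i - x $ i)*lam" using s le by (intro mult_left_mono) auto
 thus ?thesis using s by (simp add: g_def xx yy mult.commute)
 next
 case True
 hence "x = y" using xx yy by metis
 thus ?thesis by simp
 qed
 thus "norm (ff i x - ff i y) <= lam*norm (x - y)"
 using h le le' by (simp add: n[OF o] n hseg_def)
 show "hseg i (ff i x) (ff i y)" unfolding hseg_def
 proof (intro conjI allI impI o)
 fix u assume u: "u $ other i = ff i x $ other i & min (ff i x $ i) (ff i y $ i) <= u $ i & u $ i <= max (ff i x $ i) (ff i y $ i)"
 obtain v where v: "ff i v = u" using bij_is_surj[OF ff_bij[of i]] by (metis surjD)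
 have vo: "v $ other i = x $ other i" using u mu_bounds by (simp add: v[symmetric] ff_nth)
 have vv: "upd i (v $ i) x = v" using vo by (simp add: vec_eq_other[of _ v i] upd_nth)
 have "x $ i <= v $ i"
 proof (rule ccontr)
 assume "~ x $ i <= v $ i"
 from ff_line_mono[of "v $ i" "x $ i" i x] this have "u $ i < ff i x $ i" by (simp add: vv xx v)
 thus False using u le' by simp
 qed
 moreover have "v $ i <= y $ i"
 proof (rule ccontr)
 assume "~ v $ i <= y $ i"
 from ff_line_mono[of "y $ i" "v $ i" i x] this have "ff i y $ i < u $ i" by (simp add: vv yy v)
 thus False using u le' by simp
 qed
 ultimately have "v ~: Bx 3" using h vo by (simp add: hseg_def)
 thus "u ~: Bx 3" using ff_Bx3 v by blast
 qed
qed

lemma hseg_iterate: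
 assumes h: "hseg i x y"
 shows "norm ((ff i ^^ n) x - (ff i ^^ n) y) <= norm (x - y)"
proof -
 have step: "hseg i (ff i x) (ff i y) & norm (ff i x - ff i y) <= norm (x - y)" if "hseg i x y" for x y
 proof -
 have "lam*norm (x - y) <= 1*norm (x - y)" using lam_bounds by (intro mult_right_mono) auto
 thus ?thesis
 using hseg_step_le[of i x y] hseg_step_le[of i y x] that hseg_sym[of i x y] hseg_sym[of i "ff i x" "ff i y"]
 by (cases "x $ i <= y $ i") (auto simp: norm_minus_commute)
 qed
 have "hseg i ((ff i ^^ n) x) ((ff i ^^ n) y) & norm ((ff i ^^ n) x - (ff i ^^ n) y) <= norm (x - y)"
 proof (induction n)
 case (Suc n)
 thus ?case using step[of "(ff i ^^ n) x" "(ff i ^^ n) y"] by fastforce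
 qed (use h in simp)
 thus ?thesis by blast
qed

lemma far_lattice:
 assumes "norm u <= 110" "l : LL" "l ~= 0" shows "290 <= norm (u - l)"
 using LL_sep[OF assms(2)] assms RR_ge norm_triangle_ineq4[of u "u - l"] by fastforce

text \<open>The bounds 45 and 65 keep the segment within distance 110 of the origin, far from the
  boxes of the other lattice points; the box at 0 is missed since the fixed coordinate is at least 3
  in absolute value.\<close>

lemma hsegI:
 assumes "x $ other i = y $ other i" "3 <= \<bar>x $ other i\<bar>" "\<bar>x $ other i\<bar> <= 45" "\<bar>x $ i\<bar> <= 65" "\<bar>y $ i\<bar> <= 65"
 shows "hseg i x y"
 unfolding hseg_def
proof (intro conjI allI impI notI)
 show "x $ other i = y $ other i" by fact
 fix u assume u: "u $ other i = x $ other i & min (x $ i) (y $ i) <= u $ i & u $ i <= max (x $ i) (y $ i)" and B: "u : Bx 3"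
 have "\<bar>u $ i\<bar> <= 65" using u assms by linarith
 hence n: "norm u <= 110" using norm2_le[of u i] u assms by simp
 from B obtain l where l: "l : LL" and l12: "\<bar>(u - l) $ 1\<bar> < 3" "\<bar>(u - l) $ 2\<bar> < 3" unfolding Bx_def by blast
 have l2: "\<bar>(u - l) $ j\<bar> < 3" for j using l12 exhaust_2[of j] by auto
 have "norm (u - l) < 6" using norm2_le[of "u - l" 1] l12 by (simp add: other)
 hence "l = 0" using far_lattice[OF n l] by fastforce
 thus False using l2[of "other i"] u assms by simp
qed

lemma ff_Dm8: "x : Dm 8 ==> ff i x : Dm 8"
proof -
 assume x: "x : Dm 8"
 show ?thesis unfolding Dm_not
 proof (intro ballI notI)
 fix m assume m: "m : LL" "norm (ff i x - m) < 8"
 define l where "l = Lat (other i) m"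
 have l: "l : LL" "Lat i l = m" using m Lat_LL Lat_inverse by (auto simp: l_def)
 have b: "\<bar>(x - l) $ j\<bar> <= 8/mu" for j
 by (rule ff_box[OF l(1), of i]) (use m l mu_bounds comp_norm[of "ff i x - m" 8] in auto)
 have "8/mu <= 1" using mu_bounds by (simp add: divide_le_eq)
 hence "norm (x - l) <= 2" using norm2_le[of "x - l" 1] b[of 1] b[of 2] by (simp add: other)
 thus False using x l(1) by (force simp: Dm_def)
 qed
qed

lemma fm_ff: "2 <= r ==> x : Dm 8 ==> fm r (ff 2 x) = x"
 using ph_far[of r "ff 2 x"] ff_Dm8[of x 2] by (simp add: fm_def gj_ff Dm_def)

lemma fS_forward: "2 <= r ==> x : Dm 1 ==> (fS r ^^ n) (EE 1 x) = EE 1 ((ff 1 ^^ n) x) & (ff 1 ^^ n) x : Dm 1"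
proof (induction n)
 case (Suc n)
 have "ff 1 ((ff 1 ^^ n) x) : Dm (mu*1)" using fp_Dm[of 1 "(ff 1 ^^ n) x"] Suc by simp
 thus ?case using Suc fS_plus0[of "(ff 1 ^^ n) x" r] Dm_mono[of _ "mu*1" 1] mu_bounds by simp
qed simp

text \<open>\<open>Dm 8\<close> is invariant under \<open>ff 2\<close> and \<open>ph\<close> is the
  identity on it, so there the inverse of the surface map is simply \<open>ff 2\<close>.\<close>

lemma fS_backward:
 assumes r: "2 <= r" and x: "x : Dm 8"
 shows "(inv_into SS (fS r) ^^ n) (EE (- 1) x) = EE (- 1) ((ff 2 ^^ n) x) & (ff 2 ^^ n) x : Dm 8"
proof (induction n)
 case (Suc n)
 let ?y = "(ff 2 ^^ n) x"
 have y: "ff 2 ?y : Dm 8" using ff_Dm8 Suc by blast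
 hence y1: "ff 2 ?y : Dm (3/4)" "ff 2 ?y : Dm 1" using Dm_mono by auto
 have "fS r (EE (- 1) (ff 2 ?y)) = EE (- 1) ?y" using fS_minus[OF r y1(1)] fm_ff[OF r] Suc by simp
 moreover have "EE (- 1) (ff 2 ?y) : SS" using y1 by (auto simp: SS_def)
 ultimately have "inv_into SS (fS r) (EE (- 1) ?y) = EE (- 1) (ff 2 ?y)"
 using fS_bij[OF r] inv_into_f_f[of "fS r" SS] by (metis bij_betw_def)
 thus ?case using Suc y by simp
qed (use x in simp)

text \<open>The points \<open>w e i\<close> sit on the line s = 2 + e at the r roots of
  \<open>QQ\<close>. There DD = kap0 s t, so the second upper coordinate mu/(kap0 s) is the same for
  all i. The offset e > 0 keeps the roots apart and makes the points as close as desired.\<close>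

lemma not_expansive_fS:
 assumes r: "2 <= r" shows "~ N_expansive SS (fS r) (r - 1)"
proof
 assume "N_expansive SS (fS r) (r - 1)"
 then obtain dl where d: "0 < dl" and ex: "!!A. A <= SS ==> (ALL n. diameter (iter_int SS (fS r) n ` A) < dl) ==> finite A & card A <= r - 1"
 unfolding N_expansive_def by blast
 obtain e1 where e1: "0 < e1" "!!x y. x : Dm 1 ==> y : Dm 1 ==> norm (x - y) < e1 ==> dist (EE 1 x) (EE 1 y) < dl/2"
 using EE_uniform[of 1 "dl/2"] d by auto
 obtain e2 where e2: "0 < e2" "!!x y. x : Dm 1 ==> y : Dm 1 ==> norm (x - y) < e2 ==> dist (EE (- 1) x) (EE (- 1) y) < dl/2"
 using EE_uniform[of "- 1" "dl/2"] d by auto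
 define w :: "real => nat => real^2" where "w e i = (\<chi> j. if j = 1 then 2 + e else tau0 r*(2 + e) + cc r i (2 + e))" for e i
 have w12: "w e i $ 1 = 2 + e" "w e i $ 2 = tau0 r*(2 + e) + cc r i (2 + e)" for e i by (simp_all add: w_def)
 have wb: "2 <= norm (w e i)" "norm (w e i) <= 9" "\<bar>w e i $ 2\<bar> <= 6" "1 <= w e i $ 2" if "0 <= e" "e <= 1/4" "i < r" for e i
 proof -
 have c: "\<bar>cc r i (2 + e)\<bar> <= 1/2" using cc_bound[OF that(3), of "2 + e"] that hh by simp
 have "1*2 <= tau0 r*(2 + e)" "tau0 r*(2 + e) <= 2*(9/4)" using tau0[of r] that by (auto intro!: mult_mono)
 thus "\<bar>w e i $ 2\<bar> <= 6" "1 <= w e i $ 2" using c by (auto simp: w12)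
 thus "norm (w e i) <= 9" using norm2_le[of "w e i" 1] that by (simp add: other w12)
 show "2 <= norm (w e i)" using component_le_norm_cart[of "w e i" 1] that by (simp add: w12)
 qed
 have ccl: "\<bar>cc r i (2 + e)\<bar> <= e" if "0 <= e" "i < r" for e i
 proof -
 have "real i*(hh/(2*real r)) <= real r*(hh/(2*real r))" using that hh by (intro mult_right_mono) auto
 also have "... <= 1" using that hh by simp
 finally have "real i*(hh/(2*real r))*e <= 1*e" using that by (intro mult_right_mono) auto
 thus ?thesis using that hh by (simp add: cc_def)
 qed
 have wd: "norm (w e i - w e j) <= 2*e" if "0 <= e" "i < r" "j < r" for e i j
 using norm2_le[of "w e i - w e j" 1] ccl[of e i] ccl[of e j] that by (simp add: other w12)
 have "uniformly_continuous_on (cball 0 9) (ff 2)"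
 by (intro compact_uniformly_continuous continuous_on_subset[OF Cr_on_continuous_on[OF Cr_on_ff]]) auto
 then obtain e3 where e3: "0 < e3" "!!x y. norm x <= 9 ==> norm y <= 9 ==> dist y x < e3 ==> dist (ff 2 y) (ff 2 x) < e2"
 unfolding uniformly_continuous_on_def using e2(1) by (metis mem_cball_0)
 \<comment> \<open>The lower points are at most 2 e apart, and the crossing stretches this by less
   than 18; dividing by 40 covers that.\<close>
 define e where "e = min (1/4) (min (e1/40) (min (e2/4) (e3/4)))"
 have e: "0 < e" "e <= 1/4" "20*(2*e) <= e1" "2*e < e2" "2*e < e3"
 using e1(1) e2(1) e3(1) by (auto simp: e_def)
 have e0: "0 <= e" using e by simp
 note wb = wb[OF e0 e(2)] and wd = wd[OF e0]
 have k: "2 <= kap0 r" "kap0 r <= 5/2" using tau0(1)[of r] by (auto simp: kap0_def)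
 have Dw: "Dv r (w e i) = kap0 r*(w e i $ 1)*(w e i $ 2)" if "i < r" for i
 proof -
 let ?s = "w e i $ 1" and ?t = "w e i $ 2"
 have c: "chi ?s = 1" using e by (intro chi_1) (simp add: w12)
 have "\<bar>cc r i ?s\<bar> <= hh" using cc_bound[OF that, of ?s] e hh by (simp add: w12)
 hence ka: "kap ((?t - tau0 r*?s)/hh) = 1" using hh by (intro kap_1) (simp add: w12)
 have "(\<Prod>j<r. ?t - tau0 r*?s - cc r j ?s) = 0" using that by (intro prod_zero) (auto simp: w12)
 thus ?thesis by (simp add: Dv_def DD_def PP_def c ka QQ_def b0_def)
 qed
 define z where "z i = TR r (w e i)" for i
 have z12: "z i $ 1 = mu/(kap0 r*w e i $ 2)" "z i $ 2 = mu/(kap0 r*(2 + e))" if "i < r" for i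
 using Dw[OF that] wb(4)[OF that] e by (simp_all add: z_def TR_def w12)
 have ring: "fS r (EE (- 1) (w e i)) = EE 1 (z i)" "1/2 <= norm (z i)" "norm (z i) <= 25" if "i < r" for i
 using fS_ring[OF r LL_0, of "w e i"] wb[OF that] Lat_add[of 1 0 0] by (simp_all add: z_def)
 have z2: "3 <= \<bar>z i $ 2\<bar>" if "i < r" for i
 proof -
 have "kap0 r*(2 + e) <= 5/2*(9/4)" using k e by (intro mult_mono) auto
 moreover have "0 < kap0 r*(2 + e)" using k e by simp
 ultimately have "3 <= mu/(kap0 r*(2 + e))" using mu_bounds by (simp add: pos_le_divide_eq)
 hence "3 <= z i $ 2" unfolding z12(2)[OF that] .
 thus ?thesis by linarith
 qed
 have zD: "z i : Dm 1" if "i < r" for i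
 unfolding Dm_not
 proof (intro ballI notI)
 fix l assume l: "l : LL" "norm (z i - l) < 1"
 hence "l = 0" using far_lattice[of "z i" l] ring(3)[OF that] by fastforce
 thus False using l comp_norm[of "z i" 1 2] z2[OF that] by simp
 qed
 have zz: "hseg 1 (z i) (z j)" "norm (z i - z j) < e1" if "i < r" "j < r" for i j
 proof -
 have b: "\<bar>z k $ q\<bar> <= 25" if "k < r" for k q using comp_norm[of "z k" 25] ring(3)[OF that] by simp
 have "z i $ 2 = z j $ 2" using z12(2) that by simp
 thus "hseg 1 (z i) (z j)"
 by (intro hsegI, unfold other) (use z2[OF that(1)] b[OF that(1), of 1] b[OF that(1), of 2] b[OF that(2), of 1] in linarith)+
 let ?a = "w e i $ 2" and ?b = "w e j $ 2"
 have ab: "1 <= ?a" "1 <= ?b" using wb that by auto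
 have "mu/(kap0 r*?a) - mu/(kap0 r*?b) = mu*(?b - ?a)/(kap0 r*(?a*?b))"
 using ab k by (simp add: field_simps)
 moreover have "\<bar>mu*(?b - ?a)/(kap0 r*(?a*?b))\<bar> <= mu*\<bar>?b - ?a\<bar>"
 proof -
 have "1*(1*1) <= kap0 r*(?a*?b)" using ab k by (intro mult_mono) auto
 hence Y: "1 <= kap0 r*(?a*?b)" by simp
 have "\<bar>X/Y\<bar> <= \<bar>X\<bar>" if "1 <= Y" for X Y :: real
 using that divide_left_mono[of 1 Y "\<bar>X\<bar>"] by (simp add: abs_divide)
 from this[OF Y, of "mu*(?b - ?a)"] show ?thesis using mu_bounds by (simp add: abs_mult)
 qed
 moreover have "mu*\<bar>?b - ?a\<bar> <= 18*(2*e)"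
 using mu_bounds wd[OF that] component_le_norm_cart[of "w e i - w e j" 2] by (intro mult_mono) auto
 ultimately have "\<bar>z i $ 1 - z j $ 1\<bar> <= 18*(2*e)" using z12 that by simp
 thus "norm (z i - z j) < e1" using norm2_le[of "z i - z j" 1] z12 that e by (simp add: other)
 qed
 define y where "y i = ff 2 (w e i)" for i
 have y1: "y i $ 1 = mu*(2 + e)" for i using ff_nth(2)[of 2 "w e i"] by (simp add: y_def other w12)
 have y2: "\<bar>y i $ 2\<bar> <= 65" if "i < r" for i
 proof -
 have "\<bar>per (hbi 2) (w e i)\<bar> <= 60" by (rule per_bound) (simp_all add: hbi_def hb_bound)
 moreover have "lam*\<bar>w e i $ 2\<bar> <= 0.06*6" by (rule mult_mono) (use lam_bounds wb(3)[OF that] in auto)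
 hence "\<bar>lam*w e i $ 2\<bar> <= 0.36" using lam_bounds by (simp add: abs_mult)
 ultimately show ?thesis using ff_nth(1)[of 2 "w e i"] by (simp add: y_def)
 qed
 have m2: "17.9*2 <= mu*(2 + e)" "mu*(2 + e) <= 18*(9/4)" by (intro mult_mono; use mu_bounds e in simp)+
 have yn: "norm (y i) <= 110" if "i < r" for i using norm2_le[of "y i" 1] y1[of i] y2[OF that] m2 by (simp add: other)
 have yD: "y i : Dm 8" if "i < r" for i
 unfolding Dm_not
 proof (intro ballI notI)
 fix l assume l: "l : LL" "norm (y i - l) < 8"
 hence "l = 0" using far_lattice[OF yn[OF that] l(1)] by fastforce
 thus False using l comp_norm[of "y i" 8 1] y1[of i] m2 by simp
 qed
 have yy: "hseg 2 (y i) (y j)" "norm (y i - y j) < e2" if "i < r" "j < r" for i j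
 proof -
 show "hseg 2 (y i) (y j)" by (rule hsegI) (use that y1 y2 m2 in \<open>auto simp: other\<close>)
 show "norm (y i - y j) < e2" using e3(2)[of "w e i" "w e j"] wb(2) wd[OF that] that e
 by (simp add: y_def dist_norm norm_minus_commute)
 qed
 have w8: "w e i : Dm 1" if "i < r" for i
 using Dm_near[OF LL_0, of 1 "w e i"] wb[OF that] RR_ge by simp
 define p where "p i = EE (- 1) (w e i)" for i
 let ?A = "p ` {..<r}"
 have pS: "p i : SS" if "i < r" for i using w8[OF that] by (auto simp: p_def SS_def)
 \<comment> \<open>The first backward step starts near the support of \<open>ph\<close>, but its
   result \<open>y i\<close> lies in \<open>Dm 8\<close>, where \<open>ph\<close> is the identity;
   from there on \<open>fS_backward\<close> applies.\<close>
 have bkw: "inv_into SS (fS r) (p i) = EE (- 1) (y i)" if "i < r" for i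
 proof -
 have y1: "y i : Dm (3/4)" "y i : Dm 1" using yD[OF that] Dm_mono by auto
 have "ph r (y i) = y i" by (rule ph_far[OF r]) (use yD[OF that] in \<open>simp add: Dm_def\<close>)
 hence "fS r (EE (- 1) (y i)) = p i" using fS_minus[OF r y1(1)] by (simp add: p_def y_def fm_def gj_ff)
 moreover have "EE (- 1) (y i) : SS" using y1 by (auto simp: SS_def)
 ultimately show ?thesis using fS_bij[OF r] inv_into_f_f[of "fS r" SS] by (metis bij_betw_def)
 qed
 have close: "dist (iter_int SS (fS r) n (p i)) (iter_int SS (fS r) n (p j)) <= dl/2" if ij: "i < r" "j < r" for n i j
 proof -
 consider "n = 0" | m where "n = int (Suc m)" | m where "n = - int (Suc m)"
 by (metis int_cases4 not0_implies_Suc of_nat_0 minus_zero)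
 thus ?thesis
 proof cases
 case 1
 have "dist (p i) (p j) < dl/2" unfolding p_def
 by (rule e2(2)[OF w8 w8]) (use wd[OF ij] e ij in auto)
 thus ?thesis using 1 by (simp add: iter_int_def)
 next
 case (2 m)
 have it: "iter_int SS (fS r) n (p i) = EE 1 ((ff 1 ^^ m) (z i))" "(ff 1 ^^ m) (z i) : Dm 1" if "i < r" for i
 using fS_forward[OF r zD[OF that], of m] 2 ring(1)[OF that]
 by (auto simp: iter_int_def p_def nat_add_distrib funpow_swap1 funpow_Suc_right simp del: funpow.simps of_nat_Suc)
 show ?thesis unfolding it(1)[OF ij(1)] it(1)[OF ij(2)]
 by (rule less_imp_le, rule e1(2)[OF it(2)[OF ij(1)] it(2)[OF ij(2)]])
 (use hseg_iterate[OF zz(1)[OF ij], of m] zz(2)[OF ij] in linarith)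
 next
 case (3 m)
 have it: "iter_int SS (fS r) n (p i) = EE (- 1) ((ff 2 ^^ m) (y i))" "(ff 2 ^^ m) (y i) : Dm 1" if "i < r" for i
 proof -
 have "nat (- n) = Suc m" "~ 0 <= n" using 3 by auto
 thus "iter_int SS (fS r) n (p i) = EE (- 1) ((ff 2 ^^ m) (y i))"
 using fS_backward[OF r yD[OF that], of m] bkw[OF that]
 by (simp add: iter_int_def funpow_Suc_right del: funpow.simps)
 show "(ff 2 ^^ m) (y i) : Dm 1" using fS_backward[OF r yD[OF that], of m] Dm_mono[of _ 8 1] by simp
 qed
 show ?thesis unfolding it(1)[OF ij(1)] it(1)[OF ij(2)]
 by (rule less_imp_le, rule e2(2)[OF it(2)[OF ij(1)] it(2)[OF ij(2)]])
 (use hseg_iterate[OF yy(1)[OF ij], of m] yy(2)[OF ij] in linarith)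
 qed
 qed
 have "diameter (iter_int SS (fS r) n ` ?A) <= dl/2" for n
 by (rule diameter_le) (use close d r in \<open>auto simp: dist_norm[symmetric]\<close>)
 hence "diameter (iter_int SS (fS r) n ` ?A) < dl" for n using d by (smt (verit) half_gt_zero field_sum_of_halves)
 hence "card ?A <= r - 1" using ex[of ?A] pS by blast
 moreover have "inj_on p {..<r}"
 proof (rule inj_onI)
 fix i j assume ij: "i : {..<r}" "j : {..<r}" "p i = p j"
 have "w e i - w e j : LL"
 by (rule EE_inj[OF Dm_RR[OF w8] Dm_RR[OF w8], of _ _ "- 1"]) (use ij in \<open>auto simp: p_def\<close>)
 moreover have "norm (w e i - w e j) < 4*RR" using wd[of i j] ij e RR_ge by auto
 ultimately have "w e i = w e j" using LL_sep[of "w e i - w e j"] by auto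
 hence "w e i $ 2 = w e j $ 2" by simp
 thus "i = j" using e hh r by (simp add: w12 cc_def)
 qed
 ultimately show False using r by (simp add: card_image)
qed

section \<open>Links and chains: small divided differences along half orbits\<close>

lemma wfam_mono: "wfam r U G M ==> k <= r ==> wfam k U G M"
 unfolding wfam_def by (meson le_trans less_le_trans)

lemma dd_pair:
 fixes t q :: "'i => real"
 assumes "a ~= b" "t a ~= t b"
 shows "dd t q {a, b} * (t a - t b) = q a - q b"
proof -
 let ?p = "interp t q {a, b}"
 have "inj_on t {a, b}" using assms by auto
 from interp[OF _ this, where q=q] have p: "poly ?p (t a) = q a" "poly ?p (t b) = q b" "degree ?p < card {a, b}" by auto
 have "degree ?p <= 1" using p(3) assms by (simp add: card_insert_if)
 hence "poly ?p x = coeff ?p 0 + coeff ?p 1*x" for x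
 proof (cases "degree ?p = 0")
 case True
 thus ?thesis by (simp add: poly_altdef coeff_eq_0)
 next
 case False
 hence "degree ?p = 1" using \<open>degree ?p <= 1\<close> by simp
 thus ?thesis by (simp add: poly_altdef)
 qed
 hence "q a - q b = coeff ?p 1*(t a - t b)" using p(1,2) by (simp add: algebra_simps)
 moreover have "dd t q {a, b} = coeff ?p 1" using assms by (simp add: dd_def card_insert_if)
 ultimately show ?thesis by simp
qed

text \<open>One step of the dynamics on labelled points: q is multiplied by c0 up to a function with
  partials of size \<open>eps\<close>, and t moves with slope between lo and hi. The pairwise
  estimates feed the cone arguments, the families G and E the Rolle argument; the distances rh/2 and
  1 are those of \<open>one_step\<close>.\<close>

definition link :: "nat => real => real => real => real => real => real => 'i set =>
 ('i => real) => ('i => real) => ('i => real) => ('i => real) => bool" where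
 "link r A eps rh c0 lo hi P t q t' q' \<longleftrightarrow>
 (ALL i:P. ALL j:P. \<bar>q' i - q' j - c0*(q i - q j)\<bar> <= eps*(\<bar>t i - t j\<bar> + \<bar>q i - q j\<bar>) &
 (EX s h. t' i - t' j = s*(t i - t j) + h*(q i - q j) & lo <= s & s <= hi & \<bar>h\<bar> <= A) &
 \<bar>t i - t j\<bar> <= rh/2 & \<bar>t' i - t' j\<bar> <= 1) &
 (EX G E c1. (ALL c:P. wfam r (sqr (t c) (q c) rh) G A & wfam r (sqr (t c) (q c) rh) E eps &
 (ALL x y. (x, y) : sqr (t c) (q c) rh --> lo <= G [False] x y & G [False] x y <= hi)) &
 (ALL j:P. t' j = G [] (t j) (q j) & q' j = c0*q j + c1 + E [] (t j) (q j)))"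

lemma link_diff:
 assumes "link r A eps rh c0 lo hi P t q t' q'" "i : P" "j : P" "0 <= lo" "0 <= c0"
 shows "c0*\<bar>q i - q j\<bar> - eps*(\<bar>t i - t j\<bar> + \<bar>q i - q j\<bar>) <= \<bar>q' i - q' j\<bar>"
 "\<bar>q' i - q' j\<bar> <= c0*\<bar>q i - q j\<bar> + eps*(\<bar>t i - t j\<bar> + \<bar>q i - q j\<bar>)"
 "lo*\<bar>t i - t j\<bar> - A*\<bar>q i - q j\<bar> <= \<bar>t' i - t' j\<bar>"
 "\<bar>t' i - t' j\<bar> <= hi*\<bar>t i - t j\<bar> + A*\<bar>q i - q j\<bar>"
 "\<bar>t i - t j\<bar> <= rh/2" "\<bar>t' i - t' j\<bar> <= 1"
proof -
 have a: "\<bar>q' i - q' j - c0*(q i - q j)\<bar> <= eps*(\<bar>t i - t j\<bar> + \<bar>q i - q j\<bar>)"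
 and ex: "EX s h. t' i - t' j = s*(t i - t j) + h*(q i - q j) & lo <= s & s <= hi & \<bar>h\<bar> <= A"
 and b: "\<bar>t i - t j\<bar> <= rh/2" "\<bar>t' i - t' j\<bar> <= 1"
 using assms unfolding link_def by blast+
 have m: "\<bar>c0*(q i - q j)\<bar> = c0*\<bar>q i - q j\<bar>" using assms by (simp add: abs_mult)
 show "c0*\<bar>q i - q j\<bar> - eps*(\<bar>t i - t j\<bar> + \<bar>q i - q j\<bar>) <= \<bar>q' i - q' j\<bar>"
 "\<bar>q' i - q' j\<bar> <= c0*\<bar>q i - q j\<bar> + eps*(\<bar>t i - t j\<bar> + \<bar>q i - q j\<bar>)" using a m by linarith+
 obtain s h where s: "t' i - t' j = s*(t i - t j) + h*(q i - q j)" "lo <= s" "s <= hi" "\<bar>h\<bar> <= A" using ex by blast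
 have "\<bar>h*(q i - q j)\<bar> <= A*\<bar>q i - q j\<bar>" using s(4) by (simp add: abs_mult mult_right_mono)
 moreover have "lo*\<bar>t i - t j\<bar> <= \<bar>s*(t i - t j)\<bar>" "\<bar>s*(t i - t j)\<bar> <= hi*\<bar>t i - t j\<bar>"
 using s assms(4) by (simp_all add: abs_mult mult_right_mono)
 ultimately show "lo*\<bar>t i - t j\<bar> - A*\<bar>q i - q j\<bar> <= \<bar>t' i - t' j\<bar>"
 "\<bar>t' i - t' j\<bar> <= hi*\<bar>t i - t j\<bar> + A*\<bar>q i - q j\<bar>" using s(1) by linarith+
 show "\<bar>t i - t j\<bar> <= rh/2" "\<bar>t' i - t' j\<bar> <= 1" by (rule b)+
qed

text \<open>The index runs away from the crossing in both sheets, forwards in time above and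
  backwards below; below, the map leads from the primed data to the unprimed, hence the exchanged
  arguments. A weak step may pass close to a hole, where the slope of t is controlled by
  \<open>A\<close> alone.\<close>

definition olink :: "bool => bool => nat => real => real => real => 'i set =>
 ('i => real) => ('i => real) => ('i => real) => ('i => real) => bool" where
 "olink up weak r A eps rh P t q t' q' \<longleftrightarrow>
 (if up then link r A eps rh mu (1/50) (if weak then A else 1/10) P t q t' q'
 else link r A eps rh lam (if weak then 1/A else 10) 40 P t' q' t q)"

text \<open>A half orbit of close, pairwise distinct points starting at the crossing. Only step 0
  may be weak, since the orbit then stays far from the holes.\<close>

definition chain :: "bool => nat => real => real => real => 'i set => (nat => 'i => real) => (nat => 'i => real) => bool" where
 "chain up r A eps rh P t q \<longleftrightarrow>
 (ALL n. olink up (n = 0) r A eps rh P (t n) (q n) (t (Suc n)) (q (Suc n))) &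
 (ALL n. ALL i:P. ALL j:P. \<bar>t n i - t n j\<bar> <= 1 & \<bar>q n i - q n j\<bar> <= 1 & (i ~= j --> t n i ~= t n j | q n i ~= q n j))"

text \<open>With growing index q expands in both sheets: above by \<open>mu\<close>, below because
  forward time contracts it by \<open>lam\<close>. So the excess of a pair over the cone of slope
  \<open>ze\<close> at least doubles.\<close>

lemma olink_expand:
 assumes L: "olink up False r A eps rh P t q t' q'" and ij: "i : P" "j : P"
 and A: "1 <= A" and eta: "0 < ze" "8*A*A*ze <= 1" and ep: "0 <= eps" "eps <= ze"
 shows "2*(\<bar>q i - q j\<bar> - ze*\<bar>t i - t j\<bar>) <= \<bar>q' i - q' j\<bar> - ze*\<bar>t' i - t' j\<bar>"
proof -
 have AA: "A*1 <= A*A" using A by (intro mult_left_mono) auto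
 hence "8*A <= 8*A*A" by linarith
 hence "8*A*ze <= 8*A*A*ze" by (rule mult_right_mono) (use eta(1) in simp)
 hence Ae: "A*ze <= 1/8" using eta by simp
 have "1*ze <= A*ze" using A eta by (intro mult_right_mono) auto
 hence e8: "ze <= 1/8" "eps <= 1/8" using Ae ep by auto
 show ?thesis
 proof (cases up)
 case True
 hence l: "link r A eps rh mu (1/50) (1/10) P t q t' q'" using L by (simp add: olink_def)
 define dt dq where d: "dt = \<bar>t i - t j\<bar>" "dq = \<bar>q i - q j\<bar>"
 define et eq where d': "et = \<bar>t' i - t' j\<bar>" "eq = \<bar>q' i - q' j\<bar>"
 have n: "0 <= dt" "0 <= dq" by (simp_all add: d)
 have 1: "mu*dq - eps*(dt + dq) <= eq" "et <= 1/10*dt + A*dq"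
 using link_diff(1,4)[OF l ij] mu_bounds by (auto simp: d d')
 have "ze*et <= ze*(1/10*dt + A*dq)" using 1 eta by (intro mult_left_mono) auto
 also have "... = ze*dt/10 + (A*ze)*dq" by (simp add: algebra_simps)
 also have "... <= ze*dt/10 + (1/8)*dq" using Ae n by (intro add_left_mono mult_right_mono) auto
 finally have a: "ze*et <= ze*dt/10 + (1/8)*dq" .
 have b: "eps*dt <= ze*dt" "eps*dq <= (1/8)*dq" "17*dq <= mu*dq"
 by (rule mult_right_mono; use ep e8 mu_bounds n in simp)+
 have b': "0 <= ze*dt" using n eta by simp
 have c: "eps*(dt + dq) = eps*dt + eps*dq" by (simp add: algebra_simps)
 have "2*(y - X) <= e - Z" if "Z <= X/10 + 1/8*y" "W <= X" "V <= 1/8*y" "17*y <= U" "0 <= X" "U - (W + V) <= e" "0 <= y"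
 for X Z W V U e y :: real using that by argo
 from this[OF a b b' 1(1)[unfolded c] n(2)] show ?thesis unfolding d[symmetric] d'[symmetric] .
 next
 case False
 hence l: "link r A eps rh lam 10 40 P t' q' t q" using L by (simp add: olink_def)
 define dt dq where d: "dt = \<bar>t' i - t' j\<bar>" "dq = \<bar>q' i - q' j\<bar>"
 define et eq where d': "et = \<bar>t i - t j\<bar>" "eq = \<bar>q i - q j\<bar>"
 have n: "0 <= dt" "0 <= dq" by (simp_all add: d)
 have 1: "eq <= lam*dq + eps*(dt + dq)" "10*dt - A*dq <= et"
 using link_diff(2,3)[OF l ij] lam_bounds by (auto simp: d d')
 have "ze*(10*dt - A*dq) <= ze*et" using 1 eta by (intro mult_left_mono) auto
 moreover have "ze*(10*dt - A*dq) = 10*(ze*dt) - (A*ze)*dq" by (simp add: algebra_simps)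
 moreover have "(A*ze)*dq <= (1/8)*dq" using Ae n by (intro mult_right_mono) auto
 ultimately have a: "10*(ze*dt) - (1/8)*dq <= ze*et" by linarith
 have b: "eps*dt <= ze*dt" "eps*dq <= (1/8)*dq" "lam*dq <= 3/50*dq"
 by (rule mult_right_mono; use ep e8 lam_bounds n in simp)+
 have b': "0 <= ze*dt" using n eta by simp
 have c: "eps*(dt + dq) = eps*dt + eps*dq" by (simp add: algebra_simps)
 have "2*(e - Z) <= y - X" if "10*X - 1/8*y <= Z" "W <= X" "V <= 1/8*y" "U <= 3/50*y" "0 <= X" "e <= U + (W + V)" "0 <= y"
 for X Z W V U e y :: real using that by argo
 from this[OF a b b' 1(1)[unfolded c] n(2)] show ?thesis unfolding d[symmetric] d'[symmetric] .
 qed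
qed

text \<open>A positive excess over the cone would double forever, although it never exceeds the
  difference of q, which is at most 1.\<close>

lemma cone_strong:
 fixes t q :: "nat => 'i => real"
 assumes L: "!!n. n >= n0 ==> olink up False r A eps rh P (t n) (q n) (t (Suc n)) (q (Suc n))"
 and B: "!!n. n >= n0 ==> \<bar>q n i - q n j\<bar> <= 1" and ij: "i : P" "j : P"
 and A: "1 <= A" and eta: "0 < ze" "8*A*A*ze <= 1" and ep: "0 <= eps" "eps <= ze"
 shows "\<bar>q n0 i - q n0 j\<bar> <= ze*\<bar>t n0 i - t n0 j\<bar>"
proof (rule ccontr)
 define M where "M k = \<bar>q (n0 + k) i - q (n0 + k) j\<bar> - ze*\<bar>t (n0 + k) i - t (n0 + k) j\<bar>" for k
 assume "~ ?thesis"
 hence M0: "0 < M 0" by (simp add: M_def)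
 have "2 ^ k*M 0 <= M k" for k
 proof (induction k)
 case (Suc k)
 have "2*M k <= M (Suc k)"
 unfolding M_def add_Suc_right by (rule olink_expand[OF L ij A eta ep]) simp
 thus ?case using Suc by simp
 qed simp
 moreover have "M k <= 1" for k
 proof -
 have "0 <= ze*\<bar>t (n0 + k) i - t (n0 + k) j\<bar>" using eta by simp
 thus ?thesis using B[of "n0 + k"] by (simp add: M_def)
 qed
 ultimately have b: "2 ^ k*M 0 <= 1" for k using order_trans by blast
 obtain k where "1/M 0 < 2 ^ k" using real_arch_pow[of 2 "1/M 0"] by auto
 hence "1 < 2 ^ k*M 0" using M0 by (simp add: field_simps)
 thus False using b[of k] by simp
qed

text \<open>Inside the cone the differences of q are negligible for those of t, which therefore
  follow the slope bounds: with growing index they at least halve in a step that is not weak, and no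
  step shrinks them by more than 60.\<close>

lemma olink_growth:
 assumes L: "olink up w r A eps rh P t q t' q'" and ij: "i : P" "j : P"
 and A: "1 <= A" and eta: "0 < ze" "8*A*A*ze <= 1/50"
 and c: "\<bar>q i - q j\<bar> <= ze*\<bar>t i - t j\<bar>" "\<bar>q' i - q' j\<bar> <= ze*\<bar>t' i - t' j\<bar>"
 shows "\<bar>t i - t j\<bar>/60 <= \<bar>t' i - t' j\<bar>" "~ up ==> \<bar>t' i - t' j\<bar>/(2*A) <= \<bar>t i - t j\<bar>"
 "up ==> ~ w ==> \<bar>t' i - t' j\<bar> <= \<bar>t i - t j\<bar>/2" "~ up ==> ~ w ==> 2*\<bar>t' i - t' j\<bar> <= \<bar>t i - t j\<bar>"
proof -
 have "8*A*1*ze <= 8*A*A*ze" using A eta by (intro mult_right_mono mult_left_mono) auto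
 hence Ae: "A*ze <= 1/400" using eta by simp
 have a1: "A*\<bar>q i - q j\<bar> <= 1/400*\<bar>t i - t j\<bar>"
 proof -
 have "A*\<bar>q i - q j\<bar> <= A*(ze*\<bar>t i - t j\<bar>)" using c A by (intro mult_left_mono) auto
 also have "... = A*ze*\<bar>t i - t j\<bar>" by simp
 also have "... <= 1/400*\<bar>t i - t j\<bar>" using Ae by (intro mult_right_mono) auto
 finally show ?thesis .
 qed
 have a2: "A*\<bar>q' i - q' j\<bar> <= 1/400*\<bar>t' i - t' j\<bar>" "A*\<bar>q' i - q' j\<bar> <= 1/(2*A)*\<bar>t' i - t' j\<bar>"
 proof -
 have 1: "A*\<bar>q' i - q' j\<bar> <= A*(ze*\<bar>t' i - t' j\<bar>)" using c A by (intro mult_left_mono) auto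
 hence 2: "A*\<bar>q' i - q' j\<bar> <= A*ze*\<bar>t' i - t' j\<bar>" by simp
 have "A*ze*\<bar>t' i - t' j\<bar> <= 1/400*\<bar>t' i - t' j\<bar>" using Ae by (intro mult_right_mono) auto
 thus "A*\<bar>q' i - q' j\<bar> <= 1/400*\<bar>t' i - t' j\<bar>" using 2 by linarith
 have "A*ze <= 1/(2*A)" using A eta by (simp add: pos_le_divide_eq mult_ac)
 hence "A*ze*\<bar>t' i - t' j\<bar> <= 1/(2*A)*\<bar>t' i - t' j\<bar>" by (intro mult_right_mono) auto
 thus "A*\<bar>q' i - q' j\<bar> <= 1/(2*A)*\<bar>t' i - t' j\<bar>" using 2 by linarith
 qed
 have "0 <= \<bar>t i - t j\<bar>" "0 <= \<bar>t' i - t' j\<bar>" by simp_all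
 have u: "link r A eps rh mu (1/50) (if w then A else 1/10) P t q t' q'" if up using L that by (simp add: olink_def)
 have v: "link r A eps rh lam (if w then 1/A else 10) 40 P t' q' t q" if "~ up" using L that by (simp add: olink_def)
 have lo: "0 <= (if w then 1/A else 10)" using A by simp
 show "\<bar>t i - t j\<bar>/60 <= \<bar>t' i - t' j\<bar>"
 proof (cases up)
 case True
 have "1/50*\<bar>t i - t j\<bar> - A*\<bar>q i - q j\<bar> <= \<bar>t' i - t' j\<bar>"
 by (rule link_diff(3)[OF u[OF True] ij]) (use mu_bounds in auto)
 thus ?thesis using a1 \<open>0 <= \<bar>t i - t j\<bar>\<close> by linarith
 next
 case False
 have "\<bar>t i - t j\<bar> <= 40*\<bar>t' i - t' j\<bar> + A*\<bar>q' i - q' j\<bar>"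
 by (rule link_diff(4)[OF v[OF False] ij lo]) (use lam_bounds in simp)
 moreover have "x/60 <= y" if "x <= 40*y + z" "z <= 1/400*y" "0 <= y" for x y z :: real
 using that by linarith
 ultimately show ?thesis using a2(1) by (metis abs_ge_zero)
 qed
 show "\<bar>t' i - t' j\<bar>/(2*A) <= \<bar>t i - t j\<bar>" if "~ up"
 proof -
 have "1/A*\<bar>t' i - t' j\<bar> <= (if w then 1/A else 10)*\<bar>t' i - t' j\<bar>"
 using A by (intro mult_right_mono) (auto simp: divide_le_eq)
 moreover have "1/A*\<bar>t' i - t' j\<bar> = 2*(1/(2*A)*\<bar>t' i - t' j\<bar>)" by simp
 moreover have "\<bar>t' i - t' j\<bar>/(2*A) = 1/(2*A)*\<bar>t' i - t' j\<bar>" by simp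
 ultimately show ?thesis using link_diff(3)[OF v[OF that] ij lo] lam_bounds a2(2) by linarith
 qed
 show "\<bar>t' i - t' j\<bar> <= \<bar>t i - t j\<bar>/2" if "up" "~ w"
 proof -
 have "\<bar>t' i - t' j\<bar> <= 1/10*\<bar>t i - t j\<bar> + A*\<bar>q i - q j\<bar>"
 using link_diff(4)[OF u[OF that(1)] ij] that mu_bounds by simp
 moreover have "y <= x/2" if "y <= 1/10*x + z" "z <= 1/400*x" "0 <= x" for x y z :: real
 using that by argo
 ultimately show ?thesis using a1 by (metis abs_ge_zero)
 qed
 show "2*\<bar>t' i - t' j\<bar> <= \<bar>t i - t j\<bar>" if "~ up" "~ w"
 proof -
 have "10*\<bar>t' i - t' j\<bar> - A*\<bar>q' i - q' j\<bar> <= \<bar>t i - t j\<bar>"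
 using link_diff(3)[OF v[OF that(1)] ij lo] that lam_bounds by simp
 moreover have "2*x <= y" if "10*x - z <= y" "z <= 1/400*x" "0 <= x" for x y z :: real
 using that by argo
 ultimately show ?thesis using a2(1) by (metis abs_ge_zero)
 qed
qed

lemma chain_cone:
 assumes A: "1 <= A" and k: "0 < kp"
 shows "EX eps0>0. ALL eps up (P :: 'i set) t q. 0 <= eps & eps <= eps0 & chain up r A eps rh P t q -->
 (ALL n. ALL i:P. ALL j:P. \<bar>q n i - q n j\<bar> <= kp*\<bar>t n i - t n j\<bar>)"
proof -
 define ze where "ze = min (kp/(4*A)) (1/(8*A*A))"
 have eta: "0 < ze" "4*A*ze <= kp" "8*A*A*ze <= 1"
 proof -
 show "0 < ze" using A k by (simp add: ze_def)
 have "ze <= kp/(4*A)" "ze <= 1/(8*A*A)" by (simp_all add: ze_def)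
 thus "4*A*ze <= kp" "8*A*A*ze <= 1" using A by (simp_all add: pos_le_divide_eq mult_ac)
 qed
 have "1*ze <= (4*A)*ze" using A eta by (intro mult_right_mono) auto
 hence ek: "ze <= kp" using eta by linarith
 have AA: "A*1 <= A*A" using A by (intro mult_left_mono) auto
 hence "8*A <= 8*A*A" by linarith
 hence "8*A*ze <= 8*A*A*ze" by (rule mult_right_mono) (use eta(1) in simp)
 hence Ae: "A*ze <= 1/8" using eta by simp
 have "1*ze <= A*ze" using A eta by (intro mult_right_mono) auto
 hence e8: "ze <= 1/8" using Ae by auto
 show ?thesis
 proof (rule exI[of _ ze], intro conjI allI impI ballI eta)
 fix eps up and P :: "'i set" and t q n i j
 assume "0 <= eps & eps <= ze & chain up r A eps rh P t q" and ij: "i : P" "j : P"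
 hence ep: "0 <= eps" "eps <= ze" and ch: "chain up r A eps rh P t q" by auto
 have S: "\<bar>q n i - q n j\<bar> <= ze*\<bar>t n i - t n j\<bar>" if n: "1 <= n" for n
 proof (rule cone_strong[OF _ _ ij A eta(1,3) ep])
 fix m assume "n <= m"
 hence "m ~= 0" using n by simp
 thus "olink up False r A eps rh P (t m) (q m) (t (Suc m)) (q (Suc m))" using ch unfolding chain_def by metis
 show "\<bar>q m i - q m j\<bar> <= 1" using ch ij unfolding chain_def by blast
 qed
 show "\<bar>q n i - q n j\<bar> <= kp*\<bar>t n i - t n j\<bar>"
 proof (cases "n = 0")
 case False
 hence "\<bar>q n i - q n j\<bar> <= ze*\<bar>t n i - t n j\<bar>" using S by simp
 also have "... <= kp*\<bar>t n i - t n j\<bar>" using ek by (intro mult_right_mono) auto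
 finally show ?thesis .
 next
 case True
 have L: "olink up True r A eps rh P (t 0) (q 0) (t 1) (q 1)" using ch unfolding chain_def by (metis One_nat_def)
 define dt dq where d: "dt = \<bar>t 0 i - t 0 j\<bar>" "dq = \<bar>q 0 i - q 0 j\<bar>"
 define et eq where e: "et = \<bar>t 1 i - t 1 j\<bar>" "eq = \<bar>q 1 i - q 1 j\<bar>"
 have n: "0 <= dt" "0 <= dq" "0 <= et" "0 <= eq" by (simp_all add: d e)
 have s: "eq <= ze*et" using S[of 1] by (simp add: e)
 have "dq <= 4*A*ze*dt"
 proof (cases up)
 case True
 hence l: "link r A eps rh mu (1/50) A P (t 0) (q 0) (t 1) (q 1)" using L by (simp add: olink_def)
 have 1: "mu*dq - eps*(dt + dq) <= eq" "et <= A*dt + A*dq"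
 using link_diff(1,4)[OF l ij] mu_bounds by (auto simp: d e)
 have "ze*et <= ze*(A*dt + A*dq)" using 1 eta by (intro mult_left_mono) auto
 also have "... = A*ze*dt + A*ze*dq" by (simp add: algebra_simps)
 also have "... <= A*ze*dt + (1/8)*dq" using Ae n by (intro add_left_mono mult_right_mono) auto
 finally have a: "ze*et <= A*ze*dt + (1/8)*dq" .
 have "eps*dt <= A*ze*dt" "eps*dq <= (1/8)*dq" "17*dq <= mu*dq"
 by (rule mult_right_mono; use ep e8 \<open>1 * ze <= A * ze\<close> mu_bounds n in simp)+
 moreover have "eps*(dt + dq) = eps*dt + eps*dq" "4*A*ze*dt = 4*(A*ze*dt)" by (simp_all add: algebra_simps)
 moreover have "0 <= A*ze*dt" using A eta n by simp
 ultimately show ?thesis using a 1(1) s n by linarith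
 next
 case False
 hence l: "link r A eps rh lam (1/A) 40 P (t 1) (q 1) (t 0) (q 0)" using L by (simp add: olink_def)
 have 1: "dq <= lam*eq + eps*(et + eq)" "1/A*et - A*eq <= dt"
 using link_diff(2,3)[OF l ij] lam_bounds A by (auto simp: d e)
 have "eps*et <= ze*et" "eps*eq <= (1/8)*eq" "lam*eq <= 3/50*eq"
 by (rule mult_right_mono; use ep e8 lam_bounds n in simp)+
 moreover have "eps*(et + eq) = eps*et + eps*eq" by (simp add: algebra_simps)
 ultimately have a: "dq <= 2*(ze*et)" using 1(1) mult_left_mono[OF s, of 1] n by argo
 have "A*eq <= A*(ze*et)" using s A by (intro mult_left_mono) auto
 also have "... <= et/(2*A)"
 proof -
 have "A*ze <= 1/(2*A)" using A eta by (simp add: pos_le_divide_eq mult_ac)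
 hence "A*ze*et <= 1/(2*A)*et" using n by (intro mult_right_mono) auto
 thus ?thesis by simp
 qed
 finally have "et/(2*A) <= dt" using 1(2) by (simp add: field_simps)
 hence "et <= 2*A*dt" using A by (simp add: field_simps)
 hence "ze*et <= ze*(2*A*dt)" using eta by (intro mult_left_mono) auto
 thus ?thesis using a by (simp add: mult_ac)
 qed
 also have "... <= kp*dt" using eta n by (intro mult_right_mono) auto
 finally show ?thesis using True by (simp add: d)
 qed
 qed
qed

text \<open>Iteration gives D 1 <= D (1 + j)/400^j + 2 e, and the first term tends to 0 because
  60/400 < 1, however large K is.\<close>

lemma decay:
 fixes D :: "nat => real"
 assumes rec: "!!n. 1 <= n ==> D n <= D (Suc n)/400 + e" and bd: "!!n. D n <= K*60 ^ n" and e: "0 <= e"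
 shows "D 1 <= 2*e"
proof -
 have it: "D 1 <= D (1 + j)/400 ^ j + 2*e*(1 - 1/2 ^ j)" for j
 proof (induction j)
 case (Suc j)
 have "D (1 + j)/400 ^ j <= (D (1 + Suc j)/400 + e)/400 ^ j" using rec[of "1 + j"] by (intro divide_right_mono) auto
 also have "... = D (1 + Suc j)/400 ^ Suc j + e/400 ^ j" by (simp add: add_divide_distrib)
 also have "... <= D (1 + Suc j)/400 ^ Suc j + e/2 ^ j" using e by (intro add_left_mono divide_left_mono power_mono) auto
 finally have "D 1 <= D (1 + Suc j)/400 ^ Suc j + (e/2 ^ j + 2*e*(1 - 1/2 ^ j))" using Suc by linarith
 also have "e/2 ^ j + 2*e*(1 - 1/2 ^ j) = 2*e*(1 - 1/2 ^ Suc j)" by (simp add: algebra_simps)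
 finally show ?case .
 qed simp
 have b: "D 1 <= 60*\<bar>K\<bar>*(3/20) ^ j + 2*e" for j
 proof -
 have p: "(3/20 :: real) ^ j = 60 ^ j/400 ^ j" by (simp add: power_divide[symmetric])
 have "K*60 ^ (1 + j)/400 ^ j = 60*K*(3/20) ^ j" unfolding p by simp
 also have "... <= 60*\<bar>K\<bar>*(3/20) ^ j" by (intro mult_right_mono) auto
 finally have "D (1 + j)/400 ^ j <= 60*\<bar>K\<bar>*(3/20) ^ j"
 using divide_right_mono[OF bd[of "1 + j"], of "400 ^ j"] by simp
 moreover have "2*e*(1 - 1/2 ^ j) <= 2*e*1" using e by (intro mult_left_mono) auto
 ultimately show ?thesis using it[of j] by linarith
 qed
 have "(%j. 60*\<bar>K\<bar>*(3/20) ^ j + 2*e) \<longlonglongrightarrow> 60*\<bar>K\<bar>*0 + 2*e"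
 by (intro tendsto_intros LIMSEQ_realpow_zero) auto
 from LIMSEQ_le_const[OF this] b show ?thesis by auto
qed

text \<open>From order k - 1 to order k. For n >= 1, \<open>one_step\<close> yields D n <= D (n +
  1)/400 + e, and \<open>decay\<close> bounds D by 2 e from index 1 on. The weak step at index 0
  costs a factor (2 A)^k.\<close>

lemma chain_dd_step:
 fixes P :: "'i set"
 assumes ch: "chain up r A eps rh P t q" and A: "1 <= A" and rho: "0 < rh" "rh <= 1" and k: "2 <= k" "k <= r"
 and eta: "0 < ze" "8*A*A*ze <= 1/50" "20*A*A*(10 ^ k*fact k*ze) <= 1" "C*(2*ze) <= 1/20" and C: "C = osC k A (1/(60*A))" "0 <= C"
 and ep: "0 <= eps" "eps <= ze"
 and cone: "!!n i j. i : P ==> j : P ==> \<bar>q n i - q n j\<bar> <= ze*\<bar>t n i - t n j\<bar>"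
 and IH: "!!n J. J <= P ==> 2 <= card J ==> card J <= k ==> \<bar>dd (t n) (q n) J\<bar> <= ze"
 and N: "N <= P" "card N = Suc k"
 shows "\<bar>dd (t n) (q n) N\<bar> <= (2*A) ^ k*(6*C*ze + 6*C*ze)"
proof -
 have fN: "finite N" using N(2) k by (metis card.infinite nat.distinct(1))
 have inj: "inj_on (t n) N" for n
 proof (rule inj_onI, rule ccontr)
 fix i j assume ij: "i : N" "j : N" "t n i = t n j" "i ~= j"
 hence "q n i = q n j" using cone[of i j n] N by auto
 moreover have "t n i ~= t n j | q n i ~= q n j" using ch ij N unfolding chain_def by blast
 ultimately show False using ij by blast
 qed
 have L: "olink up (n = 0) r A eps rh P (t n) (q n) (t (Suc n)) (q (Suc n))" for n using ch unfolding chain_def by blast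
 note gr = olink_growth[OF L _ _ A eta(1,2) cone cone]
 obtain c where c: "c : N" using N(2) by fastforce
 define D where "D n = \<bar>dd (t n) (q n) N\<bar>" for n
 define e where "e = C*(2*ze)"
 have e0: "0 <= e" using C eta by (simp add: e_def)
 have e1: "C*(ze + eps) <= e" unfolding e_def using C ep by (intro mult_left_mono) auto
 define xk where "xk = 10 ^ k*fact k*ze"
 have xi0: "0 <= xk" using eta by (simp add: xk_def)
 have "A*1*xk <= A*A*xk" "1*1*xk <= A*A*xk" using A xi0 by (intro mult_right_mono mult_mono; simp)+
 hence xi: "A*xk <= 1/20" "xk <= 1" "20*A*A*xk <= 1" using eta(3)[folded xk_def] by linarith+
 have m: "1/(60*A) <= 1/60" using A by (intro divide_left_mono) auto
 have fk: "1 <= (fact k :: real)" by (simp add: fact_ge_1)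
 have one: "EX S. \<bar>c0*dd tt qq N - dd tt' qq' N*S ^ k\<bar> <= e*(1 + \<bar>dd tt qq N\<bar>) & lo - 1/20 <= S & S <= hi + 1/20 & lo - A*xk <= S"
 if l: "link r A eps rh c0 lo hi P tt qq tt' qq'" and lo: "0 <= lo" "0 <= c0"
 and j: "inj_on tt N" "inj_on tt' N" and gg: "!!i j. i : N ==> j : N ==> 1/(60*A)*\<bar>tt i - tt j\<bar> <= \<bar>tt' i - tt' j\<bar>"
 and dd: "!!J. J <= N ==> 2 <= card J ==> card J <= k ==> \<bar>dd tt qq J\<bar> <= ze & \<bar>dd tt' qq' J\<bar> <= ze"
 for c0 lo hi tt qq tt' qq'
 proof -
 obtain G E c1 where GE: "ALL c:P. wfam r (sqr (tt c) (qq c) rh) G A & wfam r (sqr (tt c) (qq c) rh) E eps &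
 (ALL x y. (x, y) : sqr (tt c) (qq c) rh --> lo <= G [False] x y & G [False] x y <= hi)"
 "ALL j:P. tt' j = G [] (tt j) (qq j) & qq' j = c0*qq j + c1 + E [] (tt j) (qq j)"
 using l unfolding link_def by blast
 have cP: "c : P" using c N by blast
 have "EX x y s. (x, y) : sqr (tt c) (qq c) rh & \<bar>s\<bar> <= 10 ^ k*fact k*ze &
 \<bar>c0*(fact k*dd tt qq N) - fact k*dd tt' qq' N*(G [False] x y + G [True] x y * s) ^ k\<bar>
 <= osC k A (1/(60*A))*(ze + eps)*(1 + \<bar>dd tt qq N\<bar>)"
 proof (rule one_step[OF fN j N(2) k(1) _ _ ep(1) A _ dd c rho])
 show "wfam k (sqr (tt c) (qq c) rh) G A" "wfam k (sqr (tt c) (qq c) rh) E eps"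
 using GE(1) cP wfam_mono[OF _ k(2)] by blast+
 show "tt' i = G [] (tt i) (qq i) & qq' i = c0*qq i + c1 + E [] (tt i) (qq i)" if "i : N" for i
 using GE(2) that N by blast
 show "\<bar>tt i - tt j\<bar> <= rh/2 & \<bar>tt' i - tt' j\<bar> <= 1 & 1/(60*A)*\<bar>tt i - tt j\<bar> <= \<bar>tt' i - tt' j\<bar>"
 if "i : N" "j : N" for i j using link_diff(5,6)[OF l _ _ lo, of i j] gg that N by blast
 qed (use eta A xi in \<open>auto simp: xk_def\<close>)
 then obtain x y s where xy: "(x, y) : sqr (tt c) (qq c) rh" "\<bar>s\<bar> <= xk"
 "\<bar>c0*(fact k*dd tt qq N) - fact k*dd tt' qq' N*(G [False] x y + G [True] x y * s) ^ k\<bar>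
 <= C*(ze + eps)*(1 + \<bar>dd tt qq N\<bar>)" unfolding C xk_def by blast
 define S where "S = G [False] x y + G [True] x y * s"
 have wf: "wfam r (sqr (tt c) (qq c) rh) G A" and GF: "lo <= G [False] x y" "G [False] x y <= hi" using GE(1) cP xy(1) by blast+
 have "\<bar>G [True] x y\<bar> <= A" using wf xy(1) k unfolding wfam_def by auto
 hence "\<bar>G [True] x y * s\<bar> <= A*xk" unfolding abs_mult using xy(2) A by (intro mult_mono) auto
 hence S: "lo - 1/20 <= S" "S <= hi + 1/20" "lo - A*xk <= S" using GF xi by (simp_all add: S_def abs_le_iff)
 have "c0*(fact k*dd tt qq N) - fact k*dd tt' qq' N*S ^ k = fact k*(c0*dd tt qq N - dd tt' qq' N*S ^ k)"
 by (simp add: algebra_simps)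
 hence "fact k*\<bar>c0*dd tt qq N - dd tt' qq' N*S ^ k\<bar> = \<bar>c0*(fact k*dd tt qq N) - fact k*dd tt' qq' N*S ^ k\<bar>"
 by (simp add: abs_mult)
 also have "... <= C*(ze + eps)*(1 + \<bar>dd tt qq N\<bar>)" using xy(3) by (simp add: S_def)
 also have "... <= e*(1 + \<bar>dd tt qq N\<bar>)" using e1 by (intro mult_right_mono) auto
 finally have "fact k*\<bar>c0*dd tt qq N - dd tt' qq' N*S ^ k\<bar> <= e*(1 + \<bar>dd tt qq N\<bar>)" .
 moreover have "1*\<bar>c0*dd tt qq N - dd tt' qq' N*S ^ k\<bar> <= fact k*\<bar>c0*dd tt qq N - dd tt' qq' N*S ^ k\<bar>"
 using fk by (intro mult_right_mono) auto
 ultimately show ?thesis using S by (intro exI[of _ S]) auto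
 qed
 have two: "D n <= (if n = 0 then (2*A) ^ k*(D (Suc n) + 2*e) else D (Suc n)/400 + e)" for n
 proof -
 have IH': "\<bar>dd (t m) (q m) J\<bar> <= ze" if "J <= N" "2 <= card J" "card J <= k" for J m using IH that N by blast
 have D0: "0 <= D m" for m by (simp add: D_def)
 have pw1: "1 <= (2*A) ^ k" using A by (intro one_le_power) simp
 show ?thesis
 proof (cases up)
 case True
 hence l: "link r A eps rh mu (1/50) (if n = 0 then A else 1/10) P (t n) (q n) (t (Suc n)) (q (Suc n))"
 using L[of n] by (simp add: olink_def)
 have "EX S. \<bar>mu*dd (t n) (q n) N - dd (t (Suc n)) (q (Suc n)) N*S ^ k\<bar> <= e*(1 + \<bar>dd (t n) (q n) N\<bar>) &
 1/50 - 1/20 <= S & S <= (if n = 0 then A else 1/10) + 1/20 & 1/50 - A*xk <= S"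
 proof (rule one[OF l _ _ inj inj])
 fix i j assume ij: "i : N" "j : N"
 have "1/(60*A)*\<bar>t n i - t n j\<bar> <= 1/60*\<bar>t n i - t n j\<bar>" using m by (intro mult_right_mono) auto
 also have "... <= \<bar>t (Suc n) i - t (Suc n) j\<bar>" using gr(1)[of i j n] ij N by auto
 finally show "1/(60*A)*\<bar>t n i - t n j\<bar> <= \<bar>t (Suc n) i - t (Suc n) j\<bar>" .
 qed (use IH' mu_bounds in auto)
 then obtain S where S: "\<bar>mu*dd (t n) (q n) N - dd (t (Suc n)) (q (Suc n)) N*S ^ k\<bar> <= e*(1 + D n)"
 "1/50 - 1/20 <= S" "S <= (if n = 0 then A else 1/10) + 1/20" unfolding D_def by blast
 have "\<bar>mu*dd (t n) (q n) N\<bar> = mu*D n" using mu_bounds by (simp add: abs_mult D_def)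
 moreover have "\<bar>dd (t (Suc n)) (q (Suc n)) N*S ^ k\<bar> = D (Suc n)*\<bar>S\<bar> ^ k" by (simp add: abs_mult D_def power_abs)
 ultimately have 1: "mu*D n <= D (Suc n)*\<bar>S\<bar> ^ k + e*(1 + D n)" using S(1) by linarith
 have "e*D n <= 1/20*D n" using eta(4) D0 by (intro mult_right_mono) (auto simp: e_def)
 moreover have "17*D n <= mu*D n" using mu_bounds D0 by (intro mult_right_mono) auto
 moreover have "e*(1 + D n) = e + e*D n" by (simp add: algebra_simps)
 ultimately have 2: "16*D n <= D (Suc n)*\<bar>S\<bar> ^ k + e" using 1 D0[of n] by linarith
 show ?thesis
 proof (cases "n = 0")
 case True
 have "\<bar>S\<bar> <= 2*A" using S(2,3) True A by auto
 hence "\<bar>S\<bar> ^ k <= (2*A) ^ k" by (intro power_mono) auto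
 hence "D (Suc n)*\<bar>S\<bar> ^ k <= D (Suc n)*(2*A) ^ k" using D0 by (intro mult_left_mono) auto
 moreover have "1*(2*e) <= (2*A) ^ k*(2*e)" using pw1 e0 by (intro mult_right_mono) auto
 moreover have "(2*A) ^ k*(D (Suc n) + 2*e) = D (Suc n)*(2*A) ^ k + (2*A) ^ k*(2*e)" by (simp add: algebra_simps)
 ultimately have "D n <= (2*A) ^ k*(D (Suc n) + 2*e)" using 2 D0[of n] e0 by linarith
 thus ?thesis using True by simp
 next
 case False
 \<comment> \<open>Since k >= 2, the rate is at most (1/5)^2/16 = 1/400.\<close>
 have "\<bar>S\<bar> <= 1/5" using S(2,3) False by auto
 hence "\<bar>S\<bar> ^ k <= (1/5) ^ k" by (intro power_mono) auto
 also have "... <= (1/5) ^ 2" using k by (intro power_decreasing) auto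
 finally have "D (Suc n)*\<bar>S\<bar> ^ k <= D (Suc n)*(1/5) ^ 2" using D0 by (intro mult_left_mono) auto
 hence "D (Suc n)*\<bar>S\<bar> ^ k <= D (Suc n)/25" by (simp add: power2_eq_square)
 thus ?thesis using 2 False D0[of "Suc n"] e0 by simp
 qed
 next
 case False
 hence l: "link r A eps rh lam (if n = 0 then 1/A else 10) 40 P (t (Suc n)) (q (Suc n)) (t n) (q n)"
 using L[of n] by (simp add: olink_def)
 have "EX S. \<bar>lam*dd (t (Suc n)) (q (Suc n)) N - dd (t n) (q n) N*S ^ k\<bar> <= e*(1 + \<bar>dd (t (Suc n)) (q (Suc n)) N\<bar>) &
 (if n = 0 then 1/A else 10) - 1/20 <= S & S <= 40 + 1/20 & (if n = 0 then 1/A else 10) - A*xk <= S"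
 proof (rule one[OF l _ _ inj inj])
 fix i j assume ij: "i : N" "j : N"
 have "1/(60*A)*\<bar>t (Suc n) i - t (Suc n) j\<bar> <= 1/(2*A)*\<bar>t (Suc n) i - t (Suc n) j\<bar>"
 using A by (intro mult_right_mono divide_left_mono) auto
 also have "... <= \<bar>t n i - t n j\<bar>" using gr(2)[of i j n] ij N False by auto
 finally show "1/(60*A)*\<bar>t (Suc n) i - t (Suc n) j\<bar> <= \<bar>t n i - t n j\<bar>" .
 qed (use IH' lam_bounds A in auto)
 then obtain S where S: "\<bar>lam*dd (t (Suc n)) (q (Suc n)) N - dd (t n) (q n) N*S ^ k\<bar> <= e*(1 + D (Suc n))"
 "(if n = 0 then 1/A else 10) - 1/20 <= S" "(if n = 0 then 1/A else 10) - A*xk <= S" unfolding D_def by blast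
 have "\<bar>lam*dd (t (Suc n)) (q (Suc n)) N\<bar> = lam*D (Suc n)" using lam_bounds by (simp add: abs_mult D_def)
 moreover have "\<bar>dd (t n) (q n) N*S ^ k\<bar> = D n*\<bar>S\<bar> ^ k" by (simp add: abs_mult D_def power_abs)
 ultimately have 1: "D n*\<bar>S\<bar> ^ k <= lam*D (Suc n) + e*(1 + D (Suc n))" using S(1) by linarith
 have "e*D (Suc n) <= 1/20*D (Suc n)" using eta(4) D0 by (intro mult_right_mono) (auto simp: e_def)
 moreover have "lam*D (Suc n) <= 3/50*D (Suc n)" using lam_bounds D0 by (intro mult_right_mono) auto
 moreover have "e*(1 + D (Suc n)) = e + e*D (Suc n)" by (simp add: algebra_simps)
 ultimately have 2: "D n*\<bar>S\<bar> ^ k <= 11/100*D (Suc n) + e" using 1 by linarith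
 show ?thesis
 proof (cases "n = 0")
 case True
 have "A*xk <= 1/(2*A)" using xi(3) A by (simp add: pos_le_divide_eq mult_ac xi0)
 moreover have "1/A = 2*(1/(2*A))" by simp
 ultimately have S': "1/(2*A) <= S" using S(3) True by simp
 hence "(1/(2*A)) ^ k <= \<bar>S\<bar> ^ k" using A by (intro power_mono) auto
 hence "D n*(1/(2*A)) ^ k <= D n*\<bar>S\<bar> ^ k" using D0 by (intro mult_left_mono) auto
 hence "D n*(1/(2*A)) ^ k <= D (Suc n) + 2*e" using 2 D0[of "Suc n"] e0 by linarith
 hence "(2*A) ^ k*(D n*(1/(2*A)) ^ k) <= (2*A) ^ k*(D (Suc n) + 2*e)" using A by (intro mult_left_mono) auto
 moreover have p1: "(2*A) ^ k*(1/(2*A)) ^ k = 1"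
 proof -
 have "(2*A) ^ k*(1/(2*A)) ^ k = (2*A*(1/(2*A))) ^ k" by (rule power_mult_distrib[symmetric])
 also have "2*A*(1/(2*A)) = 1" using A by simp
 finally show ?thesis by simp
 qed
 moreover have "(2*A) ^ k*(D n*(1/(2*A)) ^ k) = D n"
 unfolding mult.left_commute[of "(2*A) ^ k" "D n"] p1 by (rule mult_1_right)
 ultimately have "D n <= (2*A) ^ k*(D (Suc n) + 2*e)" by argo
 thus ?thesis unfolding if_P[OF True] .
 next
 case False
 \<comment> \<open>Below, the rate is at most (11/100)/81, again less than 1/400.\<close>
 have "9 <= S" using S(2) False by simp
 hence "9 ^ k <= \<bar>S\<bar> ^ k" by (intro power_mono) auto
 moreover have "(9::real) ^ 2 <= 9 ^ k" using k by (intro power_increasing) auto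
 ultimately have "81 <= \<bar>S\<bar> ^ k" by simp
 hence "D n*81 <= D n*\<bar>S\<bar> ^ k" using D0 by (intro mult_left_mono) auto
 thus ?thesis using 2 False D0[of "Suc n"] D0[of n] e0 by simp
 qed
 qed
 qed
 have "~ card N <= Suc 0" using N(2) k by simp
 then obtain a b where ab: "a : N" "b : N" "a ~= b" unfolding card_le_Suc0_iff_eq[OF fN] by blast
 define T where "T n = \<bar>t n a - t n b\<bar>" for n
 have T0: "0 < T 0" using inj[of 0] ab by (auto simp: T_def inj_on_def)
 have Tn: "T 0/60 ^ n <= T n" for n
 proof (induction n)
 case (Suc n)
 have "T n/60 <= T (Suc n)" using gr(1)[of a b n] ab N by (auto simp: T_def)
 moreover have "T 0/60 ^ n/60 <= T n/60" using Suc by (intro divide_right_mono) auto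
 moreover have "T 0/60 ^ Suc n = T 0/60 ^ n/60" by simp
 ultimately show ?case by linarith
 qed simp
 \<comment> \<open>The only a priori bound on the top divided difference: by the recurrence it is at
   most 2 ze over the distance of two nodes, and that distance shrinks by at most 60 per
   step.\<close>
 have bd: "D n <= 2*ze/T 0*60 ^ n" for n
 proof -
 have c3: "3 <= card N" using N k by simp
 have "dd (t n) (q n) N*(t n a - t n b) = dd (t n) (q n) (N - {b}) - dd (t n) (q n) (N - {a})"
 by (rule dd_recurrence[OF fN inj ab c3])
 hence "D n*T n = \<bar>dd (t n) (q n) (N - {b}) - dd (t n) (q n) (N - {a})\<bar>" by (simp add: D_def T_def abs_mult[symmetric])
 moreover have "\<bar>dd (t n) (q n) (N - {x})\<bar> <= ze" if "x : N" for x
 using IH[of "N - {x}" n] N that fN k by auto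
 hence "\<bar>dd (t n) (q n) (N - {b})\<bar> <= ze" "\<bar>dd (t n) (q n) (N - {a})\<bar> <= ze" using ab by blast+
 ultimately have "D n*T n <= 2*ze" by linarith
 moreover have "D n*(T 0/60 ^ n) <= D n*T n" using Tn by (intro mult_left_mono) (auto simp: D_def)
 ultimately have "D n*(T 0/60 ^ n) <= 2*ze" by linarith
 moreover have "D n*(T 0/60 ^ n) = D n*T 0/60 ^ n" by simp
 ultimately have "D n*T 0 <= 2*ze*60 ^ n" by (simp only: pos_divide_le_eq[OF zero_less_power[of "60::real"]] zero_less_numeral)
 hence "D n <= 2*ze*60 ^ n/T 0" by (simp only: pos_le_divide_eq[OF T0])
 thus ?thesis by simp
 qed
 have two0: "D 0 <= (2*A) ^ k*(D 1 + 2*e)" using two[of 0] unfolding if_P[OF refl] One_nat_def .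
 have twoS: "D n <= D (Suc n)/400 + e" if "1 <= n" for n
 proof -
 have "n ~= 0" using that by simp
 from two[of n, unfolded if_not_P[OF this]] show ?thesis .
 qed
 have D1: "D m <= 2*e" if m1: "1 <= m" for m
 proof -
 obtain m' where m': "m = 1 + m'" using le_Suc_ex[OF m1] by blast
 have "D (m' + 1) <= 2*e"
 proof (rule decay[where D="%n. D (m' + n)" and K="2*ze/T 0*60 ^ m'"])
 show "D (m' + n) <= D (m' + Suc n)/400 + e" if "1 <= n" for n unfolding add_Suc_right by (rule twoS) (use that in simp)
 show "D (m' + n) <= 2*ze/T 0*60 ^ m'*60 ^ n" for n using bd[of "m' + n"] unfolding power_add by (simp only: mult.assoc)
 qed (rule e0)
 thus ?thesis by (simp add: m' add.commute)
 qed
 have pw1: "1 <= (2*A) ^ k" using A by (intro one_le_power) simp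
 have "D n <= (2*A) ^ k*(2*e + 2*e)"
 proof (cases "n = 0")
 case True
 have "(2*A) ^ k*(D 1 + 2*e) <= (2*A) ^ k*(2*e + 2*e)" using D1[of 1] A by (intro mult_left_mono) auto
 hence "D 0 <= (2*A) ^ k*(2*e + 2*e)" using two0 by (rule order_trans[rotated])
 thus ?thesis unfolding True .
 next
 case False
 have "1*(2*e + 2*e) <= (2*A) ^ k*(2*e + 2*e)" using pw1 e0 by (intro mult_right_mono) auto
 thus ?thesis using D1[of n] False e0 by simp
 qed
 also have "... <= (2*A) ^ k*(6*C*ze + 6*C*ze)" using A C eta by (intro mult_left_mono) (auto simp: e_def)
 finally show ?thesis by (simp add: D_def)
qed

text \<open>Induction on the order: lower orders are first made so small that the constant of
  \<open>chain_dd_step\<close> brings the next order below \<open>kp\<close>. The bound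
  \<open>eps0\<close> is the same for all chains and hence for all perturbations.\<close>

lemma chain_dd:
 assumes A: "1 <= A" and rho: "0 < rh" "rh <= 1" and k: "1 <= k" "k <= r" and kap: "0 < kp"
 shows "\<exists>eps0>0. \<forall>eps up (P :: 'i set) t q. 0 <= eps \<and> eps <= eps0 \<and> chain up r A eps rh P t q -->
 (\<forall>n J. J \<subseteq> P \<and> 2 <= card J \<and> card J <= Suc k --> \<bar>dd (t n) (q n) J\<bar> <= kp)"
 using k kap
proof (induction k arbitrary: kp rule: nat_induct_at_least)
 case base
 obtain eps0 where e0: "0 < eps0" "\<forall>eps up (P :: 'i set) t q. 0 <= eps \<and> eps <= eps0 \<and> chain up r A eps rh P t q -->
 (\<forall>n. \<forall>i\<in>P. \<forall>j\<in>P. \<bar>q n i - q n j\<bar> <= kp * \<bar>t n i - t n j\<bar>)" using chain_cone[OF A base(2), of r rh] by blast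
 show ?case
 proof (rule exI[of _ eps0], intro conjI allI impI e0(1))
 fix eps up and P :: "'i set" and t q n J
 assume h: "0 <= eps \<and> eps <= eps0 \<and> chain up r A eps rh P t q" and J: "J \<subseteq> P \<and> 2 <= card J \<and> card J <= Suc 1"
 hence "card J = 2" by simp
 then obtain a b where ab: "J = {a, b}" "a ~= b" by (meson card_2_iff)
 have c: "\<bar>q n a - q n b\<bar> <= kp * \<bar>t n a - t n b\<bar>" using e0(2)[rule_format, OF h] ab J by blast
 have "t n a ~= t n b"
 proof
 assume "t n a = t n b"
 moreover hence "q n a = q n b" using c by simp
 moreover have "t n a ~= t n b \<or> q n a ~= q n b" using h ab J unfolding chain_def by blast
 ultimately show False by blast
 qed
 hence "\<bar>dd (t n) (q n) J\<bar> * \<bar>t n a - t n b\<bar> = \<bar>q n a - q n b\<bar>"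
 using dd_pair[OF ab(2), of "t n" "q n"] by (simp add: ab(1) abs_mult[symmetric])
 hence "\<bar>dd (t n) (q n) J\<bar> * \<bar>t n a - t n b\<bar> <= kp * \<bar>t n a - t n b\<bar>" using c by simp
 thus "\<bar>dd (t n) (q n) J\<bar> <= kp" using \<open>t n a ~= t n b\<close> by simp
 qed
next
 case (Suc k)
 let ?k = "Suc k"
 have k: "2 <= ?k" "?k <= r" using Suc by auto
 define C where "C = \<bar>osC ?k A (1 / (60 * A))\<bar> + 1"
 \<comment> \<open>One summand for each smallness requirement, so that \<open>1 / B\<close> meets
   all of them.\<close>
 define B where "B = 400 * A * A + 20 * A * A * (10 ^ ?k * fact ?k) + 40 * C + (2 * A) ^ ?k * (12 * C) / kp + 1 / kp"
 define ze where "ze = 1 / B"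
 have C: "1 <= C" by (simp add: C_def)
 have pos: "0 < 400 * A * A" "0 < 20 * A * A * (10 ^ ?k * fact ?k)" "0 < 40 * C" "0 < (2 * A) ^ ?k * (12 * C) / kp" "0 < 1 / kp"
 using A C Suc.prems by (auto intro!: mult_pos_pos divide_pos_pos zero_less_power)
 hence B: "0 < B" unfolding B_def by linarith
 have le: "X * ze <= 1" if "X <= B" for X using that B by (simp add: ze_def)
 have eta: "0 < ze" "(400 * A * A) * ze <= 1" "(20 * A * A * (10 ^ ?k * fact ?k)) * ze <= 1" "(40 * C) * ze <= 1"
 "((2 * A) ^ ?k * (12 * C) / kp) * ze <= 1" "1 / kp * ze <= 1"
 proof -
 show "0 < ze" using B by (simp add: ze_def)
 have "400 * A * A <= B" "20 * A * A * (10 ^ ?k * fact ?k) <= B" "40 * C <= B" "(2 * A) ^ ?k * (12 * C) / kp <= B" "1 / kp <= B"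
 unfolding B_def using pos by linarith+
 from this[THEN le] show "(400 * A * A) * ze <= 1" "(20 * A * A * (10 ^ ?k * fact ?k)) * ze <= 1" "(40 * C) * ze <= 1"
 "((2 * A) ^ ?k * (12 * C) / kp) * ze <= 1" "1 / kp * ze <= 1" .
 qed
 have ek: "ze <= kp" "(2 * A) ^ ?k * (12 * C) * ze <= kp" using eta(5,6) Suc.prems by (simp_all add: pos_divide_le_eq divide_le_eq)
 obtain eps1 where e1: "0 < eps1" "\<forall>eps up (P :: 'i set) t q. 0 <= eps \<and> eps <= eps1 \<and> chain up r A eps rh P t q -->
 (\<forall>n J. J \<subseteq> P \<and> 2 <= card J \<and> card J <= Suc k --> \<bar>dd (t n) (q n) J\<bar> <= ze)"
 using Suc.IH[OF _ eta(1)] k by fastforce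
 obtain eps2 where e2: "0 < eps2" "\<forall>eps up (P :: 'i set) t q. 0 <= eps \<and> eps <= eps2 \<and> chain up r A eps rh P t q -->
 (\<forall>n. \<forall>i\<in>P. \<forall>j\<in>P. \<bar>q n i - q n j\<bar> <= ze * \<bar>t n i - t n j\<bar>)" using chain_cone[OF A eta(1), of r rh] by blast
 show ?case
 proof (rule exI[of _ "min ze (min eps1 eps2)"], intro conjI allI impI)
 show "0 < min ze (min eps1 eps2)" using eta e1 e2 by simp
 fix eps up and P :: "'i set" and t q n J
 assume h: "0 <= eps \<and> eps <= min ze (min eps1 eps2) \<and> chain up r A eps rh P t q" and J: "J \<subseteq> P \<and> 2 <= card J \<and> card J <= Suc ?k"
 have c1: "\<And>n J. J \<subseteq> P ==> 2 <= card J ==> card J <= ?k ==> \<bar>dd (t n) (q n) J\<bar> <= ze"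
 using e1(2) h by (metis min.boundedE)
 have c2: "\<And>n i j. i \<in> P ==> j \<in> P ==> \<bar>q n i - q n j\<bar> <= ze * \<bar>t n i - t n j\<bar>"
 using e2(2) h by (metis min.boundedE)
 show "\<bar>dd (t n) (q n) J\<bar> <= kp"
 proof (cases "card J <= ?k")
 case True
 thus ?thesis using c1[of J n] J ek by linarith
 next
 case False
 hence cJ: "card J = Suc ?k" using J by simp
 have C0: "0 <= osC ?k A (1 / (60 * A))"
 proof -
 have "0 <= famC ?k 1" using famC_ge1[of 1 ?k] by simp
 moreover have "0 <= cmpC ?k (famC ?k 1 * A)"
 using famC_ge1[of 1 ?k] A by (intro cmpC_nonneg mult_nonneg_nonneg) auto
 moreover have "0 <= (4 * osK ?k A (1 / (60 * A)) + 2) ^ ?k" by (intro zero_le_power) (simp add: osK_def)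
 ultimately show ?thesis unfolding osC_def by (intro mult_nonneg_nonneg add_nonneg_nonneg) auto
 qed
 have "\<bar>dd (t n) (q n) J\<bar> <= (2 * A) ^ ?k * (6 * osC ?k A (1 / (60 * A)) * ze + 6 * osC ?k A (1 / (60 * A)) * ze)"
 proof (rule chain_dd_step[OF _ A rho k eta(1) _ _ _ refl C0 _ _ c2 c1])
 show "chain up r A eps rh P t q" "J \<subseteq> P" "card J = Suc ?k" "0 <= eps" "eps <= ze" using h J cJ by auto
 show "8 * A * A * ze <= 1 / 50" using eta(2) by simp
 show "20 * A * A * (10 ^ ?k * fact ?k * ze) <= 1" using eta(3) by (simp add: mult_ac del: power_Suc fact_Suc)
 have "osC ?k A (1 / (60 * A)) * (2 * ze) <= C * (2 * ze)" using eta(1) by (intro mult_right_mono) (auto simp: C_def)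
 thus "osC ?k A (1 / (60 * A)) * (2 * ze) <= 1 / 20" using eta(4) by simp
 qed
 also have "\<dots> = (2 * A) ^ ?k * (12 * osC ?k A (1 / (60 * A))) * ze" by (simp add: algebra_simps)
 also have "\<dots> <= (2 * A) ^ ?k * (12 * C) * ze" using A eta(1) by (intro mult_right_mono mult_left_mono) (auto simp: C_def)
 finally show ?thesis using ek by simp
 qed
 qed
qed

section \<open>Lifting perturbed maps to the charts\<close>

text \<open>Turns closeness in finitely many subbasic data into lifts on balls of one radius. For
  finitely many centres, the discs of quarter radius cover K, the data use the half radius and the
  charts the full one; a ball of radius \<open>rh\<close> about any point of K then stays inside one
  datum.\<close>

lemma rep_data:
 fixes F :: "real^2 => real^2"
 assumes s: "sgn_ok s" "sgn_ok s'" and K: "compact K" "K <= V0" and V0: "open V0" "V0 <= Dmo (1/RR)"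
 and F: "continuous_on V0 F" "!!y. y : V0 ==> F y : Dmo (1/RR)"
 and conj: "!!y. y : V0 ==> f (EE s y) = EE s' (F y)"
 shows "EX D rh. 0 < rh & (ALL d:set D. cr_datum_ok SS f d) & (ALL g eps. Cr_diffeo k SS g & (ALL d:set D. cr_close k eps d f g) -->
 (ALL x:K. EX G. Cr_on k G (ball x rh) & (ALL y:ball x rh. EE s' (G y) = g (EE s y) &
 (ALL vs. set vs <= Basis & length vs <= k --> norm (ipd G vs y - ipd F vs y) < eps))))"
proof -
 have "EX e e'. 0 < e & cball x e <= V0 & (ALL y:cball x e. F y : ball (F x) e') &
 surf_param (EE s) (ball x e) SS & surf_param (EE s') (ball (F x) e') SS" if x: "x : K" for x
 proof -
 have xV: "x : V0" using x K by blast
 obtain e' where e': "0 < e'" "surf_param (EE s') (ball (F x) e') SS"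
 using surf_param_EE_at[OF s(2) F(2)[OF xV] open_UNIV UNIV_I] by metis
 have o: "open (V0 Int F -` ball (F x) e')" using continuous_open_preimage[OF F(1) V0(1) open_ball] .
 have "x : V0 Int F -` ball (F x) e'" "x : Dmo (1/RR)" using xV e' V0 by auto
 then obtain e where "0 < e" "cball x e <= V0 Int F -` ball (F x) e'" "surf_param (EE s) (ball x e) SS"
 using surf_param_EE_at[OF s(1) _ o] by metis
 thus ?thesis using e' by (intro exI[of _ e] exI[of _ e']) auto
 qed
 then obtain e e' where e: "!!x. x : K ==> 0 < e x & cball x (e x) <= V0 & (ALL y:cball x (e x). F y : ball (F x) (e' x)) &
 surf_param (EE s) (ball x (e x)) SS & surf_param (EE s') (ball (F x) (e' x)) SS" by metis
 obtain C where C: "C <= K" "finite C" "K <= (\<Union>x\<in>C. ball x (e x/4))"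
 proof (rule compactE_image[OF K(1), of K "%x. ball x (e x/4)"])
 show "K <= (\<Union>x\<in>K. ball x (e x/4))"
 proof
 fix x assume x: "x : K"
 hence "x : ball x (e x/4)" using e by simp
 thus "x : (\<Union>x\<in>K. ball x (e x/4))" using x by blast
 qed
 qed (use that in auto)
 define rh where "rh = Min (insert 1 ((%x. e x/4) ` C))"
 have rho: "0 < rh" "!!x. x : C ==> rh <= e x/4" proof -
 show "0 < rh" using C e by (auto simp: rh_def)
 show "rh <= e x/4" if "x : C" for x unfolding rh_def using C(2) that by (intro Min_le) auto
 qed
 define dat where "dat x = (EE s, ball x (e x), EE s', ball (F x) (e' x), cball x (e x/2))" for x
 obtain D where D: "set D = dat ` C" using finite_list C(2) by (metis finite_imageI)
 have sub: "cball x (e x/2) <= ball x (e x)" "ball x (e x) <= cball x (e x)" if "x : K" for x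
 using e[OF that] by (auto simp: dist_norm)
 show ?thesis
 proof (intro exI[of _ D] exI[of _ rh] conjI rho(1) ballI allI impI)
 fix d assume "d : set D"
 then obtain x where x: "x : C" "d = dat x" unfolding D by blast
 hence xK: "x : K" using C by blast
 have "f (EE s y) : EE s' ` ball (F x) (e' x)" if "y : cball x (e x/2)" for y
 using sub[OF xK] that conj[of y] e[OF xK] by blast
 thus "cr_datum_ok SS f d" unfolding x(2) dat_def cr_datum_ok_def using e[OF xK] sub[OF xK] by auto
 next
 fix g eps x assume g: "Cr_diffeo k SS g & (ALL d:set D. cr_close k eps d f g)" and x: "x : K"
 obtain a where a: "a : C" "x : ball a (e a/4)" using C(3) x by blast
 hence aK: "a : K" using C by blast
 have cl: "cr_close k eps (dat a) f g" using g a D by blast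
 let ?gi = "EE s'" and ?W = "ball (F a) (e' a)" and ?V = "ball a (e a)"
 define G where "G = inv_into ?W ?gi \<circ> g \<circ> EE s"
 have gK: "g (EE s y) : ?gi ` ?W" if "y : cball a (e a/2)" for y
 using cl that unfolding dat_def cr_close_def by auto
 have clo: "norm (ipd G vs y - ipd (inv_into ?W ?gi \<circ> f \<circ> EE s) vs y) < eps"
 if "y : cball a (e a/2)" "set vs <= Basis" "length vs <= k" for y vs
 using cl that unfolding dat_def cr_close_def G_def by auto
 have bs: "ball x rh <= cball a (e a/2)"
 proof
 fix y assume "y : ball x rh"
 thus "y : cball a (e a/2)" using a rho(2)[OF a(1)] dist_triangle[of a y x] by simp
 qed
 have sp: "surf_param (EE s) ?V SS" "surf_param ?gi ?W SS" using e[OF aK] by auto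
 have "Cr_map k SS g" using g by (simp add: Cr_diffeo_def)
 hence "Cr_on k G {y : ?V. g (EE s y) : ?gi ` ?W}" unfolding Cr_map_def G_def using sp by blast
 hence "Cr_on k G (ball x rh)"
 by (rule Cr_on_subset) (use bs sub[OF aK] gK in auto)
 moreover have "EE s' (G y) = g (EE s y)" if "y : ball x rh" for y
 using f_inv_into_f[OF gK[of y]] that bs by (auto simp: G_def)
 moreover have "norm (ipd G vs y - ipd F vs y) < eps" if "y : ball x rh" "set vs <= Basis" "length vs <= k" for y vs
 proof -
 have yV: "y : ?V" using that bs sub[OF aK] by blast
 have "ipd (inv_into ?W ?gi \<circ> f \<circ> EE s) vs y = ipd F vs y"
 proof (rule ipd_cong[OF open_ball _ yV])
 fix z assume z: "z : ?V"
 hence "z : V0" "F z : ?W" using e[OF aK] sub[OF aK] by auto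
 thus "(inv_into ?W ?gi \<circ> f \<circ> EE s) z = F z" using conj[of z] surf_paramD(8)[OF sp(2)] by simp
 qed
 thus ?thesis using clo[of y vs] that bs by auto
 qed
 ultimately show "EX G. Cr_on k G (ball x rh) & (ALL y:ball x rh. EE s' (G y) = g (EE s y) &
 (ALL vs. set vs <= Basis & length vs <= k --> norm (ipd G vs y - ipd F vs y) < eps))" by blast
 qed
qed

text \<open>A Lebesgue number argument: chart images are open in \<open>SS\<close>, and K is
  compact.\<close>

lemma lift_near:
 assumes s: "sgn_ok s" and K: "compact K" "K <= Dmo (1/RR)" and rho: "0 < rh"
 shows "EX dl>0. ALL c:K. ALL q:SS. dist (EE s c) q < dl --> (EX x. EE s x = q & norm (x - c) < rh)"
proof -
 have "EX d>0. ALL q:SS. dist (EE s c) q < 2*d --> q : EE s ` ball c (rh/2)" if c: "c : K" for c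
 proof -
 have "c : ball c (rh/2)" using rho by simp
 then obtain e where e: "0 < e" "cball c e <= ball c (rh/2)" "surf_param (EE s) (ball c e) SS"
 using surf_param_EE_at[OF s _ open_ball] c K(2) by (metis subsetD)
 have "openin (top_of_set SS) (EE s ` ball c e)" by (rule surf_paramD(5)[OF e(3)])
 moreover have "EE s c : EE s ` ball c e" using e by simp
 ultimately obtain d where d: "0 < d" "!!q. q : SS ==> dist q (EE s c) < d ==> q : EE s ` ball c e"
 unfolding openin_euclidean_subtopology_iff by blast
 thus ?thesis using e(2) ball_subset_cball[of c e]
 by (intro exI[of _ "d/2"]) (force simp: dist_commute)
 qed
 then obtain d where d: "!!c. c : K ==> 0 < d c & (ALL q:SS. dist (EE s c) q < 2*d c --> q : EE s ` ball c (rh/2))" by metis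
 define U where "U c = (ball c (rh/2) Int Dmo 0) Int EE s -` ball (EE s c) (d c)" for c
 have oU: "open (U c)" for c unfolding U_def
 by (rule continuous_open_preimage[OF continuous_on_subset[OF EE_continuous] _ open_ball]) (auto simp: open_Dmo)
 have KD: "K <= Dmo 0" using K(2) Dmo_mono[of _ "1/RR" 0] RR_ge by auto
 obtain C where C: "C <= K" "finite C" "K <= (\<Union>x\<in>C. U x)"
 proof (rule compactE_image[OF K(1), of K U])
 show "K <= (\<Union>x\<in>K. U x)"
 proof
 fix x assume x: "x : K"
 hence "x : U x" using d KD rho by (auto simp: U_def)
 thus "x : (\<Union>x\<in>K. U x)" using x by blast
 qed
 qed (use oU that in auto)
 define dl where "dl = Min (insert 1 (d ` C))"
 have del: "0 < dl" "!!x. x : C ==> dl <= d x" proof -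
 show "0 < dl" using C d by (auto simp: dl_def)
 show "dl <= d x" if "x : C" for x unfolding dl_def using C(2) that by (intro Min_le) auto
 qed
 show ?thesis
 proof (intro exI[of _ dl] conjI del ballI impI)
 fix c q assume c: "c : K" and q: "q : SS" "dist (EE s c) q < dl"
 obtain a where a: "a : C" "c : U a" using C(3) c by blast
 have "dist (EE s a) q <= dist (EE s a) (EE s c) + dist (EE s c) q" by (rule dist_triangle)
 also have "... < 2*d a" using a del(2)[OF a(1)] q by (auto simp: U_def)
 finally have "q : EE s ` ball a (rh/2)" using d a C q by blast
 then obtain x where x: "x : ball a (rh/2)" "EE s x = q" by blast
 have "dist x c <= dist x a + dist a c" by (rule dist_triangle)
 also have "... < rh" using x a by (auto simp: U_def dist_commute)
 finally show "EX x. EE s x = q & norm (x - c) < rh" using x by (auto simp: dist_norm)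
 qed
qed

lemma ipd_bounded:
 fixes F :: "real^2 => real^2"
 assumes F: "Cr_on k F U" and K: "compact K" "K <= U"
 shows "EX B>=1. ALL y:K. ALL vs. set vs <= Basis & length vs <= k --> norm (ipd F vs y) <= B"
proof -
 let ?L = "{vs. set vs <= (Basis :: (real^2) set) & length vs <= k}"
 have fin: "finite ?L" by (rule finite_lists_length_le) simp
 have "EX B. ALL y:K. norm (ipd F vs y) <= B" if "vs : ?L" for vs
 proof -
 have "continuous_on U (ipd F vs)" using F that unfolding Cr_on_def by blast
 hence "compact (ipd F vs ` K)" using compact_continuous_image[OF continuous_on_subset[OF _ K(2)] K(1)] by blast
 then obtain B where "ALL z:ipd F vs ` K. norm z <= B" using compact_imp_bounded bounded_iff by metis
 thus ?thesis by blast
 qed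
 then obtain B where B: "ALL vs:?L. ALL y:K. norm (ipd F vs y) <= B vs"
 using bchoice[of ?L "%vs B. ALL y:K. norm (ipd F vs y) <= B"] by blast
 show ?thesis
 proof (intro exI[of _ "Max (insert 1 (B ` ?L))"] conjI ballI allI impI)
 show "1 <= Max (insert 1 (B ` ?L))" using fin by (intro Max_ge) auto
 fix y and vs :: "(real^2) list" assume y: "y : K" and vs: "set vs <= Basis & length vs <= k"
 hence "norm (ipd F vs y) <= B vs" using B by blast
 also have "... <= Max (insert 1 (B ` ?L))" using fin vs by (intro Max_ge) auto
 finally show "norm (ipd F vs y) <= Max (insert 1 (B ` ?L))" .
 qed
qed

section \<open>From C^r closeness to links\<close>

text \<open>Coordinate i is put first, because t is the first coordinate above and the second below;
  the two sheets are then handled alike.\<close>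

definition pt :: "2 => real => real => real^2" where "pt i a b = (\<chi> j. if j = i then a else b)"
definition dir :: "2 => bool list => (real^2) list" where "dir i w = map (%b. if b then axis (other i) 1 else axis i 1) w"
definition fam :: "2 => (real^2 => real) => bool list => real => real => real" where
 "fam i H w a b = ipd H (dir i w) (pt i a b)"

lemma pt_nth [simp]: "pt i a b $ i = a" "pt i a b $ other i = b"
 using other(3)[of i] by (simp_all add: pt_def)

lemma pt_eta [simp]: "pt i (x $ i) (x $ other i) = x"
 by (simp add: vec_eq_other[of _ x i])

lemma dir_basis: "set (dir i w) <= Basis"
 by (auto simp: dir_def)

lemma length_dir: "length (dir i w) = length w"
 by (simp add: dir_def)

lemma deriv_split:
 fixes H :: "real^2 => real"
 assumes "(H has_derivative D) (at x)"
 shows "D v = frechet_derivative H (at x) (axis i 1) * v $ i + frechet_derivative H (at x) (axis (other i) 1) * v $ other i"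
proof -
 have D: "frechet_derivative H (at x) = D" using frechet_derivative_at[OF assms] by simp
 interpret linear D using assms by (rule has_derivative_linear)
 have "v = v $ i *\<^sub>R axis i 1 + v $ other i *\<^sub>R axis (other i) 1"
 using other(3)[of i] by (simp add: vec_eq_other[of v _ i] axis_def)
 hence "D v = D (v $ i *\<^sub>R axis i 1 + v $ other i *\<^sub>R axis (other i) 1)" by simp
 thus ?thesis by (simp add: D add scale mult.commute)
qed

lemma fam_wfam:
 assumes H: "Cr_on r H U" and sub: "!!a b. (a, b) : S ==> pt i a b : U"
 and bd: "!!vs y. set vs <= Basis ==> length vs <= r ==> y : U ==> \<bar>ipd H vs y\<bar> <= M"
 shows "wfam r S (fam i H) M"
 unfolding wfam_def
proof (intro conjI allI impI)
 fix w :: "bool list" and p x p' assume a: "length w < r & (x, p x) : S & DERIV p x :> p'"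
 let ?h = "ipd H (dir i w)" and ?x = "pt i x (p x)"
 have D: "(?h has_derivative frechet_derivative ?h (at ?x)) (at ?x)"
 by (rule Cr_on_ipd_deriv[OF H sub]) (use a dir_basis length_dir in auto)
 have "((%s. pt i s (p s)) has_derivative (%h. h *\<^sub>R pt i 1 p')) (at x)"
 proof -
 have e: "(%s. pt i s (p s)) = (%s. s *\<^sub>R axis i 1 + p s *\<^sub>R axis (other i) 1)"
 using other(3)[of i] by (auto simp: fun_eq_iff vec_eq_other[of "pt i _ _" _ i] axis_def)
 have e': "pt i 1 p' = axis i 1 + p' *\<^sub>R axis (other i) 1"
 using other(3)[of i] by (auto simp: vec_eq_other[of "pt i _ _" _ i] axis_def)
 have p: "(p has_derivative (%h. h*p')) (at x)" using a by (simp add: has_field_derivative_def mult_commute_abs)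
 show ?thesis unfolding e e' by (rule derivative_eq_intros p refl | simp add: algebra_simps)+
 qed
 from has_derivative_compose[OF this D]
 have "((%s. ?h (pt i s (p s))) has_derivative (%h. h*frechet_derivative ?h (at ?x) (pt i 1 p'))) (at x)"
 using linear_scale[OF has_derivative_linear[OF D]] by simp
 hence "DERIV (%s. ?h (pt i s (p s))) x :> frechet_derivative ?h (at ?x) (pt i 1 p')"
 by (simp add: has_field_derivative_def mult_commute_abs)
 moreover have "frechet_derivative ?h (at ?x) (pt i 1 p') = fam i H (w @ [False]) x (p x) + fam i H (w @ [True]) x (p x)*p'"
 using deriv_split[OF D, of "pt i 1 p'" i] by (simp add: fam_def dir_def ipd_append)
 ultimately show "DERIV (%s. fam i H w s (p s)) x :> fam i H (w @ [False]) x (p x) + fam i H (w @ [True]) x (p x)*p'"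
 by (simp add: fam_def)
next
 fix w :: "bool list" and x y assume "length w <= r & (x, y) : S"
 thus "\<bar>fam i H w x y\<bar> <= M" unfolding fam_def using bd dir_basis length_dir sub by auto
qed

lemma mvt2:
 fixes H :: "real^2 => real"
 assumes H: "Cr_on r H (ball c rh)" "1 <= r" and xy: "x : ball c rh" "y : ball c rh"
 shows "EX z:ball c rh. H x - H y = ipd H [axis i 1] z*(x - y) $ i + ipd H [axis (other i) 1] z*(x - y) $ other i"
proof -
 have D: "(H has_derivative frechet_derivative H (at z)) (at z)" if "z : ball c rh" for z
 using Cr_on_ipd_deriv[OF H(1) that, of "[]"] H(2) by simp
 define g where "g t = y + t *\<^sub>R (x - y)" for t
 have gb: "g t : ball c rh" if "0 <= t" "t <= 1" for t
 proof -
 have "g t = (1 - t) *\<^sub>R y + t *\<^sub>R x" by (simp add: g_def algebra_simps)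
 thus ?thesis using convexD[OF convex_ball xy(2,1), of "1 - t" t] that by simp
 qed
 have "DERIV (%t. H (g t)) t :> frechet_derivative H (at (g t)) (x - y)" if "0 <= t" "t <= 1" for t
 proof -
 have "(g has_derivative (%h. h *\<^sub>R (x - y))) (at t)" unfolding g_def by (auto intro!: derivative_eq_intros)
 from has_derivative_compose[OF this D[OF gb[OF that]]]
 have "((%t. H (g t)) has_derivative (%h. h*frechet_derivative H (at (g t)) (x - y))) (at t)"
 using linear_scale[OF has_derivative_linear[OF D[OF gb[OF that]]]] by simp
 thus ?thesis by (simp add: has_field_derivative_def mult_commute_abs)
 qed
 from MVT2[of 0 1 "%t. H (g t)", OF _ this] obtain t where t: "0 < t" "t < 1"
 "H (g 1) - H (g 0) = (1 - 0)*frechet_derivative H (at (g t)) (x - y)" by auto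
 have b: "g t : ball c rh" using gb t by simp
 show ?thesis
 by (rule bexI[OF _ b]) (use t(3) deriv_split[OF D[OF b], of "x - y" i] in \<open>simp add: g_def\<close>)
qed

lemma ipd_nth:
 fixes G :: "real^2 => real^2"
 assumes "Cr_on r G U" "x : U" "set vs <= Basis" "length vs <= r"
 shows "ipd (%x. G x $ j) vs x = ipd G vs x $ j"
 by (rule ipd_bounded_linear[OF bounded_linear_vec_nth Cr_on_mono[OF assms(1,4)] assms(3,2)])

lemma ipd_const: "ipd (%x. c) vs y = (if vs = [] then c else 0)"
 by (induction vs arbitrary: c) (auto simp: frechet_derivative_const)

text \<open>The model F multiplies the coordinate \<open>other i\<close> exactly by c0, so the
  deviation E of G in it has all partials at most \<open>eps\<close>. One vector l relates the
  values of G to the chosen image points for all labels and is absorbed in the family for t and in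
  the constant for q. Squares of half side rh/4 about points within rh/16 of c stay inside the
  ball.\<close>

lemma link_of_map:
 fixes F G :: "real^2 => real^2" and i :: 2
 assumes r: "1 <= r" and G: "Cr_on r G (ball c rh)" and F: "Cr_on r F (ball c rh)" and ep: "eps <= 1"
 and cl: "!!y vs. y : ball c rh ==> set vs <= Basis ==> length vs <= r ==> norm (ipd G vs y - ipd F vs y) <= eps"
 and lin: "!!y. y : ball c rh ==> F y $ other i = c0*y $ other i"
 and A1: "!!y vs. y : ball c rh ==> set vs <= Basis ==> length vs <= r ==> norm (ipd F vs y) <= A1"
 and s: "!!y. y : ball c rh ==> lo + eps <= ipd F [axis i 1] y $ i & ipd F [axis i 1] y $ i <= hi - eps"
 and rho: "0 < rh" "rh <= 1"
 and pts: "!!p. p : P ==> norm (X p - c) < rh/16 & G (X p) = X' p + l & norm (X' p) <= A1 & norm (X' p - c') <= 1/2"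
 and A: "3*A1 + 2 <= A"
 shows "link r A eps (rh/4) c0 lo hi P (%p. X p $ i) (%p. X p $ other i) (%p. X' p $ i) (%p. X' p $ other i)"
proof -
 let ?B = "ball c rh" and ?o = "other i"
 define H where "H x = G x $ i - l $ i" for x
 define E where "E x = G x $ ?o - F x $ ?o" for x
 have o: "open ?B" by simp
 have HC: "Cr_on r H ?B" unfolding H_def[abs_def] by (intro Cr_on_diff Cr_on_component[OF G] Cr_on_const o)
 have EC: "Cr_on r E ?B" unfolding E_def[abs_def] by (intro Cr_on_diff Cr_on_component[OF G] Cr_on_component[OF F])
 have XB: "X p : ?B" if "p : P" for p using pts[OF that] rho by (simp add: dist_norm norm_minus_commute)
 have cmp: "\<bar>x $ j\<bar> <= norm x" for x :: "real^2" and j by (rule component_le_norm_cart)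
 have ipdH: "ipd H vs y = ipd G vs y $ i - (if vs = [] then l $ i else 0)"
 if "y : ?B" "set vs <= Basis" "length vs <= r" for y vs
 using ipd_diff[OF Cr_on_mono[OF Cr_on_component[OF G] that(3)] Cr_on_const[OF o] that(2,1)] ipd_nth[OF G that]
 by (simp add: H_def[abs_def] ipd_const)
 have ipdE: "ipd E vs y = (ipd G vs y - ipd F vs y) $ ?o"
 if "y : ?B" "set vs <= Basis" "length vs <= r" for y vs
 using ipd_diff[OF Cr_on_mono[OF Cr_on_component[OF G] that(3)] Cr_on_mono[OF Cr_on_component[OF F] that(3)] that(2,1)]
 ipd_nth[OF G that] ipd_nth[OF F that] by (simp add: E_def[abs_def])
 have Gb: "\<bar>ipd G vs y $ j\<bar> <= A1 + 1" if "y : ?B" "set vs <= Basis" "length vs <= r" for y vs j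
 proof -
 have "norm (ipd G vs y) <= norm (ipd G vs y - ipd F vs y) + norm (ipd F vs y)" by (metis diff_add_cancel norm_triangle_ineq)
 thus ?thesis using cl[OF that] A1[OF that] ep cmp[of "ipd G vs y" j] by linarith
 qed
 have lb: "\<bar>l $ i\<bar> <= 2*A1 + 1" if "p : P" for p
 proof -
 have "l $ i = G (X p) $ i - X' p $ i" using pts[OF that] by simp
 moreover have "\<bar>G (X p) $ i\<bar> <= A1 + 1" using Gb[OF XB[OF that], of "[]" i] by simp
 moreover have "\<bar>X' p $ i\<bar> <= A1" using pts[OF that] cmp[of "X' p" i] by linarith
 ultimately show ?thesis by linarith
 qed
 \<comment> \<open>Source of 3 A1 + 2: A1 + 1 bounds the perturbed map, 2 A1 + 1 the shift
   l.\<close>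
 have ipdHb: "\<bar>ipd H vs y\<bar> <= A" if "p : P" "y : ?B" "set vs <= Basis" "length vs <= r" for p y vs
 using ipdH[OF that(2-4)] Gb[OF that(2-4), of i] lb[OF that(1)] A by (cases "vs = []") auto
 have ipdEb: "\<bar>ipd E vs y\<bar> <= eps" if "y : ?B" "set vs <= Basis" "length vs <= r" for y vs
 using ipdE[OF that] cl[OF that] cmp[of "ipd G vs y - ipd F vs y" ?o] by linarith
 have sq: "pt i a b : ?B" if "p : P" "(a, b) : sqr (X p $ i) (X p $ ?o) (rh/4)" for p a b
 proof -
 have "norm (pt i a b - X p) <= \<bar>a - X p $ i\<bar> + \<bar>b - X p $ ?o\<bar>" using norm2_le[of "pt i a b - X p" i] by simp
 moreover have "\<bar>a - X p $ i\<bar> < rh/4" "\<bar>b - X p $ ?o\<bar> < rh/4" using that(2) by (auto simp: sqr_def)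
 moreover have "norm (pt i a b - c) <= norm (pt i a b - X p) + norm (X p - c)" using norm_triangle_ineq[of "pt i a b - X p" "X p - c"] by simp
 ultimately have "norm (pt i a b - c) < rh" using pts[OF that(1)] by linarith
 thus ?thesis by (simp add: dist_norm norm_minus_commute)
 qed
 have slope: "lo <= ipd H [axis i 1] y & ipd H [axis i 1] y <= hi" if "y : ?B" for y
 proof -
 have b: "set [axis i 1 :: real^2] <= Basis" "length [axis i 1 :: real^2] <= r" using r by auto
 have "\<bar>ipd G [axis i 1] y $ i - ipd F [axis i 1] y $ i\<bar> <= eps"
 using cl[OF that b] cmp[of "ipd G [axis i 1] y - ipd F [axis i 1] y" i] unfolding vector_minus_component by linarith
 moreover have "ipd H [axis i 1] y = ipd G [axis i 1] y $ i" using ipdH[OF that b] by (simp only: list.distinct if_False diff_zero)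
 ultimately show ?thesis using s[OF that] by linarith
 qed
 show ?thesis unfolding link_def
 proof (intro conjI ballI)
 fix p p' assume p: "p : P" "p' : P"
 have o1: "set [axis (?o) 1 :: real^2] <= Basis" "length [axis (?o) 1 :: real^2] <= r"
 "set [axis i 1 :: real^2] <= Basis" "length [axis i 1 :: real^2] <= r" using r by auto
 have e1: "X' p $ i - X' p' $ i = H (X p) - H (X p')" using pts[OF p(1)] pts[OF p(2)] by (simp add: H_def)
 have e2: "X' p $ ?o - X' p' $ ?o - c0*(X p $ ?o - X p' $ ?o) = E (X p) - E (X p')"
 using pts[OF p(1)] pts[OF p(2)] lin[OF XB[OF p(1)]] lin[OF XB[OF p(2)]] by (simp add: E_def algebra_simps)
 obtain z where z: "z : ?B" "E (X p) - E (X p') = ipd E [axis i 1] z*(X p - X p') $ i + ipd E [axis ?o 1] z*(X p - X p') $ ?o"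
 using mvt2[OF EC r XB[OF p(1)] XB[OF p(2)]] by blast
 have "\<bar>ipd E [axis i 1] z*(X p - X p') $ i\<bar> <= eps*\<bar>X p $ i - X p' $ i\<bar>"
 "\<bar>ipd E [axis ?o 1] z*(X p - X p') $ ?o\<bar> <= eps*\<bar>X p $ ?o - X p' $ ?o\<bar>"
 unfolding abs_mult vector_minus_component using ipdEb[OF z(1) o1(3,4)] ipdEb[OF z(1) o1(1,2)] by (intro mult_right_mono; simp)+
 thus "\<bar>X' p $ ?o - X' p' $ ?o - c0*(X p $ ?o - X p' $ ?o)\<bar> <= eps*(\<bar>X p $ i - X p' $ i\<bar> + \<bar>X p $ ?o - X p' $ ?o\<bar>)"
 unfolding e2 z(2) distrib_left by linarith
 obtain y where y: "y : ?B" "H (X p) - H (X p') = ipd H [axis i 1] y*(X p - X p') $ i + ipd H [axis ?o 1] y*(X p - X p') $ ?o"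
 using mvt2[OF HC r XB[OF p(1)] XB[OF p(2)]] by blast
 show "EX s h. X' p $ i - X' p' $ i = s*(X p $ i - X p' $ i) + h*(X p $ ?o - X p' $ ?o) & lo <= s & s <= hi & \<bar>h\<bar> <= A"
 using slope[OF y(1)] ipdHb[OF p(1) y(1) o1(1,2)] y(2) unfolding e1 vector_minus_component by blast
 have n: "\<bar>a $ j - b $ j\<bar> <= norm (a - b)" for a b :: "real^2" and j using cmp[of "a - b" j] by simp
 have t: "norm (a - b) <= norm (a - d) + norm (b - d)" for a b d :: "real^2" using norm_triangle_ineq4[of "a - d" "b - d"] by simp
 show "\<bar>X p $ i - X p' $ i\<bar> <= rh/4/2"
 using n[of "X p" i "X p'"] t[of "X p" "X p'" c] pts[OF p(1)] pts[OF p(2)] by linarith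
 show "\<bar>X' p $ i - X' p' $ i\<bar> <= 1"
 using n[of "X' p" i "X' p'"] t[of "X' p" "X' p'" c'] pts[OF p(1)] pts[OF p(2)] by linarith
 next
 show "EX Gf Ef c1. (ALL p:P. wfam r (sqr (X p $ i) (X p $ ?o) (rh/4)) Gf A & wfam r (sqr (X p $ i) (X p $ ?o) (rh/4)) Ef eps &
 (ALL x y. (x, y) : sqr (X p $ i) (X p $ ?o) (rh/4) --> lo <= Gf [False] x y & Gf [False] x y <= hi)) &
 (ALL j:P. X' j $ i = Gf [] (X j $ i) (X j $ ?o) & X' j $ ?o = c0*X j $ ?o + c1 + Ef [] (X j $ i) (X j $ ?o))"
 proof (rule exI[of _ "fam i H"], rule exI[of _ "fam i E"], rule exI[of _ "- (l $ ?o)"], intro conjI ballI allI impI)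
 fix p assume p: "p : P"
 show "wfam r (sqr (X p $ i) (X p $ ?o) (rh/4)) (fam i H) A" by (rule fam_wfam[OF HC sq[OF p] ipdHb[OF p]])
 show "wfam r (sqr (X p $ i) (X p $ ?o) (rh/4)) (fam i E) eps" by (rule fam_wfam[OF EC sq[OF p] ipdEb])
 show "X' p $ i = fam i H [] (X p $ i) (X p $ ?o)" using pts[OF p] by (simp add: fam_def dir_def H_def)
 show "X' p $ ?o = c0*X p $ ?o + - (l $ ?o) + fam i E [] (X p $ i) (X p $ ?o)"
 using pts[OF p] lin[OF XB[OF p]] by (simp add: fam_def dir_def E_def)
 fix x y assume xy: "(x, y) : sqr (X p $ i) (X p $ ?o) (rh/4)"
 show "lo <= fam i H [False] x y" "fam i H [False] x y <= hi"
 using slope[OF sq[OF p xy]] by (simp_all add: fam_def dir_def)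
 qed
 qed
qed

lemma lipschitz_ball:
 fixes F :: "real^2 => real^2"
 assumes F: "Cr_on r F (ball c rh)" "1 <= r"
 and A1: "!!y vs. y : ball c rh ==> set vs <= Basis ==> length vs <= r ==> norm (ipd F vs y) <= A1" and y: "y : ball c rh"
 shows "norm (F y - F c) <= 4*A1*rh"
proof -
 have "0 < rh" using y by (metis ball_eq_empty empty_iff not_less)
 hence c: "c : ball c rh" by simp
 have "\<bar>F y $ j - F c $ j\<bar> <= 2*A1*rh" for j
 proof -
 obtain z where z: "z : ball c rh" "F y $ j - F c $ j = ipd (%x. F x $ j) [axis 1 1] z*(y - c) $ 1 + ipd (%x. F x $ j) [axis 2 1] z*(y - c) $ 2"
 using mvt2[OF Cr_on_component[OF F(1)] F(2) y c, of j 1] by (auto simp: other)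
 have "\<bar>ipd (%x. F x $ j) [axis m 1] z*(y - c) $ m\<bar> <= A1*rh" for m
 proof -
 have b: "set [axis m 1 :: real^2] <= Basis" "length [axis m 1 :: real^2] <= r" using F(2) by auto
 have 1: "\<bar>ipd F [axis m 1] z $ j\<bar> <= A1" using A1[OF z(1) b] component_le_norm_cart[of "ipd F [axis m 1] z" j] by linarith
 have "norm (y - c) < rh" using y by (simp add: dist_norm norm_minus_commute)
 hence 2: "\<bar>(y - c) $ m\<bar> <= rh" using component_le_norm_cart[of "y - c" m] by linarith
 show ?thesis unfolding ipd_nth[OF F(1) z(1) b] abs_mult using 1 2 by (intro mult_mono) auto
 qed
 from this[of 1] this[of 2] show ?thesis unfolding z(2) by linarith
 qed
 from this[of 1] this[of 2] show ?thesis using norm2_le[of "F y - F c" 1] by (simp add: other)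
qed

lemma Dm_perturb:
 fixes z y :: "real^2"
 assumes "norm (z - y) <= e" "y : Dm d" shows "z : Dm (d - e)"
proof -
 have "d <= norm (z - l) + e" if "l : LL" for l
 proof -
 have "d <= norm (y - l)" using assms(2) that by (simp add: Dm_def)
 also have "... <= norm (z - l) + norm (z - y)" using norm_triangle_ineq4[of "z - l" "z - y"] by simp
 finally show ?thesis using assms(1) by simp
 qed
 thus ?thesis by (force simp: Dm_def)
qed

text \<open>Lifts are unique up to a lattice vector only. Nearby points get the same vector, since
  two such vectors would differ by less than 4 RR.\<close>

lemma common_shift:
 fixes F G :: "real^2 => real^2"
 assumes s: "sgn_ok s" and cl: "!!y. y : ball c rh ==> norm (G y - F y) <= 1/100"
 and lip: "!!y. y : ball c rh ==> norm (F y - F c) <= 1/100" and rho: "0 < rh"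
 and Fc: "F c : Dm (1/18)" and c': "c' : Dm 1" "EE s (G c) = EE s c'"
 obtains l where "l : LL" "norm (F c - (c' + l)) <= 1/100"
 "!!x x'. x : ball c rh ==> norm (x' - c') < 1/2 ==> EE s (G x) = EE s x' ==> G x = x' + l"
proof -
 have GF: "norm (G x - F c) <= 1/50" if "x : ball c rh" for x
 using norm_triangle_ineq[of "G x - F x" "F x - F c"] cl[OF that] lip[OF that] by simp
 have GD: "G x : Dm (1/RR)" if "x : ball c rh" for x
 proof -
 have "1/RR <= 1/100" using RR_ge by (intro divide_left_mono) auto
 thus ?thesis using Dm_mono[OF Dm_perturb[OF GF[OF that] Fc], of "1/RR"] by simp
 qed
 have cb: "c : ball c rh" using rho by simp
 define l where "l = G c - c'"
 have l: "l : LL" unfolding l_def by (rule EE_inj[OF GD[OF cb] Dm_RR[OF c'(1)] s c'(2)]) simp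
 show thesis
 proof (rule that[OF l])
 show "norm (F c - (c' + l)) <= 1/100" using cl[OF cb] by (simp add: l_def norm_minus_commute)
 fix x x' assume x: "x : ball c rh" and x': "norm (x' - c') < 1/2" and e: "EE s (G x) = EE s x'"
 have "x' : Dm (1 - 1/2)" by (rule Dm_perturb[OF less_imp_le[OF x'] c'(1)])
 hence m: "G x - x' : LL" using EE_inj[OF GD[OF x] Dm_RR s e] by simp
 have "norm (G x - G c) <= 1/50 + 1/50"
 using norm_triangle_ineq4[of "G x - F c" "G c - F c"] GF[OF x] GF[OF cb] by simp
 moreover have eq: "(G x - x') - l = (G x - G c) - (x' - c')" by (simp add: l_def)
 ultimately have "norm ((G x - x') - l) < 4*RR"
 unfolding eq using norm_triangle_ineq4[of "G x - G c" "x' - c'"] x' RR_ge by linarith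
 hence "(G x - x') - l = 0" using LL_sep[OF LL_diff[OF m l]] by blast
 thus "G x = x' + l" by (simp add: algebra_simps)
 qed
qed

lemma frechet_nth:
 assumes "(F has_derivative D) (at x)"
 shows "ipd F [v] x = D v"
 using frechet_derivative_at[OF assms] by simp

lemma ff_slope:
 "lam/2 <= ipd (ff i) [axis i 1] y $ i" "y ~: Bx 3 ==> ipd (ff i) [axis i 1] y $ i <= lam"
proof -
 obtain s h where s: "(ff i has_derivative (%v. \<chi> j. if j = i then s * v $ i + h * v $ other i else mu * v $ j)) (at y)"
 "lam/2 <= s" "y ~: Bx 3 --> s <= lam" by (rule ff_deriv[of i y])
 have "ipd (ff i) [axis i 1] y $ i = s" using other(3)[of i] unfolding frechet_nth[OF s(1)] by (simp add: axis_def)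
 thus "lam/2 <= ipd (ff i) [axis i 1] y $ i" "y ~: Bx 3 ==> ipd (ff i) [axis i 1] y $ i <= lam" using s by auto
qed

lemma gj_lin: "gj y $ 1 = lam*y $ 1"
proof -
 have "mu*gj y $ 1 = y $ 1" using ff_nth(2)[of 2 "gj y"] by (simp add: other ff_gj)
 hence "lam*(mu*gj y $ 1) = lam*y $ 1" by simp
 thus ?thesis using mu_lam by (simp add: mult.assoc[symmetric])
qed

lemma gj_slope: "ipd gj [axis 2 1] y $ 2 = 1/ipd (ff 2) [axis 2 1] (gj y) $ 2"
proof -
 obtain s h where s: "(ff 2 has_derivative (%v. \<chi> j. if j = 2 then s * v $ 2 + h * v $ other 2 else mu * v $ j)) (at (gj y))"
 "lam/2 <= s" "gj y ~: Bx 3 --> s <= lam" by (rule ff_deriv[of 2 "gj y"])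
 have s': "ipd (ff 2) [axis 2 1] (gj y) $ 2 = s" unfolding frechet_nth[OF s(1)] by (simp add: axis_def other)
 obtain D where D: "(gj has_derivative D) (at y)" using Cr_on_SucD(1)[OF Cr_on_gj[of "Suc 0"] UNIV_I] by blast
 have "((%x. ff 2 (gj x)) has_derivative (%v. \<chi> j. if j = 2 then s*D v $ 2 + h*D v $ other 2 else mu*D v $ j)) (at y)"
 by (rule has_derivative_compose[OF D s(1)])
 hence "((%x. x) has_derivative (%v. \<chi> j. if j = 2 then s*D v $ 2 + h*D v $ other 2 else mu*D v $ j)) (at y)"
 by (simp only: ff_gj)
 from has_derivative_unique[OF this has_derivative_ident]
 have e: "(\<chi> j. if j = 2 then s*D v $ 2 + h*D v $ other 2 else mu*D v $ j) = v" for v by (rule fun_cong)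
 have "mu*D (axis 2 1) $ 1 = 0" using arg_cong[OF e[of "axis 2 1"], of "%x. x $ 1"] by (simp add: axis_def)
 hence "D (axis 2 1) $ 1 = 0" using mu_bounds by simp
 hence "s*D (axis 2 1) $ 2 = 1" using arg_cong[OF e[of "axis 2 1"], of "%x. x $ 2"] by (simp add: axis_def other)
 thus ?thesis unfolding s' frechet_nth[OF D] using s(2) lam_bounds by (simp add: field_simps)
qed

lemma Cr_on_TR: "2 <= r ==> Cr_on k (TR r) (- {0})"
 unfolding TR_def[abs_def] using Dv_pos
 by (intro Cr_on_intros Cr_on_subset[OF Cr_on_Dv] open_Compl closed_singleton) force+

text \<open>Identifies pure vertical partials with derivatives on a vertical line, the form in which
  \<open>TT_nondegenerate\<close> is stated.\<close>

lemma ipd_vertical: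
 fixes h :: "real^2 => real"
 assumes h: "Cr_on r h U" and "k <= r" "pt 1 a b : U"
 shows "ipd h (replicate k (axis 2 1)) (pt 1 a b) = (deriv ^^ k) (%t. h (pt 1 a t)) b"
 using assms(2,3)
proof (induction k arbitrary: b)
 case (Suc k)
 have U: "open U" by (rule Cr_on_open[OF h])
 let ?g = "ipd h (replicate k (axis 2 1))"
 have D: "(?g has_derivative frechet_derivative ?g (at (pt 1 a b))) (at (pt 1 a b))"
 by (rule Cr_on_ipd_deriv[OF h Suc.prems(2)]) (use Suc.prems(1) in auto)
 have e: "pt 1 a t = pt 1 a 0 + t *\<^sub>R axis 2 1" for t by (auto simp: pt_def axis_def vec_eq_iff forall_2)
 have L: "(pt 1 a has_derivative (%h. h *\<^sub>R axis 2 1)) (at b)"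
 proof -
 have "((%t. pt 1 a 0 + t *\<^sub>R axis 2 1) has_derivative (%h. h *\<^sub>R axis 2 1)) (at b)" by (auto intro!: derivative_eq_intros)
 moreover have "pt 1 a = (%t. pt 1 a 0 + t *\<^sub>R axis 2 1)" by (rule ext) (rule e)
 ultimately show ?thesis by metis
 qed
 have "((%t. ?g (pt 1 a t)) has_derivative (%h. h*frechet_derivative ?g (at (pt 1 a b)) (axis 2 1))) (at b)"
 using has_derivative_compose[OF L D] linear_scale[OF has_derivative_linear[OF D]] by simp
 hence "DERIV (%t. ?g (pt 1 a t)) b :> frechet_derivative ?g (at (pt 1 a b)) (axis 2 1)"
 by (simp add: has_field_derivative_def mult_commute_abs)
 hence "deriv (%t. ?g (pt 1 a t)) b = frechet_derivative ?g (at (pt 1 a b)) (axis 2 1)" by (rule DERIV_imp_deriv)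
 moreover have "deriv (%t. ?g (pt 1 a t)) b = deriv ((deriv ^^ k) (%t. h (pt 1 a t))) b"
 proof (rule deriv_cong_open)
 have "continuous_on UNIV (%t. pt 1 a 0 + t *\<^sub>R axis 2 1)" by (intro continuous_intros)
 hence "continuous_on UNIV (pt 1 a)" by (simp only: e[symmetric])
 thus "open (pt 1 a -` U)" using U by (rule open_vimage[rotated])
 show "b : pt 1 a -` U" using Suc.prems by simp
 show "?g (pt 1 a t) = (deriv ^^ k) (%t. h (pt 1 a t)) t" if "t : pt 1 a -` U" for t using Suc that by simp
 qed
 moreover have "replicate (Suc k) (axis 2 1 :: real^2) = replicate k (axis 2 1) @ [axis 2 1]"
 by (simp add: replicate_append_same)
 ultimately show ?case by (simp only: ipd_append ipd.simps funpow.simps o_apply)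
qed simp

section \<open>Uniform nondegeneracy on the ring\<close>

text \<open>Up to lattice translation it contains every lower point that a map near f can send to
  the upper sheet; the radius 20 comes from \<open>stepR\<close>.\<close>

definition ring :: "(real^2) set" where "ring = {w. 1 <= norm w & norm w <= 20}"

lemma compact_ring: "compact ring"
proof -
 have "ring = cball 0 20 Int - ball 0 1" by (auto simp: ring_def)
 moreover have "compact (cball 0 20 Int - ball (0 :: real^2) 1)"
 by (rule compact_Int_closed[OF compact_cball closed_Compl[OF open_ball]])
 ultimately show ?thesis by simp
qed

text \<open>At every point of the ring some vertical derivative of order at most r is nonzero;
  continuity and compactness make radius and lower bound uniform, while the order still depends on
  the point.\<close>

lemma TR_nondegenerate:
 assumes r: "2 <= r"
 shows "EX rh>0. EX c>0. ALL w:ring. EX k. 1 <= k & k <= r & (ALL z. norm (z - w) < rh --> c <= \<bar>ipd (TR r) (replicate k (axis 2 1)) z $ 2\<bar>)"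
proof -
 have "EX k d. 1 <= k & k <= r & 0 < d & (ALL z. norm (z - w) < 2*d --> d <= \<bar>ipd (TR r) (replicate k (axis 2 1)) z $ 2\<bar>)" if w: "w : ring" for w
 proof -
 have w0: "w ~= 0" using w by (auto simp: ring_def)
 hence "w $ 1 ~= 0 | w $ 2 ~= 0" by (auto simp: vec_eq_iff forall_2)
 then obtain k where k: "1 <= k" "k <= r" "(deriv ^^ k) (TT r (w $ 1)) (w $ 2) ~= 0" using TT_nondegenerate[OF r] by blast
 let ?h = "%z. ipd (TR r) (replicate k (axis 2 1)) z $ 2"
 have b: "set (replicate k (axis 2 1 :: real^2)) <= Basis" "length (replicate k (axis 2 1 :: real^2)) <= k" by auto
 have pw: "pt 1 (w $ 1) (w $ 2) = w" using pt_eta[of 1 w] by (simp add: other)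
 have T2: "(%t. TR r (pt 1 (w $ 1) t) $ 2) = TT r (w $ 1)"
 by (auto simp: fun_eq_iff TR_def TT_def Dv_def pt_def)
 have "?h w = ipd (%x. TR r x $ 2) (replicate k (axis 2 1)) w"
 using ipd_nth[OF Cr_on_TR[OF r, of k] _ b, of w 2] w0 by simp
 also have "... = (deriv ^^ k) (TT r (w $ 1)) (w $ 2)"
 using ipd_vertical[OF Cr_on_component[OF Cr_on_TR[OF r, of k]] order_refl, of "w $ 1" "w $ 2" 2] w0 unfolding pw T2 by simp
 finally have hw: "?h w ~= 0" using k by simp
 have "continuous_on (- {0}) (ipd (TR r) (replicate k (axis 2 1)))"
 using Cr_on_TR[OF r, of k] b unfolding Cr_on_def by blast
 hence "isCont ?h w" using w0 by (intro continuous_intros) (simp add: continuous_on_eq_continuous_at open_Compl)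
 then obtain d where d: "0 < d" "!!z. dist z w < d ==> dist (?h z) (?h w) < \<bar>?h w\<bar>/2"
 unfolding continuous_at_eps_delta using hw by (metis half_gt_zero zero_less_abs_iff)
 define d' where "d' = min (d/2) (\<bar>?h w\<bar>/2)"
 have d': "0 < d'" using d hw by (simp add: d'_def)
 have "d' <= \<bar>?h z\<bar>" if "norm (z - w) < 2*d'" for z
 proof -
 have "dist z w < d" using that by (simp add: dist_norm d'_def)
 hence "\<bar>?h z - ?h w\<bar> < \<bar>?h w\<bar>/2" using d(2) by (simp add: dist_real_def)
 thus ?thesis unfolding d'_def by linarith
 qed
 thus ?thesis using k d' by blast
 qed
 then obtain k d where kd: "!!w. w : ring ==> 1 <= k w & k w <= r & 0 < d w &
 (ALL z. norm (z - w) < 2*d w --> d w <= \<bar>ipd (TR r) (replicate (k w) (axis 2 1)) z $ 2\<bar>)" by metis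
 obtain C where C: "C <= ring" "finite C" "ring <= (\<Union>x\<in>C. ball x (d x))"
 proof (rule compactE_image[OF compact_ring, of ring "%x. ball x (d x)"])
 show "ring <= (\<Union>x\<in>ring. ball x (d x))"
 proof
 fix x assume x: "x : ring"
 hence "x : ball x (d x)" using kd by simp
 thus "x : (\<Union>x\<in>ring. ball x (d x))" using x by blast
 qed
 qed (use that in auto)
 define rh where "rh = Min (insert 1 (d ` C))"
 have rho: "0 < rh" "!!x. x : C ==> rh <= d x" proof -
 show "0 < rh" using C kd by (auto simp: rh_def)
 show "rh <= d x" if "x : C" for x unfolding rh_def using C(2) that by (intro Min_le) auto
 qed
 show ?thesis
 proof (rule exI[of _ rh], intro conjI rho(1), rule exI[of _ rh], intro conjI rho(1) ballI)
 fix w assume "w : ring"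
 then obtain a where a: "a : C" "w : ball a (d a)" using C(3) by blast
 have "rh <= \<bar>ipd (TR r) (replicate (k a) (axis 2 1)) z $ 2\<bar>" if "norm (z - w) < rh" for z
 proof -
 have "norm (z - a) <= norm (z - w) + norm (w - a)" using norm_triangle_ineq[of "z - w" "w - a"] by simp
 hence "norm (z - a) < 2*d a" using that rho(2)[OF a(1)] a(2) by (simp add: dist_norm norm_minus_commute)
 thus ?thesis using kd[of a] a(1) C(1) rho(2)[OF a(1)] by (meson order_trans subsetD)
 qed
 thus "EX k. 1 <= k & k <= r & (ALL z. norm (z - w) < rh --> rh <= \<bar>ipd (TR r) (replicate k (axis 2 1)) z $ 2\<bar>)"
 using kd[of a] a(1) C(1) by blast
 qed
qed

section \<open>Orbits of a perturbation of f\<close>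

lemma iter_int_orbit:
 assumes b: "bij_betw g S S" and p: "p : S"
 shows "iter_int S g n p : S" "g (iter_int S g n p) = iter_int S g (n + 1) p"
proof -
 have gS: "!!x. x : S ==> g x : S" and hS: "!!x. x : S ==> inv_into S g x : S"
 using b by (auto simp: bij_betw_def inv_into_into)
 have f: "(g ^^ k) p : S" "(inv_into S g ^^ k) p : S" for k
 by (induction k) (auto simp: p gS hS)
 show "iter_int S g n p : S" by (simp add: iter_int_def f)
 show "g (iter_int S g n p) = iter_int S g (n + 1) p"
 proof (cases "0 <= n")
 case True
 hence "nat (n + 1) = Suc (nat n)" by simp
 thus ?thesis using True by (simp add: iter_int_def)
 next
 case False
 define k where "k = nat (- n) - 1"
 have k: "nat (- n) = Suc k" "nat (- (n + 1)) = k" using False by (auto simp: k_def)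
 have "iter_int S g n p = inv_into S g ((inv_into S g ^^ k) p)" using False k by (simp add: iter_int_def)
 hence "g (iter_int S g n p) = (inv_into S g ^^ k) p" using b f_inv_into_f[of _ g S] f(2)[of k] by (simp add: bij_betw_def)
 moreover have "iter_int S g (n + 1) p = (inv_into S g ^^ k) p"
 \<comment> \<open>Between -1 and 0 the definition of \<open>iter_int\<close> switches from iterates
   of the inverse to iterates of g.\<close>
 proof (cases "n = - 1")
 case True
 thus ?thesis using k by (simp add: iter_int_def)
 next
 case False
 thus ?thesis using \<open>~ 0 <= n\<close> k by (simp add: iter_int_def)
 qed
 ultimately show ?thesis by simp
 qed
qed

lemma iter_int_inj:
 assumes b: "bij_betw g S S" and pq: "p : S" "q : S" "iter_int S g n p = iter_int S g n q"
 shows "p = q"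
proof -
 have i: "inj_on g S" "inj_on (inv_into S g) S"
 using b bij_betw_inv_into[OF b] by (auto simp: bij_betw_def)
 have gS: "!!x. x : S ==> g x : S" and hS: "!!x. x : S ==> inv_into S g x : S"
 using b by (auto simp: bij_betw_def inv_into_into)
 have "(h ^^ k) p = (h ^^ k) q ==> p = q" if "inj_on h S" "!!x. x : S ==> h x : S" for h k
 proof (induction k)
 case (Suc k)
 have "(h ^^ k) x : S" if "x : S" for x by (induction k) (auto simp: that \<open>!!x. x : S ==> h x : S\<close>)
 thus ?case using Suc that(1) pq by (auto simp: inj_on_def)
 qed simp
 from this[OF i(1) gS] this[OF i(2) hS] show ?thesis using pq(3) by (auto simp: iter_int_def split: if_splits)
qed

lemma Dm_Bx: "y : Dm 6 ==> y ~: Bx 3"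
proof
 assume y: "y : Dm 6" and "y : Bx 3"
 then obtain l where l: "l : LL" "\<bar>(y - l) $ 1\<bar> < 3" "\<bar>(y - l) $ 2\<bar> < 3" unfolding Bx_def by blast
 hence "norm (y - l) < 6" using norm2_le[of "y - l" 1] by (simp add: other)
 thus False using y l(1) by (force simp: Dm_def)
qed

text \<open>Represents all of \<open>Dm 1\<close> modulo the lattice; the extra 20 keeps base points
  inside when they are translated into the ring.\<close>

definition K2 :: "(real^2) set" where "K2 = Dm 1 Int cball 0 (RC + 20)"

definition rep :: "nat => (real^4 => real^4) => real => real => real => real => (real^2 => real^2) => real^2 => (real^2 => real^2) => bool" where
 "rep r g rh eps s s' F c G \<longleftrightarrow> Cr_on r G (ball c rh) & (ALL y:ball c rh. EE s' (G y) = g (EE s y) &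
 (ALL vs. set vs <= Basis & length vs <= r --> norm (ipd G vs y - ipd F vs y) < eps))"

definition bnd :: "nat => real => real => (real^2 => real^2) => real^2 => bool" where
 "bnd r A1 rh F c \<longleftrightarrow> Cr_on r F (ball c rh) & (ALL y:ball c rh. ALL vs. set vs <= Basis & length vs <= r --> norm (ipd F vs y) <= A1)"

text \<open>What is used of a perturbation g: lifts close to the three models (upper map, lower map,
  crossing) and uniform bounds for the models. Bounds for \<open>gj\<close> and for
  \<open>ff 2\<close> at its values appear because away from the holes the lower map is
  \<open>gj\<close>, whose slope is the reciprocal of that of \<open>ff 2\<close>.\<close>

locale near_map =
 fixes r :: nat and g :: "real^4 => real^4" and rh eps A1 :: real
 assumes r: "2 <= r" and g: "bij_betw g SS SS" and rho: "0 < rh" "rh <= 1" and ep: "0 < eps" "eps <= 1/1000"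
 and A1: "RC + 30 <= A1" "400*A1*rh <= 1" "3*(eps*A1) <= 1"
 and repP: "!!c. c : K2 ==> EX G. rep r g rh eps 1 1 (ff 1) c G"
 and repM: "!!c. c : K2 ==> EX G. rep r g rh eps (- 1) (- 1) (fm r) c G"
 and repR: "!!c. c : ring ==> EX G. rep r g rh eps (- 1) 1 (TR r) c G"
 and bnds: "!!c. c : K2 ==> bnd r A1 rh (ff 1) c" "!!c. c : K2 ==> bnd r A1 rh (fm r) c" "!!c. c : K2 ==> bnd r A1 rh gj c"
 "!!c y. c : K2 ==> y : ball c rh ==> norm (ipd (ff 2) [axis 2 1] (gj y)) <= A1" "!!c. c : ring ==> bnd r A1 rh (TR r) c"
begin

definition A :: real where "A = 3*A1 + 2"

lemma A_pos: "30 <= A1" "1 <= A" using A1(1) RC_pos by (auto simp: A_def)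

lemma shift:
 assumes G: "rep r g rh eps s s' F c G" and F: "bnd r A1 rh F c" and s: "sgn_ok s'"
 and Fc: "F c : Dm (1/18)" and c': "c' : Dm 1" "EE s' c' = g (EE s c)"
 obtains l where "l : LL" "norm (F c - (c' + l)) <= 1/100"
 "!!x x'. x : ball c rh ==> norm (x' - c') < 1/2 ==> EE s' x' = g (EE s x) ==> G x = x' + l"
proof -
 have cb: "c : ball c rh" using rho by simp
 have GE: "EE s' (G y) = g (EE s y)" if "y : ball c rh" for y using G that by (simp add: rep_def)
 show thesis
 proof (rule common_shift[where F=F and c=c and G=G and rh=rh and s=s' and c'=c', OF s _ _ rho(1) Fc c'(1)])
 show "norm (G y - F y) <= 1/100" if "y : ball c rh" for y
 proof -
 have "norm (ipd G [] y - ipd F [] y) < eps" using G that unfolding rep_def by (metis empty_subsetI list.set(1) list.size(3) zero_le)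
 thus ?thesis using ep by simp
 qed
 show "norm (F y - F c) <= 1/100" if "y : ball c rh" for y
 proof -
 have "norm (F y - F c) <= 4*A1*rh" by (rule lipschitz_ball[OF _ _ _ that, of r]) (use F r in \<open>auto simp: bnd_def\<close>)
 thus ?thesis using A1(2) by simp
 qed
 show "EE s' (G c) = EE s' c'" using GE[OF cb] c'(2) by simp
 fix l assume l: "l : LL" "norm (F c - (c' + l)) <= 1/100"
 "!!x x'. x : ball c rh ==> norm (x' - c') < 1/2 ==> EE s' (G x) = EE s' x' ==> G x = x' + l"
 show thesis by (rule that[OF l(1,2)], rule l(3)) (auto simp: GE)
 qed
qed

lemma K2_Dm: "c : K2 ==> c : Dm 1" by (simp add: K2_def)

lemma fp_K2: "c : K2 ==> ff 1 c : Dm mu" using fp_Dm[of 1 c] K2_Dm by simp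

lemma fm_K2: "c : K2 ==> fm r c : Dm (1/18)"
 using fm_Dm[OF r, of lam c] K2_Dm lam_bounds mu_lam lam_gt Dm_mono[of "fm r c" lam "1/18"] by simp

lemma fp_K2': "c : K2 ==> ff 1 c : Dm (1/18)"
 using Dm_mono[OF fp_K2, of c "1/18"] mu_bounds by simp

text \<open>The upper sheet is forward invariant under g too: the model moves it to distance
  \<open>mu\<close> from the lattice, which leaves a wide margin.\<close>

lemma stepP_ex: "c : K2 ==> g (EE 1 c) : EE 1 ` Dm 1"
proof -
 assume c: "c : K2"
 obtain G where G: "rep r g rh eps 1 1 (ff 1) c G" using repP[OF c] by blast
 have cb: "c : ball c rh" using rho by simp
 have "norm (ipd G [] c - ipd (ff 1) [] c) < eps" using G cb unfolding rep_def by (metis empty_subsetI list.set(1) list.size(3) zero_le)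
 hence "norm (G c - ff 1 c) <= 1" using ep by simp
 hence "G c : Dm (mu - 1)" by (rule Dm_perturb[OF _ fp_K2[OF c]])
 hence "G c : Dm 1" by (rule Dm_mono) (use mu_bounds in simp)
 moreover have "g (EE 1 c) = EE 1 (G c)" using G cb by (simp add: rep_def)
 ultimately show ?thesis by simp
qed

text \<open>One step in the upper sheet leads to distance at least mu - 1/100 > 17 from the lattice.
  \<open>stepM\<close> is its mirror image: a lower point with lower image was itself that far away.
  Hence only the steps next to a crossing can be weak.\<close>

lemma stepP:
 assumes c: "c : K2" and c': "c' : Dm 1" "EE 1 c' = g (EE 1 c)" shows "c' : Dm 17"
proof -
 obtain G where G: "rep r g rh eps 1 1 (ff 1) c G" using repP[OF c] by blast
 obtain l where l: "l : LL" "norm (ff 1 c - (c' + l)) <= 1/100"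
 by (rule shift[OF G bnds(1)[OF c] _ fp_K2'[OF c] c']) auto
 have "c' + l : Dm (mu - 1/100)" by (rule Dm_perturb[OF _ fp_K2[OF c]]) (use l(2) in \<open>simp add: norm_minus_commute\<close>)
 hence "c' : Dm (mu - 1/100)" using Dm_periodic[OF l(1)] by simp
 thus ?thesis by (rule Dm_mono) (use mu_bounds in simp)
qed

lemma stepM:
 assumes c: "c : K2" and c': "c' : Dm 1" "EE (- 1) c' = g (EE (- 1) c)" shows "c : Dm 17"
proof -
 obtain G where G: "rep r g rh eps (- 1) (- 1) (fm r) c G" using repM[OF c] by blast
 obtain l where l: "l : LL" "norm (fm r c - (c' + l)) <= 1/100"
 by (rule shift[OF G bnds(2)[OF c] _ fm_K2[OF c] c']) auto
 have "c' + l : Dm 1" using Dm_periodic[OF l(1)] c'(1) by simp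
 hence "fm r c : Dm (1 - 1/100)" by (rule Dm_perturb[OF l(2)])
 hence "c : Dm (mu*(1 - 1/100))" by (subst fm_Dm[OF r, symmetric]) (use mu_bounds in auto)
 thus ?thesis by (rule Dm_mono) (use mu_bounds in simp)
qed

text \<open>An upper image, read in the lower chart, is within distance 1 of a lattice point. The
  model contracts by \<open>lam\<close> there, so the point itself is within mu * 11/10 < 20 of a
  lattice point.\<close>

lemma stepR:
 assumes c: "c : K2" and c': "c' : Dm 1" "EE 1 c' = g (EE (- 1) c)" shows "EX m:LL. norm (c - m) <= 20"
proof -
 obtain G where G: "rep r g rh eps (- 1) (- 1) (fm r) c G" using repM[OF c] by blast
 have cb: "c : ball c rh" using rho by simp
 have "norm (ipd G [] c - ipd (fm r) [] c) < eps" using G cb unfolding rep_def by (metis empty_subsetI list.set(1) list.size(3) zero_le)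
 hence n: "norm (G c - fm r c) <= 1/1000" using ep by simp
 have RR: "1/RR <= 1/100" using RR_ge by (intro divide_left_mono) auto
 have "G c : Dm (1/18 - 1/1000)" by (rule Dm_perturb[OF n fm_K2[OF c]])
 hence GD: "G c : Dm (1/RR)" by (rule Dm_mono) (use RR in simp)
 have "EE 1 c' = EE (- 1) (G c)" using G cb c'(2) by (simp add: rep_def)
 from EE_cross[OF Dm_RR[OF c'(1)] GD _ this] obtain l m w where
 w: "l : LL" "m : LL" "w ~= 0" "c' = l + w" "G c = m + inv2 w" by auto
 have "1 <= norm w" using c'(1) w by (force simp: Dm_def)
 hence "norm (G c - m) <= 1" using w by (simp add: inv2 divide_le_eq)
 hence f: "norm (fm r c - m) < 11/10"
 using norm_triangle_ineq4[of "G c - m" "G c - fm r c"] n by simp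
 obtain l' where l': "l' : LL" "m = Lat 1 l'" using Lat_surj[OF w(2)] by blast
 have "norm (ph r c - l') < mu*(11/10)"
 using f gj_norm(1)[OF l'(1), of "11/10" "ph r c"] by (simp add: l'(2) fm_def)
 hence "norm (ph r c - l') < 20" using mu_bounds by simp
 hence "norm (c - l') < 20" using ph_ball[OF r l'(1), of 20 c] RR_ge by simp
 thus ?thesis using l'(1) by (intro bexI[of _ l']) auto
qed

lemma linkP:
 assumes c: "c : K2" and c': "c' : K2" "EE 1 c' = g (EE 1 c)"
 and P: "!!p. p : P ==> norm (X p - c) < rh/16 & norm (X' p - c') < rh/16 & EE 1 (X' p) = g (EE 1 (X p))"
 shows "olink True (c ~: Dm 17) r A eps (rh/4) P (%p. X p $ 1) (%p. X p $ 2) (%p. X' p $ 1) (%p. X' p $ 2)"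
proof -
 obtain G where G: "rep r g rh eps 1 1 (ff 1) c G" using repP[OF c] by blast
 obtain l where l: "l : LL"
 "!!x x'. x : ball c rh ==> norm (x' - c') < 1/2 ==> EE 1 x' = g (EE 1 x) ==> G x = x' + l"
 by (rule shift[OF G bnds(1)[OF c] _ fp_K2'[OF c] K2_Dm[OF c'(1)] c'(2)]) auto
 have "link r A eps (rh/4) mu (1/50) (if c ~: Dm 17 then A else 1/10) P (%p. X p $ 1) (%p. X p $ other 1) (%p. X' p $ 1) (%p. X' p $ other 1)"
 proof (rule link_of_map[where G=G and F="ff 1" and c=c and c'=c' and l=l and ?A1.0=A1])
 show "1 <= r" "0 < rh" "rh <= 1" "eps <= 1" "3*A1 + 2 <= A" using r rho ep by (auto simp: A_def)
 show "Cr_on r G (ball c rh)" using G by (simp add: rep_def)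
 show "Cr_on r (ff 1) (ball c rh)" using bnds(1)[OF c] by (simp add: bnd_def)
 show "norm (ipd G vs y - ipd (ff 1) vs y) <= eps" if "y : ball c rh" "set vs <= Basis" "length vs <= r" for y vs
 using G that unfolding rep_def by (meson less_imp_le)
 show nb: "norm (ipd (ff 1) vs y) <= A1" if "y : ball c rh" "set vs <= Basis" "length vs <= r" for y vs
 using bnds(1)[OF c] that unfolding bnd_def by blast
 show "ff 1 y $ other 1 = mu*y $ other 1" for y by (rule ff_nth)
 fix y assume y: "y : ball c rh"
 have "\<bar>ipd (ff 1) [axis 1 1] y $ 1\<bar> <= A1"
 using nb[OF y, of "[axis 1 1]"] component_le_norm_cart[of "ipd (ff 1) [axis 1 1] y" 1] r by auto
 moreover have "ipd (ff 1) [axis 1 1] y $ 1 <= lam" if "c : Dm 17"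
 proof (rule ff_slope(2)[OF Dm_Bx])
 have "y : Dm (17 - 1)" by (rule Dm_perturb[OF _ that]) (use y rho in \<open>auto simp: dist_norm norm_minus_commute\<close>)
 thus "y : Dm 6" by (rule Dm_mono) simp
 qed
 ultimately show "1/50 + eps <= ipd (ff 1) [axis 1 1] y $ 1 & ipd (ff 1) [axis 1 1] y $ 1 <= (if c ~: Dm 17 then A else 1/10) - eps"
 using ff_slope(1)[of 1 y] lam_gt lam_bounds ep A_pos by (auto simp: A_def)
 next
 fix p assume p: "p : P"
 have nc: "norm c' <= RC + 20" using c'(1) by (simp add: K2_def)
 have "norm (X' p) <= norm (X' p - c') + norm c'" using norm_triangle_ineq[of "X' p - c'" c'] by simp
 moreover have "X p : ball c rh" using P[OF p] rho by (simp add: dist_norm norm_minus_commute)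
 moreover have "norm (X' p - c') < 1/2" using P[OF p] rho by linarith
 ultimately show "norm (X p - c) < rh/16 & G (X p) = X' p + l & norm (X' p) <= A1 & norm (X' p - c') <= 1/2"
 using P[OF p] l(2)[of "X p" "X' p"] nc A1(1) by auto
 qed
 thus ?thesis unfolding olink_def by (simp only: if_True other)
qed

text \<open>By \<open>stepM\<close> the base point is in \<open>Dm 17\<close>, so \<open>ph\<close>
  is the identity on the ball and the model is \<open>gj\<close>. The slope bounds are the
  reciprocals of those of \<open>ff 2\<close> at the image point.\<close>

lemma linkM:
 assumes c: "c : K2" and c': "c' : K2" "EE (- 1) c' = g (EE (- 1) c)"
 and P: "!!p. p : P ==> norm (X p - c) < rh/16 & norm (X' p - c') < rh/16 & EE (- 1) (X' p) = g (EE (- 1) (X p))"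
 shows "olink False (c' ~: Dm 17) r A eps (rh/4) P (%p. X' p $ 2) (%p. X' p $ 1) (%p. X p $ 2) (%p. X p $ 1)"
proof -
 obtain G where G: "rep r g rh eps (- 1) (- 1) (fm r) c G" using repM[OF c] by blast
 obtain l where l: "l : LL" "norm (fm r c - (c' + l)) <= 1/100"
 "!!x x'. x : ball c rh ==> norm (x' - c') < 1/2 ==> EE (- 1) x' = g (EE (- 1) x) ==> G x = x' + l"
 by (rule shift[OF G bnds(2)[OF c] _ fm_K2[OF c] K2_Dm[OF c'(1)] c'(2)]) auto
 have c17: "c : Dm 17" by (rule stepM[OF c K2_Dm[OF c'(1)] c'(2)])
 have fmg: "fm r y = gj y" if "y : ball c rh" for y
 proof -
 have "y : Dm (17 - 1)" by (rule Dm_perturb[OF _ c17]) (use that rho in \<open>auto simp: dist_norm norm_minus_commute\<close>)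
 hence "y : Dm 8" by (rule Dm_mono) simp
 hence "ph r y = y" by (intro ph_far[OF r]) (simp add: Dm_def)
 thus ?thesis by (simp add: fm_def)
 qed
 have cb: "c : ball c rh" using rho by simp
 have "link r A eps (rh/4) lam (if c' ~: Dm 17 then 1/A else 10) 40 P (%p. X p $ 2) (%p. X p $ other 2) (%p. X' p $ 2) (%p. X' p $ other 2)"
 proof (rule link_of_map[where G=G and F=gj and c=c and c'=c' and l=l and ?A1.0=A1])
 show "1 <= r" "0 < rh" "rh <= 1" "eps <= 1" "3*A1 + 2 <= A" using r rho ep by (auto simp: A_def)
 show "Cr_on r G (ball c rh)" using G by (simp add: rep_def)
 show "Cr_on r gj (ball c rh)" using bnds(3)[OF c] by (simp add: bnd_def)
 show "norm (ipd G vs y - ipd gj vs y) <= eps" if "y : ball c rh" "set vs <= Basis" "length vs <= r" for y vs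
 proof -
 have "norm (ipd G vs y - ipd (fm r) vs y) < eps" using G that unfolding rep_def by blast
 moreover have "ipd (fm r) vs y = ipd gj vs y" by (rule ipd_cong[OF open_ball fmg that(1)])
 ultimately show ?thesis by simp
 qed
 show "norm (ipd gj vs y) <= A1" if "y : ball c rh" "set vs <= Basis" "length vs <= r" for y vs
 using bnds(3)[OF c] that unfolding bnd_def by blast
 show "gj y $ other 2 = lam*y $ other 2" for y unfolding other by (rule gj_lin)
 fix y assume y: "y : ball c rh"
 define s where "s = ipd (ff 2) [axis 2 1] (gj y) $ 2"
 have s1: "lam/2 <= s" unfolding s_def by (rule ff_slope(1))
 have s2: "s <= A1" using bnds(4)[OF c y] component_le_norm_cart[of "ipd (ff 2) [axis 2 1] (gj y)" 2] unfolding s_def by linarith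
 have s3: "s <= lam" if "c' : Dm 17" unfolding s_def
 proof (rule ff_slope(2)[OF Dm_Bx])
 have "c' + l : Dm 17" using Dm_periodic[OF l(1)] that by simp
 from Dm_perturb[OF l(2)[unfolded fmg[OF cb]] this] have 1: "gj c : Dm (17 - 1/100)" .
 have "norm (gj y - gj c) <= 4*A1*rh" by (rule lipschitz_ball[OF _ _ _ y, of r]) (use bnds(3)[OF c] r in \<open>auto simp: bnd_def\<close>)
 hence "norm (gj y - gj c) <= 1" using A1(2) by simp
 hence "gj y : Dm (17 - 1/100 - 1)" by (rule Dm_perturb[OF _ 1])
 thus "gj y : Dm 6" by (rule Dm_mono) simp
 qed
 have sp: "0 < s" "1/36 < s" using s1 lam_bounds lam_gt by linarith+
 have "1/s <= 36" using sp by (simp add: divide_le_eq)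
 moreover have "1/A + eps <= 1/s"
 proof -
 have "1/A <= 1/(3*A1)" using A_pos by (intro divide_left_mono) (auto simp: A_def)
 moreover have "eps <= 1/(3*A1)" using A1(3) A_pos by (simp add: pos_le_divide_eq mult_ac)
 moreover have "1/(3*A1) + 1/(3*A1) <= 1/A1" using A_pos by (simp add: field_simps)
 moreover have "1/A1 <= 1/s" using s2 sp A_pos by (intro divide_left_mono) auto
 ultimately show ?thesis by linarith
 qed
 moreover have "11 <= 1/s" if "c' : Dm 17"
 proof -
 have "s <= 0.06" using s3[OF that] lam_bounds by linarith
 thus ?thesis using sp by (simp add: pos_le_divide_eq)
 qed
 ultimately show "(if c' ~: Dm 17 then 1/A else 10) + eps <= ipd gj [axis 2 1] y $ 2 & ipd gj [axis 2 1] y $ 2 <= 40 - eps"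
 unfolding gj_slope s_def[symmetric] using ep by auto
 next
 fix p assume p: "p : P"
 have nc: "norm c' <= RC + 20" using c'(1) by (simp add: K2_def)
 have "norm (X' p) <= norm (X' p - c') + norm c'" using norm_triangle_ineq[of "X' p - c'" c'] by simp
 moreover have "X p : ball c rh" using P[OF p] rho by (simp add: dist_norm norm_minus_commute)
 moreover have "norm (X' p - c') < 1/2" using P[OF p] rho by linarith
 ultimately show "norm (X p - c) < rh/16 & G (X p) = X' p + l & norm (X' p) <= A1 & norm (X' p - c') <= 1/2"
 using P[OF p] l(3)[of "X p" "X' p"] nc A1(1) by auto
 qed
 thus ?thesis unfolding olink_def by (simp only: if_False other)
qed

text \<open>\<open>final_step\<close> with t and q the second and first lower coordinates and t' and
  q' the first and second upper ones. The function E is then the second component of the crossing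
  map, and its pure partials in t are the vertical derivatives that \<open>TR_nondegenerate\<close>
  keeps away from 0.\<close>

lemma ring_step:
 assumes c: "c : ring" and c': "c' : K2" "EE 1 c' = g (EE (- 1) c)"
 and P: "!!p. p : P ==> norm (X p - c) < rh/16 & norm (X' p - c') < rh/16 & EE 1 (X' p) = g (EE (- 1) (X p))"
 and k: "1 <= k" "k <= r" and N: "N <= P" "card N = Suc k" "inj_on (%p. X p $ 2) N" "inj_on (%p. X' p $ 1) N"
 and e: "0 <= kp" "3 ^ k*fact k*kp <= 1" "rh/4*(famC k 1*A) <= 1"
 and dd: "!!J. J <= N ==> 2 <= card J ==> \<bar>dd (%p. X p $ 2) (%p. X p $ 1) J\<bar> <= kp & \<bar>dd (%p. X' p $ 1) (%p. X' p $ 2) J\<bar> <= kp"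
 shows "EX z. norm (z - c) < rh & \<bar>ipd (TR r) (replicate k (axis 2 1)) z $ 2\<bar> <= fsC k A*kp + eps"
proof -
 obtain G where G: "rep r g rh eps (- 1) 1 (TR r) c G" using repR[OF c] by blast
 have c0: "3/4 <= norm c" "norm c <= 24" using c by (auto simp: ring_def)
 have "0 + TR r c : Dm (1/18)" by (rule Dm_near[OF LL_0]) (use fS_ring(2,3)[OF r LL_0 c0] RR_ge in auto)
 hence TD: "TR r c : Dm (1/18)" by simp
 obtain l where l: "l : LL"
 "!!x x'. x : ball c rh ==> norm (x' - c') < 1/2 ==> EE 1 x' = g (EE (- 1) x) ==> G x = x' + l"
 by (rule shift[OF G bnds(5)[OF c] _ TD K2_Dm[OF c'(1)] c'(2)]) auto
 have GC: "Cr_on r G (ball c rh)" using G by (simp add: rep_def)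
 have cl: "norm (ipd G vs y - ipd (TR r) vs y) <= eps" if "y : ball c rh" "set vs <= Basis" "length vs <= r" for y vs
 using G that unfolding rep_def by (meson less_imp_le)
 have Gb: "\<bar>ipd G vs y $ j\<bar> <= A1 + 1" if "y : ball c rh" "set vs <= Basis" "length vs <= r" for y vs j
 proof -
 have "norm (ipd (TR r) vs y) <= A1" using bnds(5)[OF c] that unfolding bnd_def by blast
 moreover have "norm (ipd G vs y) <= norm (ipd G vs y - ipd (TR r) vs y) + norm (ipd (TR r) vs y)" by (metis diff_add_cancel norm_triangle_ineq)
 ultimately show ?thesis using cl[OF that] ep component_le_norm_cart[of "ipd G vs y" j] by linarith
 qed
 have XB: "X p : ball c rh" and X'b: "norm (X' p - c') < 1/2" if "p : P" for p
 using P[OF that] rho by (auto simp: dist_norm norm_minus_commute)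
 have GX: "G (X p) = X' p + l" if "p : P" for p using l(2)[OF XB[OF that] X'b[OF that]] P[OF that] by blast
 obtain a where a: "a : N" using N(2) by fastforce
 hence aP: "a : P" using N(1) by blast
 have lb: "\<bar>l $ j\<bar> <= 2*A1 + 1" for j
 proof -
 have "l $ j = G (X a) $ j - X' a $ j" using GX[OF aP] by simp
 moreover have "\<bar>G (X a) $ j\<bar> <= A1 + 1" using Gb[OF XB[OF aP], of "[]" j] by simp
 moreover have "norm (X' a) <= norm (X' a - c') + norm c'" using norm_triangle_ineq[of "X' a - c'" c'] by simp
 moreover have "norm c' <= RC + 20" using c'(1) by (simp add: K2_def)
 ultimately show ?thesis using X'b[OF aP] A1(1) component_le_norm_cart[of "X' a" j] by linarith
 qed
 define H where "H j x = G x $ j - l $ j" for j x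
 have HC: "Cr_on r (H j) (ball c rh)" for j unfolding H_def[abs_def] by (intro Cr_on_diff Cr_on_component[OF GC] Cr_on_const open_ball)
 have ipdH: "ipd (H j) vs y = ipd G vs y $ j - (if vs = [] then l $ j else 0)"
 if "y : ball c rh" "set vs <= Basis" "length vs <= r" for y vs j
 using ipd_diff[OF Cr_on_mono[OF Cr_on_component[OF GC] that(3)] Cr_on_const[OF open_ball] that(2,1)] ipd_nth[OF GC that]
 by (simp add: H_def[abs_def] ipd_const)
 have Hb: "\<bar>ipd (H j) vs y\<bar> <= A" if "set vs <= Basis" "length vs <= r" "y : ball c rh" for y vs j
 using ipdH[OF that(3,1,2), of j] Gb[OF that(3,1,2), of j] lb[of j] by (cases "vs = []") (auto simp: A_def)
 have sq: "pt 2 x y : ball c rh" if "(x, y) : sqr (X a $ 2) (X a $ 1) (rh/4)" for x y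
 proof -
 have "norm (pt 2 x y - X a) <= \<bar>x - X a $ 2\<bar> + \<bar>y - X a $ 1\<bar>" using norm2_le[of "pt 2 x y - X a" 2] pt_nth(2)[of 2 x y] by (simp add: other)
 moreover have "\<bar>x - X a $ 2\<bar> < rh/4" "\<bar>y - X a $ 1\<bar> < rh/4" using that by (auto simp: sqr_def)
 moreover have "norm (pt 2 x y - c) <= norm (pt 2 x y - X a) + norm (X a - c)" using norm_triangle_ineq[of "pt 2 x y - X a" "X a - c"] by simp
 ultimately have "norm (pt 2 x y - c) < rh" using P[OF aP] by linarith
 thus ?thesis by (simp add: dist_norm norm_minus_commute)
 qed
 have fN: "finite N" using N(2) by (metis card.infinite nat.distinct(1))
 have W: "wfam k (sqr (X a $ 2) (X a $ 1) (rh/4)) (fam 2 (H j)) A" for j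
 by (rule wfam_mono[OF fam_wfam[OF HC sq Hb] k(2)])
 have pe: "pt 2 (x $ 2) (x $ 1) = x" for x :: "real^2" using pt_eta[of 2 x] by (simp add: other)
 have n: "\<bar>a $ j - b $ j\<bar> <= norm (a - b)" for a b :: "real^2" and j using component_le_norm_cart[of "a - b" j] by simp
 have t: "norm (a - b) <= norm (a - d) + norm (b - d)" for a b d :: "real^2" using norm_triangle_ineq4[of "a - d" "b - d"] by simp
 have "EX x y. (x, y) : sqr (X a $ 2) (X a $ 1) (rh/4) & \<bar>fam 2 (H 2) (replicate k False) x y\<bar> <= fsC k A*kp"
 proof (rule final_step[OF fN N(3,4,2) k(1) e(1,2) A_pos(2) dd a _ e(3) _ W W])
 show "0 < rh/4" using rho by simp
 fix p assume p: "p : N"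
 hence pP: "p : P" using N(1) by blast
 show "\<bar>X p $ 2 - X a $ 2\<bar> < rh/4 & \<bar>X' p $ 1 - X' a $ 1\<bar> < 1"
 using n[of "X p" 2 "X a"] t[of "X p" "X a" c] n[of "X' p" 1 "X' a"] t[of "X' p" "X' a" c'] P[OF pP] P[OF aP] rho by linarith
 show "X' p $ 1 = fam 2 (H 1) [] (X p $ 2) (X p $ 1) & X' p $ 2 = fam 2 (H 2) [] (X p $ 2) (X p $ 1)"
 using GX[OF pP] by (simp add: fam_def dir_def pe H_def)
 qed
 then obtain x y where xy: "(x, y) : sqr (X a $ 2) (X a $ 1) (rh/4)" "\<bar>fam 2 (H 2) (replicate k False) x y\<bar> <= fsC k A*kp" by blast
 let ?z = "pt 2 x y" and ?vs = "replicate k (axis 2 1 :: real^2)"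
 have z: "?z : ball c rh" by (rule sq[OF xy(1)])
 have vs: "set ?vs <= Basis" "length ?vs <= r" "?vs ~= []" using k by auto
 have "dir 2 (replicate k False) = ?vs" by (simp add: dir_def)
 hence "\<bar>ipd G ?vs ?z $ 2\<bar> <= fsC k A*kp" using xy(2) ipdH[OF z vs(1,2), of 2] vs(3) by (simp add: fam_def)
 moreover have "\<bar>ipd G ?vs ?z $ 2 - ipd (TR r) ?vs ?z $ 2\<bar> <= eps"
 using cl[OF z vs(1,2)] component_le_norm_cart[of "ipd G ?vs ?z - ipd (TR r) ?vs ?z" 2] unfolding vector_minus_component by linarith
 ultimately have "\<bar>ipd (TR r) ?vs ?z $ 2\<bar> <= fsC k A*kp + eps" by linarith
 thus ?thesis using z by (intro exI[of _ ?z]) (simp add: dist_norm norm_minus_commute)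
qed

end

section \<open>Itineraries and expansivity\<close>

lemma halving_zero:
 fixes d :: "int => real"
 assumes h: "!!n. d n <= d (n + s)/2" and b: "!!n. 0 <= d n & d n <= 1"
 shows "d n = 0"
proof -
 have it: "d n <= d (n + int k * s)/2 ^ k" for k
 proof (induction k)
 case (Suc k)
 have "d (n + int k * s)/2 ^ k <= (d (n + int k * s + s)/2)/2 ^ k" by (intro divide_right_mono h) simp
 also have "n + int k * s + s = n + int (Suc k) * s" by (simp add: algebra_simps)
 finally show ?case using Suc by simp
 qed simp
 have le: "d n <= (1/2) ^ k" for k
 proof -
 have "d (n + int k * s)/2 ^ k <= 1/2 ^ k" using b by (intro divide_right_mono) auto
 thus ?thesis using it[of k] by (simp add: power_divide)
 qed
 have "(%k. (1/2 :: real) ^ k) \<longlonglongrightarrow> 0" by (rule LIMSEQ_realpow_zero) auto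
 from LIMSEQ_le_const[OF this, of "d n"] le have "d n <= 0" by auto
 thus ?thesis using b[of n] by simp
qed

lemma last_outside:
 fixes P :: "int => bool"
 assumes up: "!!n. P n ==> P (n + 1)" and a: "P a" and b: "~ P b"
 obtains n0 where "!!n. n <= n0 ==> ~ P n" "!!n. n0 < n ==> P n"
proof -
 have mono: "P (m + int k)" if "P m" for m k
 by (induction k) (use that up[of "m + int _"] in \<open>auto simp: algebra_simps\<close>)
 have mono': "P n" if "P m" "m <= n" for m n using mono[OF that(1), of "nat (n - m)"] that(2) by simp
 define k where "k = (LEAST k. P (b + int k))"
 have ba: "b <= a" using mono'[OF a, of b] b by linarith
 hence "P (b + int (nat (a - b)))" using a by simp
 hence k: "P (b + int k)" unfolding k_def by (rule LeastI[of "%k. P (b + int k)"])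
 have k': "~ P (b + int j)" if "j < k" for j using that unfolding k_def by (rule not_less_Least)
 show thesis
 proof (rule that[of "b + int k - 1"])
 fix n assume n: "n <= b + int k - 1"
 show "~ P n"
 proof (cases "n <= b")
 case True
 thus ?thesis using mono'[of n b] b by blast
 next
 case False
 thus ?thesis using k'[of "nat (n - b)"] n by simp
 qed
 next
 fix n assume "b + int k - 1 < n"
 thus "P n" using mono'[OF k] by simp
 qed
qed

lemma link_weaken:
 assumes L: "link r A eps rh c0 lo hi P t q t' q'" and b: "lo' <= lo" "hi <= hi'"
 shows "link r A eps rh c0 lo' hi' P t q t' q'"
 unfolding link_def
proof (intro conjI ballI)
 fix i j assume ij: "i : P" "j : P"
 have *: "\<bar>q' i - q' j - c0*(q i - q j)\<bar> <= eps*(\<bar>t i - t j\<bar> + \<bar>q i - q j\<bar>) &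
 (EX s h. t' i - t' j = s*(t i - t j) + h*(q i - q j) & lo <= s & s <= hi & \<bar>h\<bar> <= A) &
 \<bar>t i - t j\<bar> <= rh/2 & \<bar>t' i - t' j\<bar> <= 1"
 using L ij unfolding link_def by blast
 thus "\<bar>q' i - q' j - c0*(q i - q j)\<bar> <= eps*(\<bar>t i - t j\<bar> + \<bar>q i - q j\<bar>)"
 "\<bar>t i - t j\<bar> <= rh/2" "\<bar>t' i - t' j\<bar> <= 1" by blast+
 obtain s h where "t' i - t' j = s*(t i - t j) + h*(q i - q j)" "lo <= s" "s <= hi" "\<bar>h\<bar> <= A" using * by blast
 thus "EX s h. t' i - t' j = s*(t i - t j) + h*(q i - q j) & lo' <= s & s <= hi' & \<bar>h\<bar> <= A"
 using b by (intro exI[of _ s] exI[of _ h]) auto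
next
 obtain G E c1 where G: "ALL c:P. wfam r (sqr (t c) (q c) rh) G A & wfam r (sqr (t c) (q c) rh) E eps &
 (ALL x y. (x, y) : sqr (t c) (q c) rh --> lo <= G [False] x y & G [False] x y <= hi)"
 "ALL j:P. t' j = G [] (t j) (q j) & q' j = c0*q j + c1 + E [] (t j) (q j)"
 using L unfolding link_def by blast
 show "EX G E c1. (ALL c:P. wfam r (sqr (t c) (q c) rh) G A & wfam r (sqr (t c) (q c) rh) E eps &
 (ALL x y. (x, y) : sqr (t c) (q c) rh --> lo' <= G [False] x y & G [False] x y <= hi')) &
 (ALL j:P. t' j = G [] (t j) (q j) & q' j = c0*q j + c1 + E [] (t j) (q j))"
 proof (rule exI[of _ G], rule exI[of _ E], rule exI[of _ c1], intro conjI ballI G(2)[rule_format, THEN conjunct1] G(2)[rule_format, THEN conjunct2] allI impI)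
 fix c assume c: "c : P"
 show "wfam r (sqr (t c) (q c) rh) G A" "wfam r (sqr (t c) (q c) rh) E eps" using G(1) c by blast+
 fix x y assume "(x, y) : sqr (t c) (q c) rh"
 hence "lo <= G [False] x y & G [False] x y <= hi" using G(1) c by blast
 thus "lo' <= G [False] x y" "G [False] x y <= hi'" using b by linarith+
 qed
qed

lemma olink_weaken:
 assumes "olink up w r A eps rh P t q t' q'" "1 <= A" shows "olink up True r A eps rh P t q t' q'"
proof -
 have "1/A <= 10" "1/10 <= A" using assms(2) by (auto simp: divide_le_eq)
 thus ?thesis using assms(1) link_weaken[of r A eps rh lam 10 40 P t' q' t q "1/A" 40]
 link_weaken[of r A eps rh mu "1/50" "1/10" P t q t' q' "1/50" A]
 unfolding olink_def by (cases up; cases w) (simp_all only: if_True if_False order_refl simp_thms)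
qed

text \<open>For orbits that never change sheet the cone holds at every index. The differences of t
  then halve with each index, so they double towards the past of the index; being bounded on both
  sides, they vanish.\<close>

lemma two_sided_rigid:
 fixes t q :: "int => 'i => real"
 assumes L: "!!n. olink up False r A eps rh P (t n) (q n) (t (n + 1)) (q (n + 1))"
 and b: "!!n. \<bar>t n i - t n j\<bar> <= 1" "!!n. \<bar>q n i - q n j\<bar> <= 1" and ij: "i : P" "j : P"
 and A: "1 <= A" and eta: "0 < ze" "8*A*A*ze <= 1/50" and ep: "0 <= eps" "eps <= ze"
 shows "t 0 i = t 0 j & q 0 i = q 0 j"
proof -
 have eta1: "8*A*A*ze <= 1" using eta(2) by linarith
 have C: "\<bar>q n i - q n j\<bar> <= ze*\<bar>t n i - t n j\<bar>" for n
 proof -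
 define T where "T k = t (n + int k)" for k
 define S where "S k = q (n + int k)" for k
 have c1: "olink up False r A eps rh P (T k) (S k) (T (Suc k)) (S (Suc k))" for k
 using L[of "n + int k"] by (simp add: T_def S_def add.commute add.left_commute)
 have c2: "\<bar>S k i - S k j\<bar> <= 1" for k unfolding S_def by (rule b(2))
 have "\<bar>S 0 i - S 0 j\<bar> <= ze*\<bar>T 0 i - T 0 j\<bar>"
 by (rule cone_strong[where t=T and q=S and ?n0.0=0, OF c1 c2 ij A eta(1) eta1 ep])
 thus ?thesis by (simp add: T_def S_def)
 qed
 have H: "\<bar>t (n + 1) i - t (n + 1) j\<bar> <= \<bar>t n i - t n j\<bar>/2" for n
 using olink_growth(3,4)[OF L[of n] ij A eta C[of n] C[of "n + 1"]] by (cases up) auto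
 define d where "d n = \<bar>t n i - t n j\<bar>" for n
 have "d 0 = 0"
 proof (rule halving_zero[where s="- 1"])
 show "d n <= d (n + - 1)/2" for n using H[of "n - 1"] by (simp add: d_def)
 show "0 <= d n & d n <= 1" for n using b(1)[of n] by (simp add: d_def)
 qed
 thus ?thesis using C[of 0] by (simp add: d_def)
qed

context near_map
begin

text \<open>One of r + 1 close points is the base, and the others are lifted near its orbit. As the
  upper sheet is forward invariant, the itinerary of the base is upper, lower, or one crossing from
  lower to upper. Without crossing any two of the points coincide by \<open>two_sided_rigid\<close>;
  the bound r comes from the crossing alone.\<close>

theorem expansive:
 assumes cone: "eps <= 1/(400*A*A)"
 and chains: "!!up (P :: (real^4) set) t q n J. chain up r A eps (rh/4) P t q ==> J <= P ==> 2 <= card J ==> card J <= Suc r ==>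
 \<bar>dd (t n) (q n) J\<bar> <= kp"
 and cones: "!!up (P :: (real^4) set) t q n i j. chain up r A eps (rh/4) P t q ==> i : P ==> j : P ==>
 \<bar>q n i - q n j\<bar> <= 1*\<bar>t n i - t n j\<bar>"
 and kap: "0 <= kp" "!!k. 1 <= k ==> k <= r ==> 3 ^ k*fact k*kp <= 1 & rh/4*(famC k 1*A) <= 1 & fsC k A*kp + eps < cT"
 and nondeg: "!!w. w : ring ==> EX k. 1 <= k & k <= r & (ALL z. norm (z - w) < rh --> cT <= \<bar>ipd (TR r) (replicate k (axis 2 1)) z $ 2\<bar>)"
 shows "N_expansive SS g r"
proof -
 have K2: "compact K2" unfolding K2_def by (intro closed_Int_compact closed_Dm compact_cball)
 have K2R: "K2 <= Dmo (1/RR)" using Dm_Dmo[of _ 1 "1/RR"] one_RR unfolding K2_def by auto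
 have r16: "0 < rh/16" using rho by simp
 obtain d1 where d1: "0 < d1" "ALL c:K2. ALL q:SS. dist (EE 1 c) q < d1 --> (EX x. EE 1 x = q & norm (x - c) < rh/16)"
 using lift_near[of 1, OF _ K2 K2R r16] by auto
 obtain d2 where d2: "0 < d2" "ALL c:K2. ALL q:SS. dist (EE (- 1) c) q < d2 --> (EX x. EE (- 1) x = q & norm (x - c) < rh/16)"
 using lift_near[of "- 1", OF _ K2 K2R r16] by auto
 show ?thesis unfolding N_expansive_def
 proof (intro exI[of _ "min d1 d2"] conjI allI impI)
 show "0 < min d1 d2" using d1 d2 by simp
 fix Q assume QS: "Q <= SS" and diam: "ALL n. diameter (iter_int SS g n ` Q) < min d1 d2"
 define Or where "Or n p = iter_int SS g n p" for n p
 have OS: "Or n p : SS" "g (Or n p) = Or (n + 1) p" if "p : SS" for n p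
 using iter_int_orbit[OF g that] by (auto simp: Or_def)
 have Oinj: "p = q" if "p : SS" "q : SS" "Or n p = Or n q" for n p q
 using iter_int_inj[OF g that(1,2)] that(3) by (simp add: Or_def)
 have close: "dist (Or n p) (Or n q) < min d1 d2" if "p : Q" "q : Q" for n p q
 proof -
 have "bounded (iter_int SS g n ` Q)"
 by (rule bounded_subset[OF compact_imp_bounded[OF compact_SS]]) (use OS(1) QS in \<open>auto simp: Or_def\<close>)
 hence "dist (Or n p) (Or n q) <= diameter (iter_int SS g n ` Q)"
 using that by (intro diameter_bounded_bound) (auto simp: Or_def)
 thus ?thesis using diam[rule_format, of n] by linarith
 qed
 have small: "~ (finite N & card N = Suc r)" if N: "N <= Q" for N
 proof
 assume cN: "finite N & card N = Suc r"
 then obtain b where b: "b : N" by fastforce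
 hence bQ: "b : Q" "b : SS" using N QS by auto
 define inX where "inX n \<longleftrightarrow> Or n b : EE 1 ` Dm 1" for n
 define sg where "sg n = (if inX n then 1 else - 1 :: real)" for n
 have K1K2: "EE s ` Dm 1 <= EE s ` K2" for s unfolding EE_Dm1 K1_def K2_def using RC_pos by auto
 \<comment> \<open>The representative looks one step ahead: before a crossing it is translated so
   that the nearby lattice point is 0, for which the crossing model \<open>TR\<close> is
   written.\<close>
 have "EX c:K2. EE (sg n) c = Or n b & (~ inX n & inX (n + 1) --> c : ring)" for n
 proof -
 have "EX c:K2. EE (sg n) c = Or n b"
 proof (cases "inX n")
 case True
 hence "Or n b : EE 1 ` K2" using K1K2[of 1] unfolding inX_def by blast
 thus ?thesis using True unfolding sg_def by auto
 next
 case False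
 hence "Or n b : EE (- 1) ` Dm 1" using OS(1)[OF bQ(2), of n] unfolding SS_def inX_def by blast
 hence "Or n b : EE (- 1) ` K2" using K1K2[of "- 1"] by blast
 thus ?thesis using False unfolding sg_def by auto
 qed
 then obtain c where c: "c : K2" "EE (sg n) c = Or n b" by blast
 show ?thesis
 proof (cases "~ inX n & inX (n + 1)")
 case True
 then obtain c' where c': "c' : Dm 1" "EE 1 c' = Or (n + 1) b" unfolding inX_def by auto
 have s: "sg n = - 1" using True by (simp add: sg_def)
 obtain m where m: "m : LL" "norm (c - m) <= 20"
 using stepR[OF c(1) c'(1)] c'(2) c(2) OS(2)[OF bQ(2), of n] unfolding s by auto
 have 1: "EE (sg n) (c - m) = Or n b" using EE_periodic[OF LL_minus[OF m(1)], of "sg n" c] c(2) by simp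
 have D: "c - m : Dm 1" using Dm_periodic[OF LL_minus[OF m(1)], of c 1] K2_Dm[OF c(1)] by simp
 have "1 <= norm (c - m)" using K2_Dm[OF c(1)] m(1) by (simp add: Dm_def)
 hence "c - m : ring" "c - m : K2" using D m(2) RC_pos by (auto simp: ring_def K2_def)
 thus ?thesis using 1 by blast
 qed (use c in blast)
 qed
 then obtain c where c: "!!n. c n : K2" "!!n. EE (sg n) (c n) = Or n b" "!!n. ~ inX n & inX (n + 1) --> c n : ring" by metis
 have up: "inX (n + 1)" if "inX n" for n
 using stepP_ex[OF c(1)[of n]] c(2)[of n] OS(2)[OF bQ(2), of n] that unfolding inX_def sg_def by simp
 have "EX x. EE (sg n) x = Or n p & norm (x - c n) < rh/16" if "p : N" for n p
 proof -
 have p: "p : Q" "p : SS" using that N QS by auto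
 have "dist (EE (sg n) (c n)) (Or n p) < min d1 d2" unfolding c(2) by (rule close[OF bQ(1) p(1)])
 thus ?thesis using d1(2) d2(2) c(1)[of n] OS(1)[OF p(2), of n] unfolding sg_def by (cases "inX n") auto
 qed
 note ex = this
 define X where "X n p = (SOME x. EE (sg n) x = Or n p & norm (x - c n) < rh/16)" for n p
 have XX: "EE (sg n) (X n p) = Or n p & norm (X n p - c n) < rh/16" if "p : N" for n p
 unfolding X_def by (rule someI_ex[OF ex[OF that]])
 have X: "EE (sg n) (X n p) = Or n p" "norm (X n p - c n) < rh/16" if "p : N" for n p using XX[OF that] by blast+
 have NSS: "N <= SS" using N QS by blast
 have LP: "olink True (c n ~: Dm 17) r A eps (rh/4) N (%p. X n p $ 1) (%p. X n p $ 2) (%p. X (n + 1) p $ 1) (%p. X (n + 1) p $ 2)"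
 if i: "inX n" for n
 proof (rule linkP[OF c(1) c(1)])
 have s: "sg n = 1" "sg (n + 1) = 1" using i up[OF i] by (auto simp: sg_def)
 show "EE 1 (c (n + 1)) = g (EE 1 (c n))" using c(2)[of n] c(2)[of "n + 1"] OS(2)[OF bQ(2), of n] s by simp
 show "norm (X n p - c n) < rh/16 & norm (X (n + 1) p - c (n + 1)) < rh/16 & EE 1 (X (n + 1) p) = g (EE 1 (X n p))" if "p : N" for p
 using X[OF that, of n] X[OF that, of "n + 1"] OS(2)[of p n] that NSS s by auto
 qed
 have LM: "olink False (c (n + 1) ~: Dm 17) r A eps (rh/4) N (%p. X (n + 1) p $ 2) (%p. X (n + 1) p $ 1) (%p. X n p $ 2) (%p. X n p $ 1)"
 and c17: "c n : Dm 17"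
 if i: "~ inX (n + 1)" for n
 proof -
 have "~ inX n" using up i by blast
 hence s: "sg n = - 1" "sg (n + 1) = - 1" using i by (auto simp: sg_def)
 have e: "EE (- 1) (c (n + 1)) = g (EE (- 1) (c n))" using c(2)[of n] c(2)[of "n + 1"] OS(2)[OF bQ(2), of n] s by simp
 show "c n : Dm 17" by (rule stepM[OF c(1) K2_Dm[OF c(1)] e])
 show "olink False (c (n + 1) ~: Dm 17) r A eps (rh/4) N (%p. X (n + 1) p $ 2) (%p. X (n + 1) p $ 1) (%p. X n p $ 2) (%p. X n p $ 1)"
 proof (rule linkM[OF c(1) c(1) e])
 show "norm (X n p - c n) < rh/16 & norm (X (n + 1) p - c (n + 1)) < rh/16 & EE (- 1) (X (n + 1) p) = g (EE (- 1) (X n p))" if "p : N" for p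
 using X[OF that, of n] X[OF that, of "n + 1"] OS(2)[of p n] that NSS s by auto
 qed
 qed
 have P17: "c (n + 1) : Dm 17" if i: "inX n" for n
 proof (rule stepP[OF c(1)[of n] K2_Dm[OF c(1)]])
 have s: "sg n = 1" "sg (n + 1) = 1" using i up[OF i] by (auto simp: sg_def)
 show "EE 1 (c (n + 1)) = g (EE 1 (c n))" using c(2)[of n] c(2)[of "n + 1"] OS(2)[OF bQ(2), of n] s by simp
 qed
 have Xd: "\<bar>X n p $ j - X n q $ j\<bar> <= 1" if "p : N" "q : N" for n p q j
 proof -
 have "norm (X n p - X n q) <= norm (X n p - c n) + norm (X n q - c n)" using norm_triangle_ineq4[of "X n p - c n" "X n q - c n"] by simp
 thus ?thesis using X(2)[OF that(1), of n] X(2)[OF that(2), of n] rho component_le_norm_cart[of "X n p - X n q" j] unfolding vector_minus_component by linarith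
 qed
 have Xne: "X n p $ 1 ~= X n q $ 1 | X n p $ 2 ~= X n q $ 2" if "p : N" "q : N" "p ~= q" for n p q
 proof (rule ccontr)
 assume "~ ?thesis"
 hence "X n p = X n q" by (simp add: vec_eq_iff forall_2)
 hence "Or n p = Or n q" using X(1)[OF that(1), of n] X(1)[OF that(2), of n] by simp
 thus False using Oinj[of p q n] that NSS by blast
 qed
 define ze where "ze = 1/(400*A*A)"
 have eta: "0 < ze" "8*A*A*ze <= 1/50" "8*A*A*ze <= 1" "0 <= eps" "eps <= ze"
 using A_pos(2) cone ep by (auto simp: ze_def)
 obtain p q where pq: "p : N" "q : N" "p ~= q"
 proof -
 have "~ card N <= Suc 0" using cN r by simp
 thus thesis using that card_le_Suc0_iff_eq[of N] cN by blast
 qed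
 have "(ALL n. inX n) | (ALL n. ~ inX n) | (EX n0. (ALL n. n <= n0 --> ~ inX n) & (ALL n. n0 < n --> inX n))"
 proof (rule ccontr)
 assume no: "~ ?thesis"
 then obtain a b where ab: "inX a" "~ inX b" by blast
 obtain n0 where "!!n. n <= n0 ==> ~ inX n" "!!n. n0 < n ==> inX n"
 by (rule last_outside[where P=inX, OF up ab]) blast+
 thus False using no by blast
 qed
 then consider (inside) "ALL n. inX n" | (outside) "ALL n. ~ inX n"
 | (crossing) n0 where "ALL n. n <= n0 --> ~ inX n" "ALL n. n0 < n --> inX n" by blast
 thus False
 proof cases
 case inside
 have L: "olink True False r A eps (rh/4) N (%p. X n p $ 1) (%p. X n p $ 2) (%p. X (n + 1) p $ 1) (%p. X (n + 1) p $ 2)" for n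
 using LP[of n] P17[of "n - 1"] inside by simp
 have "X 0 p $ 1 = X 0 q $ 1 & X 0 p $ 2 = X 0 q $ 2"
 using two_sided_rigid[where t="%n p. X n p $ 1" and q="%n p. X n p $ 2" and i=p and j=q,
 OF L Xd[OF pq(1,2)] Xd[OF pq(1,2)] pq(1,2) A_pos(2) eta(1,2,4,5)] .
 thus False using Xne[OF pq, of 0] by blast
 next
 case outside
 \<comment> \<open>Time is reversed, as links of the lower kind run backwards.\<close>
 have L: "olink False False r A eps (rh/4) N (%p. X (- n) p $ 2) (%p. X (- n) p $ 1) (%p. X (- (n + 1)) p $ 2) (%p. X (- (n + 1)) p $ 1)" for n
 proof -
 have e: "- (n + 1) + 1 = - n" by simp
 have "c (- n) : Dm 17" using c17[of "- n"] outside by blast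
 thus ?thesis using LM[of "- (n + 1)"] outside unfolding e by simp
 qed
 have "X (- 0) p $ 2 = X (- 0) q $ 2 & X (- 0) p $ 1 = X (- 0) q $ 1"
 using two_sided_rigid[where t="%n p. X (- n) p $ 2" and q="%n p. X (- n) p $ 1" and i=p and j=q,
 OF L Xd[OF pq(1,2)] Xd[OF pq(1,2)] pq(1,2) A_pos(2) eta(1,2,4,5)] .
 thus False using Xne[OF pq, of 0] by simp
 next
 case crossing
 note 3 = crossing[rule_format]
 have cU: "chain True r A eps (rh/4) N (%k p. X (n0 + 1 + int k) p $ 1) (%k p. X (n0 + 1 + int k) p $ 2)"
 unfolding chain_def
 proof (intro conjI allI ballI impI)
 fix k :: nat
 have i: "inX (n0 + 1 + int k)" using 3(2) by simp
 \<comment> \<open>Only the first point above may lie near a hole; all later ones are images of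
   upper points.\<close>
 have "c (n0 + 1 + int k) : Dm 17" if "k ~= 0"
 using P17[of "n0 + int k"] 3(2)[of "n0 + int k"] that by (simp add: ac_simps)
 note calculation = this
 have e: "n0 + 1 + int (Suc k) = n0 + 1 + int k + 1" by simp
 show "olink True (k = 0) r A eps (rh/4) N (%p. X (n0 + 1 + int k) p $ 1) (%p. X (n0 + 1 + int k) p $ 2)
 (%p. X (n0 + 1 + int (Suc k)) p $ 1) (%p. X (n0 + 1 + int (Suc k)) p $ 2)"
 unfolding e using LP[OF i] olink_weaken[OF LP[OF i] A_pos(2)] calculation by (cases "k = 0") simp_all
 qed (use Xd Xne in auto)
 have cL: "chain False r A eps (rh/4) N (%k p. X (n0 - int k) p $ 2) (%k p. X (n0 - int k) p $ 1)"
 unfolding chain_def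
 proof (intro conjI allI ballI impI)
 fix k :: nat
 have i: "~ inX (n0 - int (Suc k) + 1)" using 3(1) by simp
 have "c (n0 - int k) : Dm 17" if "k ~= 0"
 using c17[of "n0 - int k"] 3(1)[of "n0 - int k + 1"] that by simp
 note calculation = this
 have e: "n0 - int k = n0 - int (Suc k) + 1" by simp
 show "olink False (k = 0) r A eps (rh/4) N (%p. X (n0 - int k) p $ 2) (%p. X (n0 - int k) p $ 1)
 (%p. X (n0 - int (Suc k)) p $ 2) (%p. X (n0 - int (Suc k)) p $ 1)"
 using LM[OF i] olink_weaken[OF LM[OF i] A_pos(2)] calculation unfolding e[symmetric] by (cases "k = 0") simp_all
 qed (use Xd Xne in auto)
 have n0: "~ inX n0" "inX (n0 + 1)" using 3 by auto
 have cr: "c n0 : ring" using c(3) n0 by blast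
 obtain k where k: "1 <= k" "k <= r" "!!z. norm (z - c n0) < rh ==> cT <= \<bar>ipd (TR r) (replicate k (axis 2 1)) z $ 2\<bar>"
 using nondeg[OF cr] by blast
 have "Suc k <= card N" using cN k by simp
 then obtain M where M: "M <= N" "card M = Suc k" using obtain_subset_with_card_n by metis
 have dU: "\<bar>dd (%p. X (n0 + 1) p $ 1) (%p. X (n0 + 1) p $ 2) J\<bar> <= kp"
 and dL: "\<bar>dd (%p. X n0 p $ 2) (%p. X n0 p $ 1) J\<bar> <= kp" if J: "J <= N" "2 <= card J" for J
 proof -
 have "card J <= Suc r" using card_mono[of N J] J cN by auto
 from chains[OF cU J this, of 0] chains[OF cL J this, of 0]
 show "\<bar>dd (%p. X (n0 + 1) p $ 1) (%p. X (n0 + 1) p $ 2) J\<bar> <= kp" "\<bar>dd (%p. X n0 p $ 2) (%p. X n0 p $ 1) J\<bar> <= kp" by simp_all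
 qed
 have iL: "inj_on (%p. X n0 p $ 2) M"
 proof (rule inj_onI, rule ccontr)
 fix i j assume ij: "i : M" "j : M" "X n0 i $ 2 = X n0 j $ 2" "i ~= j"
 thus False using cones[OF cL, of i j 0] Xne[of i j n0] M(1) by auto
 qed
 have iU: "inj_on (%p. X (n0 + 1) p $ 1) M"
 proof (rule inj_onI, rule ccontr)
 fix i j assume ij: "i : M" "j : M" "X (n0 + 1) i $ 1 = X (n0 + 1) j $ 1" "i ~= j"
 thus False using cones[OF cU, of i j 0] Xne[of i j "n0 + 1"] M(1) by auto
 qed
 have s: "sg n0 = - 1" "sg (n0 + 1) = 1" using n0 by (auto simp: sg_def)
 have "EX z. norm (z - c n0) < rh & \<bar>ipd (TR r) (replicate k (axis 2 1)) z $ 2\<bar> <= fsC k A*kp + eps"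
 proof (rule ring_step[where P=N, OF cr c(1)[of "n0 + 1"] _ _ k(1,2) M iL iU kap(1)])
 show "EE 1 (c (n0 + 1)) = g (EE (- 1) (c n0))" using c(2)[of n0] c(2)[of "n0 + 1"] OS(2)[OF bQ(2), of n0] s by simp
 show "norm (X n0 p - c n0) < rh/16 & norm (X (n0 + 1) p - c (n0 + 1)) < rh/16 & EE 1 (X (n0 + 1) p) = g (EE (- 1) (X n0 p))" if "p : N" for p
 using X[OF that, of n0] X[OF that, of "n0 + 1"] OS(2)[of p n0] that NSS s by auto
 show "3 ^ k*fact k*kp <= 1" "rh/4*(famC k 1*A) <= 1" using kap(2)[OF k(1,2)] by auto
 show "\<bar>dd (%p. X n0 p $ 2) (%p. X n0 p $ 1) J\<bar> <= kp & \<bar>dd (%p. X (n0 + 1) p $ 1) (%p. X (n0 + 1) p $ 2) J\<bar> <= kp" if "J <= M" "2 <= card J" for J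
 using dU dL that M(1) by blast
 qed
 thus False using k(3) kap(2)[OF k(1,2)] by fastforce
 qed
 qed
 show "finite Q"
 proof (rule ccontr)
 assume "infinite Q"
 then obtain N where "N <= Q" "finite N" "card N = Suc r" using infinite_arbitrarily_large by blast
 thus False using small by blast
 qed
 show "card Q <= r"
 proof (rule ccontr)
 assume "~ card Q <= r"
 then obtain N where "N <= Q" "card N = Suc r" "finite N" using obtain_subset_with_card_n[of "Suc r" Q] by auto
 thus False using small by blast
 qed
 qed
qed

end

section \<open>Choice of the neighbourhood and of the constants\<close>

lemma bndI:
 assumes F: "Cr_on r F U" "ball c rh <= K" "K <= U"
 and B: "ALL y:K. ALL vs. set vs <= Basis & length vs <= r --> norm (ipd F vs y) <= B" "B <= A1"
 shows "bnd r A1 rh F c"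
 unfolding bnd_def
proof (intro conjI ballI allI impI)
 show "Cr_on r F (ball c rh)" by (rule Cr_on_subset[OF F(1) open_ball]) (use F in blast)
 show "norm (ipd F vs y) <= A1" if "y : ball c rh" "set vs <= Basis & length vs <= r" for y vs
 using B that F(2) by (meson order_trans subsetD)
qed

lemma rep_mono:
 assumes "rep r g rh' eps s s' F c G" "rh <= rh'" shows "rep r g rh eps s s' F c G"
proof -
 have "ball c rh <= ball c rh'" using assms(2) by auto
 thus ?thesis using assms(1) Cr_on_subset[OF _ open_ball] unfolding rep_def by blast
qed

lemma sheet_data:
 assumes r: "2 <= r" and s: "sgn_ok s"
 shows "EX D rh. 0 < rh & (ALL d:set D. cr_datum_ok SS (fS r) d) & (ALL g eps. Cr_diffeo r SS g & (ALL d:set D. cr_close r eps d (fS r) g) -->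
 (ALL c:K2. EX G. rep r g rh eps s s (fh r s) c G))"
 unfolding rep_def
proof (rule rep_data[OF s s])
 have cF: "continuous_on UNIV (fh r s)" by (rule Cr_on_continuous_on[OF Cr_on_fh[OF r]])
 let ?V = "Dmo (3/4) Int fh r s -` Dmo (1/RR)"
 show "compact K2" unfolding K2_def by (intro closed_Int_compact closed_Dm compact_cball)
 show "K2 <= ?V" using fh_Dmo[OF r s] Dm_Dmo[of _ 1 "3/4"] by (auto simp: K2_def)
 show "open ?V" using open_Dmo open_vimage[OF open_Dmo cF] by blast
 show "?V <= Dmo (1/RR)" using Dmo_mono[of _ "3/4" "1/RR"] one_RR by auto
 show "continuous_on ?V (fh r s)" by (rule continuous_on_subset[OF cF]) simp
 show "fh r s y : Dmo (1/RR)" if "y : ?V" for y using that by simp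
 show "fS r (EE s y) = EE s (fh r s y)" if "y : ?V" for y using fS_fh[OF r s Dmo_Dm] that by blast
qed

lemma ring_data:
 assumes r: "2 <= r"
 shows "EX D rh. 0 < rh & (ALL d:set D. cr_datum_ok SS (fS r) d) & (ALL g eps. Cr_diffeo r SS g & (ALL d:set D. cr_close r eps d (fS r) g) -->
 (ALL c:ring. EX G. rep r g rh eps (- 1) 1 (TR r) c G))"
 unfolding rep_def
proof (rule rep_data)
 let ?V = "ball 0 24 - cball (0 :: real^2) (3/4)"
 have V: "3/4 <= norm y" "norm y <= 24" if "y : ?V" for y using that by auto
 have D: "y : Dmo (1/RR)" if "1/2 <= norm y" "norm y <= 25" for y
 proof -
 have "0 + y : Dm (1/2)" by (rule Dm_near[OF LL_0]) (use that RR_ge in auto)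
 thus ?thesis using Dm_Dmo[OF _ one_RR] by simp
 qed
 show "sgn_ok (- 1)" "sgn_ok 1" by simp_all
 show "compact ring" by (rule compact_ring)
 show "ring <= ?V" by (auto simp: ring_def)
 show "open ?V" by (intro open_Diff open_ball closed_cball)
 show "?V <= Dmo (1/RR)" using D V by (force dest: V)
 have "?V <= - {0}" by auto
 thus "continuous_on ?V (TR r)" using Cr_on_continuous_on[OF Cr_on_TR[OF r]] continuous_on_subset by blast
 show "TR r y : Dmo (1/RR)" if "y : ?V" for y using D fS_ring(2,3)[OF r LL_0 V[OF that]] by blast
 show "fS r (EE (- 1) y) = EE 1 (TR r y)" if "y : ?V" for y
 using fS_ring(1)[OF r LL_0 V[OF that]] Lat_add[of 1 0 0] by simp
qed

lemma ball_cball_sub: "c : cball 0 R ==> rh <= 1 ==> ball c rh <= cball (0 :: real^2) (R + 1)"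
proof
 fix y assume "c : cball 0 R" "rh <= 1" "y : ball c rh"
 thus "y : cball 0 (R + 1)" using norm_triangle_ineq[of "y - c" c] by (simp add: dist_norm norm_minus_commute)
qed

lemma uniform_bounds:
 assumes r: "2 <= r"
 shows "EX A1>=RC + 30. ALL rh. rh <= 1/4 --> (ALL c:K2. bnd r A1 rh (ff 1) c & bnd r A1 rh (fm r) c & bnd r A1 rh gj c &
 (ALL y:ball c rh. norm (ipd (ff 2) [axis 2 1] (gj y)) <= A1)) & (ALL c:ring. bnd r A1 rh (TR r) c)"
proof -
 let ?K = "cball (0 :: real^2) (RC + 20 + 1)" and ?R = "cball 0 21 - ball (0 :: real^2) (1/2)"
 have K: "compact ?K" "?K <= UNIV" by auto
 have R: "compact ?R" "?R <= - {0}" by (auto intro: compact_diff)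
 have G: "compact (gj ` ?K)" "gj ` ?K <= UNIV"
 by (auto intro!: compact_continuous_image continuous_on_subset[OF Cr_on_continuous_on[OF Cr_on_gj]])
 obtain B1 where B1: "ALL y:?K. ALL vs. set vs <= Basis & length vs <= r --> norm (ipd (ff 1) vs y) <= B1" "1 <= B1"
 using ipd_bounded[OF Cr_on_ff K] by blast
 obtain B2 where B2: "ALL y:?K. ALL vs. set vs <= Basis & length vs <= r --> norm (ipd (fm r) vs y) <= B2" "1 <= B2"
 using ipd_bounded[OF Cr_on_fm[OF r] K] by blast
 obtain B3 where B3: "ALL y:?K. ALL vs. set vs <= Basis & length vs <= r --> norm (ipd gj vs y) <= B3" "1 <= B3"
 using ipd_bounded[OF Cr_on_gj K] by blast
 obtain B4 where B4: "ALL y:gj ` ?K. ALL vs. set vs <= Basis & length vs <= r --> norm (ipd (ff 2) vs y) <= B4" "1 <= B4"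
 using ipd_bounded[OF Cr_on_ff G] by blast
 obtain B5 where B5: "ALL y:?R. ALL vs. set vs <= Basis & length vs <= r --> norm (ipd (TR r) vs y) <= B5" "1 <= B5"
 using ipd_bounded[OF Cr_on_TR[OF r] R] by blast
 define A1 where "A1 = (RC + 30) + B1 + B2 + B3 + B4 + B5"
 have A: "RC + 30 <= A1" "B1 <= A1" "B2 <= A1" "B3 <= A1" "B4 <= A1" "B5 <= A1"
 using B1(2) B2(2) B3(2) B4(2) B5(2) RC_pos by (auto simp: A1_def)
 show ?thesis
 proof (intro exI[of _ A1] conjI A allI impI ballI)
 fix rh :: real and c assume rh: "rh <= 1/4"
 {
 assume c: "c : K2"
 have s: "ball c rh <= ?K" by (rule ball_cball_sub) (use c rh in \<open>auto simp: K2_def\<close>)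
 show "bnd r A1 rh (ff 1) c" by (rule bndI[OF Cr_on_ff s K(2) B1(1) A(2)])
 show "bnd r A1 rh (fm r) c" by (rule bndI[OF Cr_on_fm[OF r] s K(2) B2(1) A(3)])
 show "bnd r A1 rh gj c" by (rule bndI[OF Cr_on_gj s K(2) B3(1) A(4)])
 show "norm (ipd (ff 2) [axis 2 1] (gj y)) <= A1" if "y : ball c rh" for y
 proof -
 have "gj y : gj ` ?K" "set [axis 2 1 :: real^2] <= Basis" "length [axis 2 1 :: real^2] <= r" using s that r by auto
 hence "norm (ipd (ff 2) [axis 2 1] (gj y)) <= B4" using B4(1) by blast
 thus ?thesis using A(5) by linarith
 qed
 }
 assume c: "c : ring"
 have "ball c rh <= ?R"
 proof
 fix y assume "y : ball c rh"
 hence "norm (y - c) < 1/4" using rh by (simp add: dist_norm norm_minus_commute)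
 thus "y : ?R" using c norm_triangle_ineq[of "y - c" c] norm_triangle_ineq4[of y "y - c"] by (simp add: ring_def)
 qed
 thus "bnd r A1 rh (TR r) c" using bndI[OF Cr_on_TR[OF r] _ R(2) B5(1) A(6)] by blast
 qed
qed

text \<open>The order of choices matters: \<open>A1\<close> and \<open>A\<close> depend on f alone,
  \<open>rh\<close> on them and on the three finite systems of data, \<open>kp\<close> on the
  contact bound \<open>cT\<close>, and \<open>eps\<close> comes last, since the thresholds of
  \<open>chain_dd\<close> and \<open>chain_cone\<close> depend on all the others.\<close>

lemma robust_fS:
 assumes r: "2 \<le> r" shows "Cr_robustly_N_expansive r SS (fS r) r"
proof -
 obtain A1 where A1: "RC + 30 \<le> A1" and bn: "\<And>rh. rh \<le> 1 / 4 \<Longrightarrow> (\<forall>c\<in>K2. bnd r A1 rh (ff 1) c \<and> bnd r A1 rh (fm r) c \<and> bnd r A1 rh gj c \<and>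
 (\<forall>y\<in>ball c rh. norm (ipd (ff 2) [axis 2 1] (gj y)) \<le> A1)) \<and> (\<forall>c\<in>ring. bnd r A1 rh (TR r) c)"
 using uniform_bounds[OF r] by blast
 define A where "A = 3 * A1 + 2"
 note A_eq = A_def
 have A: "1 \<le> A" "30 \<le> A1" using A1 RC_pos by (auto simp: A_def)
 obtain D1 rh1 where D1: "0 < rh1" "\<forall>d\<in>set D1. cr_datum_ok SS (fS r) d" "\<And>g eps. Cr_diffeo r SS g \<Longrightarrow> (\<forall>d\<in>set D1. cr_close r eps d (fS r) g) \<Longrightarrow>
 (\<forall>c\<in>K2. \<exists>G. rep r g rh1 eps 1 1 (fh r 1) c G)" using sheet_data[OF r sgn_ok_simps(1)] by blast
 obtain D2 rh2 where D2: "0 < rh2" "\<forall>d\<in>set D2. cr_datum_ok SS (fS r) d" "\<And>g eps. Cr_diffeo r SS g \<Longrightarrow> (\<forall>d\<in>set D2. cr_close r eps d (fS r) g) \<Longrightarrow>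
 (\<forall>c\<in>K2. \<exists>G. rep r g rh2 eps (- 1) (- 1) (fh r (- 1)) c G)" using sheet_data[OF r sgn_ok_simps(2)] by blast
 obtain D3 rh3 where D3: "0 < rh3" "\<forall>d\<in>set D3. cr_datum_ok SS (fS r) d" "\<And>g eps. Cr_diffeo r SS g \<Longrightarrow> (\<forall>d\<in>set D3. cr_close r eps d (fS r) g) \<Longrightarrow>
 (\<forall>c\<in>ring. \<exists>G. rep r g rh3 eps (- 1) 1 (TR r) c G)" using ring_data[OF r] by blast
 obtain rhT cT where T: "0 < rhT" "0 < cT" "\<And>w. w \<in> ring \<Longrightarrow> \<exists>k. 1 \<le> k \<and> k \<le> r \<and> (\<forall>z. norm (z - w) < rhT \<longrightarrow> cT \<le> \<bar>ipd (TR r) (replicate k (axis 2 1)) z $ 2\<bar>)"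
 using TR_nondegenerate[OF r] by blast
 \<comment> \<open>Dominates the constants of all orders k <= r at once, because the order of
   contact varies over the ring.\<close>
 define M where "M = 1 + (\<Sum>k\<le>r. \<bar>famC k 1 * A\<bar> + 3 ^ k * fact k + \<bar>fsC k A\<bar>)"
 have Mk: "1 + (\<bar>famC k 1 * A\<bar> + 3 ^ k * fact k + \<bar>fsC k A\<bar>) \<le> M" if "k \<le> r" for k
 unfolding M_def by (intro add_left_mono member_le_sum) (use that in auto)
 have M1: "1 \<le> M" unfolding M_def by (simp add: sum_nonneg)
 have Mk3: "famC k 1 * A \<le> M" "3 ^ k * fact k \<le> M" "fsC k A \<le> M" if "k \<le> r" for k
 proof -
 have "0 \<le> (3 ^ k * fact k :: real)" by simp
 then show "famC k 1 * A \<le> M" "3 ^ k * fact k \<le> M" "fsC k A \<le> M" using Mk[OF that] by linarith+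
 qed
 define rh where "rh = min (min (1 / 4) (min rh1 rh2)) (min (min rh3 rhT) (min (1 / (400 * A1)) (1 / M)))"
 have rho: "0 < rh" "rh \<le> 1 / 4" "rh \<le> rh1" "rh \<le> rh2" "rh \<le> rh3" "rh \<le> rhT" "rh \<le> 1 / (400 * A1)" "rh \<le> 1 / M"
 using D1 D2 D3 T A M1 by (auto simp: rh_def)
 define kp where "kp = min 1 (cT / 4) / M"
 have k0: "0 < kp" "M * kp \<le> 1" "M * kp \<le> cT / 4" using M1 T by (auto simp: kp_def)
 have r4: "0 < rh / 4" "rh / 4 \<le> 1" using rho by auto
 obtain e1 where e1: "0 < e1" "\<forall>eps up (P :: (real^4) set) t q. 0 \<le> eps \<and> eps \<le> e1 \<and> chain up r A eps (rh / 4) P t q \<longrightarrow>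
 (\<forall>n J. J \<subseteq> P \<and> 2 \<le> card J \<and> card J \<le> Suc r \<longrightarrow> \<bar>dd (t n) (q n) J\<bar> \<le> kp)"
 using chain_dd[OF A(1) r4 _ order_refl k0(1), of r] r by auto
 obtain e2 where e2: "0 < e2" "\<forall>eps up (P :: (real^4) set) t q. 0 \<le> eps \<and> eps \<le> e2 \<and> chain up r A eps (rh / 4) P t q \<longrightarrow>
 (\<forall>n. \<forall>i\<in>P. \<forall>j\<in>P. \<bar>q n i - q n j\<bar> \<le> 1 * \<bar>t n i - t n j\<bar>)"
 using chain_cone[OF A(1), of 1 r "rh / 4"] by auto
 define eps where "eps = min (min e1 e2) (min (min (1 / 1000) (cT / 4)) (min (1 / (3 * A1)) (1 / (400 * A * A))))"
 have ep: "0 < eps" "eps \<le> e1" "eps \<le> e2" "eps \<le> 1 / 1000" "eps \<le> cT / 4" "eps \<le> 1 / (3 * A1)" "eps \<le> 1 / (400 * A * A)"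
 using e1 e2 T A by (auto simp: eps_def)
 have "Cr_diffeo r SS (fS r)" using Cr_diffeo_fS[OF r, of "r - 1"] r by simp
 moreover have "N_expansive SS g r" if g: "Cr_diffeo r SS g" and cl: "\<forall>d\<in>set (D1 @ D2 @ D3). cr_close r eps d (fS r) g" for g
 proof -
 interpret nm: near_map r g rh eps A1
 proof
 show "2 \<le> r" "0 < rh" "rh \<le> 1" "0 < eps" "eps \<le> 1 / 1000" "RC + 30 \<le> A1" using r rho ep A1 by auto
 show "bij_betw g SS SS" using g by (simp add: Cr_diffeo_def)
 show "400 * A1 * rh \<le> 1" "3 * (eps * A1) \<le> 1" using rho(7) ep(6) A by (simp_all add: pos_le_divide_eq mult_ac)
 show "\<exists>G. rep r g rh eps 1 1 (ff 1) c G" if "c \<in> K2" for c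
 using D1(3)[OF g, of eps] cl that rep_mono[OF _ rho(3)] by (fastforce simp: fh_simps)
 show "\<exists>G. rep r g rh eps (- 1) (- 1) (fm r) c G" if "c \<in> K2" for c
 using D2(3)[OF g, of eps] cl that rep_mono[OF _ rho(4)] by (fastforce simp: fh_simps)
 show "\<exists>G. rep r g rh eps (- 1) 1 (TR r) c G" if "c \<in> ring" for c
 using D3(3)[OF g, of eps] cl that rep_mono[OF _ rho(5)] by fastforce
 qed (use bn[OF rho(2)] in blast)+
 have AA: "near_map.A A1 = A" unfolding A_eq by (rule near_map.A_def[OF nm.near_map_axioms])
 show ?thesis
 proof (rule nm.expansive[where kp=kp and cT=cT, unfolded AA])
 show "eps \<le> 1 / (400 * A * A)" by (rule ep(7))
 show "\<bar>dd (t n) (q n) J\<bar> \<le> kp" if "chain up r A eps (rh / 4) P t q" "J \<subseteq> P" "2 \<le> card J" "card J \<le> Suc r" for up and P :: "(real^4) set" and t q n J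
 using e1(2) ep(1,2) that by (meson less_imp_le)
 show "\<bar>q n i - q n j\<bar> \<le> 1 * \<bar>t n i - t n j\<bar>" if "chain up r A eps (rh / 4) P t q" "i \<in> P" "j \<in> P" for up and P :: "(real^4) set" and t q n i j
 using e2(2) ep(1,3) that by (meson less_imp_le)
 show "0 \<le> kp" using k0 by simp
 show "3 ^ k * fact k * kp \<le> 1 \<and> rh / 4 * (famC k 1 * A) \<le> 1 \<and> fsC k A * kp + eps < cT" if "1 \<le> k" "k \<le> r" for k
 proof (intro conjI)
 show "3 ^ k * fact k * kp \<le> 1" using mult_right_mono[OF Mk3(2)[OF that(2)], of kp] k0 by linarith
 have "rh / 4 * (famC k 1 * A) \<le> rh / 4 * M" using Mk3(1)[OF that(2)] rho(1) by (intro mult_left_mono) auto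
 moreover have "rh * M \<le> 1" using rho(8) M1 by (simp add: pos_le_divide_eq)
 ultimately show "rh / 4 * (famC k 1 * A) \<le> 1" by simp
 show "fsC k A * kp + eps < cT" using mult_right_mono[OF Mk3(3)[OF that(2)], of kp] k0 ep(5) T(2) by linarith
 qed
 show "\<exists>k. 1 \<le> k \<and> k \<le> r \<and> (\<forall>z. norm (z - w) < rh \<longrightarrow> cT \<le> \<bar>ipd (TR r) (replicate k (axis 2 1)) z $ 2\<bar>)" if "w \<in> ring" for w
 using T(3)[OF that] rho(6) by (meson less_le_trans)
 qed
 qed
 ultimately show ?thesis unfolding Cr_robustly_N_expansive_def
 using D1(2) D2(2) D3(2) ep(1) by (intro conjI exI[of _ "D1 @ D2 @ D3"] exI[of _ eps]) auto
qed

theorem theorem5p1: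
  fixes r :: nat
  assumes "r \<ge> 2"
  shows "\<exists>(S :: (real^4) set) f. compact_surface S \<and> Cr_diffeo r S f \<and>
           Cr_robustly_N_expansive r S f r \<and> \<not> N_expansive S f (r - 1)"
proof -
  have "Cr_robustly_N_expansive r SS (fS r) r" by (rule robust_fS[OF assms])
  then show ?thesis
    using compact_surface_SS not_expansive_fS[OF assms] unfolding Cr_robustly_N_expansive_def by blast
qed

end
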